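(* Fix $K>0$ and $\varepsilon>0$ and consider the stochastic differential equation $dh=K(1-h^2)\,dt+\sqrt2\,i\,\varepsilon\,h\circ dW$ with associated Markov semigroups $(P_t^A)_{t\ge0}$ for $A\in\{B,\partial B,\overline{B}\}$. (i) On $\partial B$ there exists a unique invariant probability measure $\mu_{K,\varepsilon}^{\partial B}$ with respect to $(P_t^{\partial B})_{t\ge0}$. (ii) On $B$ there is no invariant probability measure with respect to $(P_t^{B})_{t\ge0}$. (iii) On $\overline{B}$ there exists a unique invariant probability measure $\mu_{K,\varepsilon}^{\overline{B}}$ with respect to $(P_t^{\overline{B}})_{t\ge0}$, and it is the natural extension of $\mu_{K,\varepsilon}^{\partial B}$ to $\overline{B}$, i.e. $\mu_{K,\varepsilon}^{\overline{B}}(F)=\mu_{K,\varepsilon}^{\partial B}(F\cap\partial B)$ for every Borel set $F\subset\overline{B}$.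
   Context: $B=\{z\in\mathbb{C}:|z|<1\}$, $\partial B=\{|z|=1\}$, $\overline{B}=\{|z|\le1\}$. $W$ is a one-dimensional real Brownian motion; $\circ$ is the Stratonovich product. For $x\in\overline{B}$, $h^x$ denotes the unique global solution with $h^x(0)=x$. Each $A\in\{B,\partial B,\overline{B}\}$ is preserved by the dynamics: if $x\in A$ then almost surely $h^x(t)\in A$ for all $t\ge0$. For bounded Borel $f:A\to\mathbb{R}$ and $x\in A$, $P_t^Af(x)=\mathbb{E}(f(h^x(t)))$. For a probability measure $\mu$ on $A$, $\mu P_t^A$ is defined by $\int_A f\,d(\mu P_t^A)=\int_A P_t^Af\,d\mu$. A probability measure $\mu$ on $A$ is invariant with respect to $(P_t^A)$ if $\mu P_t^A=\mu$ for all $t\ge0$. *)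

theory Defs
  imports "HOL-Probability.Probability"
begin

section \<open>Processes on a filtered probability space\<close>

text \<open>
  Processes have type \<open>real \<Rightarrow> 'a \<Rightarrow> 'b\<close>, time first, and only times \<open>t \<ge> 0\<close> matter.
  The library's filtrations are indexed by the whole type \<open>real\<close>; a filtration given on
  \<open>[0, \<infinity>)\<close> is extended by \<open>F t = F 0\<close> for \<open>t < 0\<close>.
\<close>

definition filtered_prob_space :: "'a measure \<Rightarrow> (real \<Rightarrow> 'a measure) \<Rightarrow> bool" where
  "filtered_prob_space M F \<longleftrightarrow>
     prob_space M \<and> filtration (space M) F \<and> (\<forall>t. subalgebra M (F t))"

definition adapted :: "(real \<Rightarrow> 'a measure) \<Rightarrow> (real \<Rightarrow> 'a \<Rightarrow> 'b::topological_space) \<Rightarrow> bool" where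
  "adapted F X \<longleftrightarrow> (\<forall>t\<ge>0. X t \<in> borel_measurable (F t))"

definition continuous_paths :: "'a measure \<Rightarrow> (real \<Rightarrow> 'a \<Rightarrow> 'b::topological_space) \<Rightarrow> bool" where
  "continuous_paths M X \<longleftrightarrow> (AE \<omega> in M. continuous_on {0..} (\<lambda>t. X t \<omega>))"

definition brownian_motion ::
    "'a measure \<Rightarrow> (real \<Rightarrow> 'a measure) \<Rightarrow> (real \<Rightarrow> 'a \<Rightarrow> real) \<Rightarrow> bool" where
  "brownian_motion M F W \<longleftrightarrow>
     adapted F W \<and> continuous_paths M W \<and> (AE \<omega> in M. W 0 \<omega> = 0) \<and>
     (\<forall>s t. 0 \<le> s \<and> s < t \<longrightarrow>
        distributed M lborel (\<lambda>\<omega>. W t \<omega> - W s \<omega>) (normal_density 0 (sqrt (t - s))) \<and>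
        prob_space.indep_set M (sets (F s))
          (sets (vimage_algebra (space M) (\<lambda>\<omega>. W t \<omega> - W s \<omega>) borel)))"


section \<open>Continuous semimartingales\<close>

definition martingale ::
    "'a measure \<Rightarrow> (real \<Rightarrow> 'a measure) \<Rightarrow> (real \<Rightarrow> 'a \<Rightarrow> real) \<Rightarrow> bool" where
  "martingale M F X \<longleftrightarrow>
     adapted F X \<and> (\<forall>t\<ge>0. integrable M (X t)) \<and>
     (\<forall>s t. 0 \<le> s \<and> s \<le> t \<longrightarrow> (AE \<omega> in M. real_cond_exp M (F s) (X t) \<omega> = X s \<omega>))"

text \<open>
  Real-valued (hence finite) localizing stopping times suffice: \<open>\<tau> n\<close> may always be
  replaced by \<open>min (\<tau> n) n\<close>.
\<close>

definition continuous_local_martingale ::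
    "'a measure \<Rightarrow> (real \<Rightarrow> 'a measure) \<Rightarrow> (real \<Rightarrow> 'a \<Rightarrow> real) \<Rightarrow> bool" where
  "continuous_local_martingale M F X \<longleftrightarrow>
     adapted F X \<and> continuous_paths M X \<and>
     (\<exists>\<tau> :: nat \<Rightarrow> 'a \<Rightarrow> real.
        (\<forall>n. stopping_time F (\<tau> n) \<and> (\<forall>\<omega>\<in>space M. 0 \<le> \<tau> n \<omega>)) \<and>
        (AE \<omega> in M. incseq (\<lambda>n. \<tau> n \<omega>) \<and> filterlim (\<lambda>n. \<tau> n \<omega>) at_top sequentially) \<and>
        (\<forall>n. martingale M F (\<lambda>t \<omega>. X (min t (\<tau> n \<omega>)) \<omega>)))"

text \<open>\<open>0 = p 0 \<le> p 1 \<le> \<dots> \<le> p n = t\<close>; repeated points are harmless.\<close>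

definition is_partition :: "real \<Rightarrow> nat \<Rightarrow> (nat \<Rightarrow> real) \<Rightarrow> bool" where
  "is_partition t n p \<longleftrightarrow> p 0 = 0 \<and> p n = t \<and> (\<forall>k<n. p k \<le> p (Suc k))"

definition finite_variation_paths :: "'a measure \<Rightarrow> (real \<Rightarrow> 'a \<Rightarrow> real) \<Rightarrow> bool" where
  "finite_variation_paths M V \<longleftrightarrow>
     (AE \<omega> in M. \<forall>t\<ge>0. \<exists>C. \<forall>n p. is_partition t n p \<longrightarrow>
        (\<Sum>k<n. \<bar>V (p (Suc k)) \<omega> - V (p k) \<omega>\<bar>) \<le> C)"

definition continuous_semimartingale ::
    "'a measure \<Rightarrow> (real \<Rightarrow> 'a measure) \<Rightarrow> (real \<Rightarrow> 'a \<Rightarrow> real) \<Rightarrow> bool" where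
  "continuous_semimartingale M F X \<longleftrightarrow>
     adapted F X \<and> continuous_paths M X \<and>
     (\<exists>N V. continuous_local_martingale M F N \<and>
        adapted F V \<and> continuous_paths M V \<and> finite_variation_paths M V \<and>
        (AE \<omega> in M. \<forall>t\<ge>0. X t \<omega> = N t \<omega> + V t \<omega>))"

definition complex_continuous_semimartingale ::
    "'a measure \<Rightarrow> (real \<Rightarrow> 'a measure) \<Rightarrow> (real \<Rightarrow> 'a \<Rightarrow> complex) \<Rightarrow> bool" where
  "complex_continuous_semimartingale M F X \<longleftrightarrow>
     continuous_semimartingale M F (\<lambda>t \<omega>. Re (X t \<omega>)) \<and>
     continuous_semimartingale M F (\<lambda>t \<omega>. Im (X t \<omega>))"


section \<open>Stratonovich integral and stochastic differential equations\<close>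

text \<open>
  \<open>S t\<close> is the Stratonovich integral of \<open>Y\<close> against \<open>W\<close> over \<open>[0, t]\<close>: the limit in
  probability of the symmetric Riemann sums as the mesh of the partition tends to 0.
\<close>

definition symmetric_sum ::
    "(real \<Rightarrow> 'a \<Rightarrow> complex) \<Rightarrow> (real \<Rightarrow> 'a \<Rightarrow> real) \<Rightarrow> nat \<Rightarrow> (nat \<Rightarrow> real) \<Rightarrow> 'a \<Rightarrow> complex" where
  "symmetric_sum Y W n p \<omega> =
     (\<Sum>k<n. (Y (p k) \<omega> + Y (p (Suc k)) \<omega>) / 2 * of_real (W (p (Suc k)) \<omega> - W (p k) \<omega>))"

definition has_stratonovich_integral ::
    "'a measure \<Rightarrow> (real \<Rightarrow> 'a \<Rightarrow> complex) \<Rightarrow> (real \<Rightarrow> 'a \<Rightarrow> real) \<Rightarrow>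
     (real \<Rightarrow> 'a \<Rightarrow> complex) \<Rightarrow> bool" where
  "has_stratonovich_integral M Y W S \<longleftrightarrow>
     (\<forall>t\<ge>0. S t \<in> borel_measurable M \<and>
        (\<forall>\<eta>>0. \<exists>\<delta>>0. \<forall>n p.
           is_partition t n p \<and> (\<forall>k<n. p (Suc k) - p k < \<delta>) \<longrightarrow>
           measure M {\<omega> \<in> space M. norm (symmetric_sum Y W n p \<omega> - S t \<omega>) > \<eta>} < \<eta>))"

text \<open>Global solutions of \<open>dh = b(h) dt + \<sigma>(h) \<circ> dW\<close>, \<open>h(0) = x\<close>.\<close>

definition stratonovich_solution ::
    "'a measure \<Rightarrow> (real \<Rightarrow> 'a measure) \<Rightarrow> (real \<Rightarrow> 'a \<Rightarrow> real) \<Rightarrow>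
     (complex \<Rightarrow> complex) \<Rightarrow> (complex \<Rightarrow> complex) \<Rightarrow> complex \<Rightarrow> (real \<Rightarrow> 'a \<Rightarrow> complex) \<Rightarrow> bool" where
  "stratonovich_solution M F W b \<sigma> x h \<longleftrightarrow>
     complex_continuous_semimartingale M F h \<and>
     (AE \<omega> in M. h 0 \<omega> = x) \<and>
     (\<exists>S. has_stratonovich_integral M (\<lambda>t \<omega>. \<sigma> (h t \<omega>)) W S \<and>
        (AE \<omega> in M. \<forall>t\<ge>0. h t \<omega> = x + integral {0..t} (\<lambda>s. b (h s \<omega>)) + S t \<omega>))"


section \<open>Markov semigroup and invariant measures\<close>

text \<open>
  Here \<open>h x\<close> is the solution started at \<open>x\<close>. A function on \<open>A\<close> is represented by a total
  function of which only the values on \<open>A\<close> are used: since \<open>h x t\<close> lies in \<open>A\<close> almost surely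
  for \<open>x \<in> A\<close>, the indicator does not affect the expectation.
\<close>

definition markov_semigroup ::
    "'a measure \<Rightarrow> (complex \<Rightarrow> real \<Rightarrow> 'a \<Rightarrow> complex) \<Rightarrow> complex set \<Rightarrow> real \<Rightarrow>
     (complex \<Rightarrow> real) \<Rightarrow> complex \<Rightarrow> real" where
  "markov_semigroup M h A t f x = (LINT \<omega>|M. indicator A (h x t \<omega>) * f (h x t \<omega>))"

definition prob_measure_on :: "complex set \<Rightarrow> complex measure \<Rightarrow> bool" where
  "prob_measure_on A \<mu> \<longleftrightarrow> prob_space \<mu> \<and> sets \<mu> = sets (restrict_space borel A)"

text \<open>\<open>\<nu> = \<mu>P\<^sub>t\<close>, which is characterized by duality.\<close>

definition is_transported ::
    "'a measure \<Rightarrow> (complex \<Rightarrow> real \<Rightarrow> 'a \<Rightarrow> complex) \<Rightarrow> complex set \<Rightarrow> real \<Rightarrow>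
     complex measure \<Rightarrow> complex measure \<Rightarrow> bool" where
  "is_transported M h A t \<mu> \<nu> \<longleftrightarrow>
     prob_measure_on A \<nu> \<and>
     (\<forall>f \<in> borel_measurable (restrict_space borel A). bounded (f ` A) \<longrightarrow>
        (LINT x|\<nu>. f x) = (LINT x|\<mu>. markov_semigroup M h A t f x))"

definition invariant_measure ::
    "'a measure \<Rightarrow> (complex \<Rightarrow> real \<Rightarrow> 'a \<Rightarrow> complex) \<Rightarrow> complex set \<Rightarrow> complex measure \<Rightarrow> bool" where
  "invariant_measure M h A \<mu> \<longleftrightarrow>
     prob_measure_on A \<mu> \<and> (\<forall>t\<ge>0. is_transported M h A t \<mu> \<mu>)"

end

theory Submission
  imports Defs
begin

text \<open>
  Put \<open>u = exp (- \<i> \<surd>2 \<epsilon> W)\<close>. The Stratonovich product rule turns the equation into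
  \<open>d (u h) = K u (1 - h\<^sup>2) dt\<close>, which is an ordinary differential equation along each path. It gives
  \<open>1 - |h(t)|\<^sup>2 = (1 - |x|\<^sup>2) exp (- 2 K \<integral> Re h)\<close>, hence the invariance of the disc and of the circle,
  and the continuous dependence on the starting point. Independence of the increments of \<open>W\<close> then yields
  \<open>(E h\<^sup>n)' = n K (E h\<^sup>n\<^sup>-\<^sup>1 - E h\<^sup>n\<^sup>+\<^sup>1) - \<epsilon>\<^sup>2 n\<^sup>2 E h\<^sup>n\<close>.

  The von Mises distribution with density proportional to \<open>exp ((2 K / \<epsilon>\<^sup>2) cos \<theta>)\<close> annihilates the
  right-hand side, and bounded solutions of this infinite linear system are determined by their initial
  values, so it is invariant. Conversely the real and imaginary parts of the moments of an invariant
  measure satisfy the three-term recurrence obtained by equating the right-hand side to zero; a bounded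
  solution vanishes when its zeroth term is nonnegative and its first term is nonpositive. Applied to
  the restriction to the open disc, whose first moment has real part 0 by stationarity of the
  functions \<open>(1 - |z|\<^sup>2)\<^sup>\<delta>\<close>, this rules out mass inside the disc; applied to the difference with the
  von Mises moments it gives uniqueness, since moments determine a measure on the circle.
\<close>

section \<open>Brownian increments\<close>

text \<open>The obstacle is the product rule. The noise enters only through limits in probability of
  symmetric sums, at each fixed time, and \<open>h\<close> is merely a semimartingale. Over a fine
  partition the residuals of the equation have small sums, but multiplying them by \<open>u\<close>
  before summing keeps the sums small only because semimartingale increments are good integrators,
  uniformly over all partitions. One half of the averaged weight looks a step ahead and is not
  adapted; summation by parts moves it onto the increments of \<open>u\<close>, whose law is
  explicit.

  Afterwards the noise enters only through independence and the characteristic function of Gaussian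
  increments. The equations for E h^n close up in powers of \<open>h\<close> alone because the
  coefficients are holomorphic. Such powers determine a measure on the circle, where cnj(z) = 1/z,
  but not one on the disc, so mass in the open disc has to be excluded before moments are compared.

  No regularity in the starting point is assumed. It comes from comparing solutions driven by the
  same \<open>u\<close>, and supplies the measurability of transition kernels.\<close>

context prob_space
begin

text \<open>If the claim failed, a bad index could be chosen beyond every level; this gives a single
  sequence of events of probability at least \<open>\<epsilon>\<close>, while almost every point
  eventually leaves it. Choosing a sequence avoids the union over all indices: the indices will be
  partitions, so that union is uncountable and may fail to be measurable.\<close>

lemma uniform_small:
  fixes A :: "nat \<Rightarrow> 'i \<Rightarrow> 'a set"
  assumes meas: "\<And>m i. i \<in> I m \<Longrightarrow> A m i \<in> events"
    and ae: "AE \<omega> in M. \<exists>m0. \<forall>m\<ge>m0. \<forall>i\<in>I m. \<omega> \<notin> A m i" and e: "\<epsilon> > 0"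
  shows "\<exists>m0. \<forall>m\<ge>m0. \<forall>i\<in>I m. prob (A m i) < \<epsilon>"
proof (rule ccontr)
  assume "\<not> ?thesis"
  then have "\<forall>m0. \<exists>m\<ge>m0. \<exists>i\<in>I m. prob (A m i) \<ge> \<epsilon>"
    by (auto simp: not_less)
  then obtain f i where f: "\<And>m. f m \<ge> m" and i: "\<And>m. i m \<in> I (f m)"
    and big: "\<And>m. prob (A (f m) (i m)) \<ge> \<epsilon>"
    by metis
  define B where "B m = A (f m) (i m)" for m
  have B[measurable]: "B m \<in> events" for m
    using meas i by (auto simp: B_def)
  define U where "U n = (\<Union>m\<in>{n..}. B m)" for n
  have U[measurable]: "U n \<in> events" for n unfolding U_def by measurable
  have Ub: "prob (U n) \<ge> \<epsilon>" for n
  proof -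
    have "prob (B n) \<le> prob (U n)" by (intro finite_measure_mono U) (auto simp: U_def)
    then show ?thesis using big[of n] by (simp add: B_def)
  qed
  have "decseq U" unfolding U_def decseq_def by (intro allI impI UN_mono) auto
  then have "(\<lambda>n. prob (U n)) \<longlonglongrightarrow> prob (\<Inter>n. U n)"
    by (intro finite_Lim_measure_decseq) auto
  then have "prob (\<Inter>n. U n) \<ge> \<epsilon>"
    by (rule LIMSEQ_le_const) (use Ub in auto)
  moreover have "AE \<omega> in M. \<omega> \<notin> (\<Inter>n. U n)"
    using ae
  proof eventually_elim
    case (elim \<omega>)
    then obtain m0 where m0: "\<And>m j. m \<ge> m0 \<Longrightarrow> j \<in> I m \<Longrightarrow> \<omega> \<notin> A m j" by auto
    have "\<omega> \<notin> U m0"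
      using m0[OF order_trans[OF _ f]] i by (auto simp: U_def B_def)
    then show ?case by auto
  qed
  then have "prob (\<Inter>n. U n) = 0"
    by (subst prob_eq_0) auto
  ultimately show False using e by simp
qed

lemma prob_le_add:
  assumes "AE \<omega> in M. P \<omega> \<longrightarrow> Q \<omega> \<or> R \<omega>"
    and "{\<omega>\<in>space M. Q \<omega>} \<in> events" "{\<omega>\<in>space M. R \<omega>} \<in> events"
  shows "prob {\<omega>\<in>space M. P \<omega>} \<le> prob {\<omega>\<in>space M. Q \<omega>} + prob {\<omega>\<in>space M. R \<omega>}"
proof -
  have "prob {\<omega>\<in>space M. P \<omega>} \<le> prob ({\<omega>\<in>space M. Q \<omega>} \<union> {\<omega>\<in>space M. R \<omega>})"
    using assms by (intro finite_measure_mono_AE) auto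
  also have "\<dots> \<le> prob {\<omega>\<in>space M. Q \<omega>} + prob {\<omega>\<in>space M. R \<omega>}"
    using assms by (intro measure_Un_le) auto
  finally show ?thesis .
qed

lemma prob_le_AE:
  assumes "AE \<omega> in M. P \<omega> \<longrightarrow> Q \<omega>" and "{\<omega>\<in>space M. Q \<omega>} \<in> events"
  shows "prob {\<omega>\<in>space M. P \<omega>} \<le> prob {\<omega>\<in>space M. Q \<omega>}"
  using assms by (intro finite_measure_mono_AE) auto

lemma prob_markov:
  fixes X :: "'a \<Rightarrow> real"
  assumes "integrable M X" "AE \<omega> in M. 0 \<le> X \<omega>" "c > 0"
  shows "prob {\<omega>\<in>space M. X \<omega> > c} \<le> expectation X / c"
proof -
  have [measurable]: "X \<in> borel_measurable M" using assms by auto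
  have "prob {\<omega>\<in>space M. X \<omega> > c} \<le> prob {\<omega>\<in>space M. X \<omega> \<ge> c}"
    by (intro finite_measure_mono) auto
  also have "\<dots> \<le> expectation X / c"
    by (rule integral_Markov_inequality_measure[where A = "space M"]) (use assms in auto)
  finally show ?thesis .
qed

lemma integrable_mult_bounded:
  fixes f g :: "'a \<Rightarrow> 'b::{real_normed_algebra,banach,second_countable_topology}"
  assumes "integrable M g" "f \<in> borel_measurable M" "\<And>\<omega>. \<omega> \<in> space M \<Longrightarrow> norm (f \<omega>) \<le> C"
  shows "integrable M (\<lambda>\<omega>. f \<omega> * g \<omega>)"
proof (rule Bochner_Integration.integrable_bound)
  show "integrable M (\<lambda>\<omega>. C * norm (g \<omega>))" using assms by auto
  show "(\<lambda>\<omega>. f \<omega> * g \<omega>) \<in> borel_measurable M" using assms by auto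
  show "AE \<omega> in M. norm (f \<omega> * g \<omega>) \<le> norm (C * norm (g \<omega>))"
  proof (intro AE_I2)
    fix \<omega> assume "\<omega> \<in> space M"
    then have f: "norm (f \<omega>) \<le> C" by (rule assms)
    have "norm (f \<omega> * g \<omega>) \<le> norm (f \<omega>) * norm (g \<omega>)" by (rule norm_mult_ineq)
    also have "\<dots> \<le> C * norm (g \<omega>)" using f by (intro mult_right_mono) auto
    also have "\<dots> \<le> norm (C * norm (g \<omega>))" by simp
    finally show "norm (f \<omega> * g \<omega>) \<le> norm (C * norm (g \<omega>))" .
  qed
qed

end

locale bm_space = prob_space M for M :: "'a measure" +
  fixes F :: "real \<Rightarrow> 'a measure" and W :: "real \<Rightarrow> 'a \<Rightarrow> real"
  assumes filt: "filtration (space M) F"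
    and sub: "\<And>t. subalgebra M (F t)"
    and bm: "brownian_motion M F W"
begin

lemma space_F[simp]: "space (F t) = space M"
  using filt by (auto simp: filtration_def)

lemma subalgebra_F: "s \<le> t \<Longrightarrow> subalgebra (F t) (F s)"
  using filt by (auto simp: filtration_def subalgebra_def)

lemma meas_F_mono: "f \<in> borel_measurable (F s) \<Longrightarrow> s \<le> t \<Longrightarrow> f \<in> borel_measurable (F t)"
  using measurable_from_subalg[OF subalgebra_F] by blast

lemma meas_F_M: "f \<in> borel_measurable (F s) \<Longrightarrow> f \<in> borel_measurable M"
  using measurable_from_subalg[OF sub] by blast

lemma finite_measure_subalgebra_F: "finite_measure_subalgebra M (F t)"
  by unfold_locales (rule sub)

lemma sigma_finite_subalgebra_F: "sigma_finite_subalgebra M (F t)"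
  using finite_measure_subalgebra_F finite_measure_subalgebra_is_sigma_finite by blast

lemma W_adapted: "t \<ge> 0 \<Longrightarrow> W t \<in> borel_measurable (F t)"
  using bm by (auto simp: brownian_motion_def adapted_def)

lemma W_meas: "t \<ge> 0 \<Longrightarrow> W t \<in> borel_measurable M"
  using W_adapted meas_F_M by blast

lemma W_cont: "AE \<omega> in M. continuous_on {0..} (\<lambda>t. W t \<omega>)"
  using bm by (auto simp: brownian_motion_def continuous_paths_def)

lemma W_0: "AE \<omega> in M. W 0 \<omega> = 0"
  using bm by (auto simp: brownian_motion_def)

lemma W_normal: "0 \<le> s \<Longrightarrow> s < t \<Longrightarrow>
    distributed M lborel (\<lambda>\<omega>. W t \<omega> - W s \<omega>) (normal_density 0 (sqrt (t - s)))"
  using bm by (auto simp: brownian_motion_def)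

lemma W_indep:
  fixes X :: "'a \<Rightarrow> complex" and \<phi> :: "real \<Rightarrow> complex"
  assumes st: "0 \<le> s" "s < t" and X: "X \<in> borel_measurable (F s)"
    and \<phi>[measurable]: "\<phi> \<in> borel_measurable borel"
  shows "indep_var borel X borel (\<lambda>\<omega>. \<phi> (W t \<omega> - W s \<omega>))"
proof -
  let ?D = "\<lambda>\<omega>. W t \<omega> - W s \<omega>"
  have ind: "indep_set (sets (F s)) (sets (vimage_algebra (space M) ?D borel))"
    using bm st by (auto simp: brownian_motion_def)
  have [measurable]: "W t \<in> borel_measurable M" "W s \<in> borel_measurable M"
    using st by (auto intro: W_meas)
  show ?thesis
    unfolding indep_var_eq
  proof (intro conjI)
    show "X \<in> borel_measurable M" using X meas_F_M by blast
    show "(\<lambda>\<omega>. \<phi> (?D \<omega>)) \<in> borel_measurable M" by measurable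
    have 1: "sigma_sets (space M) {X -` A \<inter> space M |A. A \<in> sets borel} \<subseteq> sets (F s)"
      using measurable_sets[OF X] sets.sigma_sets_subset[of "{X -` A \<inter> space M |A. A \<in> sets borel}" "F s"] by auto
    have "(\<lambda>\<omega>. \<phi> (?D \<omega>)) -` A \<inter> space M \<in> sets (vimage_algebra (space M) ?D borel)"
      if A: "A \<in> sets borel" for A
    proof -
      have "(\<lambda>\<omega>. \<phi> (?D \<omega>)) -` A \<inter> space M = ?D -` (\<phi> -` A) \<inter> space M" by auto
      moreover have "\<phi> -` A \<in> sets borel" using measurable_sets[OF \<phi> A] by simp
      ultimately show ?thesis by (auto intro: in_vimage_algebra)
    qed
    then have 2: "sigma_sets (space M) {(\<lambda>\<omega>. \<phi> (?D \<omega>)) -` A \<inter> space M |A. A \<in> sets borel} \<subseteq>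
        sets (vimage_algebra (space M) ?D borel)"
      using sets.sigma_sets_subset[of "{(\<lambda>\<omega>. \<phi> (?D \<omega>)) -` A \<inter> space M |A. A \<in> sets borel}" "vimage_algebra (space M) ?D borel"]
      by auto
    show "indep_set (sigma_sets (space M) {X -` A \<inter> space M |A. A \<in> sets borel})
        (sigma_sets (space M) {(\<lambda>\<omega>. \<phi> (?D \<omega>)) -` A \<inter> space M |A. A \<in> sets borel})"
      using ind 1 2 unfolding indep_set_def
      by (rule_tac indep_sets_mono_sets[where F = "case_bool (sets (F s)) (sets (vimage_algebra (space M) ?D borel))"])
        (auto split: bool.split)
  qed
qed

text \<open>Independence is postulated only for \<open>s < t\<close>. At \<open>s = t\<close> the
  second factor is the constant \<open>\<phi> 0\<close>; this case is included because partitions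
  may repeat points.\<close>

lemma W_indep_integral:
  fixes X :: "'a \<Rightarrow> complex" and \<phi> :: "real \<Rightarrow> complex"
  assumes st: "0 \<le> s" "s \<le> t" and X: "X \<in> borel_measurable (F s)" "integrable M X"
    and \<phi>[measurable]: "\<phi> \<in> borel_measurable borel" and i: "integrable M (\<lambda>\<omega>. \<phi> (W t \<omega> - W s \<omega>))"
  shows "integrable M (\<lambda>\<omega>. X \<omega> * \<phi> (W t \<omega> - W s \<omega>))"
    and "expectation (\<lambda>\<omega>. X \<omega> * \<phi> (W t \<omega> - W s \<omega>)) = expectation X * expectation (\<lambda>\<omega>. \<phi> (W t \<omega> - W s \<omega>))"
proof -
  have "integrable M (\<lambda>\<omega>. X \<omega> * \<phi> (W t \<omega> - W s \<omega>)) \<and>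
   expectation (\<lambda>\<omega>. X \<omega> * \<phi> (W t \<omega> - W s \<omega>)) = expectation X * expectation (\<lambda>\<omega>. \<phi> (W t \<omega> - W s \<omega>))"
  proof (cases "s = t")
    case True
    then show ?thesis using X by (simp add: prob_space)
  next
    case False
    with st have "s < t" by simp
    note ind = W_indep[OF st(1) this X(1) \<phi>]
    show ?thesis
      using indep_var_integrable[OF ind X(2) i] indep_var_lebesgue_integral[OF ind X(2) i] by simp
  qed
  then show "integrable M (\<lambda>\<omega>. X \<omega> * \<phi> (W t \<omega> - W s \<omega>))"
    "expectation (\<lambda>\<omega>. X \<omega> * \<phi> (W t \<omega> - W s \<omega>)) = expectation X * expectation (\<lambda>\<omega>. \<phi> (W t \<omega> - W s \<omega>))"
    by auto
qed

lemma W_moments: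
  assumes st: "0 \<le> s" "s \<le> t"
  shows "integrable M (\<lambda>\<omega>. W t \<omega> - W s \<omega>)" "expectation (\<lambda>\<omega>. W t \<omega> - W s \<omega>) = 0"
    "integrable M (\<lambda>\<omega>. (W t \<omega> - W s \<omega>)\<^sup>2)" "expectation (\<lambda>\<omega>. (W t \<omega> - W s \<omega>)\<^sup>2) = t - s"
proof -
  have "integrable M (\<lambda>\<omega>. W t \<omega> - W s \<omega>) \<and> expectation (\<lambda>\<omega>. W t \<omega> - W s \<omega>) = 0 \<and>
    integrable M (\<lambda>\<omega>. (W t \<omega> - W s \<omega>)\<^sup>2) \<and> expectation (\<lambda>\<omega>. (W t \<omega> - W s \<omega>)\<^sup>2) = t - s"
  proof (cases "s = t")
    case False
    with st have lt: "s < t" by simp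
    note D = W_normal[OF st(1) lt]
    have sp: "sqrt (t - s) > 0" using lt by simp
    have i1: "integrable M (\<lambda>\<omega>. W t \<omega> - W s \<omega>)"
      using integrable_normal_moment[OF sp, where k=1 and \<mu>=0] distributed_integrable[OF D, of "\<lambda>x. x"] by simp
    have i2: "integrable M (\<lambda>\<omega>. (W t \<omega> - W s \<omega>)\<^sup>2)"
      using integrable_normal_moment[OF sp, where k=2 and \<mu>=0] distributed_integrable[OF D, of "\<lambda>x. x\<^sup>2"] by simp
    have e1: "expectation (\<lambda>\<omega>. W t \<omega> - W s \<omega>) = 0"
      by (rule normal_distributed_expectation[OF sp D])
    have "variance (\<lambda>\<omega>. W t \<omega> - W s \<omega>) = (sqrt (t - s))\<^sup>2"
      by (rule normal_distributed_variance[OF sp D])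
    with e1 have "expectation (\<lambda>\<omega>. (W t \<omega> - W s \<omega>)\<^sup>2) = t - s" using lt by simp
    with i1 i2 e1 show ?thesis by simp
  qed simp
  then show "integrable M (\<lambda>\<omega>. W t \<omega> - W s \<omega>)" "expectation (\<lambda>\<omega>. W t \<omega> - W s \<omega>) = 0"
    "integrable M (\<lambda>\<omega>. (W t \<omega> - W s \<omega>)\<^sup>2)" "expectation (\<lambda>\<omega>. (W t \<omega> - W s \<omega>)\<^sup>2) = t - s"
    by auto
qed

lemma W_char:
  assumes st: "0 \<le> s" "s \<le> t"
  shows "expectation (\<lambda>\<omega>. exp (\<i> * of_real (y * (W t \<omega> - W s \<omega>)))) = of_real (exp (- (y\<^sup>2 * (t - s) / 2)))"
proof (cases "s = t")
  case False
  with st have lt: "s < t" by simp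
  note D = W_normal[OF st(1) lt]
  have sp: "sqrt (t - s) > 0" using lt by simp
  let ?Z = "\<lambda>\<omega>. (W t \<omega> - W s \<omega>) / sqrt (t - s)"
  have Z: "distributed M lborel ?Z std_normal_density"
    using normal_standard_normal_convert[OF sp, of "\<lambda>\<omega>. W t \<omega> - W s \<omega>" 0] D by simp
  have [measurable]: "?Z \<in> borel_measurable M"
    using Z by (auto simp: distributed_def)
  have dd: "distr M lborel ?Z = std_normal_distribution"
    using Z by (auto simp: distributed_def)
  have "expectation (\<lambda>\<omega>. exp (\<i> * of_real (y * (W t \<omega> - W s \<omega>)))) =
     expectation (\<lambda>\<omega>. iexp ((y * sqrt (t - s)) * ?Z \<omega>))"
    using sp by (intro Bochner_Integration.integral_cong refl) (simp)
  also have "\<dots> = (CLINT x|distr M lborel ?Z. iexp ((y * sqrt (t - s)) * x))"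
    by (subst integral_distr) auto
  also have "\<dots> = char std_normal_distribution (y * sqrt (t - s))"
    unfolding dd char_def ..
  also have "\<dots> = of_real (exp (- (y\<^sup>2 * (t - s) / 2)))"
    using lt by (simp add: char_std_normal_distribution power_mult_distrib)
  finally show ?thesis .
qed (simp add: prob_space)

end

section \<open>Clipped martingale transforms\<close>

text \<open>Truncation of the values replaces stopping at the first exit from [-c, c]. It gives
  square integrability to a process that is only an L1 martingale, at the price of a drift that has
  to be controlled.\<close>

definition clip :: "real \<Rightarrow> real \<Rightarrow> real" where
  "clip c x = max (- c) (min c x)"

lemma clip_measurable[measurable]: "clip c \<in> borel_measurable borel"
  unfolding clip_def by measurable

lemma clip_bound: "c \<ge> 0 \<Longrightarrow> \<bar>clip c x\<bar> \<le> c"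
  by (auto simp: clip_def)

lemma clip_eq: "\<bar>x\<bar> \<le> c \<Longrightarrow> clip c x = x"
  by (auto simp: clip_def)

lemma partition_mono:
  assumes "is_partition T n p" "i \<le> j" "j \<le> n"
  shows "p i \<le> p j"
  using assms(2,3)
proof (induction j rule: dec_induct)
  case (step j)
  then show ?case using assms(1) unfolding is_partition_def by (metis Suc_le_eq Suc_leD order_trans)
qed simp

lemma partition_bounds:
  assumes "is_partition T n p" "k \<le> n"
  shows "0 \<le> p k" "p k \<le> T"
  using partition_mono[OF assms(1), of 0 k] partition_mono[OF assms(1), of k n] assms
  by (auto simp: is_partition_def)

context bm_space
begin

lemma martingale_orth:
  assumes N: "martingale M F N" and st: "0 \<le> s" "s \<le> t"
    and \<Phi>: "\<Phi> \<in> borel_measurable (F s)" "\<And>\<omega>. \<omega> \<in> space M \<Longrightarrow> \<bar>\<Phi> \<omega>\<bar> \<le> C"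
  shows "expectation (\<lambda>\<omega>. \<Phi> \<omega> * (N t \<omega> - N s \<omega>)) = 0"
proof -
  interpret S: sigma_finite_subalgebra M "F s" by (rule sigma_finite_subalgebra_F)
  have i: "integrable M (N t)" "integrable M (N s)"
    and ae: "AE \<omega> in M. real_cond_exp M (F s) (N t) \<omega> = N s \<omega>"
    using N st by (auto simp: martingale_def)
  have \<Phi>M: "\<Phi> \<in> borel_measurable M" using \<Phi> meas_F_M by blast
  have it: "integrable M (\<lambda>\<omega>. \<Phi> \<omega> * N t \<omega>)" "integrable M (\<lambda>\<omega>. \<Phi> \<omega> * N s \<omega>)"
    using integrable_mult_bounded[OF _ \<Phi>M, of _ C] i \<Phi>(2) by auto
  have "expectation (\<lambda>\<omega>. \<Phi> \<omega> * N t \<omega>) = expectation (\<lambda>\<omega>. \<Phi> \<omega> * real_cond_exp M (F s) (N t) \<omega>)"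
    using S.real_cond_exp_intg(2)[OF it(1) \<Phi>(1)] i by auto
  also have "\<dots> = expectation (\<lambda>\<omega>. \<Phi> \<omega> * N s \<omega>)"
    using ae i \<Phi>M by (intro integral_cong_AE) auto
  finally show ?thesis using it by (simp add: right_diff_distrib)
qed

lemma martingale_uminus:
  assumes N: "martingale M F N"
  shows "martingale M F (\<lambda>t \<omega>. - N t \<omega>)"
  unfolding martingale_def
proof (intro conjI allI impI)
  show "adapted F (\<lambda>t \<omega>. - N t \<omega>)" using N by (auto simp: martingale_def adapted_def)
  show "integrable M (\<lambda>\<omega>. - N t \<omega>)" if "0 \<le> t" for t using N that by (auto simp: martingale_def)
  fix s t :: real assume st: "0 \<le> s \<and> s \<le> t"
  interpret S: sigma_finite_subalgebra M "F s" by (rule sigma_finite_subalgebra_F)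
  have i: "integrable M (N t)" and ae: "AE \<omega> in M. real_cond_exp M (F s) (N t) \<omega> = N s \<omega>"
    using N st by (auto simp: martingale_def)
  show "AE \<omega> in M. real_cond_exp M (F s) (\<lambda>\<omega>. - N t \<omega>) \<omega> = - N s \<omega>"
    using S.real_cond_exp_cmult[OF i, of "-1"] ae by eventually_elim simp
qed

text \<open>A weak conditional Jensen inequality: the convex function \<open>max 0 (y - c)\<close>
  lies above its supporting line at \<open>N s\<close>, whose slope is 1 or 0 according to
  \<open>N s > c\<close>. The slope is known at time \<open>s\<close>, so martingale orthogonality
  removes the linear term.\<close>

lemma excess_submartingale:
  assumes N: "martingale M F N" and st: "0 \<le> s" "s \<le> t"
    and \<Phi>: "\<Phi> \<in> borel_measurable (F s)" "\<And>\<omega>. \<omega> \<in> space M \<Longrightarrow> 0 \<le> \<Phi> \<omega>" "\<And>\<omega>. \<omega> \<in> space M \<Longrightarrow> \<Phi> \<omega> \<le> C"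
  shows "expectation (\<lambda>\<omega>. \<Phi> \<omega> * (max 0 (N t \<omega> - c) - max 0 (N s \<omega> - c))) \<ge> 0"
proof -
  let ?\<Psi> = "\<lambda>\<omega>. \<Phi> \<omega> * (if N s \<omega> > c then 1 else 0)"
  have i[simp]: "integrable M (N t)" "integrable M (N s)" and [measurable]: "N s \<in> borel_measurable (F s)"
    using N st by (auto simp: martingale_def adapted_def)
  have \<Phi>M: "\<Phi> \<in> borel_measurable M" using \<Phi> meas_F_M by blast
  have \<Psi>: "?\<Psi> \<in> borel_measurable (F s)" using \<Phi>(1) by measurable
  have b: "\<bar>\<Phi> \<omega>\<bar> \<le> C" "\<bar>?\<Psi> \<omega>\<bar> \<le> C" if "\<omega> \<in> space M" for \<omega> using \<Phi>(2,3)[OF that] by auto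
  have "0 = expectation (\<lambda>\<omega>. ?\<Psi> \<omega> * (N t \<omega> - N s \<omega>))"
    using martingale_orth[OF N st \<Psi> b(2)] by simp
  also have "\<dots> \<le> expectation (\<lambda>\<omega>. \<Phi> \<omega> * (max 0 (N t \<omega> - c) - max 0 (N s \<omega> - c)))"
  proof (rule integral_mono)
    show "integrable M (\<lambda>\<omega>. ?\<Psi> \<omega> * (N t \<omega> - N s \<omega>))"
      using b(2) \<Psi> by (intro integrable_mult_bounded[where C=C]) (auto intro: meas_F_M)
    show "integrable M (\<lambda>\<omega>. \<Phi> \<omega> * (max 0 (N t \<omega> - c) - max 0 (N s \<omega> - c)))"
      using b(1) \<Phi>M by (intro integrable_mult_bounded[where C=C] Bochner_Integration.integrable_diff integrable_max) auto
    show "?\<Psi> \<omega> * (N t \<omega> - N s \<omega>) \<le> \<Phi> \<omega> * (max 0 (N t \<omega> - c) - max 0 (N s \<omega> - c))"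
      if "\<omega> \<in> space M" for \<omega>
      using \<Phi>(2)[OF that] by (cases "N s \<omega> > c") (auto intro!: mult_left_mono)
  qed
  finally show ?thesis .
qed

text \<open>Since \<open>clip c y = y - max 0 (y - c) + max 0 (- y - c)\<close>, the clipped process
  is a martingale minus one submartingale plus another. Its drift over [s, t] is bounded by the
  growth of the expected excess \<open>V\<close>, and this bound telescopes along a partition. The
  second moment bound uses (y - x)^2 = y^2 - x^2 - 2 x (y - x), where -x is a weight bounded by
  \<open>c\<close>.\<close>

lemma clipped_martingale_increment:
  fixes N :: "real \<Rightarrow> 'a \<Rightarrow> real"
  assumes N: "martingale M F N" and st: "0 \<le> s" "s \<le> t" and c: "c > 0"
  defines "V \<equiv> (\<lambda>r. expectation (\<lambda>\<omega>. max 0 (N r \<omega> - c) + max 0 (- N r \<omega> - c)))"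
  defines "Y \<equiv> (\<lambda>r \<omega>. clip c (N r \<omega>))"
  shows "expectation (\<lambda>\<omega>. (Y t \<omega> - Y s \<omega>)\<^sup>2) \<le>
           expectation (\<lambda>\<omega>. (Y t \<omega>)\<^sup>2) - expectation (\<lambda>\<omega>. (Y s \<omega>)\<^sup>2) + 2 * c * (V t - V s)" (is ?A)
    and "\<And>\<sigma>. \<sigma> \<in> borel_measurable (F s) \<Longrightarrow> (\<And>\<omega>. \<omega> \<in> space M \<Longrightarrow> \<bar>\<sigma> \<omega>\<bar> \<le> 1) \<Longrightarrow>
            expectation (\<lambda>\<omega>. \<sigma> \<omega> * (Y t \<omega> - Y s \<omega>)) \<le> V t - V s"
proof -
  define P where "P r \<omega> = max 0 (N r \<omega> - c)" for r \<omega>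
  define Q where "Q r \<omega> = max 0 (- N r \<omega> - c)" for r \<omega>
  have i[simp]: "integrable M (N t)" "integrable M (N s)" and [measurable]: "N s \<in> borel_measurable (F s)"
    using N st by (auto simp: martingale_def adapted_def)
  have [measurable]: "N s \<in> borel_measurable M" "N t \<in> borel_measurable M"
    using borel_measurable_integrable i by blast+
  have iPQ[simp]: "integrable M (P t)" "integrable M (P s)" "integrable M (Q t)" "integrable M (Q s)"
    unfolding P_def Q_def by (auto intro!: integrable_max)
  have Y: "Y r \<omega> = N r \<omega> - P r \<omega> + Q r \<omega>" for r \<omega>
    using c by (auto simp: Y_def P_def Q_def clip_def)
  have Yb: "\<bar>Y r \<omega>\<bar> \<le> c" for r \<omega> using c by (simp add: Y_def clip_bound)
  have [measurable]: "Y s \<in> borel_measurable (F s)" by (simp add: Y_def)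
  have [measurable]: "Y s \<in> borel_measurable M" "Y t \<in> borel_measurable M"  by (simp_all add: Y_def)
  have V: "V r = expectation (P r) + expectation (Q r)" if "r = s \<or> r = t" for r
  proof -
    have "V r = expectation (\<lambda>\<omega>. P r \<omega> + Q r \<omega>)" by (simp add: V_def P_def Q_def)
    also have "\<dots> = expectation (P r) + expectation (Q r)"
      using iPQ that by (intro Bochner_Integration.integral_add) auto
    finally show ?thesis .
  qed
  have main: "expectation (\<lambda>\<omega>. \<sigma> \<omega> * (Y t \<omega> - Y s \<omega>)) \<le> K * (V t - V s)"
    if \<sigma>: "\<sigma> \<in> borel_measurable (F s)" "\<And>\<omega>. \<omega> \<in> space M \<Longrightarrow> \<bar>\<sigma> \<omega>\<bar> \<le> K" for \<sigma> K
  proof -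
    have \<sigma>M[measurable]: "\<sigma> \<in> borel_measurable M" using \<sigma> meas_F_M by blast
    have \<sigma>': "- K \<le> \<sigma> \<omega>" "\<sigma> \<omega> \<le> K" if "\<omega> \<in> space M" for \<omega> using \<sigma>(2)[OF that] by auto
    have im: "integrable M (\<lambda>\<omega>. \<sigma> \<omega> * X \<omega>)" if "integrable M X" for X
      by (rule integrable_mult_bounded[OF that \<sigma>M, of K]) (use \<sigma>(2) in auto)
    \<comment> \<open>Both \<open>K + \<sigma>\<close> and \<open>K - \<sigma>\<close> are
      nonnegative, so \<open>\<sigma>\<close> can be traded for the constant \<open>K\<close> in
      front of each submartingale separately.\<close>
    have A: "expectation (\<lambda>\<omega>. (K + \<sigma> \<omega>) * (P t \<omega> - P s \<omega>)) \<ge> 0" unfolding P_def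
      by (rule excess_submartingale[OF N st, where C = "2 * K"]) (use \<sigma> \<sigma>' in \<open>auto simp: add.commute\<close>, fastforce+)
    have B: "expectation (\<lambda>\<omega>. (K - \<sigma> \<omega>) * (Q t \<omega> - Q s \<omega>)) \<ge> 0" unfolding Q_def
      by (rule excess_submartingale[OF martingale_uminus[OF N] st, where C = "2 * K"])
        (use \<sigma> \<sigma>' in \<open>auto\<close>, fastforce+)
    have D: "expectation (\<lambda>\<omega>. \<sigma> \<omega> * (N t \<omega> - N s \<omega>)) = 0"
      by (rule martingale_orth[OF N st \<sigma>])
    show ?thesis
      using A B D
      by (simp add: Y V im algebra_simps)
  qed
  show "expectation (\<lambda>\<omega>. \<sigma> \<omega> * (Y t \<omega> - Y s \<omega>)) \<le> V t - V s"
    if "\<sigma> \<in> borel_measurable (F s)" "\<And>\<omega>. \<omega> \<in> space M \<Longrightarrow> \<bar>\<sigma> \<omega>\<bar> \<le> 1" for \<sigma>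
    using main[OF that] by simp
  have iYb: "integrable M f" if "f \<in> borel_measurable M" "\<And>\<omega>. \<bar>f \<omega>\<bar> \<le> 4 * c * c" for f
    by (rule integrable_const_bound[where B = "4 * c * c"]) (use that in auto)
  have Y2: "\<bar>Y r \<omega> * Y q \<omega>\<bar> \<le> c * c" for r q \<omega>
    unfolding abs_mult using Yb c by (intro mult_mono) auto
  have Y2': "\<bar>Y r \<omega> * Y q \<omega>\<bar> \<le> 4 * c * c" for r q \<omega>
    using Y2[of r \<omega> q] by (rule order_trans) (use c in auto)
  have iYY: "integrable M (\<lambda>\<omega>. Y t \<omega> * Y t \<omega>)" "integrable M (\<lambda>\<omega>. Y s \<omega> * Y t \<omega>)" 
    "integrable M (\<lambda>\<omega>. Y s \<omega> * Y s \<omega>)"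
    by (auto intro!: iYb Y2')
  have "expectation (\<lambda>\<omega>. - Y s \<omega> * (Y t \<omega> - Y s \<omega>)) \<le> c * (V t - V s)"
    by (rule main) (use Yb in auto)
  then show ?A
    using iYY by (simp add: power2_eq_square algebra_simps)
qed

end

lemma abs_square_le: "\<bar>x\<bar> \<le> B \<Longrightarrow> \<bar>x\<^sup>2\<bar> \<le> B\<^sup>2" for x B :: real
  by (metis abs_ge_zero abs_power2 power2_abs power_mono)

context bm_space
begin

text \<open>Doob decomposition of the clipped sequence: \<open>G\<close> is the predictable
  increment and \<open>D\<close> the martingale difference. The sum of E|G| is at most
  \<open>L\<close> and the sum of E(\<Delta>^2) at most \<open>3 * c * L\<close>, whatever the
  partition. Chebyshev at \<open>\<epsilon> / 2\<close> for the \<open>D\<close>-part and Markov at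
  \<open>\<epsilon> / (2 * \<kappa>)\<close> for the \<open>G\<close>-part give the two terms; hence
  the constants 12 = 3 * 4 and 2.\<close>

lemma clipped_transform_bound:
  fixes N :: "real \<Rightarrow> 'a \<Rightarrow> real"
  assumes N: "martingale M F N" and p: "is_partition T n p" and c: "c > 0"
    and w: "\<And>k. k < n \<Longrightarrow> w k \<in> borel_measurable (F (p k))"
    and wb: "\<And>k \<omega>. k < n \<Longrightarrow> \<omega> \<in> space M \<Longrightarrow> \<bar>w k \<omega>\<bar> \<le> \<kappa>"
    and pos: "\<kappa> > 0" "\<epsilon> > 0"
  defines "L \<equiv> expectation (\<lambda>\<omega>. \<bar>N T \<omega>\<bar>)"
  shows "prob {\<omega>\<in>space M. \<bar>\<Sum>k<n. w k \<omega> * (clip c (N (p (Suc k)) \<omega>) - clip c (N (p k) \<omega>))\<bar> > \<epsilon>}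
         \<le> 12 * c * \<kappa>\<^sup>2 * L / \<epsilon>\<^sup>2 + 2 * \<kappa> * L / \<epsilon>"
proof -
  define V where "V r = expectation (\<lambda>\<omega>. max 0 (N r \<omega> - c) + max 0 (- N r \<omega> - c))" for r
  define Y where "Y r \<omega> = clip c (N r \<omega>)" for r \<omega>
  define \<Delta> where "\<Delta> k \<omega> = Y (p (Suc k)) \<omega> - Y (p k) \<omega>" for k \<omega>
  \<comment> \<open>A conditional expectation of \<open>\<Delta> k\<close> is within 2c only almost
    everywhere; clipping selects a version bounded at every point.\<close>
  define G where "G k \<omega> = clip (2 * c) (real_cond_exp M (F (p k)) (\<Delta> k) \<omega>)" for k \<omega>
  define D where "D k \<omega> = \<Delta> k \<omega> - G k \<omega>" for k \<omega>
  have pk: "0 \<le> p k" "p k \<le> T" if "k \<le> n" for k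
    using partition_bounds[OF p that] by auto
  have pS: "p k \<le> p (Suc k)" if "k < n" for k using p that by (auto simp: is_partition_def)
  have T: "0 \<le> T" and p0: "p 0 = 0" "p n = T" using pk[of n] p by (auto simp: is_partition_def)
  have Ni: "integrable M (N r)" "N r \<in> borel_measurable (F r)" if "0 \<le> r" for r
    using N that by (auto simp: martingale_def adapted_def)
  have YF: "Y (p k) \<in> borel_measurable (F (p k))" if "k \<le> n" for k
    using Ni(2)[OF pk(1)[OF that]] unfolding Y_def by measurable
  have YM[measurable]: "Y (p k) \<in> borel_measurable M" if "k \<le> n" for k using YF[OF that] meas_F_M by blast
  have Yb: "\<bar>Y r \<omega>\<bar> \<le> c" for r \<omega> using c by (simp add: Y_def clip_bound)
  have \<Delta>M[measurable]: "\<Delta> k \<in> borel_measurable M" if "k < n" for k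
    unfolding \<Delta>_def using YM[of k] YM[of "Suc k"] that by (intro borel_measurable_diff) auto
  have \<Delta>b: "\<bar>\<Delta> k \<omega>\<bar> \<le> 2 * c" for k \<omega>
    using Yb[of "p (Suc k)" \<omega>] Yb[of "p k" \<omega>] by (auto simp: \<Delta>_def)
  have GF: "G k \<in> borel_measurable (F (p k))" for k
    unfolding G_def by measurable
  have GM[measurable]: "G k \<in> borel_measurable M" for k using GF meas_F_M by blast
  have Gb: "\<bar>G k \<omega>\<bar> \<le> 2 * c" for k \<omega> using c by (simp add: G_def clip_bound)
  have DM[measurable]: "D k \<in> borel_measurable M" if "k < n" for k
    unfolding D_def using that by measurable
  have Db: "\<bar>D k \<omega>\<bar> \<le> 4 * c" for k \<omega> using \<Delta>b[of k \<omega>] Gb[of k \<omega>] by (auto simp: D_def)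
  have \<Delta>i: "integrable M (\<Delta> k)" if "k < n" for k
    by (rule integrable_const_bound[where B = "2 * c"]) (use \<Delta>b \<Delta>M[OF that] in auto)
  have bi: "integrable M f" if "f \<in> borel_measurable M" "\<And>\<omega>. \<omega> \<in> space M \<Longrightarrow> \<bar>f \<omega>\<bar> \<le> B" for f :: "'a \<Rightarrow> real" and B
    by (rule integrable_const_bound[where B = B]) (use that in auto)
  have iG: "integrable M (\<lambda>\<omega>. \<bar>G k \<omega>\<bar>)" for k
    by (rule bi[of _ "2 * c"]) (use Gb[of k] in auto)
  have orth: "expectation (\<lambda>\<omega>. \<Phi> \<omega> * \<Delta> k \<omega>) = expectation (\<lambda>\<omega>. \<Phi> \<omega> * G k \<omega>)"
    if k: "k < n" and \<Phi>: "\<Phi> \<in> borel_measurable (F (p k))" "\<And>\<omega>. \<omega> \<in> space M \<Longrightarrow> \<bar>\<Phi> \<omega>\<bar> \<le> C" for k \<Phi> C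
  proof -
    interpret S: sigma_finite_subalgebra M "F (p k)" by (rule sigma_finite_subalgebra_F)
    have [measurable]: "\<Phi> \<in> borel_measurable M" using \<Phi> meas_F_M by blast
    have i: "integrable M (\<lambda>\<omega>. \<Phi> \<omega> * \<Delta> k \<omega>)"
      by (rule integrable_mult_bounded[OF \<Delta>i[OF k], where C = C]) (use \<Phi> in auto)
    have "AE \<omega> in M. real_cond_exp M (F (p k)) (\<Delta> k) \<omega> \<le> 2 * c"
      by (rule S.real_cond_exp_le_c[OF \<Delta>i[OF k]]) (use \<Delta>b abs_le_D1 in blast)
    moreover have "AE \<omega> in M. real_cond_exp M (F (p k)) (\<Delta> k) \<omega> \<ge> - (2 * c)"
      by (rule S.real_cond_exp_ge_c[OF \<Delta>i[OF k]]) (use \<Delta>b abs_le_D2 minus_le_iff in blast)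
    ultimately have ae: "AE \<omega> in M. real_cond_exp M (F (p k)) (\<Delta> k) \<omega> = G k \<omega>"
      by eventually_elim (simp add: G_def clip_eq abs_le_iff)
    have "expectation (\<lambda>\<omega>. \<Phi> \<omega> * \<Delta> k \<omega>) = expectation (\<lambda>\<omega>. \<Phi> \<omega> * real_cond_exp M (F (p k)) (\<Delta> k) \<omega>)"
      using S.real_cond_exp_intg(2)[OF i \<Phi>(1)] k by auto
    also have "\<dots> = expectation (\<lambda>\<omega>. \<Phi> \<omega> * G k \<omega>)"
      using ae by (intro integral_cong_AE) auto
    finally show ?thesis .
  qed
  have EG: "expectation (\<lambda>\<omega>. \<bar>G k \<omega>\<bar>) \<le> V (p (Suc k)) - V (p k)" if k: "k < n" for k
  proof -
    \<comment> \<open>The sign of \<open>G k\<close> is an admissible weight at time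
      \<open>p k\<close>; testing with it turns E|G| into the expectation of a weighted clipped
      increment.\<close>
    have s: "(\<lambda>\<omega>. sgn (G k \<omega>)) \<in> borel_measurable (F (p k))" using GF[of k] by measurable
    have sb: "\<bar>sgn (G k \<omega>)\<bar> \<le> 1" if "\<omega> \<in> space M" for \<omega> by (simp add: abs_sgn_eq)
    have "expectation (\<lambda>\<omega>. \<bar>G k \<omega>\<bar>) = expectation (\<lambda>\<omega>. sgn (G k \<omega>) * G k \<omega>)"
      by (simp add: abs_sgn mult.commute)
    also have "\<dots> = expectation (\<lambda>\<omega>. sgn (G k \<omega>) * \<Delta> k \<omega>)"
      by (rule orth[OF k s sb, symmetric])
    also have "\<dots> \<le> V (p (Suc k)) - V (p k)"
      unfolding \<Delta>_def V_def Y_def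
      by (rule clipped_martingale_increment(2)[OF N _ _ c s]) (use k pk pS in \<open>auto simp: abs_sgn_eq\<close>)
    finally show ?thesis .
  qed
  have ED: "expectation (\<lambda>\<omega>. (\<Delta> k \<omega>)\<^sup>2) \<le>
      expectation (\<lambda>\<omega>. (Y (p (Suc k)) \<omega>)\<^sup>2) - expectation (\<lambda>\<omega>. (Y (p k) \<omega>)\<^sup>2) + 2 * c * (V (p (Suc k)) - V (p k))"
    if k: "k < n" for k
    unfolding \<Delta>_def V_def Y_def
    by (rule clipped_martingale_increment(1)[OF N _ _ c]) (use k pk pS in auto)
  have V0: "V r \<ge> 0" for r unfolding V_def by (rule integral_nonneg_AE) auto
  have VT: "V T \<le> L" unfolding V_def L_def
    by (rule integral_mono) (use Ni(1)[OF T] c in \<open>auto intro!: integrable_max\<close>)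
  have L0: "L \<ge> 0" unfolding L_def by simp
  have sumG: "(\<Sum>k<n. expectation (\<lambda>\<omega>. \<bar>G k \<omega>\<bar>)) \<le> L"
  proof -
    have "(\<Sum>k<n. expectation (\<lambda>\<omega>. \<bar>G k \<omega>\<bar>)) \<le> (\<Sum>k<n. V (p (Suc k)) - V (p k))"
      using EG by (intro sum_mono) auto
    also have "\<dots> = V T - V 0" using p0 by (simp add: sum_lessThan_telescope[of "\<lambda>k. V (p k)"])
    finally show ?thesis using VT V0[of 0] by linarith
  qed
  have sumD: "(\<Sum>k<n. expectation (\<lambda>\<omega>. (\<Delta> k \<omega>)\<^sup>2)) \<le> 3 * c * L"
  proof -
    have "(\<Sum>k<n. expectation (\<lambda>\<omega>. (\<Delta> k \<omega>)\<^sup>2)) \<le> (\<Sum>k<n. 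
      (expectation (\<lambda>\<omega>. (Y (p (Suc k)) \<omega>)\<^sup>2) + 2 * c * V (p (Suc k))) - (expectation (\<lambda>\<omega>. (Y (p k) \<omega>)\<^sup>2) + 2 * c * V (p k)))"
      using ED by (intro sum_mono) (auto simp: algebra_simps)
    also have "\<dots> = (expectation (\<lambda>\<omega>. (Y T \<omega>)\<^sup>2) + 2 * c * V T) - (expectation (\<lambda>\<omega>. (Y 0 \<omega>)\<^sup>2) + 2 * c * V 0)"
      using p0 by (subst sum_lessThan_telescope[of "\<lambda>k. expectation (\<lambda>\<omega>. (Y (p k) \<omega>)\<^sup>2) + 2 * c * V (p k)"]) simp
    also have "\<dots> \<le> expectation (\<lambda>\<omega>. (Y T \<omega>)\<^sup>2) + 2 * c * V T"
    proof -
      have "0 \<le> expectation (\<lambda>\<omega>. (Y 0 \<omega>)\<^sup>2)" "0 \<le> 2 * c * V 0"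
        using V0[of 0] c by (auto intro!: integral_nonneg_AE)
      then show ?thesis by linarith
    qed
    \<comment> \<open>|Y| is bounded by \<open>c\<close> and by |N|, hence Y^2 by c|N|. The total is
      c L + 2 c L.\<close>
    also have "\<dots> \<le> expectation (\<lambda>\<omega>. c * \<bar>N T \<omega>\<bar>) + 2 * c * L"
    proof (intro add_mono integral_mono mult_left_mono VT)
      show "integrable M (\<lambda>\<omega>. (Y T \<omega>)\<^sup>2)"
        using YM[of n] p0 Yb c by (intro bi[of _ "c\<^sup>2"]) (auto simp: abs_le_square_iff[symmetric])
      show "(Y T \<omega>)\<^sup>2 \<le> c * \<bar>N T \<omega>\<bar>" for \<omega>
      proof -
        have "\<bar>Y T \<omega>\<bar> * \<bar>Y T \<omega>\<bar> \<le> c * \<bar>N T \<omega>\<bar>"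
          using Yb[of T \<omega>] c by (intro mult_mono) (auto simp: Y_def clip_def)
        then show ?thesis by (simp add: power2_eq_square)
      qed
    qed (use Ni(1)[OF T] c in auto)
    also have "\<dots> = 3 * c * L" by (simp add: L_def)
    finally show ?thesis .
  qed
  define S where "S j \<omega> = (\<Sum>k<j. w k \<omega> * D k \<omega>)" for j \<omega>
  have wM[measurable]: "w k \<in> borel_measurable M" if "k < n" for k using w[OF that] meas_F_M by blast
  have Sb: "\<bar>S j \<omega>\<bar> \<le> real j * (\<kappa> * (4 * c))" if "j \<le> n" "\<omega> \<in> space M" for j \<omega>
  proof -
    have "\<bar>S j \<omega>\<bar> \<le> (\<Sum>k<j. \<kappa> * (4 * c))" unfolding S_def
      using wb Db that pos c by (intro sum_abs[THEN order_trans] sum_mono) (auto simp: abs_mult intro!: mult_mono)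
    then show ?thesis by simp
  qed
  have SF: "S j \<in> borel_measurable (F (p j))" if "j \<le> n" for j
    unfolding S_def
  proof (rule borel_measurable_sum)
    fix k assume k: "k \<in> {..<j}"
    have kj: "p (Suc k) \<le> p j" "p k \<le> p j" using partition_mono[OF p] that k by auto
    have "Y (p (Suc k)) \<in> borel_measurable (F (p j))" "Y (p k) \<in> borel_measurable (F (p j))" 
      "G k \<in> borel_measurable (F (p j))" "w k \<in> borel_measurable (F (p j))"
      using YF[of k] YF[of "Suc k"] GF[of k] w[of k] k that kj by (auto intro: meas_F_mono)
    then show "(\<lambda>\<omega>. w k \<omega> * D k \<omega>) \<in> borel_measurable (F (p j))"
      unfolding D_def \<Delta>_def by measurable
  qed
  have SM: "S j \<in> borel_measurable M" if "j \<le> n" for j using SF[OF that] meas_F_M by blast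
  have S2: "integrable M (\<lambda>\<omega>. (S j \<omega>)\<^sup>2)" if "j \<le> n" for j
    by (rule bi[of _ "(real j * (\<kappa> * (4 * c)))\<^sup>2"])
      (use SM[OF that] Sb[OF that] pos c in \<open>auto simp: abs_le_square_iff[symmetric] abs_mult\<close>)
  have ES: "expectation (\<lambda>\<omega>. (S j \<omega>)\<^sup>2) \<le> \<kappa>\<^sup>2 * (\<Sum>k<j. expectation (\<lambda>\<omega>. (\<Delta> k \<omega>)\<^sup>2))" if "j \<le> n" for j
    using that
  proof (induction j)
    case 0
    then show ?case by (simp add: S_def)
  next
    case (Suc j)
    then have j: "j < n" "j \<le> n" by auto
    note [measurable] = wM[OF j(1)] \<Delta>M[OF j(1)] DM[OF j(1)] SM[OF j(2)]
    \<comment> \<open>Twice the earlier sum times the new weight is known at time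
      \<open>p j\<close>, so the cross term pairs it with \<Delta> - G and vanishes.\<close>
    define \<Phi> where "\<Phi> \<omega> = 2 * S j \<omega> * w j \<omega>" for \<omega>
    define B where "B = 2 * (real j * (\<kappa> * (4 * c))) * \<kappa>"
    have \<Phi>F: "\<Phi> \<in> borel_measurable (F (p j))" unfolding \<Phi>_def using SF[OF j(2)] w[OF j(1)] by measurable
    have [measurable]: "\<Phi> \<in> borel_measurable M" using \<Phi>F meas_F_M by blast
    have \<Phi>b: "\<bar>\<Phi> \<omega>\<bar> \<le> B" if "\<omega> \<in> space M" for \<omega>
      unfolding \<Phi>_def B_def abs_mult using Sb[OF j(2) that] wb[OF j(1) that] pos c
      by (intro mult_mono) auto
    have i1: "integrable M (\<lambda>\<omega>. \<Phi> \<omega> * \<Delta> j \<omega>)"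
      by (rule integrable_mult_bounded[OF \<Delta>i[OF j(1)], where C = B]) (use \<Phi>b in auto)
    have i2: "integrable M (\<lambda>\<omega>. \<Phi> \<omega> * G j \<omega>)"
      by (rule integrable_mult_bounded[OF bi[of _ "2*c"], where C = B]) (use \<Phi>b Gb in auto)
    have i3: "integrable M (\<lambda>\<omega>. (w j \<omega> * D j \<omega>)\<^sup>2)"
      by (rule bi[of _ "(\<kappa> * (4 * c))\<^sup>2"], measurable, rule abs_square_le)
        (use Db wb[OF j(1)] pos c in \<open>auto simp: abs_mult intro!: mult_mono\<close>)
    have i4: "integrable M (\<lambda>\<omega>. (D j \<omega>)\<^sup>2)"
      by (rule bi[of _ "(4 * c)\<^sup>2"], measurable, rule abs_square_le, rule Db)
    have i5: "integrable M (\<lambda>\<omega>. (\<Delta> j \<omega>)\<^sup>2)" 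
      by (rule bi[of _ "(2 * c)\<^sup>2"], measurable, rule abs_square_le, rule \<Delta>b)
    have i6: "integrable M (\<lambda>\<omega>. (G j \<omega>)\<^sup>2)" 
      by (rule bi[of _ "(2 * c)\<^sup>2"], measurable, rule abs_square_le, rule Gb)
    have i7: "integrable M (\<lambda>\<omega>. G j \<omega> * \<Delta> j \<omega>)" 
      by (rule integrable_mult_bounded[OF \<Delta>i[OF j(1)], where C = "2*c"]) (use Gb in auto)
    have "expectation (\<lambda>\<omega>. (S (Suc j) \<omega>)\<^sup>2) =
        expectation (\<lambda>\<omega>. (S j \<omega>)\<^sup>2 + (\<Phi> \<omega> * \<Delta> j \<omega> - \<Phi> \<omega> * G j \<omega>) + (w j \<omega> * D j \<omega>)\<^sup>2)"
      by (intro Bochner_Integration.integral_cong refl)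
        (simp add: S_def \<Phi>_def D_def power2_eq_square algebra_simps)
    also have "\<dots> = expectation (\<lambda>\<omega>. (S j \<omega>)\<^sup>2) + expectation (\<lambda>\<omega>. (w j \<omega> * D j \<omega>)\<^sup>2)"
      using orth[OF j(1) \<Phi>F \<Phi>b] i1 i2 i3 S2[OF j(2)] by simp
    also have "expectation (\<lambda>\<omega>. (w j \<omega> * D j \<omega>)\<^sup>2) \<le> expectation (\<lambda>\<omega>. \<kappa>\<^sup>2 * (D j \<omega>)\<^sup>2)"
      using i3 i4 wb[OF j(1)] pos
      by (intro integral_mono) (auto simp: power_mult_distrib abs_le_square_iff[symmetric] intro!: mult_right_mono)
    also have "expectation (\<lambda>\<omega>. \<kappa>\<^sup>2 * (D j \<omega>)\<^sup>2) = \<kappa>\<^sup>2 * expectation (\<lambda>\<omega>. (D j \<omega>)\<^sup>2)"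
      by simp
    also have "expectation (\<lambda>\<omega>. (D j \<omega>)\<^sup>2) = expectation (\<lambda>\<omega>. (\<Delta> j \<omega>)\<^sup>2 - 2 * (G j \<omega> * \<Delta> j \<omega>) + (G j \<omega>)\<^sup>2)"
      by (intro Bochner_Integration.integral_cong refl)
        (simp add: D_def power2_eq_square algebra_simps)
    also have "\<dots> = expectation (\<lambda>\<omega>. (\<Delta> j \<omega>)\<^sup>2) - expectation (\<lambda>\<omega>. (G j \<omega>)\<^sup>2)"
      using orth[OF j(1) GF Gb] i5 i6 i7 by (simp add: power2_eq_square)
    also have "\<dots> \<le> expectation (\<lambda>\<omega>. (\<Delta> j \<omega>)\<^sup>2)" by (simp add: integral_nonneg_AE)
    finally show ?case using Suc.IH[OF j(2)] by (simp add: distrib_left mult_left_mono)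
  qed
  have "prob {\<omega>\<in>space M. \<bar>\<Sum>k<n. w k \<omega> * \<Delta> k \<omega>\<bar> > \<epsilon>} \<le>
     prob {\<omega>\<in>space M. (S n \<omega>)\<^sup>2 > (\<epsilon>/2)\<^sup>2} + prob {\<omega>\<in>space M. (\<Sum>k<n. \<bar>G k \<omega>\<bar>) > \<epsilon>/(2*\<kappa>)}"
  proof (rule prob_le_add)
    have "(S n \<omega>)\<^sup>2 > (\<epsilon>/2)\<^sup>2 \<or> (\<Sum>k<n. \<bar>G k \<omega>\<bar>) > \<epsilon>/(2*\<kappa>)"
      if \<omega>: "\<omega> \<in> space M" and gt: "\<bar>\<Sum>k<n. w k \<omega> * \<Delta> k \<omega>\<bar> > \<epsilon>" for \<omega>
    proof (rule ccontr)
      assume "\<not> ?thesis"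
      then have a: "\<bar>S n \<omega>\<bar> \<le> \<epsilon>/2" "(\<Sum>k<n. \<bar>G k \<omega>\<bar>) \<le> \<epsilon>/(2*\<kappa>)"
        using pos by (auto simp: not_less abs_le_square_iff[symmetric])
      have "\<bar>\<Sum>k<n. w k \<omega> * G k \<omega>\<bar> \<le> (\<Sum>k<n. \<kappa> * \<bar>G k \<omega>\<bar>)"
        using wb[OF _ \<omega>] by (intro sum_abs[THEN order_trans] sum_mono) (auto simp: abs_mult intro!: mult_right_mono)
      also have "\<dots> = \<kappa> * (\<Sum>k<n. \<bar>G k \<omega>\<bar>)" by (simp add: sum_distrib_left)
      also have "\<dots> \<le> \<kappa> * (\<epsilon>/(2*\<kappa>))" using a pos by (intro mult_left_mono) auto
      also have "\<dots> = \<epsilon>/2" using pos by simp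
      finally have b: "\<bar>\<Sum>k<n. w k \<omega> * G k \<omega>\<bar> \<le> \<epsilon>/2" .
      have "(\<Sum>k<n. w k \<omega> * \<Delta> k \<omega>) = S n \<omega> + (\<Sum>k<n. w k \<omega> * G k \<omega>)"
        by (simp add: S_def D_def sum.distrib[symmetric] algebra_simps)
      then show False using a b gt by linarith
    qed
    then show "AE \<omega> in M. \<epsilon> < \<bar>\<Sum>k<n. w k \<omega> * \<Delta> k \<omega>\<bar> \<longrightarrow>
      (\<epsilon> / 2)\<^sup>2 < (S n \<omega>)\<^sup>2 \<or> \<epsilon> / (2 * \<kappa>) < (\<Sum>k<n. \<bar>G k \<omega>\<bar>)" by auto
    note [measurable] = SM[of n, simplified]
    show "{\<omega> \<in> space M. (\<epsilon> / 2)\<^sup>2 < (S n \<omega>)\<^sup>2} \<in> events" by measurable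
    show "{\<omega> \<in> space M. \<epsilon> / (2 * \<kappa>) < (\<Sum>k<n. \<bar>G k \<omega>\<bar>)} \<in> events" by measurable
  qed
  also have "prob {\<omega>\<in>space M. (S n \<omega>)\<^sup>2 > (\<epsilon>/2)\<^sup>2} \<le> expectation (\<lambda>\<omega>. (S n \<omega>)\<^sup>2) / (\<epsilon>/2)\<^sup>2"
    using S2[of n] pos by (intro prob_markov) auto
  also have "\<dots> \<le> (\<kappa>\<^sup>2 * (3 * c * L)) / (\<epsilon>/2)\<^sup>2"
    using ES[of n] sumD pos by (intro divide_right_mono) (auto intro: order_trans mult_left_mono)
  also have "\<dots> = 12 * c * \<kappa>\<^sup>2 * L / \<epsilon>\<^sup>2"
    by (simp add: power2_eq_square)
  also have "prob {\<omega>\<in>space M. (\<Sum>k<n. \<bar>G k \<omega>\<bar>) > \<epsilon>/(2*\<kappa>)} \<le> expectation (\<lambda>\<omega>. \<Sum>k<n. \<bar>G k \<omega>\<bar>) / (\<epsilon>/(2*\<kappa>))"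
    using pos iG by (intro prob_markov) (auto intro!: sum_nonneg)
  also have "expectation (\<lambda>\<omega>. \<Sum>k<n. \<bar>G k \<omega>\<bar>) = (\<Sum>k<n. expectation (\<lambda>\<omega>. \<bar>G k \<omega>\<bar>))"
    using iG by (intro Bochner_Integration.integral_sum)
  also have "\<dots> / (\<epsilon>/(2*\<kappa>)) \<le> L / (\<epsilon>/(2*\<kappa>))"
    using sumG pos by (intro divide_right_mono) auto
  also have "\<dots> = 2 * \<kappa> * L / \<epsilon>" by simp
  finally show ?thesis unfolding \<Delta>_def Y_def by simp
qed

end

section \<open>Stable families of increments\<close>

lemma is_partition_le: "is_partition T n p \<Longrightarrow> 0 \<le> T"
  using partition_bounds(1)[of T n p n] by (auto simp: is_partition_def)

context bm_space
begin

definition weights :: "(nat \<Rightarrow> real) \<Rightarrow> nat \<Rightarrow> real \<Rightarrow> (nat \<Rightarrow> 'a \<Rightarrow> 'b::real_normed_vector) \<Rightarrow> bool" where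
  "weights p n \<kappa> w \<longleftrightarrow>
     (\<forall>k<n. w k \<in> borel_measurable (F (p k)) \<and> (\<forall>\<omega>\<in>space M. norm (w k \<omega>) \<le> \<kappa>))"

lemma weights_mono: "weights p n \<kappa> w \<Longrightarrow> \<kappa> \<le> \<kappa>' \<Longrightarrow> weights p n \<kappa>' w"
  unfolding weights_def by (meson order_trans)

text \<open>The good integrator property of semimartingales, uniformly over all partitions of \<open>[0, T]\<close>.\<close>

definition stable :: "real \<Rightarrow> ((nat \<Rightarrow> real) \<Rightarrow> nat \<Rightarrow> 'a \<Rightarrow> 'b::{real_normed_field,banach,second_countable_topology}) \<Rightarrow> bool" where
  "stable T E \<longleftrightarrow>
    (\<forall>n p k. is_partition T n p \<longrightarrow> k < n \<longrightarrow> E p k \<in> borel_measurable M) \<and>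
    (\<forall>\<epsilon>>0. \<exists>\<kappa>>0. \<forall>n p w. is_partition T n p \<longrightarrow>
      weights p n \<kappa> w \<longrightarrow>
      prob {\<omega>\<in>space M. norm (\<Sum>k<n. w k \<omega> * E p k \<omega>) > \<epsilon>} < \<epsilon>)"

text \<open>Boundedness in probability of the discrete total variation, uniformly over partitions.
  Finite variation terms and sums of squares have it, and it implies \<open>stable\<close>.\<close>

definition tight_sum :: "real \<Rightarrow> ((nat \<Rightarrow> real) \<Rightarrow> nat \<Rightarrow> 'a \<Rightarrow> 'b::real_normed_vector) \<Rightarrow> bool" where
  "tight_sum T E \<longleftrightarrow>
    (\<forall>n p k. is_partition T n p \<longrightarrow> k < n \<longrightarrow> E p k \<in> borel_measurable M) \<and>
    (\<forall>\<epsilon>>0. \<exists>C>0. \<forall>n p. is_partition T n p \<longrightarrow>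
      prob {\<omega>\<in>space M. (\<Sum>k<n. norm (E p k \<omega>)) > C} < \<epsilon>)"

definition tight_max :: "real \<Rightarrow> (real \<Rightarrow> 'a \<Rightarrow> 'b::real_normed_vector) \<Rightarrow> bool" where
  "tight_max T X \<longleftrightarrow>
    (\<forall>\<epsilon>>0. \<exists>C>0. \<forall>n p. is_partition T n p \<longrightarrow>
      prob {\<omega>\<in>space M. \<exists>k\<le>n. norm (X (p k) \<omega>) > C} < \<epsilon>)"

lemma stableD:
  assumes "stable T E" "\<epsilon> > 0"
  shows "\<exists>\<kappa>>0. \<forall>n p w. is_partition T n p \<longrightarrow> weights p n \<kappa> w \<longrightarrow>
      prob {\<omega>\<in>space M. norm (\<Sum>k<n. w k \<omega> * E p k \<omega>) > \<epsilon>} < \<epsilon>"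
  using assms unfolding stable_def by blast

lemma stable_meas: "stable T E \<Longrightarrow> is_partition T n p \<Longrightarrow> k < n \<Longrightarrow> E p k \<in> borel_measurable M"
  by (auto simp: stable_def)

lemma tight_sum_stable:
  fixes E :: "(nat \<Rightarrow> real) \<Rightarrow> nat \<Rightarrow> 'a \<Rightarrow> 'b::{real_normed_field,banach,second_countable_topology}"
  assumes "tight_sum T E"
  shows "stable T E"
  unfolding stable_def
proof (intro conjI allI impI)
  fix \<epsilon> :: real assume e: "\<epsilon> > 0"
  then obtain C where C: "C > 0" "\<And>n p. is_partition T n p \<Longrightarrow> prob {\<omega>\<in>space M. (\<Sum>k<n. norm (E p k \<omega>)) > C} < \<epsilon>"
    using assms unfolding tight_sum_def by meson
  show "\<exists>\<kappa>>0. \<forall>n p w. is_partition T n p \<longrightarrow>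
      weights p n \<kappa> w \<longrightarrow>
      prob {\<omega>\<in>space M. norm (\<Sum>k<n. w k \<omega> * E p k \<omega>) > \<epsilon>} < \<epsilon>"
  proof (intro exI[of _ "\<epsilon> / C"] conjI allI impI)
    fix n p and w :: "nat \<Rightarrow> 'a \<Rightarrow> 'b" assume p: "is_partition T n p"
      and wt: "weights p n (\<epsilon> / C) w"
    note w = wt[unfolded weights_def]
    have [measurable]: "E p k \<in> borel_measurable M" if "k < n" for k using assms p that by (auto simp: tight_sum_def)
    have "prob {\<omega>\<in>space M. norm (\<Sum>k<n. w k \<omega> * E p k \<omega>) > \<epsilon>} \<le> prob {\<omega>\<in>space M. (\<Sum>k<n. norm (E p k \<omega>)) > C}"
    proof (rule prob_le_AE)
      have "(\<Sum>k<n. norm (E p k \<omega>)) > C"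
        if \<omega>: "\<omega> \<in> space M" and gt: "norm (\<Sum>k<n. w k \<omega> * E p k \<omega>) > \<epsilon>" for \<omega>
      proof -
        have "norm (\<Sum>k<n. w k \<omega> * E p k \<omega>) \<le> (\<Sum>k<n. \<epsilon> / C * norm (E p k \<omega>))"
          using w \<omega> by (intro sum_norm_le) (auto simp: norm_mult intro!: mult_right_mono simp del: times_divide_eq_left)
        also have "\<dots> = \<epsilon> / C * (\<Sum>k<n. norm (E p k \<omega>))" by (simp add: sum_distrib_left)
        finally have "\<epsilon> < \<epsilon> / C * (\<Sum>k<n. norm (E p k \<omega>))" using gt by linarith
        then show ?thesis using C(1) e by (simp add: field_simps)
      qed
      then show "AE \<omega> in M. norm (\<Sum>k<n. w k \<omega> * E p k \<omega>) > \<epsilon> \<longrightarrow> (\<Sum>k<n. norm (E p k \<omega>)) > C" by auto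
    qed measurable
    also have "\<dots> < \<epsilon>" using C p by auto
    finally show "prob {\<omega>\<in>space M. norm (\<Sum>k<n. w k \<omega> * E p k \<omega>) > \<epsilon>} < \<epsilon>" .
  qed (use C e in auto)
qed (use assms in \<open>auto simp: tight_sum_def\<close>)

lemma stable_add:
  fixes E E' :: "(nat \<Rightarrow> real) \<Rightarrow> nat \<Rightarrow> 'a \<Rightarrow> 'b::{real_normed_field,banach,second_countable_topology}"
  assumes E: "stable T E" and E': "stable T E'"
  shows "stable T (\<lambda>p k \<omega>. E p k \<omega> + E' p k \<omega>)"
  unfolding stable_def
proof (intro conjI allI impI)
  fix \<epsilon> :: real assume "\<epsilon> > 0" then have e2: "\<epsilon> / 2 > 0" by simp
  obtain \<kappa>1 where k1: "\<kappa>1 > 0" and w1: "\<And>n p w. is_partition T n p \<Longrightarrow> weights p n \<kappa>1 w \<Longrightarrow>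
      prob {\<omega>\<in>space M. norm (\<Sum>k<n. w k \<omega> * E p k \<omega>) > \<epsilon>/2} < \<epsilon>/2"
    using stableD[OF E e2] by blast
  obtain \<kappa>2 where k2: "\<kappa>2 > 0" and w2: "\<And>n p w. is_partition T n p \<Longrightarrow> weights p n \<kappa>2 w \<Longrightarrow>
      prob {\<omega>\<in>space M. norm (\<Sum>k<n. w k \<omega> * E' p k \<omega>) > \<epsilon>/2} < \<epsilon>/2"
    using stableD[OF E' e2] by blast
  show "\<exists>\<kappa>>0. \<forall>n p w. is_partition T n p \<longrightarrow>
      weights p n \<kappa> w \<longrightarrow>
      prob {\<omega>\<in>space M. norm (\<Sum>k<n. w k \<omega> * (E p k \<omega> + E' p k \<omega>)) > \<epsilon>} < \<epsilon>"
  proof (intro exI[of _ "min \<kappa>1 \<kappa>2"] conjI allI impI)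
    fix n p and w :: "nat \<Rightarrow> 'a \<Rightarrow> 'b" assume p: "is_partition T n p"
      and wt: "weights p n (min \<kappa>1 \<kappa>2) w"
    note w = wt[unfolded weights_def]
    have [measurable]: "E p k \<in> borel_measurable M" "E' p k \<in> borel_measurable M" "w k \<in> borel_measurable M" if "k < n" for k 
      using E E' p w that by (auto simp: stable_def intro: meas_F_M)
    have "prob {\<omega>\<in>space M. norm (\<Sum>k<n. w k \<omega> * (E p k \<omega> + E' p k \<omega>)) > \<epsilon>} \<le> 
       prob {\<omega>\<in>space M. norm (\<Sum>k<n. w k \<omega> * E p k \<omega>) > \<epsilon>/2} + prob {\<omega>\<in>space M. norm (\<Sum>k<n. w k \<omega> * E' p k \<omega>) > \<epsilon>/2}"
    proof (rule prob_le_add)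
      have "norm (\<Sum>k<n. w k \<omega> * E p k \<omega>) > \<epsilon>/2 \<or> norm (\<Sum>k<n. w k \<omega> * E' p k \<omega>) > \<epsilon>/2"
        if gt: "norm (\<Sum>k<n. w k \<omega> * (E p k \<omega> + E' p k \<omega>)) > \<epsilon>" for \<omega>
        using gt norm_triangle_ineq[of "\<Sum>k<n. w k \<omega> * E p k \<omega>" "\<Sum>k<n. w k \<omega> * E' p k \<omega>"]
        by (simp add: distrib_left sum.distrib) linarith
      then show "AE \<omega> in M. norm (\<Sum>k<n. w k \<omega> * (E p k \<omega> + E' p k \<omega>)) > \<epsilon> \<longrightarrow> 
        norm (\<Sum>k<n. w k \<omega> * E p k \<omega>) > \<epsilon>/2 \<or> norm (\<Sum>k<n. w k \<omega> * E' p k \<omega>) > \<epsilon>/2" by auto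
    qed measurable
    also have "\<dots> < \<epsilon>" using w1[OF p weights_mono[OF wt]] w2[OF p weights_mono[OF wt]] by fastforce
    finally show "prob {\<omega>\<in>space M. norm (\<Sum>k<n. w k \<omega> * (E p k \<omega> + E' p k \<omega>)) > \<epsilon>} < \<epsilon>" .
  qed (use k1 k2 in auto)
qed (use stable_meas[OF E] stable_meas[OF E'] in \<open>auto intro!: borel_measurable_add\<close>)

text \<open>\<open>X (p k)\<close> is known at time \<open>p k\<close>, so it can be absorbed into
  the weight once it is truncated at a level \<open>C\<close> that is rarely exceeded; the new
  weight has bound (\<kappa>/C) C = \<kappa>.\<close>

lemma stable_mult_adapted:
  fixes E :: "(nat \<Rightarrow> real) \<Rightarrow> nat \<Rightarrow> 'a \<Rightarrow> 'b::{real_normed_field,banach,second_countable_topology}"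
  assumes E: "stable T E" and X: "\<And>t. 0 \<le> t \<Longrightarrow> X t \<in> borel_measurable (F t)" and tm: "tight_max T X"
  shows "stable T (\<lambda>p k \<omega>. X (p k) \<omega> * E p k \<omega>)"
  unfolding stable_def
proof (intro conjI allI impI)
  fix n p k assume p: "is_partition T n p" and k: "k < n"
  have "X (p k) \<in> borel_measurable M" using X partition_bounds(1)[OF p, of k] k meas_F_M by auto
  then show "(\<lambda>\<omega>. X (p k) \<omega> * E p k \<omega>) \<in> borel_measurable M" using stable_meas[OF E p k] by simp
next
  fix \<epsilon> :: real assume "\<epsilon> > 0" then have e2: "\<epsilon> / 2 > 0" by simp
  obtain \<kappa> where k: "\<kappa> > 0" and w1: "\<And>n p w. is_partition T n p \<Longrightarrow> weights p n \<kappa> w \<Longrightarrow>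
      prob {\<omega>\<in>space M. norm (\<Sum>k<n. w k \<omega> * E p k \<omega>) > \<epsilon>/2} < \<epsilon>/2"
    using stableD[OF E e2] by blast
  obtain C where C: "C > 0" "\<And>n p. is_partition T n p \<Longrightarrow> prob {\<omega>\<in>space M. \<exists>k\<le>n. norm (X (p k) \<omega>) > C} < \<epsilon>/2"
    using tm e2 unfolding tight_max_def by meson
  show "\<exists>\<kappa>>0. \<forall>n p w. is_partition T n p \<longrightarrow>
      weights p n \<kappa> w \<longrightarrow>
      prob {\<omega>\<in>space M. norm (\<Sum>k<n. w k \<omega> * (X (p k) \<omega> * E p k \<omega>)) > \<epsilon>} < \<epsilon>"
  proof (intro exI[of _ "\<kappa> / C"] conjI allI impI)
    fix n p and w :: "nat \<Rightarrow> 'a \<Rightarrow> 'b" assume p: "is_partition T n p"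
      and wt: "weights p n (\<kappa> / C) w"
    note w = wt[unfolded weights_def]
    have XF[measurable]: "X (p k) \<in> borel_measurable (F (p k))" if "k \<le> n" for k
      using X partition_bounds(1)[OF p] that by auto
    have [measurable]: "E p k \<in> borel_measurable M" "w k \<in> borel_measurable M" if "k < n" for k 
      using E p w that by (auto simp: stable_def intro: meas_F_M)
    have [measurable]: "X (p k) \<in> borel_measurable M" if "k \<le> n" for k using XF[OF that] meas_F_M by blast
    define v where "v k \<omega> = w k \<omega> * (if norm (X (p k) \<omega>) \<le> C then X (p k) \<omega> else 0)" for k \<omega>
    have vm: "v k \<in> borel_measurable (F (p k))" if "k < n" for k
    proof -
      have [measurable]: "w k \<in> borel_measurable (F (p k))" "X (p k) \<in> borel_measurable (F (p k))" using w that XF by auto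
      show ?thesis unfolding v_def by measurable
    qed
    have vM[measurable]: "v k \<in> borel_measurable M" if "k < n" for k using vm[OF that] meas_F_M by blast
    have vb: "norm (v k \<omega>) \<le> \<kappa>" if "k < n" "\<omega> \<in> space M" for k \<omega>
    proof -
      have "norm (v k \<omega>) \<le> \<kappa> / C * C" unfolding v_def norm_mult
        using w that C k by (intro mult_mono) auto
      then show ?thesis using C by simp
    qed
    have "prob {\<omega>\<in>space M. norm (\<Sum>k<n. w k \<omega> * (X (p k) \<omega> * E p k \<omega>)) > \<epsilon>} \<le> 
       prob {\<omega>\<in>space M. norm (\<Sum>k<n. v k \<omega> * E p k \<omega>) > \<epsilon>/2} + prob {\<omega>\<in>space M. \<exists>k\<le>n. norm (X (p k) \<omega>) > C}"
    proof (rule prob_le_add)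
      have "norm (\<Sum>k<n. v k \<omega> * E p k \<omega>) > \<epsilon>/2 \<or> (\<exists>k\<le>n. norm (X (p k) \<omega>) > C)"
        if gt: "norm (\<Sum>k<n. w k \<omega> * (X (p k) \<omega> * E p k \<omega>)) > \<epsilon>" for \<omega>
      proof (rule disjCI)
        assume "\<not> (\<exists>k\<le>n. norm (X (p k) \<omega>) > C)"
        then have "(\<Sum>k<n. v k \<omega> * E p k \<omega>) = (\<Sum>k<n. w k \<omega> * (X (p k) \<omega> * E p k \<omega>))"
          by (intro sum.cong) (auto simp: v_def not_less)
        then show "norm (\<Sum>k<n. v k \<omega> * E p k \<omega>) > \<epsilon>/2" using gt e2 by simp
      qed
      then show "AE \<omega> in M. norm (\<Sum>k<n. w k \<omega> * (X (p k) \<omega> * E p k \<omega>)) > \<epsilon> \<longrightarrow> 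
        norm (\<Sum>k<n. v k \<omega> * E p k \<omega>) > \<epsilon>/2 \<or> (\<exists>k\<le>n. norm (X (p k) \<omega>) > C)" by auto
    qed measurable
    also have "\<dots> < \<epsilon>" using w1[OF p, of v] C(2)[OF p] vm vb by (fastforce simp: weights_def)
    finally show "prob {\<omega>\<in>space M. norm (\<Sum>k<n. w k \<omega> * (X (p k) \<omega> * E p k \<omega>)) > \<epsilon>} < \<epsilon>" .
  qed (use k C in auto)
qed

lemma stable_cmult:
  fixes E :: "(nat \<Rightarrow> real) \<Rightarrow> nat \<Rightarrow> 'a \<Rightarrow> 'b::{real_normed_field,banach,second_countable_topology}"
  assumes E: "stable T E"
  shows "stable T (\<lambda>p k \<omega>. c * E p k \<omega>)"
proof (rule stable_mult_adapted[OF E, where X = "\<lambda>t \<omega>. c"])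
  show "tight_max T (\<lambda>t \<omega>. c)" unfolding tight_max_def
    by (intro allI impI exI[of _ "norm c + 1"]) (auto simp: not_less intro: add_nonneg_pos)
qed auto

lemma stable_of_real:
  fixes E :: "(nat \<Rightarrow> real) \<Rightarrow> nat \<Rightarrow> 'a \<Rightarrow> real"
  assumes E: "stable T E"
  shows "stable T (\<lambda>p k \<omega>. complex_of_real (E p k \<omega>))"
  unfolding stable_def
proof (intro conjI allI impI)
  fix \<epsilon> :: real assume "\<epsilon> > 0" then have e2: "\<epsilon> / 2 > 0" by simp
  obtain \<kappa> where k1: "\<kappa> > 0" and w1: "\<And>n p w. is_partition T n p \<Longrightarrow> weights p n \<kappa> w \<Longrightarrow>
      prob {\<omega>\<in>space M. norm (\<Sum>k<n. w k \<omega> * E p k \<omega>) > \<epsilon>/2} < \<epsilon>/2"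
    using stableD[OF E e2] by blast
  show "\<exists>\<kappa>>0. \<forall>n p w. is_partition T n p \<longrightarrow>
      weights p n \<kappa> w \<longrightarrow>
      prob {\<omega>\<in>space M. norm (\<Sum>k<n. w k \<omega> * complex_of_real (E p k \<omega>)) > \<epsilon>} < \<epsilon>"
  proof (intro exI[of _ \<kappa>] conjI allI impI k1)
    fix n p and w :: "nat \<Rightarrow> 'a \<Rightarrow> complex" assume p: "is_partition T n p"
      and wt: "weights p n \<kappa> w"
    note w = wt[unfolded weights_def]
    have [measurable]: "E p k \<in> borel_measurable M" "w k \<in> borel_measurable M" if "k < n" for k 
      using E p w that by (auto simp: stable_def intro: meas_F_M)
    have "prob {\<omega>\<in>space M. norm (\<Sum>k<n. w k \<omega> * complex_of_real (E p k \<omega>)) > \<epsilon>} \<le> 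
       prob {\<omega>\<in>space M. norm (\<Sum>k<n. Re (w k \<omega>) * E p k \<omega>) > \<epsilon>/2} + prob {\<omega>\<in>space M. norm (\<Sum>k<n. Im (w k \<omega>) * E p k \<omega>) > \<epsilon>/2}"
    proof (rule prob_le_add)
      have "norm (\<Sum>k<n. Re (w k \<omega>) * E p k \<omega>) > \<epsilon>/2 \<or> norm (\<Sum>k<n. Im (w k \<omega>) * E p k \<omega>) > \<epsilon>/2"
        if gt: "norm (\<Sum>k<n. w k \<omega> * complex_of_real (E p k \<omega>)) > \<epsilon>" for \<omega>
        using gt cmod_le[of "\<Sum>k<n. w k \<omega> * complex_of_real (E p k \<omega>)"]
        by auto 
      then show "AE \<omega> in M. norm (\<Sum>k<n. w k \<omega> * complex_of_real (E p k \<omega>)) > \<epsilon> \<longrightarrow> 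
        norm (\<Sum>k<n. Re (w k \<omega>) * E p k \<omega>) > \<epsilon>/2 \<or> norm (\<Sum>k<n. Im (w k \<omega>) * E p k \<omega>) > \<epsilon>/2" by auto
    qed measurable
    moreover have "prob {\<omega>\<in>space M. norm (\<Sum>k<n. Re (w k \<omega>) * E p k \<omega>) > \<epsilon>/2} < \<epsilon>/2"
      using w by (intro w1[OF p]) (auto simp: weights_def intro: abs_Re_le_cmod[THEN order_trans])
    moreover have "prob {\<omega>\<in>space M. norm (\<Sum>k<n. Im (w k \<omega>) * E p k \<omega>) > \<epsilon>/2} < \<epsilon>/2"
      using w by (intro w1[OF p]) (auto simp: weights_def intro: abs_Im_le_cmod[THEN order_trans])
    ultimately show "prob {\<omega>\<in>space M. norm (\<Sum>k<n. w k \<omega> * complex_of_real (E p k \<omega>)) > \<epsilon>} < \<epsilon>" by linarith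
  qed
qed (use stable_meas[OF E] in \<open>auto intro!: borel_measurable_of_real\<close>)

text \<open>Each continuous path is bounded on [0, T]; \<open>uniform_small\<close>, indexed by all
  partitions at once, turns the path-dependent bound into one in probability.\<close>

lemma tight_max_continuous:
  fixes X :: "real \<Rightarrow> 'a \<Rightarrow> 'b::{real_normed_vector, second_countable_topology}"
  assumes X: "\<And>t. 0 \<le> t \<Longrightarrow> X t \<in> borel_measurable M" and c: "continuous_paths M X"
  shows "tight_max T X"
  unfolding tight_max_def
proof (intro allI impI)
  fix \<epsilon> :: real assume e: "\<epsilon> > 0"
  define I where "I = {(n, p). is_partition T n p}"
  define A where "A m i = {\<omega>\<in>space M. \<exists>k\<le>fst i. norm (X (snd i k) \<omega>) > real (Suc m)}" for m and i :: "nat \<times> (nat \<Rightarrow> real)"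
  have "\<exists>m0. \<forall>m\<ge>m0. \<forall>i\<in>I. prob (A m i) < \<epsilon>"
  proof (rule uniform_small[OF _ _ e, where I = "\<lambda>_. I"])
    fix m i assume "i \<in> I"
    then obtain n p where i: "i = (n, p)" and p: "is_partition T n p" by (auto simp: I_def)
    have [measurable]: "X (p k) \<in> borel_measurable M" if "k \<le> n" for k
      using X partition_bounds(1)[OF p that] by auto
    show "A m i \<in> events" unfolding A_def i by simp
  next
    show "AE \<omega> in M. \<exists>m0. \<forall>m\<ge>m0. \<forall>i\<in>I. \<omega> \<notin> A m i"
      using c unfolding continuous_paths_def
    proof eventually_elim
      case (elim \<omega>)
      have "compact ((\<lambda>t. X t \<omega>) ` {0..T})"
        by (intro compact_continuous_image continuous_on_subset[OF elim]) auto
      then obtain B where B: "\<And>t. t \<in> {0..T} \<Longrightarrow> norm (X t \<omega>) \<le> B"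
        by (meson compact_imp_bounded bounded_iff imageI)
      obtain m0 where m0: "B \<le> real m0" using real_arch_simple by blast
      show ?case
      proof (intro exI[of _ m0] allI impI ballI)
        fix m i assume m: "m \<ge> m0" and "i \<in> I"
        then obtain n p where i: "i = (n, p)" and p: "is_partition T n p" by (auto simp: I_def)
        have "norm (X (p k) \<omega>) \<le> real (Suc m)" if "k \<le> n" for k
          using B[of "p k"] partition_bounds[OF p that] m0 m by fastforce
        then show "\<omega> \<notin> A m i" by (auto simp: A_def i not_less)
      qed
    qed
  qed
  then obtain m where "\<forall>i\<in>I. prob (A m i) < \<epsilon>" by blast
  then show "\<exists>C>0. \<forall>n p. is_partition T n p \<longrightarrow> prob {\<omega>\<in>space M. \<exists>k\<le>n. norm (X (p k) \<omega>) > C} < \<epsilon>"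
    by (intro exI[of _ "real (Suc m)"]) (auto simp: I_def A_def)
qed

lemma tight_sum_finite_variation:
  fixes V :: "real \<Rightarrow> 'a \<Rightarrow> real"
  assumes V: "\<And>t. 0 \<le> t \<Longrightarrow> V t \<in> borel_measurable M" and fv: "finite_variation_paths M V"
  shows "tight_sum T (\<lambda>p k \<omega>. V (p (Suc k)) \<omega> - V (p k) \<omega>)"
proof -
  have Vm: "V (p k) \<in> borel_measurable M" if "is_partition T n p" "k \<le> n" for p n k
    using V partition_bounds(1)[OF that] by auto
  show ?thesis
    unfolding tight_sum_def
  proof (intro conjI allI impI)
    fix n p k assume "is_partition T n p" "k < n"
    then show "(\<lambda>\<omega>. V (p (Suc k)) \<omega> - V (p k) \<omega>) \<in> borel_measurable M"
      using Vm[of n p k] Vm[of n p "Suc k"] by auto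
  next
  fix \<epsilon> :: real assume e: "\<epsilon> > 0"
  define I where "I = {(n, p). is_partition T n p}"
  define A where "A m i = {\<omega>\<in>space M. (\<Sum>k<fst i. norm (V (snd i (Suc k)) \<omega> - V (snd i k) \<omega>)) > real (Suc m)}" for m and i :: "nat \<times> (nat \<Rightarrow> real)"
  have "\<exists>m0. \<forall>m\<ge>m0. \<forall>i\<in>I. prob (A m i) < \<epsilon>"
  proof (rule uniform_small[OF _ _ e, where I = "\<lambda>_. I"])
    fix m i assume "i \<in> I"
    then obtain n p where i: "i = (n, p)" and p: "is_partition T n p" by (auto simp: I_def)
    note [measurable] = Vm[OF p]
    have [measurable]: "V (p (Suc k)) \<in> borel_measurable M" "V (p k) \<in> borel_measurable M" if "k < n" for k
      using Vm[OF p] that by auto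
    show "A m i \<in> events" unfolding A_def i by simp
  next
    show "AE \<omega> in M. \<exists>m0. \<forall>m\<ge>m0. \<forall>i\<in>I. \<omega> \<notin> A m i"
      using fv unfolding finite_variation_paths_def
    proof eventually_elim
      case (elim \<omega>)
      show ?case
      proof (cases "T \<ge> 0")
        case True
        with elim obtain B where B: "\<And>n p. is_partition T n p \<Longrightarrow> (\<Sum>k<n. \<bar>V (p (Suc k)) \<omega> - V (p k) \<omega>\<bar>) \<le> B"
          by blast
        obtain m0 where m0: "B \<le> real m0" using real_arch_simple by blast
        show ?thesis
        proof (intro exI[of _ m0] allI impI ballI)
          fix m i assume m: "m \<ge> m0" and "i \<in> I"
          then obtain n p where i: "i = (n, p)" and p: "is_partition T n p" by (auto simp: I_def)
          show "\<omega> \<notin> A m i" using B[OF p] m0 m by (auto simp: A_def i not_less)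
        qed
      next
        case False
        then have "I = {}" using is_partition_le by (auto simp: I_def)
        then show ?thesis by simp
      qed
    qed
  qed
  then obtain m where "\<forall>i\<in>I. prob (A m i) < \<epsilon>" by blast
  then show "\<exists>C>0. \<forall>n p. is_partition T n p \<longrightarrow> prob {\<omega>\<in>space M. (\<Sum>k<n. norm (V (p (Suc k)) \<omega> - V (p k) \<omega>)) > C} < \<epsilon>"
    by (intro exI[of _ "real (Suc m)"]) (auto simp: I_def A_def)
  qed
qed

end

lemma cnj_measurable[measurable]: "cnj \<in> borel_measurable borel"
  by (intro borel_measurable_continuous_onI continuous_intros)

section \<open>Semimartingales are good integrators\<close>

context bm_space
begin

lemma stable_AE_cong:
  fixes E E' :: "(nat \<Rightarrow> real) \<Rightarrow> nat \<Rightarrow> 'a \<Rightarrow> 'b::{real_normed_field,banach,second_countable_topology}"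
  assumes E: "stable T E" and m: "\<And>n p k. is_partition T n p \<Longrightarrow> k < n \<Longrightarrow> E' p k \<in> borel_measurable M"
    and ae: "\<And>n p. is_partition T n p \<Longrightarrow> AE \<omega> in M. \<forall>k<n. E p k \<omega> = E' p k \<omega>"
  shows "stable T E'"
  unfolding stable_def
proof (intro conjI allI impI)
  fix \<epsilon> :: real assume e: "\<epsilon> > 0"
  obtain \<kappa> where k: "\<kappa> > 0" and w1: "\<And>n p w. is_partition T n p \<Longrightarrow> weights p n \<kappa> w \<Longrightarrow>
      prob {\<omega>\<in>space M. norm (\<Sum>k<n. w k \<omega> * E p k \<omega>) > \<epsilon>} < \<epsilon>"
    using stableD[OF E e] by blast
  show "\<exists>\<kappa>>0. \<forall>n p w. is_partition T n p \<longrightarrow> weights p n \<kappa> w \<longrightarrow>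
      prob {\<omega>\<in>space M. norm (\<Sum>k<n. w k \<omega> * E' p k \<omega>) > \<epsilon>} < \<epsilon>"
  proof (intro exI[of _ \<kappa>] conjI allI impI k)
    fix n p and w :: "nat \<Rightarrow> 'a \<Rightarrow> 'b" assume p: "is_partition T n p" and w: "weights p n \<kappa> w"
    have [measurable]: "E p k \<in> borel_measurable M" "w k \<in> borel_measurable M" if "k < n" for k 
      using E p w that by (auto simp: stable_def weights_def intro: meas_F_M)
    have "prob {\<omega>\<in>space M. norm (\<Sum>k<n. w k \<omega> * E' p k \<omega>) > \<epsilon>} \<le> prob {\<omega>\<in>space M. norm (\<Sum>k<n. w k \<omega> * E p k \<omega>) > \<epsilon>}"
    proof (rule prob_le_AE)
      show "AE \<omega> in M. norm (\<Sum>k<n. w k \<omega> * E' p k \<omega>) > \<epsilon> \<longrightarrow> norm (\<Sum>k<n. w k \<omega> * E p k \<omega>) > \<epsilon>"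
        using ae[OF p] by eventually_elim simp
    qed measurable
    then show "prob {\<omega>\<in>space M. norm (\<Sum>k<n. w k \<omega> * E' p k \<omega>) > \<epsilon>} < \<epsilon>" using w1[OF p w] by simp
  qed
qed (use m in auto)

text \<open>Two rare events are removed: that the localizing time \<open>\<tau> j\<close> is at most
  \<open>T\<close>, and that |N| exceeds \<open>c\<close> at some partition point. Off them the
  stopped and clipped process agrees with \<open>N\<close> at all partition points, so the transform
  bound for one fixed martingale applies.\<close>

lemma stable_local_martingale:
  assumes N: "continuous_local_martingale M F N" and T: "T \<ge> 0"
  shows "stable T (\<lambda>p k \<omega>. N (p (Suc k)) \<omega> - N (p k) \<omega>)"
proof -
  have Na: "adapted F N" and Nc: "continuous_paths M N" using N by (auto simp: continuous_local_martingale_def)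
  have NM: "N t \<in> borel_measurable M" if "0 \<le> t" for t using Na that meas_F_M by (auto simp: adapted_def)
  have Nm: "N (p k) \<in> borel_measurable M" if "is_partition T n p" "k \<le> n" for p n k
    using NM partition_bounds(1)[OF that] by auto
  have N\<Delta>: "(\<lambda>\<omega>. N (p (Suc k)) \<omega> - N (p k) \<omega>) \<in> borel_measurable M" if "is_partition T n p" "k < n" for n p k
    using Nm[OF that(1), of k] Nm[OF that(1), of "Suc k"] that by auto
  obtain \<tau> where "\<forall>n. stopping_time F (\<tau> n) \<and> (\<forall>\<omega>\<in>space M. 0 \<le> \<tau> n \<omega>)"
    and lim': "AE \<omega> in M. incseq (\<lambda>n. \<tau> n \<omega>) \<and> filterlim (\<lambda>n. \<tau> n \<omega>) at_top sequentially"
    and "\<forall>n. martingale M F (\<lambda>t \<omega>. N (min t (\<tau> n \<omega>)) \<omega>)"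
    using N unfolding continuous_local_martingale_def by blast
  then have st: "\<And>n. stopping_time F (\<tau> n)" and mart: "\<And>n. martingale M F (\<lambda>t \<omega>. N (min t (\<tau> n \<omega>)) \<omega>)"
    by auto
  have lim: "AE \<omega> in M. filterlim (\<lambda>n. \<tau> n \<omega>) at_top sequentially"
    using lim' by eventually_elim simp
  have tau: "{\<omega>\<in>space M. \<tau> j \<omega> \<le> T} \<in> events" for j
  proof -
    have "{\<omega>\<in>space M. \<tau> j \<omega> \<le> T} \<in> sets (F T)"
      using stopping_timeD[OF st, of j T] by (simp add: pred_def)
    then show ?thesis using sub[of T] by (auto simp: subalgebra_def)
  qed
  show ?thesis
    unfolding stable_def
  proof (intro conjI allI impI)
    fix \<epsilon> :: real assume e: "\<epsilon> > 0"
    have "\<exists>m0. \<forall>m\<ge>m0. \<forall>i\<in>{()}. prob {\<omega>\<in>space M. \<tau> m \<omega> \<le> T} < \<epsilon>/3"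
    proof (rule uniform_small[where I = "\<lambda>_. {()}" and A = "\<lambda>m i. {\<omega>\<in>space M. \<tau> m \<omega> \<le> T}"])
      show "AE \<omega> in M. \<exists>m0. \<forall>m\<ge>m0. \<forall>i\<in>{()}. \<omega> \<notin> {\<omega> \<in> space M. \<tau> m \<omega> \<le> T}"
        using lim
      proof eventually_elim
        case (elim \<omega>)
        then have "eventually (\<lambda>n. \<tau> n \<omega> > T) sequentially" by (simp add: filterlim_at_top_dense)
        then show ?case by (auto simp: eventually_sequentially not_le)
      qed
    qed (use e tau in auto)
    then obtain j where j: "prob {\<omega>\<in>space M. \<tau> j \<omega> \<le> T} < \<epsilon>/3" by auto
    have "\<epsilon>/3 > 0" using e by simp
    then obtain c where c: "c > 0" "\<And>n p. is_partition T n p \<Longrightarrow> prob {\<omega>\<in>space M. \<exists>k\<le>n. norm (N (p k) \<omega>) > c} < \<epsilon>/3"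
      using tight_max_continuous[OF NM Nc, of T] unfolding tight_max_def by meson
    define L where "L = expectation (\<lambda>\<omega>. \<bar>N (min T (\<tau> j \<omega>)) \<omega>\<bar>)"
    have L0: "L \<ge> 0" by (simp add: L_def)
    \<comment> \<open>For \<open>\<kappa> \<le> 1\<close> the transform bound is at most
      \<open>\<kappa> * Q\<close>; the choice of \<open>\<kappa>\<close> makes this at most
      \<open>\<epsilon> / 4\<close>, below the third share \<open>\<epsilon> / 3\<close>.\<close>
    define Q where "Q = 12 * c * L / \<epsilon>\<^sup>2 + 2 * L / \<epsilon>"
    have Q0: "Q \<ge> 0" using L0 c e by (simp add: Q_def)
    define \<kappa> where "\<kappa> = min 1 (\<epsilon> / (4 * (Q + 1)))"
    have \<kappa>: "\<kappa> > 0" "\<kappa> \<le> 1" "\<kappa> \<le> \<epsilon> / (4 * (Q + 1))" using e Q0 by (auto simp: \<kappa>_def)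
    have "12 * c * \<kappa>\<^sup>2 * L / \<epsilon>\<^sup>2 + 2 * \<kappa> * L / \<epsilon> \<le> 12 * c * \<kappa> * L / \<epsilon>\<^sup>2 + 2 * \<kappa> * L / \<epsilon>"
      using \<kappa> c L0 e by (intro add_mono divide_right_mono mult_right_mono mult_left_mono) (auto simp: power2_eq_square mult_le_one)
    also have "\<dots> = \<kappa> * Q" by (simp add: Q_def algebra_simps)
    also have "\<dots> \<le> \<epsilon> / (4 * (Q + 1)) * Q" using \<kappa> Q0 by (intro mult_right_mono) auto
    also have "\<dots> < \<epsilon> / 3" using e Q0 by (simp add: field_simps add_nonneg_pos)
    finally have small: "12 * c * \<kappa>\<^sup>2 * L / \<epsilon>\<^sup>2 + 2 * \<kappa> * L / \<epsilon> < \<epsilon> / 3" .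
    show "\<exists>\<kappa>>0. \<forall>n p w. is_partition T n p \<longrightarrow> weights p n \<kappa> w \<longrightarrow>
      prob {\<omega>\<in>space M. norm (\<Sum>k<n. w k \<omega> * (N (p (Suc k)) \<omega> - N (p k) \<omega>)) > \<epsilon>} < \<epsilon>"
    proof (intro exI[of _ \<kappa>] conjI allI impI \<kappa>(1))
      fix n p and w :: "nat \<Rightarrow> 'a \<Rightarrow> real" assume p: "is_partition T n p" and w: "weights p n \<kappa> w"
      have [measurable]: "N (p k) \<in> borel_measurable M" if "k \<le> n" for k using Nm[OF p that] .
      have [measurable]: "w k \<in> borel_measurable M" if "k < n" for k
        using w that by (auto simp: weights_def intro: meas_F_M)
      have pk: "0 \<le> p k" "p k \<le> T" if "k \<le> n" for k
        using partition_bounds[OF p that] by auto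
      define N' where "N' t \<omega> = N (min t (\<tau> j \<omega>)) \<omega>" for t \<omega>
      have N'm: "N' (p k) \<in> borel_measurable M" if "k \<le> n" for k
        using mart[of j] pk[OF that] meas_F_M unfolding martingale_def adapted_def N'_def by blast
      have \<Delta>m[measurable]: "(\<lambda>\<omega>. clip c (N' (p (Suc k)) \<omega>) - clip c (N' (p k) \<omega>)) \<in> borel_measurable M" if "k < n" for k
      proof -
        have [measurable]: "N' (p (Suc k)) \<in> borel_measurable M" "N' (p k) \<in> borel_measurable M" using N'm that by auto
        show ?thesis by measurable
      qed
      define A where "A \<omega> \<longleftrightarrow> \<bar>\<Sum>k<n. w k \<omega> * (clip c (N' (p (Suc k)) \<omega>) - clip c (N' (p k) \<omega>))\<bar> > \<epsilon>" for \<omega>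
      have Am[measurable]: "{\<omega>\<in>space M. A \<omega>} \<in> events" unfolding A_def by measurable
      have Bm: "{\<omega>\<in>space M. \<exists>k\<le>n. norm (N (p k) \<omega>) > c} \<in> events" by measurable
      have "prob {\<omega>\<in>space M. norm (\<Sum>k<n. w k \<omega> * (N (p (Suc k)) \<omega> - N (p k) \<omega>)) > \<epsilon>} \<le>
        prob {\<omega>\<in>space M. A \<omega>} + prob {\<omega>\<in>space M. \<tau> j \<omega> \<le> T \<or> (\<exists>k\<le>n. norm (N (p k) \<omega>) > c)}"
      proof (rule prob_le_add)
        have "A \<omega> \<or> \<tau> j \<omega> \<le> T \<or> (\<exists>k\<le>n. norm (N (p k) \<omega>) > c)"
          if gt: "norm (\<Sum>k<n. w k \<omega> * (N (p (Suc k)) \<omega> - N (p k) \<omega>)) > \<epsilon>" for \<omega>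
        proof (rule disjCI)
          assume a: "\<not> (\<tau> j \<omega> \<le> T \<or> (\<exists>k\<le>n. norm (N (p k) \<omega>) > c))"
          have "clip c (N' (p k) \<omega>) = N (p k) \<omega>" if "k \<le> n" for k
          proof -
            have "N' (p k) \<omega> = N (p k) \<omega>" using a pk[OF that] by (auto simp: N'_def min_def)
            then show ?thesis using a that by (simp add: clip_eq not_less)
          qed
          then have "(\<Sum>k<n. w k \<omega> * (clip c (N' (p (Suc k)) \<omega>) - clip c (N' (p k) \<omega>))) =
            (\<Sum>k<n. w k \<omega> * (N (p (Suc k)) \<omega> - N (p k) \<omega>))"
            by (intro sum.cong) auto
          then show "A \<omega>" using gt by (simp add: A_def)
        qed
        then show "AE \<omega> in M. norm (\<Sum>k<n. w k \<omega> * (N (p (Suc k)) \<omega> - N (p k) \<omega>)) > \<epsilon> \<longrightarrow>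
          A \<omega> \<or> \<tau> j \<omega> \<le> T \<or> (\<exists>k\<le>n. norm (N (p k) \<omega>) > c)" by auto
        show "{\<omega> \<in> space M. \<tau> j \<omega> \<le> T \<or> (\<exists>k\<le>n. norm (N (p k) \<omega>) > c)} \<in> events"
          using sets.Un[OF tau[of j] Bm] by (simp add: Collect_disj_eq[symmetric] conj_disj_distribL Un_def cong: conj_cong)
      qed (rule Am)
      also have "prob {\<omega>\<in>space M. \<tau> j \<omega> \<le> T \<or> (\<exists>k\<le>n. norm (N (p k) \<omega>) > c)} \<le>
         prob {\<omega>\<in>space M. \<tau> j \<omega> \<le> T} + prob {\<omega>\<in>space M. \<exists>k\<le>n. norm (N (p k) \<omega>) > c}"
        by (rule prob_le_add) (use tau Bm in auto)
      also have "prob {\<omega>\<in>space M. A \<omega>} \<le> 12 * c * \<kappa>\<^sup>2 * L / \<epsilon>\<^sup>2 + 2 * \<kappa> * L / \<epsilon>"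
        unfolding A_def L_def N'_def
        by (rule clipped_transform_bound[OF mart p c(1) _ _ \<kappa>(1) e]) (use w in \<open>auto simp: weights_def\<close>)
      finally show "prob {\<omega>\<in>space M. norm (\<Sum>k<n. w k \<omega> * (N (p (Suc k)) \<omega> - N (p k) \<omega>)) > \<epsilon>} < \<epsilon>"
        using small j c(2)[OF p] by linarith
    qed
  qed (use N\<Delta> in auto)
qed

lemma stable_semimartingale:
  assumes X: "continuous_semimartingale M F X" and T: "T \<ge> 0"
  shows "stable T (\<lambda>p k \<omega>. X (p (Suc k)) \<omega> - X (p k) \<omega>)"
proof -
  obtain N V where N: "continuous_local_martingale M F N" and V: "adapted F V" "finite_variation_paths M V"
    and eq: "AE \<omega> in M. \<forall>t\<ge>0. X t \<omega> = N t \<omega> + V t \<omega>" and Xa: "adapted F X"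
    using X unfolding continuous_semimartingale_def by blast
  have Vm: "V t \<in> borel_measurable M" if "0 \<le> t" for t using V(1) that meas_F_M by (auto simp: adapted_def)
  have Xm: "X t \<in> borel_measurable M" if "0 \<le> t" for t using Xa that meas_F_M by (auto simp: adapted_def)
  note s = stable_add[OF stable_local_martingale[OF N T] tight_sum_stable[OF tight_sum_finite_variation[OF Vm V(2)]]]
  show ?thesis
  proof (rule stable_AE_cong[OF s])
    show "(\<lambda>\<omega>. X (p (Suc k)) \<omega> - X (p k) \<omega>) \<in> borel_measurable M" if "is_partition T n p" "k < n" for n p k
      using Xm[OF partition_bounds(1)[OF that(1), of k]] Xm[OF partition_bounds(1)[OF that(1), of "Suc k"]] that by auto
    show "AE \<omega> in M. \<forall>k<n. N (p (Suc k)) \<omega> - N (p k) \<omega> + (V (p (Suc k)) \<omega> - V (p k) \<omega>) = X (p (Suc k)) \<omega> - X (p k) \<omega>"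
      if p: "is_partition T n p" for n p
      using eq
    proof eventually_elim
      case (elim \<omega>)
      have "X (p k) \<omega> = N (p k) \<omega> + V (p k) \<omega>" if "k \<le> n" for k
        using elim partition_bounds(1)[OF p that] by auto
      then show ?case by auto
    qed
  qed auto
qed

section \<open>Second moments of Brownian transforms and sums of squares\<close>

lemma bounded_sq_integrable:
  fixes S :: "'a \<Rightarrow> complex"
  assumes "S \<in> borel_measurable M" "integrable M (\<lambda>\<omega>. (norm (S \<omega>))\<^sup>2)"
  shows "integrable M S"
proof (rule Bochner_Integration.integrable_bound)
  show "integrable M (\<lambda>\<omega>. 1 + (norm (S \<omega>))\<^sup>2)" using assms by auto
  show "AE \<omega> in M. norm (S \<omega>) \<le> norm (1 + (norm (S \<omega>))\<^sup>2)"
  proof (rule AE_I2)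
    fix \<omega>
    have "0 \<le> (norm (S \<omega>) - 1)\<^sup>2" by simp
    then have "2 * norm (S \<omega>) \<le> 1 + (norm (S \<omega>))\<^sup>2" by (simp add: power2_diff)
    moreover have "0 \<le> norm (S \<omega>)" by simp
    ultimately show "norm (S \<omega>) \<le> norm (1 + (norm (S \<omega>))\<^sup>2)" by (simp only: real_norm_def)
  qed
qed (use assms in auto)

text \<open>Discrete Ito isometry. The newest increment is independent of everything known at its
  left endpoint, so the cross term with a centred function of it vanishes. Arbitrary centred
  functions \<open>\<phi> k\<close> are allowed because later the factors exp(-i a \<Delta>W) minus
  their means take this role.\<close>

lemma increments_L2:
  fixes w :: "nat \<Rightarrow> 'a \<Rightarrow> complex" and \<phi> :: "nat \<Rightarrow> real \<Rightarrow> complex"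
  assumes p: "is_partition T n p" and w: "weights p n C w"
    and \<phi>: "\<And>k. k < n \<Longrightarrow> \<phi> k \<in> borel_measurable borel"
  defines "\<theta> \<equiv> (\<lambda>k \<omega>. \<phi> k (W (p (Suc k)) \<omega> - W (p k) \<omega>))"
  assumes i2: "\<And>k. k < n \<Longrightarrow> integrable M (\<lambda>\<omega>. (norm (\<theta> k \<omega>))\<^sup>2)"
    and z: "\<And>k. k < n \<Longrightarrow> expectation (\<theta> k) = 0"
  assumes j: "j \<le> n"
  shows "integrable M (\<lambda>\<omega>. (norm (\<Sum>k<j. w k \<omega> * \<theta> k \<omega>))\<^sup>2) \<and>
    expectation (\<lambda>\<omega>. (norm (\<Sum>k<j. w k \<omega> * \<theta> k \<omega>))\<^sup>2) =
     (\<Sum>k<j. expectation (\<lambda>\<omega>. (norm (w k \<omega>))\<^sup>2) * expectation (\<lambda>\<omega>. (norm (\<theta> k \<omega>))\<^sup>2))"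
  using j
proof (induction j)
  case (Suc j)
  then have j: "j < n" "j \<le> n" by auto
  define S where "S \<omega> = (\<Sum>k<j. w k \<omega> * \<theta> k \<omega>)" for \<omega>
  have pj: "0 \<le> p j" "p j \<le> p (Suc j)" using partition_bounds(1)[OF p j(2)] p j by (auto simp: is_partition_def)
  have \<theta>F: "\<theta> k \<in> borel_measurable (F (p (Suc k)))" if "k < n" for k
  proof -
    have "0 \<le> p k" "p k \<le> p (Suc k)" using partition_bounds(1)[OF p, of k] p that by (auto simp: is_partition_def)
    then have "W (p (Suc k)) \<in> borel_measurable (F (p (Suc k)))" "W (p k) \<in> borel_measurable (F (p (Suc k)))"
      by (auto intro!: W_adapted meas_F_mono[OF W_adapted, of "p k"])
    note [measurable] = this \<phi>[OF that]
    show ?thesis unfolding \<theta>_def by measurable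
  qed
  have wF: "w k \<in> borel_measurable (F (p k))" and wb: "\<And>\<omega>. \<omega> \<in> space M \<Longrightarrow> norm (w k \<omega>) \<le> C" if "k < n" for k
    using w that by (auto simp: weights_def)
  have SF: "S \<in> borel_measurable (F (p j))" unfolding S_def
  proof (rule borel_measurable_sum)
    fix k assume "k \<in> {..<j}"
    then have kn: "k < n" and le: "p k \<le> p j" "p (Suc k) \<le> p j" using j partition_mono[OF p] by auto
    show "(\<lambda>\<omega>. w k \<omega> * \<theta> k \<omega>) \<in> borel_measurable (F (p j))"
      using meas_F_mono[OF wF[OF kn] le(1)] meas_F_mono[OF \<theta>F[OF kn] le(2)] by measurable
  qed
  have [measurable]: "S \<in> borel_measurable M" "w j \<in> borel_measurable M" "\<theta> j \<in> borel_measurable M" 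
    using SF wF[OF j(1)] \<theta>F[OF j(1)] meas_F_M by blast+
  have S2: "integrable M (\<lambda>\<omega>. (norm (S \<omega>))\<^sup>2)" using Suc.IH j by (simp add: S_def)
  have Si: "integrable M S" by (rule bounded_sq_integrable) (use S2 in auto)
  have \<theta>i: "integrable M (\<theta> j)" by (rule bounded_sq_integrable) (use i2[OF j(1)] in auto)
  have Xi: "integrable M (\<lambda>\<omega>. cnj (w j \<omega>) * S \<omega>)"
    by (rule integrable_mult_bounded[OF Si, where C = C], measurable) (use wb[OF j(1)] in auto)
  have XF: "(\<lambda>\<omega>. cnj (w j \<omega>) * S \<omega>) \<in> borel_measurable (F (p j))"
    using SF wF[OF j(1)] by measurable
  have \<phi>j[measurable]: "\<phi> j \<in> borel_measurable borel" using \<phi>[OF j(1)] .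
  have ci: "integrable M (\<lambda>\<omega>. cnj (\<phi> j (W (p (Suc j)) \<omega> - W (p j) \<omega>)))"
    using \<theta>i unfolding \<theta>_def by simp
  have cross: "integrable M (\<lambda>\<omega>. cnj (w j \<omega>) * S \<omega> * cnj (\<theta> j \<omega>))"
     "expectation (\<lambda>\<omega>. cnj (w j \<omega>) * S \<omega> * cnj (\<theta> j \<omega>)) = 0"
    using W_indep_integral[OF pj XF Xi, of "\<lambda>x. cnj (\<phi> j x)", OF _ ci] z[OF j(1)]
    unfolding \<theta>_def by simp_all
  have wi: "integrable M (\<lambda>\<omega>. complex_of_real ((norm (w j \<omega>))\<^sup>2))"
    by (rule integrable_const_bound[where B = "C\<^sup>2"]) (use wb[OF j(1)] in \<open>auto simp: norm_power intro!: power_mono\<close>)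
  have wF2: "(\<lambda>\<omega>. complex_of_real ((norm (w j \<omega>))\<^sup>2)) \<in> borel_measurable (F (p j))"
    using wF[OF j(1)] by measurable
  have ci2: "integrable M (\<lambda>\<omega>. complex_of_real ((norm (\<phi> j (W (p (Suc j)) \<omega> - W (p j) \<omega>)))\<^sup>2))"
    using integrable_of_real[OF i2[OF j(1)], where 'a = complex] unfolding \<theta>_def by simp
  have "integrable M (\<lambda>\<omega>. complex_of_real ((norm (w j \<omega>))\<^sup>2) * complex_of_real ((norm (\<theta> j \<omega>))\<^sup>2))"
    "expectation (\<lambda>\<omega>. complex_of_real ((norm (w j \<omega>))\<^sup>2) * complex_of_real ((norm (\<theta> j \<omega>))\<^sup>2)) =
      expectation (\<lambda>\<omega>. complex_of_real ((norm (w j \<omega>))\<^sup>2)) * expectation (\<lambda>\<omega>. complex_of_real ((norm (\<theta> j \<omega>))\<^sup>2))"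
    using W_indep_integral[OF pj wF2 wi, of "\<lambda>x. complex_of_real ((norm (\<phi> j x))\<^sup>2)", OF _ ci2] unfolding \<theta>_def by simp_all
  then have "integrable M (\<lambda>\<omega>. complex_of_real ((norm (w j \<omega>))\<^sup>2 * (norm (\<theta> j \<omega>))\<^sup>2)) \<and>
      expectation (\<lambda>\<omega>. complex_of_real ((norm (w j \<omega>))\<^sup>2 * (norm (\<theta> j \<omega>))\<^sup>2)) = 
      complex_of_real (expectation (\<lambda>\<omega>. (norm (w j \<omega>))\<^sup>2) * expectation (\<lambda>\<omega>. (norm (\<theta> j \<omega>))\<^sup>2))"
    by (simp only: of_real_mult integral_complex_of_real)
  then have sq: "integrable M (\<lambda>\<omega>. (norm (w j \<omega>))\<^sup>2 * (norm (\<theta> j \<omega>))\<^sup>2)"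
     "expectation (\<lambda>\<omega>. (norm (w j \<omega>))\<^sup>2 * (norm (\<theta> j \<omega>))\<^sup>2) = expectation (\<lambda>\<omega>. (norm (w j \<omega>))\<^sup>2) * expectation (\<lambda>\<omega>. (norm (\<theta> j \<omega>))\<^sup>2)"
    by (simp_all only: complex_of_real_integrable_eq integral_complex_of_real of_real_eq_iff)
  have expand: "(norm (S \<omega> + w j \<omega> * \<theta> j \<omega>))\<^sup>2 = (norm (S \<omega>))\<^sup>2 + 2 * Re (cnj (w j \<omega>) * S \<omega> * cnj (\<theta> j \<omega>)) +
     (norm (w j \<omega>))\<^sup>2 * (norm (\<theta> j \<omega>))\<^sup>2" for \<omega>
  proof -
    have "(norm (S \<omega> + w j \<omega> * \<theta> j \<omega>))\<^sup>2 = (norm (S \<omega>))\<^sup>2 + (norm (w j \<omega> * \<theta> j \<omega>))\<^sup>2 + 2 * Re (S \<omega> * cnj (w j \<omega> * \<theta> j \<omega>))"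
      unfolding cmod_power2 by (simp add: power2_eq_square algebra_simps)
    then show ?thesis by (simp add: norm_mult power_mult_distrib mult_ac)
  qed
  have rc: "integrable M (\<lambda>\<omega>. Re (cnj (w j \<omega>) * S \<omega> * cnj (\<theta> j \<omega>)))" 
    "expectation (\<lambda>\<omega>. Re (cnj (w j \<omega>) * S \<omega> * cnj (\<theta> j \<omega>))) = 0"
    using cross by (auto simp del: complex_cnj_mult times_complex.sel intro!: integrable_Re simp: integral_Re)
  have main: "integrable M (\<lambda>\<omega>. (norm (S \<omega> + w j \<omega> * \<theta> j \<omega>))\<^sup>2)"
     "expectation (\<lambda>\<omega>. (norm (S \<omega> + w j \<omega> * \<theta> j \<omega>))\<^sup>2) =
      expectation (\<lambda>\<omega>. (norm (S \<omega>))\<^sup>2) + expectation (\<lambda>\<omega>. (norm (w j \<omega>))\<^sup>2) * expectation (\<lambda>\<omega>. (norm (\<theta> j \<omega>))\<^sup>2)"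
    unfolding expand using S2 rc sq by (simp_all del: times_complex.sel)
  have eqS: "(\<Sum>k<Suc j. w k \<omega> * \<theta> k \<omega>) = S \<omega> + w j \<omega> * \<theta> j \<omega>" for \<omega> by (simp add: S_def)
  have IH2: "expectation (\<lambda>\<omega>. (norm (S \<omega>))\<^sup>2) = (\<Sum>k<j. expectation (\<lambda>\<omega>. (norm (w k \<omega>))\<^sup>2) * expectation (\<lambda>\<omega>. (norm (\<theta> k \<omega>))\<^sup>2))"
    using Suc.IH j by (simp add: S_def)
  show ?case unfolding eqS using main IH2 by simp
qed simp

lemma stable_W:
  assumes T: "T \<ge> 0"
  shows "stable T (\<lambda>p k \<omega>. complex_of_real (W (p (Suc k)) \<omega> - W (p k) \<omega>))"
  unfolding stable_def
proof (intro conjI allI impI)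
  fix n p k assume "is_partition T n p" "k < n"
  then have [measurable]: "W (p k) \<in> borel_measurable M" "W (p (Suc k)) \<in> borel_measurable M"
    using partition_bounds(1)[of T n p k] partition_bounds(1)[of T n p "Suc k"] by (auto intro: W_meas)
  show "(\<lambda>\<omega>. complex_of_real (W (p (Suc k)) \<omega> - W (p k) \<omega>)) \<in> borel_measurable M" by measurable
next
  fix \<epsilon> :: real assume e: "\<epsilon> > 0"
  \<comment> \<open>Chebyshev and the isometry give the bound
    \<open>\<kappa>\<^sup>2 * T / \<epsilon>\<^sup>2\<close>, which this value keeps below
    \<open>\<epsilon>\<close>; T + 1 in place of T covers T = 0.\<close>
  define \<kappa> where "\<kappa> = sqrt (\<epsilon>^3 / (T + 1))"
  have k: "\<kappa> > 0" using e T by (simp add: \<kappa>_def)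
  have k2: "\<kappa>\<^sup>2 * T / \<epsilon>\<^sup>2 < \<epsilon>"
  proof -
    have "\<kappa>\<^sup>2 = \<epsilon>^3 / (T + 1)" using e T by (simp add: \<kappa>_def)
    then have "\<kappa>\<^sup>2 * T / \<epsilon>\<^sup>2 = \<epsilon> * (T / (T + 1))" using e by (simp add: power2_eq_square power3_eq_cube)
    also have "\<dots> < \<epsilon> * 1" using e T by (intro mult_strict_left_mono) auto
    finally show ?thesis by simp
  qed
  show "\<exists>\<kappa>>0. \<forall>n p w. is_partition T n p \<longrightarrow> weights p n \<kappa> w \<longrightarrow>
      prob {\<omega>\<in>space M. norm (\<Sum>k<n. w k \<omega> * complex_of_real (W (p (Suc k)) \<omega> - W (p k) \<omega>)) > \<epsilon>} < \<epsilon>"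
  proof (intro exI[of _ \<kappa>] conjI allI impI k)
    fix n p and w :: "nat \<Rightarrow> 'a \<Rightarrow> complex" assume p: "is_partition T n p" and w: "weights p n \<kappa> w"
    have pk: "0 \<le> p k" "p k \<le> p (Suc k)" if "k < n" for k
      using partition_bounds(1)[OF p, of k] p that by (auto simp: is_partition_def)
    have mom: "integrable M (\<lambda>\<omega>. (norm (complex_of_real (W (p (Suc k)) \<omega> - W (p k) \<omega>)))\<^sup>2)"
      "expectation (\<lambda>\<omega>. complex_of_real (W (p (Suc k)) \<omega> - W (p k) \<omega>)) = 0"
      "expectation (\<lambda>\<omega>. (norm (complex_of_real (W (p (Suc k)) \<omega> - W (p k) \<omega>)))\<^sup>2) = p (Suc k) - p k" if "k < n" for k
      using W_moments[OF pk[OF that]] unfolding norm_of_real power2_abs integral_complex_of_real by simp_all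
    let ?S = "\<lambda>\<omega>. \<Sum>k<n. w k \<omega> * complex_of_real (W (p (Suc k)) \<omega> - W (p k) \<omega>)"
    have L2: "integrable M (\<lambda>\<omega>. (norm (?S \<omega>))\<^sup>2)" "expectation (\<lambda>\<omega>. (norm (?S \<omega>))\<^sup>2) =
      (\<Sum>k<n. expectation (\<lambda>\<omega>. (norm (w k \<omega>))\<^sup>2) * expectation (\<lambda>\<omega>. (norm (complex_of_real (W (p (Suc k)) \<omega> - W (p k) \<omega>)))\<^sup>2))"
      using increments_L2[OF p w, where \<phi> = "\<lambda>k. complex_of_real" and j = n, OF _ mom(1) mom(2)] by auto
    have "expectation (\<lambda>\<omega>. (norm (?S \<omega>))\<^sup>2) \<le> (\<Sum>k<n. \<kappa>\<^sup>2 * (p (Suc k) - p k))"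
      unfolding L2(2)
    proof (intro sum_mono mult_mono)
      fix k assume "k \<in> {..<n}" then have kn: "k < n" by simp
      have wk: "w k \<in> borel_measurable M" "\<And>\<omega>. \<omega> \<in> space M \<Longrightarrow> norm (w k \<omega>) \<le> \<kappa>"
        using w kn by (auto simp: weights_def intro: meas_F_M)
      have b: "(norm (w k \<omega>))\<^sup>2 \<le> \<kappa>\<^sup>2" if "\<omega> \<in> space M" for \<omega> using wk(2)[OF that] by (intro power_mono) auto
      show "expectation (\<lambda>\<omega>. (norm (w k \<omega>))\<^sup>2) \<le> \<kappa>\<^sup>2"
        by (rule integral_le_const) (use b wk(1) in \<open>auto intro!: integrable_const_bound[where B = "\<kappa>\<^sup>2"]\<close>)
      show "expectation (\<lambda>\<omega>. (norm (complex_of_real (W (p (Suc k)) \<omega> - W (p k) \<omega>)))\<^sup>2) \<le> p (Suc k) - p k"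
        using mom(3)[OF kn] by simp
    qed (use pk in \<open>auto intro: integral_nonneg_AE\<close>)
    also have "\<dots> = \<kappa>\<^sup>2 * T"
      using p by (simp add: sum_distrib_left[symmetric] sum_lessThan_telescope[of p] is_partition_def)
    finally have ES: "expectation (\<lambda>\<omega>. (norm (?S \<omega>))\<^sup>2) \<le> \<kappa>\<^sup>2 * T" .
    have "prob {\<omega>\<in>space M. norm (?S \<omega>) > \<epsilon>} = prob {\<omega>\<in>space M. (norm (?S \<omega>))\<^sup>2 > \<epsilon>\<^sup>2}"
      using e by (intro arg_cong[where f = prob] Collect_cong conj_cong refl)
        (smt (verit) norm_ge_zero power_mono power_strict_mono pos2)
    also have "\<dots> \<le> expectation (\<lambda>\<omega>. (norm (?S \<omega>))\<^sup>2) / \<epsilon>\<^sup>2"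
      by (rule prob_markov) (use L2 e in auto)
    also have "\<dots> \<le> \<kappa>\<^sup>2 * T / \<epsilon>\<^sup>2" using ES by (intro divide_right_mono) auto
    also have "\<dots> < \<epsilon>" by (rule k2)
    finally show "prob {\<omega>\<in>space M. norm (?S \<omega>) > \<epsilon>} < \<epsilon>" .
  qed
qed

lemma tight_sum_W_sq:
  assumes T: "T \<ge> 0"
  shows "tight_sum T (\<lambda>p k \<omega>. (W (p (Suc k)) \<omega> - W (p k) \<omega>)\<^sup>2)"
  unfolding tight_sum_def
proof (intro conjI allI impI)
  fix n p k assume "is_partition T n p" "k < n"
  then have [measurable]: "W (p k) \<in> borel_measurable M" "W (p (Suc k)) \<in> borel_measurable M"
    using partition_bounds(1)[of T n p k] partition_bounds(1)[of T n p "Suc k"] by (auto intro: W_meas)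
  show "(\<lambda>\<omega>. (W (p (Suc k)) \<omega> - W (p k) \<omega>)\<^sup>2) \<in> borel_measurable M" by measurable
next
  fix \<epsilon> :: real assume e: "\<epsilon> > 0"
  show "\<exists>C>0. \<forall>n p. is_partition T n p \<longrightarrow>
    prob {\<omega>\<in>space M. (\<Sum>k<n. norm ((W (p (Suc k)) \<omega> - W (p k) \<omega>)\<^sup>2)) > C} < \<epsilon>"
  proof (intro exI[of _ "(T + 1) / \<epsilon>"] conjI allI impI)
    fix n p assume p: "is_partition T n p"
    have pk: "0 \<le> p k" "p k \<le> p (Suc k)" if "k < n" for k
      using partition_bounds(1)[OF p, of k] p that by (auto simp: is_partition_def)
    have "prob {\<omega>\<in>space M. (\<Sum>k<n. (W (p (Suc k)) \<omega> - W (p k) \<omega>)\<^sup>2) > (T + 1) / \<epsilon>} \<le>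
        expectation (\<lambda>\<omega>. \<Sum>k<n. (W (p (Suc k)) \<omega> - W (p k) \<omega>)\<^sup>2) / ((T + 1) / \<epsilon>)"
      by (rule prob_markov) (use T e pk in \<open>auto intro!: sum_nonneg Bochner_Integration.integrable_sum W_moments(3)\<close>)
    also have "expectation (\<lambda>\<omega>. \<Sum>k<n. (W (p (Suc k)) \<omega> - W (p k) \<omega>)\<^sup>2) = (\<Sum>k<n. p (Suc k) - p k)"
      using pk by (subst Bochner_Integration.integral_sum) (auto intro!: W_moments(3) sum.cong simp: W_moments(4))
    also have "\<dots> = T" using p by (simp add: sum_lessThan_telescope[of p] is_partition_def)
    also have "T / ((T + 1) / \<epsilon>) < \<epsilon>" using T e by (simp add: field_simps)
    finally show "prob {\<omega>\<in>space M. (\<Sum>k<n. norm ((W (p (Suc k)) \<omega> - W (p k) \<omega>)\<^sup>2)) > (T + 1) / \<epsilon>} < \<epsilon>" by simp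
  qed (use T e in auto)
qed

text \<open>The sum of (\<Delta>X)^2 equals X(T)^2 - X(0)^2 minus twice the sum of X \<Delta>X. The
  last sum has adapted weights, so stability applies to it after clipping and scaling. This takes
  the place of the quadratic variation.\<close>

lemma tight_sum_sq:
  fixes X :: "real \<Rightarrow> 'a \<Rightarrow> real"
  assumes S: "stable T (\<lambda>p k \<omega>. X (p (Suc k)) \<omega> - X (p k) \<omega>)"
    and X: "\<And>t. 0 \<le> t \<Longrightarrow> X t \<in> borel_measurable (F t)" and tm: "tight_max T X"
  shows "tight_sum T (\<lambda>p k \<omega>. (X (p (Suc k)) \<omega> - X (p k) \<omega>)\<^sup>2)"
  unfolding tight_sum_def
proof (intro conjI allI impI)
  fix n p k assume "is_partition T n p" "k < n"
  from stable_meas[OF S this]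
  show "(\<lambda>\<omega>. (X (p (Suc k)) \<omega> - X (p k) \<omega>)\<^sup>2) \<in> borel_measurable M" by simp
next
  fix \<epsilon> :: real assume e: "\<epsilon> > 0"
  define \<delta> where "\<delta> = min 1 (\<epsilon>/2)"
  have d: "\<delta> > 0" "\<delta> \<le> 1" "\<delta> \<le> \<epsilon>/2" "\<epsilon>/2 > 0" using e by (auto simp: \<delta>_def)
  obtain \<kappa> where k: "\<kappa> > 0" and w1: "\<And>n p w. is_partition T n p \<Longrightarrow> weights p n \<kappa> w \<Longrightarrow>
      prob {\<omega>\<in>space M. norm (\<Sum>k<n. w k \<omega> * (X (p (Suc k)) \<omega> - X (p k) \<omega>)) > \<delta>} < \<delta>"
    using stableD[OF S d(1)] by blast
  obtain c where c: "c > 0" "\<And>n p. is_partition T n p \<Longrightarrow> prob {\<omega>\<in>space M. \<exists>k\<le>n. norm (X (p k) \<omega>) > c} < \<epsilon>/2"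
    using tm d(4) unfolding tight_max_def by meson
  show "\<exists>C>0. \<forall>n p. is_partition T n p \<longrightarrow>
    prob {\<omega>\<in>space M. (\<Sum>k<n. norm ((X (p (Suc k)) \<omega> - X (p k) \<omega>)\<^sup>2)) > C} < \<epsilon>"
  \<comment> \<open>Off the rare events X^2 is at most c^2 at the endpoint, and the sum of X
    \<Delta>X is at most \<delta> c/\<kappa> \<le> c/\<kappa> in modulus, since the weights are
    scaled by \<kappa>/c.\<close>
  proof (intro exI[of _ "c\<^sup>2 + 2 * (c / \<kappa>)"] conjI allI impI)
    fix n p assume p: "is_partition T n p"
    define w where "w k \<omega> = (\<kappa> / c) * clip c (X (p k) \<omega>)" for k \<omega>
    have XF: "X (p k) \<in> borel_measurable (F (p k))" if "k \<le> n" for k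
      using X[OF partition_bounds(1)[OF p that]] .
    have [measurable]: "X (p k) \<in> borel_measurable M" if "k \<le> n" for k using XF[OF that] meas_F_M by blast
    have wt: "weights p n \<kappa> w"
      unfolding weights_def
    proof (intro conjI allI impI ballI)
      fix k \<omega> assume "k < n"
      then have [measurable]: "X (p k) \<in> borel_measurable (F (p k))" using XF by simp
      show "w k \<in> borel_measurable (F (p k))" unfolding w_def by measurable
      have "norm (w k \<omega>) \<le> (\<kappa> / c) * c" unfolding w_def norm_mult
        using clip_bound[of c "X (p k) \<omega>"] c k by (intro mult_mono) auto
      then show "norm (w k \<omega>) \<le> \<kappa>" using c by simp
    qed
    have [measurable]: "w k \<in> borel_measurable M" if "k < n" for k
      using wt that by (auto simp: weights_def intro: meas_F_M)
    have Dm[measurable]: "(\<lambda>\<omega>. X (p (Suc k)) \<omega> - X (p k) \<omega>) \<in> borel_measurable M" if "k < n" for k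
      using stable_meas[OF S p that] .
    have "prob {\<omega>\<in>space M. (\<Sum>k<n. norm ((X (p (Suc k)) \<omega> - X (p k) \<omega>)\<^sup>2)) > c\<^sup>2 + 2 * (c / \<kappa>)} \<le>
      prob {\<omega>\<in>space M. norm (\<Sum>k<n. w k \<omega> * (X (p (Suc k)) \<omega> - X (p k) \<omega>)) > \<delta>} + prob {\<omega>\<in>space M. \<exists>k\<le>n. norm (X (p k) \<omega>) > c}"
    proof (rule prob_le_add)
      have key: "norm (\<Sum>k<n. w k \<omega> * (X (p (Suc k)) \<omega> - X (p k) \<omega>)) > \<delta> \<or> (\<exists>k\<le>n. norm (X (p k) \<omega>) > c)"
        if gt: "(\<Sum>k<n. norm ((X (p (Suc k)) \<omega> - X (p k) \<omega>)\<^sup>2)) > c\<^sup>2 + 2 * (c / \<kappa>)" for \<omega>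
      proof (rule ccontr)
        assume a: "\<not> ?thesis"
        then have b: "\<bar>X (p k) \<omega>\<bar> \<le> c" if "k \<le> n" for k using that by (auto simp: not_less)
        define A where "A = (\<Sum>k<n. X (p k) \<omega> * (X (p (Suc k)) \<omega> - X (p k) \<omega>))"
        have "(\<Sum>k<n. w k \<omega> * (X (p (Suc k)) \<omega> - X (p k) \<omega>)) = (\<Sum>k<n. (\<kappa> / c) * (X (p k) \<omega> * (X (p (Suc k)) \<omega> - X (p k) \<omega>)))"
          using b by (intro sum.cong) (auto simp: w_def clip_eq)
        also have "\<dots> = (\<kappa> / c) * A" by (simp add: A_def sum_distrib_left)
        finally have "\<bar>(\<kappa> / c) * A\<bar> \<le> \<delta>" using a by auto
        then have "\<kappa> * \<bar>A\<bar> \<le> \<delta> * c" using c k by (simp add: abs_mult field_simps)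
        also have "\<dots> \<le> 1 * c" using d(2) c by (intro mult_right_mono) auto
        finally have A: "\<bar>A\<bar> \<le> c / \<kappa>" using k by (simp add: field_simps)
        have "(\<Sum>k<n. norm ((X (p (Suc k)) \<omega> - X (p k) \<omega>)\<^sup>2)) =
          (\<Sum>k<n. ((X (p (Suc k)) \<omega>)\<^sup>2 - (X (p k) \<omega>)\<^sup>2) - 2 * (X (p k) \<omega> * (X (p (Suc k)) \<omega> - X (p k) \<omega>)))"
          unfolding real_norm_def abs_power2
          by (intro sum.cong refl) (simp add: power2_eq_square algebra_simps)
        also have "\<dots> = ((X (p n) \<omega>)\<^sup>2 - (X (p 0) \<omega>)\<^sup>2) - 2 * A"
          by (subst sum_subtractf, subst sum_lessThan_telescope[of "\<lambda>k. (X (p k) \<omega>)\<^sup>2"]) (simp add: A_def sum_distrib_left)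
        also have "\<dots> \<le> c\<^sup>2 + 2 * (c / \<kappa>)"
        proof -
          have "(X (p n) \<omega>)\<^sup>2 \<le> c\<^sup>2" using b[of n] by (metis abs_ge_zero order_refl power2_abs power_mono)
          moreover have "0 \<le> (X (p 0) \<omega>)\<^sup>2" by simp
          ultimately show ?thesis using A by linarith
        qed
        finally show False using gt by simp
      qed
      show "AE \<omega> in M. (\<Sum>k<n. norm ((X (p (Suc k)) \<omega> - X (p k) \<omega>)\<^sup>2)) > c\<^sup>2 + 2 * (c / \<kappa>) \<longrightarrow>
        norm (\<Sum>k<n. w k \<omega> * (X (p (Suc k)) \<omega> - X (p k) \<omega>)) > \<delta> \<or> (\<exists>k\<le>n. norm (X (p k) \<omega>) > c)" by (intro AE_I2 impI key)
    qed measurable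
    also have "\<dots> < \<epsilon>" using w1[OF p wt] c(2)[OF p] d by linarith
    finally show "prob {\<omega>\<in>space M. (\<Sum>k<n. norm ((X (p (Suc k)) \<omega> - X (p k) \<omega>)\<^sup>2)) > c\<^sup>2 + 2 * (c / \<kappa>)} < \<epsilon>" .
  qed (use c k in \<open>auto intro: add_pos_pos\<close>)
qed

end

section \<open>The defect of the Stratonovich equation along partitions\<close>

definition mesh_less :: "real \<Rightarrow> nat \<Rightarrow> (nat \<Rightarrow> real) \<Rightarrow> bool" where
  "mesh_less \<delta> n p \<longleftrightarrow> (\<forall>k<n. p (Suc k) - p k < \<delta>)"

lemma mesh_less_mono: "mesh_less \<delta> n p \<Longrightarrow> \<delta> \<le> \<delta>' \<Longrightarrow> mesh_less \<delta>' n p"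
  unfolding mesh_less_def by force

definition uniform_partition :: "real \<Rightarrow> nat \<Rightarrow> nat \<Rightarrow> real" where
  "uniform_partition T n k = T * real k / real n"

lemma is_partition_uniform: "T \<ge> 0 \<Longrightarrow> n > 0 \<Longrightarrow> is_partition T n (uniform_partition T n)"
  by (auto simp: is_partition_def uniform_partition_def intro!: divide_right_mono mult_left_mono)

lemma uniform_partition_diff: "n > 0 \<Longrightarrow> uniform_partition T n (Suc k) - uniform_partition T n k = T / n"
  by (simp add: uniform_partition_def diff_divide_distrib[symmetric] algebra_simps)

lemma uniform_partition_mesh:
  assumes "T \<ge> 0" "\<delta> > 0"
  shows "\<exists>N>0. \<forall>n\<ge>N. mesh_less \<delta> n (uniform_partition T n)"
proof -
  obtain N where N: "T / \<delta> < real N" using reals_Archimedean2 by blast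
  show ?thesis
  proof (intro exI[of _ "Suc N"] conjI allI impI)
    fix n assume n: "n \<ge> Suc N"
    have "T < real N * \<delta>" using N assms by (simp add: field_simps)
    also have "\<dots> \<le> real n * \<delta>" using n assms by (intro mult_right_mono) auto
    finally have "T / n < \<delta>" using n by (simp add: field_simps)
    then show "mesh_less \<delta> n (uniform_partition T n)" using n by (simp add: mesh_less_def uniform_partition_diff)
  qed simp
qed

lemma partition_continuous_fine:
  fixes f :: "real \<Rightarrow> 'b::metric_space"
  assumes "continuous_on {0..} f" "e > 0"
  shows "\<exists>\<delta>>0. \<forall>n p. is_partition T n p \<longrightarrow> mesh_less \<delta> n p \<longrightarrow>
     (\<forall>k<n. \<forall>s\<in>{p k..p (Suc k)}. dist (f s) (f (p k)) < e)"
proof -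
  have "uniformly_continuous_on {0..T} f"
    by (intro compact_uniformly_continuous continuous_on_subset[OF assms(1)]) auto
  then obtain \<delta> where d: "\<delta> > 0" "\<And>s t. s \<in> {0..T} \<Longrightarrow> t \<in> {0..T} \<Longrightarrow> dist s t < \<delta> \<Longrightarrow> dist (f s) (f t) < e"
    using assms(2) unfolding uniformly_continuous_on_def by metis
  show ?thesis
  proof (intro exI[of _ \<delta>] conjI allI impI ballI d(1))
    fix n p k s assume p: "is_partition T n p" "mesh_less \<delta> n p" "k < n" "s \<in> {p k..p (Suc k)}"
    have "0 \<le> p k" "p (Suc k) \<le> T" using partition_bounds[OF p(1)] p(3) by auto
    then show "dist (f s) (f (p k)) < e"
      using p by (intro d) (auto simp: mesh_less_def dist_real_def)
  qed
qed

text \<open>The sampled values \<open>v k\<close> may differ from \<open>f (p k)\<close> by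
  \<open>e\<close>; this slack and the oscillation of \<open>f\<close> on a cell account for the
  factor 2. The slack serves the averages of \<open>u\<close> over both ends of a cell in the
  product rule.\<close>

lemma riemann_sum_fine:
  fixes f :: "real \<Rightarrow> complex"
  assumes f: "continuous_on {0..} f" and e: "e > 0"
  shows "\<exists>\<delta>>0. \<forall>n p v. is_partition T n p \<longrightarrow> mesh_less \<delta> n p \<longrightarrow> (\<forall>k<n. norm (v k - f (p k)) \<le> e) \<longrightarrow>
     norm (integral {0..T} f - (\<Sum>k<n. v k * of_real (p (Suc k) - p k))) \<le> 2 * e * T"
proof -
  obtain \<delta> where d: "\<delta> > 0" "\<And>n p k s. is_partition T n p \<Longrightarrow> mesh_less \<delta> n p \<Longrightarrow> k < n \<Longrightarrow> s \<in> {p k..p (Suc k)} \<Longrightarrow>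
      dist (f s) (f (p k)) < e"
    using partition_continuous_fine[OF f e, of T] by metis
  show ?thesis
  proof (intro exI[of _ \<delta>] conjI allI impI d(1))
    fix n p and v :: "nat \<Rightarrow> complex" assume p: "is_partition T n p" "mesh_less \<delta> n p" and v: "\<forall>k<n. norm (v k - f (p k)) \<le> e"
    have "norm (integral {0..p j} f - (\<Sum>k<j. v k * of_real (p (Suc k) - p k))) \<le> 2 * e * p j" if "j \<le> n" for j
      using that
    proof (induction j)
      case 0
      then show ?case using p(1) by (simp add: is_partition_def)
    next
      case (Suc j)
      then have j: "j < n" by simp
      have pj: "0 \<le> p j" "p j \<le> p (Suc j)"
        using partition_bounds(1)[OF p(1), of j] p(1) j by (auto simp: is_partition_def)
      have cf: "continuous_on {p j..p (Suc j)} f" using continuous_on_subset[OF f] pj by auto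
      have fi: "f integrable_on {0..p (Suc j)}" "f integrable_on {p j..p (Suc j)}"
        using continuous_on_subset[OF f] pj by (auto intro!: integrable_continuous_real)
      have "integral {p j..p (Suc j)} f - v j * of_real (p (Suc j) - p j) = integral {p j..p (Suc j)} (\<lambda>s. f s - v j)"
        using fi pj by (subst Henstock_Kurzweil_Integration.integral_diff) (auto simp: mult.commute scaleR_conv_of_real)
      also have "norm \<dots> \<le> 2 * e * (p (Suc j) - p j)"
      proof (rule integral_bound)
        show "norm (f t - v j) \<le> 2 * e" if "t \<in> {p j..p (Suc j)}" for t
        proof -
          have "norm (f t - v j) \<le> norm (f t - f (p j)) + norm (v j - f (p j))"
            by (metis norm_minus_commute norm_triangle_ineq diff_add_cancel add_diff_eq)
          then show ?thesis using d(2)[OF p j that] v j by (force simp: dist_norm)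
        qed
      qed (use pj cf in \<open>auto intro!: continuous_intros\<close>)
      finally have a: "norm (integral {p j..p (Suc j)} f - v j * of_real (p (Suc j) - p j)) \<le> 2 * e * (p (Suc j) - p j)" .
      have "integral {0..p (Suc j)} f = integral {0..p j} f + integral {p j..p (Suc j)} f"
        using Henstock_Kurzweil_Integration.integral_combine[OF pj fi(1)] by simp
      then have "norm (integral {0..p (Suc j)} f - (\<Sum>k<Suc j. v k * of_real (p (Suc k) - p k))) =
        norm ((integral {0..p j} f - (\<Sum>k<j. v k * of_real (p (Suc k) - p k))) + (integral {p j..p (Suc j)} f - v j * of_real (p (Suc j) - p j)))"
        by (simp add: algebra_simps)
      also have "\<dots> \<le> 2 * e * p j + 2 * e * (p (Suc j) - p j)"
        using Suc.IH j a by (intro norm_triangle_mono) auto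
      finally show ?case by (simp add: algebra_simps)
    qed
    from this[of n] show "norm (integral {0..T} f - (\<Sum>k<n. v k * of_real (p (Suc k) - p k))) \<le> 2 * e * T"
      using p(1) by (simp add: is_partition_def)
  qed
qed

context bm_space
begin

text \<open>\<open>uniform_small\<close> with the m-th index set consisting of the partitions of
  mesh below 1/(m + 1): a pathwise statement with a path-dependent mesh becomes one in probability
  with a common mesh.\<close>

lemma uniform_small_fine:
  assumes m: "\<And>n p. is_partition T n p \<Longrightarrow> {\<omega>\<in>space M. P n p \<omega>} \<in> events"
    and ae: "AE \<omega> in M. \<exists>\<delta>>0. \<forall>n p. is_partition T n p \<longrightarrow> mesh_less \<delta> n p \<longrightarrow> \<not> P n p \<omega>" and e: "\<epsilon> > 0"
  shows "\<exists>\<delta>>0. \<forall>n p. is_partition T n p \<longrightarrow> mesh_less \<delta> n p \<longrightarrow> prob {\<omega>\<in>space M. P n p \<omega>} < \<epsilon>"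
proof -
  define I where "I m = {(n, p). is_partition T n p \<and> mesh_less (1 / Suc m) n p}" for m :: nat
  have "\<exists>m0. \<forall>m\<ge>m0. \<forall>i\<in>I m. prob {\<omega>\<in>space M. P (fst i) (snd i) \<omega>} < \<epsilon>"
  proof (rule uniform_small[where A = "\<lambda>m i. {\<omega>\<in>space M. P (fst i) (snd i) \<omega>}", OF _ _ e])
    show "{\<omega>\<in>space M. P (fst i) (snd i) \<omega>} \<in> events" if "i \<in> I m" for m i
      using m that by (auto simp: I_def)
    show "AE \<omega> in M. \<exists>m0. \<forall>m\<ge>m0. \<forall>i\<in>I m. \<omega> \<notin> {\<omega>\<in>space M. P (fst i) (snd i) \<omega>}"
      using ae
    proof eventually_elim
      case (elim \<omega>)
      then obtain \<delta> where d: "\<delta> > 0" "\<And>n p. is_partition T n p \<Longrightarrow> mesh_less \<delta> n p \<Longrightarrow> \<not> P n p \<omega>" by blast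
      obtain m0 where m0: "1 / \<delta> < real m0" using reals_Archimedean2 by blast
      show ?case
      proof (intro exI[of _ m0] allI impI ballI)
        fix m i assume m: "m0 \<le> m" "i \<in> I m"
        have "1 / \<delta> \<le> real (Suc m)" using m0 m by linarith
        then have "1 / Suc m \<le> \<delta>" using d(1) by (simp add: field_simps)
        then show "\<omega> \<notin> {\<omega>\<in>space M. P (fst i) (snd i) \<omega>}"
          using m(2) d(2) mesh_less_mono by (fastforce simp: I_def)
      qed
    qed
  qed
  then obtain m0 where "\<forall>i\<in>I m0. prob {\<omega>\<in>space M. P (fst i) (snd i) \<omega>} < \<epsilon>" by blast
  then show ?thesis by (intro exI[of _ "1 / Suc m0"]) (auto simp: I_def)
qed

lemma tight_sum_dominated:
  fixes E :: "(nat \<Rightarrow> real) \<Rightarrow> nat \<Rightarrow> 'a \<Rightarrow> 'b::{real_normed_field,banach,second_countable_topology}"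
    and E1 E2 :: "(nat \<Rightarrow> real) \<Rightarrow> nat \<Rightarrow> 'a \<Rightarrow> real"
  assumes 1: "tight_sum T E1" and 2: "tight_sum T E2"
    and m: "\<And>n p k. is_partition T n p \<Longrightarrow> k < n \<Longrightarrow> E p k \<in> borel_measurable M"
    and le: "\<And>p k \<omega>. norm (E p k \<omega>) \<le> norm (E1 p k \<omega>) + norm (E2 p k \<omega>)"
  shows "tight_sum T E"
  unfolding tight_sum_def
proof (intro conjI allI impI m)
  fix \<epsilon> :: real assume "\<epsilon> > 0" then have e: "\<epsilon>/2 > 0" by simp
  obtain C1 where C1: "C1 > 0" "\<And>n p. is_partition T n p \<Longrightarrow> prob {\<omega>\<in>space M. (\<Sum>k<n. norm (E1 p k \<omega>)) > C1} < \<epsilon>/2"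
    using 1 e unfolding tight_sum_def by meson
  obtain C2 where C2: "C2 > 0" "\<And>n p. is_partition T n p \<Longrightarrow> prob {\<omega>\<in>space M. (\<Sum>k<n. norm (E2 p k \<omega>)) > C2} < \<epsilon>/2"
    using 2 e unfolding tight_sum_def by meson
  show "\<exists>C>0. \<forall>n p. is_partition T n p \<longrightarrow> prob {\<omega>\<in>space M. (\<Sum>k<n. norm (E p k \<omega>)) > C} < \<epsilon>"
  proof (intro exI[of _ "C1 + C2"] conjI allI impI)
    fix n p assume p: "is_partition T n p"
    have [measurable]: "E1 p k \<in> borel_measurable M" "E2 p k \<in> borel_measurable M" if "k < n" for k
      using 1 2 p that by (auto simp: tight_sum_def)
    have "prob {\<omega>\<in>space M. (\<Sum>k<n. norm (E p k \<omega>)) > C1 + C2} \<le>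
      prob {\<omega>\<in>space M. (\<Sum>k<n. norm (E1 p k \<omega>)) > C1} + prob {\<omega>\<in>space M. (\<Sum>k<n. norm (E2 p k \<omega>)) > C2}"
    proof (rule prob_le_add)
      have "(\<Sum>k<n. norm (E p k \<omega>)) \<le> (\<Sum>k<n. norm (E1 p k \<omega>)) + (\<Sum>k<n. norm (E2 p k \<omega>))" for \<omega>
        unfolding sum.distrib[symmetric] by (intro sum_mono le)
      then show "AE \<omega> in M. (\<Sum>k<n. norm (E p k \<omega>)) > C1 + C2 \<longrightarrow>
        (\<Sum>k<n. norm (E1 p k \<omega>)) > C1 \<or> (\<Sum>k<n. norm (E2 p k \<omega>)) > C2"
        by (intro AE_I2) (smt (verit))
    qed measurable
    then show "prob {\<omega>\<in>space M. (\<Sum>k<n. norm (E p k \<omega>)) > C1 + C2} < \<epsilon>"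
      using C1(2)[OF p] C2(2)[OF p] by linarith
  qed (use C1 C2 in auto)
qed

end

locale strat_sde = bm_space +
  fixes h :: "real \<Rightarrow> 'a \<Rightarrow> complex" and S :: "real \<Rightarrow> 'a \<Rightarrow> complex" and b :: "complex \<Rightarrow> complex"
    and a :: real and x :: complex
  assumes h_sm: "complex_continuous_semimartingale M F h"
    and h_0: "AE \<omega> in M. h 0 \<omega> = x"
    and b_cont: "continuous_on UNIV b"
    and S_strat: "has_stratonovich_integral M (\<lambda>t \<omega>. \<i> * of_real a * h t \<omega>) W S"
    and h_eq: "AE \<omega> in M. \<forall>t\<ge>0. h t \<omega> = x + integral {0..t} (\<lambda>s. b (h s \<omega>)) + S t \<omega>"
begin

lemma b_meas[measurable]: "b \<in> borel_measurable borel"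
  using b_cont by (rule borel_measurable_continuous_onI)

lemma h_adapted: "t \<ge> 0 \<Longrightarrow> h t \<in> borel_measurable (F t)"
  using h_sm unfolding complex_continuous_semimartingale_def continuous_semimartingale_def adapted_def
  by (auto simp: borel_measurable_complex_iff)

lemma h_meas: "t \<ge> 0 \<Longrightarrow> h t \<in> borel_measurable M"
  using h_adapted meas_F_M by blast

lemma h_cont: "AE \<omega> in M. continuous_on {0..} (\<lambda>t. h t \<omega>)"
proof -
  have "AE \<omega> in M. continuous_on {0..} (\<lambda>t. Re (h t \<omega>))" "AE \<omega> in M. continuous_on {0..} (\<lambda>t. Im (h t \<omega>))"
    using h_sm unfolding complex_continuous_semimartingale_def continuous_semimartingale_def continuous_paths_def by auto
  then show ?thesis
  proof eventually_elim
    case (elim \<omega>)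
    then have "continuous_on {0..} (\<lambda>t. of_real (Re (h t \<omega>)) + \<i> * of_real (Im (h t \<omega>)))"
      by (intro continuous_on_add continuous_on_mult continuous_on_of_real continuous_on_const)
    then show ?case by (simp only: complex_eq[symmetric])
  qed
qed

text \<open>The residual of the equation over one cell, with the drift taken at the left endpoint
  and the noise by the trapezoidal average that matches the symmetric sums.\<close>

definition E :: "(nat \<Rightarrow> real) \<Rightarrow> nat \<Rightarrow> 'a \<Rightarrow> complex" where
  "E p k \<omega> = h (p (Suc k)) \<omega> - h (p k) \<omega> - b (h (p k) \<omega>) * of_real (p (Suc k) - p k)
     - \<i> * of_real a * ((h (p k) \<omega> + h (p (Suc k)) \<omega>) / 2) * of_real (W (p (Suc k)) \<omega> - W (p k) \<omega>)"

definition Z :: "(nat \<Rightarrow> real) \<Rightarrow> nat \<Rightarrow> 'a \<Rightarrow> complex" where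
  "Z p j \<omega> = (\<Sum>k<j. E p k \<omega>)"

lemma partition_meas:
  assumes p: "is_partition T n p" and k: "k \<le> n"
  shows "h (p k) \<in> borel_measurable (F (p k))" "h (p k) \<in> borel_measurable M"
    "W (p k) \<in> borel_measurable (F (p k))" "W (p k) \<in> borel_measurable M"
  using h_adapted h_meas W_adapted W_meas partition_bounds(1)[OF assms] by auto

lemma E_adapted:
  assumes p: "is_partition T n p" and k: "k < j" "j \<le> n"
  shows "E p k \<in> borel_measurable (F (p j))"
proof -
  have le: "p k \<le> p j" "p (Suc k) \<le> p j" using partition_mono[OF p] k by auto
  have "h (p k) \<in> borel_measurable (F (p j))" "h (p (Suc k)) \<in> borel_measurable (F (p j))"
    "W (p k) \<in> borel_measurable (F (p j))" "W (p (Suc k)) \<in> borel_measurable (F (p j))"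
    using partition_meas[OF p, of k] partition_meas[OF p, of "Suc k"] le k by (auto intro: meas_F_mono)
  note [measurable] = this
  show ?thesis unfolding E_def by measurable
qed

lemma E_meas: "is_partition T n p \<Longrightarrow> k < n \<Longrightarrow> E p k \<in> borel_measurable M"
  using E_adapted[of T n p k n] meas_F_M by blast

lemma Z_adapted:
  assumes p: "is_partition T n p" and j: "i \<le> j" "j \<le> n"
  shows "Z p i \<in> borel_measurable (F (p j))"
  unfolding Z_def using E_adapted[OF p _ j(2)] j by (intro borel_measurable_sum) auto

lemma Z_meas: "is_partition T n p \<Longrightarrow> j \<le> n \<Longrightarrow> Z p j \<in> borel_measurable M"
  using Z_adapted[of T n p j j] meas_F_M by blast

text \<open>The trapezoidal average is h(p k) + (\<Delta>h)/2, which splits the residual into the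
  increment of \<open>h\<close>, a drift term, an adapted multiple of \<Delta>W and a multiple of
  \<Delta>h \<Delta>W. The first is stable because \<open>h\<close> is a semimartingale, the last
  because its modulus is controlled by (\<Delta>h)^2 + (\<Delta>W)^2, whose sums are tight.\<close>

lemma stable_E:
  assumes T: "T \<ge> 0"
  shows "stable T E"
proof -
  define H1 where "H1 p k \<omega> = Re (h (p (Suc k)) \<omega>) - Re (h (p k) \<omega>)" for p :: "nat \<Rightarrow> real" and k \<omega>
  define H2 where "H2 p k \<omega> = Im (h (p (Suc k)) \<omega>) - Im (h (p k) \<omega>)" for p :: "nat \<Rightarrow> real" and k \<omega>
  define D where "D p k \<omega> = complex_of_real (W (p (Suc k)) \<omega> - W (p k) \<omega>)" for p :: "nat \<Rightarrow> real" and k \<omega>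
  have sm: "continuous_semimartingale M F (\<lambda>t \<omega>. Re (h t \<omega>))" "continuous_semimartingale M F (\<lambda>t \<omega>. Im (h t \<omega>))"
    using h_sm by (auto simp: complex_continuous_semimartingale_def)
  have s1: "stable T H1" "stable T H2"
    unfolding H1_def H2_def using stable_semimartingale[OF sm(1) T] stable_semimartingale[OF sm(2) T] by simp_all
  have sD: "stable T D" unfolding D_def by (rule stable_W[OF T])
  have hF: "(\<lambda>\<omega>. Re (h t \<omega>)) \<in> borel_measurable (F t)" "(\<lambda>\<omega>. Im (h t \<omega>)) \<in> borel_measurable (F t)"
    "(\<lambda>\<omega>. b (h t \<omega>)) \<in> borel_measurable (F t)" if "0 \<le> t" for t
    using h_adapted[OF that] by measurable
  have hM: "(\<lambda>\<omega>. Re (h t \<omega>)) \<in> borel_measurable M" "(\<lambda>\<omega>. Im (h t \<omega>)) \<in> borel_measurable M"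
    "(\<lambda>\<omega>. b (h t \<omega>)) \<in> borel_measurable M" if "0 \<le> t" for t
    using h_meas[OF that] by measurable
  have cp: "continuous_paths M (\<lambda>t \<omega>. Re (h t \<omega>))" "continuous_paths M (\<lambda>t \<omega>. Im (h t \<omega>))"
    using sm by (auto simp: continuous_semimartingale_def)
  have cph: "continuous_paths M h" unfolding continuous_paths_def by (rule h_cont)
  have cpb: "continuous_paths M (\<lambda>t \<omega>. b (h t \<omega>))" unfolding continuous_paths_def
    using h_cont by eventually_elim (intro continuous_on_compose2[OF b_cont], auto)
  have Q1: "tight_sum T (\<lambda>p k \<omega>. (H1 p k \<omega>)\<^sup>2)" unfolding H1_def
    by (rule tight_sum_sq[where X = "\<lambda>t \<omega>. Re (h t \<omega>)", OF s1(1)[unfolded H1_def] hF(1) tight_max_continuous[OF hM(1) cp(1)]])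
  have Q2: "tight_sum T (\<lambda>p k \<omega>. (H2 p k \<omega>)\<^sup>2)" unfolding H2_def
    by (rule tight_sum_sq[where X = "\<lambda>t \<omega>. Im (h t \<omega>)", OF s1(2)[unfolded H2_def] hF(2) tight_max_continuous[OF hM(2) cp(2)]])
  have QW: "tight_sum T (\<lambda>p k \<omega>. (W (p (Suc k)) \<omega> - W (p k) \<omega>)\<^sup>2)" by (rule tight_sum_W_sq[OF T])
  have Hm: "H1 p k \<in> borel_measurable M" "H2 p k \<in> borel_measurable M" "D p k \<in> borel_measurable M"
    if "is_partition T n p" "k < n" for n p k
    using stable_meas[OF s1(1) that] stable_meas[OF s1(2) that] stable_meas[OF sD that] by auto
  define HD where "HD p k \<omega> = (of_real (H1 p k \<omega>) + \<i> * of_real (H2 p k \<omega>)) * D p k \<omega>" for p :: "nat \<Rightarrow> real" and k \<omega>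
  have Q12: "tight_sum T (\<lambda>p k \<omega>. (H1 p k \<omega>)\<^sup>2 + (H2 p k \<omega>)\<^sup>2)"
    using Q1 Q2 by (rule tight_sum_dominated) (use Hm in auto)
  have QHD: "tight_sum T HD"
    using Q12 QW
  proof (rule tight_sum_dominated)
    show "HD p k \<in> borel_measurable M" if "is_partition T n p" "k < n" for n p k
      unfolding HD_def using Hm[OF that] by measurable
    show "norm (HD p k \<omega>) \<le> norm ((H1 p k \<omega>)\<^sup>2 + (H2 p k \<omega>)\<^sup>2) + norm ((W (p (Suc k)) \<omega> - W (p k) \<omega>)\<^sup>2)" for p k \<omega>
    proof -
      let ?A = "norm (of_real (H1 p k \<omega>) + \<i> * of_real (H2 p k \<omega>))" and ?B = "\<bar>W (p (Suc k)) \<omega> - W (p k) \<omega>\<bar>"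
      have "0 \<le> (?A - ?B)\<^sup>2" by simp
      then have "2 * (?A * ?B) \<le> ?A\<^sup>2 + ?B\<^sup>2" by (simp add: power2_diff)
      moreover have "?A\<^sup>2 = (H1 p k \<omega>)\<^sup>2 + (H2 p k \<omega>)\<^sup>2" by (simp add: cmod_power2)
      moreover have "norm (HD p k \<omega>) = ?A * ?B" unfolding HD_def D_def norm_mult norm_of_real ..
      moreover have "0 \<le> ?A * ?B" by simp
      ultimately have "norm (HD p k \<omega>) \<le> (H1 p k \<omega>)\<^sup>2 + (H2 p k \<omega>)\<^sup>2 + ?B\<^sup>2" by linarith
      then show ?thesis by simp
    qed
  qed
  have QB: "tight_sum T (\<lambda>p k \<omega>. b (h (p k) \<omega>) * of_real (p (Suc k) - p k))"
    unfolding tight_sum_def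
  proof (intro conjI allI impI)
    fix n p k assume p: "is_partition T n p" "k < n"
    show "(\<lambda>\<omega>. b (h (p k) \<omega>) * of_real (p (Suc k) - p k)) \<in> borel_measurable M"
      using hM(3)[OF partition_bounds(1)[OF p(1), of k]] p(2) by simp
  next
    fix \<epsilon> :: real assume "\<epsilon> > 0"
    then obtain C where C: "C > 0" "\<And>n p. is_partition T n p \<Longrightarrow> prob {\<omega>\<in>space M. \<exists>k\<le>n. norm (b (h (p k) \<omega>)) > C} < \<epsilon>"
      using tight_max_continuous[OF hM(3) cpb, of T] unfolding tight_max_def by meson
    show "\<exists>C>0. \<forall>n p. is_partition T n p \<longrightarrow>
      prob {\<omega>\<in>space M. (\<Sum>k<n. norm (b (h (p k) \<omega>) * complex_of_real (p (Suc k) - p k))) > C} < \<epsilon>"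
    proof (intro exI[of _ "C * T + 1"] conjI allI impI)
      fix n p assume p: "is_partition T n p"
      have [measurable]: "(\<lambda>\<omega>. b (h (p k) \<omega>)) \<in> borel_measurable M" if "k \<le> n" for k
        using hM(3)[OF partition_bounds(1)[OF p that]] .
      have "prob {\<omega>\<in>space M. (\<Sum>k<n. norm (b (h (p k) \<omega>) * complex_of_real (p (Suc k) - p k))) > C * T + 1} \<le>
         prob {\<omega>\<in>space M. \<exists>k\<le>n. norm (b (h (p k) \<omega>)) > C}"
      proof (rule prob_le_AE)
        have key: "\<exists>k\<le>n. norm (b (h (p k) \<omega>)) > C" if gt: "(\<Sum>k<n. norm (b (h (p k) \<omega>) * complex_of_real (p (Suc k) - p k))) > C * T + 1" for \<omega>
        proof (rule ccontr)
          assume "\<not> ?thesis"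
          then have b: "norm (b (h (p k) \<omega>)) \<le> C" if "k \<le> n" for k using that by (auto simp: not_less)
          have pp: "\<bar>p (Suc k) - p k\<bar> = p (Suc k) - p k" if "k < n" for k using p that by (simp add: is_partition_def)
          have "(\<Sum>k<n. norm (b (h (p k) \<omega>) * complex_of_real (p (Suc k) - p k))) \<le> (\<Sum>k<n. C * (p (Suc k) - p k))"
            unfolding norm_mult norm_of_real using b p by (intro sum_mono mult_mono) (auto simp: is_partition_def pp less_imp_le C)
          also have "\<dots> = C * T" using p by (simp add: sum_distrib_left[symmetric] sum_lessThan_telescope[of p] is_partition_def)
          finally show False using gt by simp
        qed
        show "AE \<omega> in M. (\<Sum>k<n. norm (b (h (p k) \<omega>) * complex_of_real (p (Suc k) - p k))) > C * T + 1 \<longrightarrow> (\<exists>k\<le>n. norm (b (h (p k) \<omega>)) > C)"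
          by (intro AE_I2 impI key)
      qed measurable
      then show "prob {\<omega>\<in>space M. (\<Sum>k<n. norm (b (h (p k) \<omega>) * complex_of_real (p (Suc k) - p k))) > C * T + 1} < \<epsilon>"
        using C(2)[OF p] by linarith
    qed (use C T in \<open>auto intro: add_nonneg_pos\<close>)
  qed
  note H = stable_add[OF stable_of_real[OF s1(1)] stable_cmult[OF stable_of_real[OF s1(2)], of \<i>]]
  note A = stable_add[OF H stable_cmult[OF tight_sum_stable[OF QB], of "-1"]]
  note B = stable_add[OF A stable_cmult[OF stable_mult_adapted[OF sD h_adapted tight_max_continuous[OF h_meas cph]], of "- (\<i> * of_real a)"]]
  note C = stable_add[OF B stable_cmult[OF tight_sum_stable[OF QHD], of "- (\<i> * of_real a) / 2"]]
  show ?thesis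
  proof (rule stable_AE_cong[OF C])
    show "AE \<omega> in M. \<forall>k<n. of_real (H1 p k \<omega>) + \<i> * of_real (H2 p k \<omega>) + - 1 * (b (h (p k) \<omega>) * of_real (p (Suc k) - p k)) +
      - (\<i> * of_real a) * (h (p k) \<omega> * D p k \<omega>) + - (\<i> * of_real a) / 2 * HD p k \<omega> = E p k \<omega>" for n p
    proof (intro AE_I2 allI impI)
      fix \<omega> k
      have eq: "of_real (H1 p k \<omega>) + \<i> * of_real (H2 p k \<omega>) = h (p (Suc k)) \<omega> - h (p k) \<omega>"
        by (auto simp: complex_eq_iff H1_def H2_def)
      show "of_real (H1 p k \<omega>) + \<i> * of_real (H2 p k \<omega>) + - 1 * (b (h (p k) \<omega>) * of_real (p (Suc k) - p k)) +
      - (\<i> * of_real a) * (h (p k) \<omega> * D p k \<omega>) + - (\<i> * of_real a) / 2 * HD p k \<omega> = E p k \<omega>"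
        unfolding HD_def eq E_def D_def by (simp add: field_simps)
    qed
  qed (use E_meas in auto)
qed

end

lemma sum_lessThan_add:
  fixes f :: "nat \<Rightarrow> 'b::comm_monoid_add"
  shows "(\<Sum>k<m+l. f k) = (\<Sum>k<m. f k) + (\<Sum>i<l. f (m + i))"
  by (induction l) (auto simp: add.assoc)

context strat_sde
begin

text \<open>The increments of \<open>h\<close> telescope, and by the integrated equation the sum of
  residuals is the error of a Riemann sum for the drift minus the error of a symmetric sum for
  \<open>S T\<close>.\<close>

lemma Z_small_end:
  assumes T: "T \<ge> 0" and e: "\<eta> > 0"
  shows "\<exists>\<delta>>0. \<forall>n p. is_partition T n p \<longrightarrow> mesh_less \<delta> n p \<longrightarrow> prob {\<omega>\<in>space M. norm (Z p n \<omega>) > \<eta>} < \<eta>"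
proof -
  have e2: "\<eta>/2 > 0" using e by simp
  have Sm[measurable]: "S T \<in> borel_measurable M" using S_strat T by (auto simp: has_stratonovich_integral_def)
  have [measurable]: "h T \<in> borel_measurable M" using h_meas T by blast
  define A where "A n p \<omega> = h T \<omega> - x - S T \<omega> - (\<Sum>k<n. b (h (p k) \<omega>) * of_real (p (Suc k) - p k))" for n p \<omega>
  have Am: "A n p \<in> borel_measurable M" if p: "is_partition T n p" for n p
  proof -
    have [measurable]: "h (p k) \<in> borel_measurable M" if "k < n" for k using partition_meas(2)[OF p, of k] that by simp
    show ?thesis unfolding A_def by measurable
  qed
  have "\<exists>\<delta>>0. \<forall>n p. is_partition T n p \<longrightarrow> mesh_less \<delta> n p \<longrightarrow> prob {\<omega>\<in>space M. norm (A n p \<omega>) > \<eta>/2} < \<eta>/2"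
  proof (rule uniform_small_fine[OF _ _ e2])
    show "{\<omega> \<in> space M. norm (A n p \<omega>) > \<eta>/2} \<in> events" if "is_partition T n p" for n p
      using Am[OF that] by measurable
    show "AE \<omega> in M. \<exists>\<delta>>0. \<forall>n p. is_partition T n p \<longrightarrow> mesh_less \<delta> n p \<longrightarrow> \<not> \<eta>/2 < norm (A n p \<omega>)"
      using h_cont h_eq
    proof eventually_elim
      case (elim \<omega>)
      have c: "continuous_on {0..} (\<lambda>s. b (h s \<omega>))"
        by (rule continuous_on_compose2[OF b_cont elim(1)]) auto
      define e' where "e' = \<eta> / (4 * (T + 1))"
      have e': "e' > 0" "2 * e' * T \<le> \<eta>/2" using T e by (auto simp: e'_def field_simps)
      obtain \<delta> where d: "\<delta> > 0" "\<And>n p v. is_partition T n p \<Longrightarrow> mesh_less \<delta> n p \<Longrightarrow> (\<forall>k<n. norm (v k - b (h (p k) \<omega>)) \<le> e') \<Longrightarrow>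
        norm (integral {0..T} (\<lambda>s. b (h s \<omega>)) - (\<Sum>k<n. v k * of_real (p (Suc k) - p k))) \<le> 2 * e' * T"
        using riemann_sum_fine[OF c e'(1), of T] by blast
      have "h T \<omega> - x - S T \<omega> = integral {0..T} (\<lambda>s. b (h s \<omega>))" using elim(2) T by simp
      then have "norm (A n p \<omega>) \<le> \<eta>/2" if "is_partition T n p" "mesh_less \<delta> n p" for n p
        using d(2)[OF that, of "\<lambda>k. b (h (p k) \<omega>)"] e' by (simp add: A_def)
      then have "\<not> \<eta>/2 < norm (A n p \<omega>)" if "is_partition T n p" "mesh_less \<delta> n p" for n p
        using that by (simp add: not_less)
      then show ?case using d(1) by blast
    qed
  qed
  then obtain \<delta>1 where d1: "\<delta>1 > 0" "\<And>n p. is_partition T n p \<Longrightarrow> mesh_less \<delta>1 n p \<Longrightarrow> prob {\<omega>\<in>space M. norm (A n p \<omega>) > \<eta>/2} < \<eta>/2"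
    by blast
  obtain \<delta>2 where d2: "\<delta>2 > 0" "\<And>n p. is_partition T n p \<Longrightarrow> mesh_less \<delta>2 n p \<Longrightarrow>
      prob {\<omega>\<in>space M. norm (symmetric_sum (\<lambda>t \<omega>. \<i> * of_real a * h t \<omega>) W n p \<omega> - S T \<omega>) > \<eta>/2} < \<eta>/2"
    using S_strat T e2 unfolding has_stratonovich_integral_def mesh_less_def by meson
  show ?thesis
  proof (intro exI[of _ "min \<delta>1 \<delta>2"] conjI allI impI)
    fix n p assume p: "is_partition T n p" and f: "mesh_less (min \<delta>1 \<delta>2) n p"
    have f1: "mesh_less \<delta>1 n p" "mesh_less \<delta>2 n p" using f by (auto intro: mesh_less_mono)
    let ?S = "\<lambda>\<omega>. symmetric_sum (\<lambda>t \<omega>. \<i> * of_real a * h t \<omega>) W n p \<omega>"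
    have "prob {\<omega>\<in>space M. norm (Z p n \<omega>) > \<eta>} \<le> prob {\<omega>\<in>space M. norm (A n p \<omega>) > \<eta>/2} + prob {\<omega>\<in>space M. norm (?S \<omega> - S T \<omega>) > \<eta>/2}"
    proof (rule prob_le_add)
      show "AE \<omega> in M. norm (Z p n \<omega>) > \<eta> \<longrightarrow> norm (A n p \<omega>) > \<eta>/2 \<or> norm (?S \<omega> - S T \<omega>) > \<eta>/2"
        using h_0
      proof eventually_elim
        case (elim \<omega>)
        have "Z p n \<omega> = (\<Sum>k<n. h (p (Suc k)) \<omega> - h (p k) \<omega>) - (\<Sum>k<n. b (h (p k) \<omega>) * of_real (p (Suc k) - p k)) - ?S \<omega>"
          unfolding Z_def E_def symmetric_sum_def sum_subtractf[symmetric]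
          by (intro sum.cong refl) (simp add: field_simps)
        also have "(\<Sum>k<n. h (p (Suc k)) \<omega> - h (p k) \<omega>) = h T \<omega> - x"
          using p elim by (simp add: sum_lessThan_telescope[of "\<lambda>k. h (p k) \<omega>"] is_partition_def)
        finally have "Z p n \<omega> = A n p \<omega> - (?S \<omega> - S T \<omega>)" by (simp add: A_def)
        then have "norm (Z p n \<omega>) \<le> norm (A n p \<omega>) + norm (?S \<omega> - S T \<omega>)" by (simp add: norm_triangle_ineq4)
        then show ?case by linarith
      qed
      have hm[measurable]: "h (p k) \<in> borel_measurable M" "W (p k) \<in> borel_measurable M" if "k \<le> n" for k
        using partition_meas[OF p that] by auto
      have [measurable]: "h (p (Suc k)) \<in> borel_measurable M" "W (p (Suc k)) \<in> borel_measurable M" if "k < n" for k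
        using hm[of "Suc k"] that by auto
      have [measurable]: "?S \<in> borel_measurable M" unfolding symmetric_sum_def
        by (intro borel_measurable_sum borel_measurable_times borel_measurable_add borel_measurable_divide
          borel_measurable_of_real borel_measurable_diff) auto
      show "{\<omega> \<in> space M. norm (?S \<omega> - S T \<omega>) > \<eta>/2} \<in> events" by measurable
      show "{\<omega> \<in> space M. norm (A n p \<omega>) > \<eta>/2} \<in> events" using Am[OF p] by measurable
    qed
    then show "prob {\<omega>\<in>space M. norm (Z p n \<omega>) > \<eta>} < \<eta>" using d1(2)[OF p f1(1)] d2(2)[OF p f1(2)] by linarith
  qed (use d1 d2 in auto)
qed

text \<open>Splicing a very fine partition of \<open>[0, p j]\<close> in front of the points of \<open>p\<close> after \<open>p j\<close>
  makes the smallness of \<open>Z\<close> at the final time uniform over all intermediate times.\<close>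

lemma Z_small:
  assumes T: "T \<ge> 0" and e: "\<eta> > 0"
  shows "\<exists>\<delta>>0. \<forall>n p j. is_partition T n p \<longrightarrow> mesh_less \<delta> n p \<longrightarrow> j \<le> n \<longrightarrow> prob {\<omega>\<in>space M. norm (Z p j \<omega>) > \<eta>} < \<eta>"
proof -
  have e3: "\<eta>/3 > 0" using e by simp
  obtain \<delta>1 where d1: "\<delta>1 > 0" "\<And>n p. is_partition T n p \<Longrightarrow> mesh_less \<delta>1 n p \<Longrightarrow> prob {\<omega>\<in>space M. norm (Z p n \<omega>) > \<eta>/3} < \<eta>/3"
    using Z_small_end[OF T e3] by blast
  show ?thesis
  proof (intro exI[of _ \<delta>1] conjI allI impI d1(1))
    fix n p j assume p: "is_partition T n p" and f: "mesh_less \<delta>1 n p" and j: "j \<le> n"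
    define s where "s = p j"
    have s0: "s \<ge> 0" using partition_bounds(1)[OF p j] by (simp add: s_def)
    obtain \<delta>2 where d2: "\<delta>2 > 0" "\<And>n p. is_partition s n p \<Longrightarrow> mesh_less \<delta>2 n p \<Longrightarrow> prob {\<omega>\<in>space M. norm (Z p n \<omega>) > \<eta>/3} < \<eta>/3"
      using Z_small_end[OF s0 e3] by blast
    have "min \<delta>1 \<delta>2 > 0" using d1 d2 by simp
    then obtain m where m: "m > 0" "mesh_less (min \<delta>1 \<delta>2) m (uniform_partition s m)"
      using uniform_partition_mesh[OF s0] by blast
    define r where "r = uniform_partition s m"
    have r: "is_partition s m r" "mesh_less \<delta>1 m r" "mesh_less \<delta>2 m r"
      using is_partition_uniform[OF s0 m(1)] m(2) by (auto simp: r_def intro: mesh_less_mono)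
    \<comment> \<open>For \<open>i > m\<close> these are the points of \<open>p\<close> after index
      \<open>j\<close>; at \<open>i = m\<close> both branches give \<open>p j\<close>, which is what
      \<open>qhigh\<close> relies on.\<close>
    define q where "q i = (if i \<le> m then r i else p (i - m + j))" for i
    define N where "N = m + (n - j)"
    have qlow: "q i = r i" if "i \<le> m" for i using that by (simp add: q_def)
    have qhigh: "q (m + i) = p (j + i)" for i
      using r(1) by (cases i) (auto simp: q_def is_partition_def s_def add.commute)
    have qinc: "q i \<le> q (Suc i) \<and> q (Suc i) - q i < \<delta>1" if "i < N" for i
    proof (cases "i < m")
      case True
      then show ?thesis using r qlow[of i] qlow[of "Suc i"] by (auto simp: is_partition_def mesh_less_def)
    next
      case False
      define l where "l = i - m"
      have l: "i = m + l" "Suc i = m + Suc l" using False by (auto simp: l_def)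
      have "j + l < n" using that l j by (simp add: N_def)
      then show ?thesis using p f unfolding l(2) unfolding l(1) qhigh
        by (auto simp: is_partition_def mesh_less_def)
    qed
    have q: "is_partition T N q"
      using qinc qlow[of 0] qhigh[of "n - j"] r(1) p j by (auto simp: is_partition_def N_def)
    have qf: "mesh_less \<delta>1 N q" using qinc by (auto simp: mesh_less_def)
    \<comment> \<open>\<open>p\<close> and \<open>q\<close> share their cells after
      \<open>p j\<close>, so the difference of their totals leaves only the initial pieces. Each sum
      on the right runs over a whole partition, of [0, T] or of [0, s].\<close>
    have split: "Z p j \<omega> = Z p n \<omega> - Z q N \<omega> + Z r m \<omega>" for \<omega>
    proof -
      have 1: "Z q N \<omega> = (\<Sum>k<m. E q k \<omega>) + (\<Sum>i<n-j. E q (m + i) \<omega>)"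
        unfolding Z_def N_def by (rule sum_lessThan_add)
      have 2: "Z p n \<omega> = Z p j \<omega> + (\<Sum>i<n-j. E p (j + i) \<omega>)"
        using j sum_lessThan_add[of "\<lambda>k. E p k \<omega>" j "n - j"] unfolding Z_def by simp
      have 3: "(\<Sum>k<m. E q k \<omega>) = Z r m \<omega>"
        unfolding Z_def by (intro sum.cong refl) (simp add: E_def qlow)
      have 4: "(\<Sum>i<n-j. E q (m + i) \<omega>) = (\<Sum>i<n-j. E p (j + i) \<omega>)"
        using qhigh by (intro sum.cong refl) (simp add: E_def flip: add_Suc_right)
      show ?thesis using 1 2 3 4 by simp
    qed
    have m1: "{\<omega> \<in> space M. norm (Z p n \<omega>) > \<eta>/3} \<in> events" using Z_meas[OF p order_refl] by measurable
    have m2: "{\<omega> \<in> space M. norm (Z q N \<omega>) > \<eta>/3} \<in> events" using Z_meas[OF q order_refl] by measurable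
    have m3: "{\<omega> \<in> space M. norm (Z r m \<omega>) > \<eta>/3} \<in> events" using Z_meas[OF r(1) order_refl] by measurable
    have m23: "{\<omega> \<in> space M. norm (Z q N \<omega>) > \<eta>/3 \<or> norm (Z r m \<omega>) > \<eta>/3} \<in> events"
      using Z_meas[OF q order_refl] Z_meas[OF r(1) order_refl] by measurable
    have key: "norm (Z p n \<omega>) > \<eta>/3 \<or> norm (Z q N \<omega>) > \<eta>/3 \<or> norm (Z r m \<omega>) > \<eta>/3" if "norm (Z p j \<omega>) > \<eta>" for \<omega>
    proof -
      have "norm (Z p j \<omega>) \<le> norm (Z p n \<omega>) + norm (Z q N \<omega>) + norm (Z r m \<omega>)"
        unfolding split by (intro order_trans[OF norm_triangle_ineq] add_right_mono norm_triangle_ineq4)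
      then show ?thesis using that by linarith
    qed
    have "prob {\<omega>\<in>space M. norm (Z p j \<omega>) > \<eta>} \<le> prob {\<omega>\<in>space M. norm (Z p n \<omega>) > \<eta>/3} + prob {\<omega>\<in>space M. norm (Z q N \<omega>) > \<eta>/3 \<or> norm (Z r m \<omega>) > \<eta>/3}"
      by (rule prob_le_add[OF _ m1 m23]) (intro AE_I2 impI key)
    also have "prob {\<omega>\<in>space M. norm (Z q N \<omega>) > \<eta>/3 \<or> norm (Z r m \<omega>) > \<eta>/3} \<le>
       prob {\<omega>\<in>space M. norm (Z q N \<omega>) > \<eta>/3} + prob {\<omega>\<in>space M. norm (Z r m \<omega>) > \<eta>/3}"
      by (rule prob_le_add[OF _ m2 m3]) auto
    finally show "prob {\<omega>\<in>space M. norm (Z p j \<omega>) > \<eta>} < \<eta>"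
      using d1(2)[OF p f] d1(2)[OF q qf] d2(2)[OF r(1,3)] by linarith
  qed
qed

text \<open>Up to its first passage above \<open>c\<close>, the sum \<open>Z\<close> is a transform of \<open>E\<close> with adapted 0-1 weights.\<close>

lemma Z_tight_max:
  assumes T: "T \<ge> 0" and e: "\<epsilon> > 0"
  shows "\<exists>c>0. \<forall>n p. is_partition T n p \<longrightarrow> prob {\<omega>\<in>space M. \<exists>j\<le>n. norm (Z p j \<omega>) > c} < \<epsilon>"
proof -
  obtain \<kappa> where k: "\<kappa> > 0" and w1: "\<And>n p w. is_partition T n p \<Longrightarrow> weights p n \<kappa> w \<Longrightarrow>
      prob {\<omega>\<in>space M. norm (\<Sum>k<n. w k \<omega> * E p k \<omega>) > \<epsilon>} < \<epsilon>"
    using stableD[OF stable_E[OF T] e] by blast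
  show ?thesis
  proof (intro exI[of _ "\<epsilon> / \<kappa>"] conjI allI impI)
    fix n p assume p: "is_partition T n p"
    let ?c = "\<epsilon> / \<kappa>"
    \<comment> \<open>The condition includes \<open>i = k\<close>, so the weight is already 0 at the
      passage index \<open>J\<close> and the transform stops exactly at
      \<open>Z p J\<close>.\<close>
    define w where "w k \<omega> = (if \<exists>i\<le>k. norm (Z p i \<omega>) > ?c then 0 else complex_of_real \<kappa>)" for k \<omega>
    have wt: "weights p n \<kappa> w"
      unfolding weights_def
    proof (intro conjI allI impI ballI)
      fix k \<omega> assume k': "k < n"
      have [measurable]: "Z p i \<in> borel_measurable (F (p k))" if "i \<le> k" for i
        using Z_adapted[OF p that] k' by simp
      show "w k \<in> borel_measurable (F (p k))" unfolding w_def by measurable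
      show "norm (w k \<omega>) \<le> \<kappa>" using k by (simp add: w_def)
    qed
    have [measurable]: "w k \<in> borel_measurable M" "E p k \<in> borel_measurable M" if "k < n" for k
      using wt that E_meas[OF p that] by (auto simp: weights_def intro: meas_F_M)
    have key: "norm (\<Sum>k<n. w k \<omega> * E p k \<omega>) > \<epsilon>" if ex: "\<exists>j\<le>n. norm (Z p j \<omega>) > ?c" for \<omega>
    proof -
      define J where "J = (LEAST j. norm (Z p j \<omega>) > ?c)"
      obtain j where j: "j \<le> n" "norm (Z p j \<omega>) > ?c" using ex by blast
      have J: "norm (Z p J \<omega>) > ?c" unfolding J_def by (rule LeastI[of _ j]) (rule j)
      have Jn: "J \<le> n" using j Least_le[of "\<lambda>j. norm (Z p j \<omega>) > ?c" j] by (simp add: J_def)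
      have lt: "\<not> norm (Z p i \<omega>) > ?c" if "i < J" for i using not_less_Least that unfolding J_def by blast
      have wk: "w k \<omega> = (if k < J then of_real \<kappa> else 0)" for k
      proof (cases "k < J")
        case True
        then have "\<not> (\<exists>i\<le>k. norm (Z p i \<omega>) > ?c)" using lt by auto
        then show ?thesis using True by (auto simp: w_def)
      next
        case False
        then have "\<exists>i\<le>k. norm (Z p i \<omega>) > ?c" using J by (intro exI[of _ J]) auto
        then show ?thesis using False by (simp add: w_def)
      qed
      have "(\<Sum>k<n. w k \<omega> * E p k \<omega>) = (\<Sum>k<n. if k < J then of_real \<kappa> * E p k \<omega> else 0)"
        by (intro sum.cong refl) (simp add: wk)
      also have "\<dots> = (\<Sum>k\<in>{..<n} \<inter> {k. k < J}. of_real \<kappa> * E p k \<omega>)"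
        by (simp add: sum.inter_restrict)
      also have "{..<n} \<inter> {k. k < J} = {..<J}" using Jn by auto
      also have "(\<Sum>k<J. of_real \<kappa> * E p k \<omega>) = of_real \<kappa> * Z p J \<omega>" by (simp add: Z_def sum_distrib_left)
      finally have "norm (\<Sum>k<n. w k \<omega> * E p k \<omega>) = \<kappa> * norm (Z p J \<omega>)" using k by (simp add: norm_mult)
      then show ?thesis using J k by (simp add: field_simps)
    qed
    have "prob {\<omega>\<in>space M. \<exists>j\<le>n. norm (Z p j \<omega>) > ?c} \<le> prob {\<omega>\<in>space M. norm (\<Sum>k<n. w k \<omega> * E p k \<omega>) > \<epsilon>}"
      by (rule prob_le_AE, intro AE_I2 impI key) measurable
    then show "prob {\<omega>\<in>space M. \<exists>j\<le>n. norm (Z p j \<omega>) > ?c} < \<epsilon>" using w1[OF p wt] by linarith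
  qed (use k e in auto)
qed

end

section \<open>The product rule for the rotated solution\<close>

text \<open>The expression is the remainder of exp(-i y) after its quadratic Taylor polynomial plus
  i y/2 times the remainder after the linear one, so the bounds add up to 1/6 + 1/4 = 5/12 of |y|^3.
  The third order matters: sums of |\<Delta>W|^3 vanish with the mesh, sums of squares do
  not.\<close>

lemma exp_trapezoid:
  fixes y :: real
  shows "norm (exp (- (\<i> * of_real y)) - 1 + \<i> * of_real y * ((1 + exp (- (\<i> * of_real y))) / 2)) \<le> \<bar>y\<bar> ^ 3"
proof -
  have 1: "norm (iexp (-y) - (\<Sum>k\<le>2. (\<i> * of_real (-y)) ^ k / fact k)) \<le> \<bar>-y\<bar> ^ Suc 2 / fact (Suc 2)"
    using iexp_approx1[of "-y" 2] by simp
  have 2: "norm (iexp (-y) - (\<Sum>k\<le>1. (\<i> * of_real (-y)) ^ k / fact k)) \<le> \<bar>-y\<bar> ^ Suc 1 / fact (Suc 1)"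
    using iexp_approx1[of "-y" 1] by simp
  define e where "e = exp (- (\<i> * of_real y))"
  have s2: "(\<Sum>k\<le>2. (\<i> * complex_of_real (-y)) ^ k / fact k) = 1 - \<i> * of_real y - of_real (y\<^sup>2) / 2"
    by (simp add: complex_eq_iff numeral_2_eq_2 power2_eq_square)
  have s1: "(\<Sum>k\<le>1. (\<i> * complex_of_real (-y)) ^ k / fact k) = 1 - \<i> * of_real y"
    by simp
  have a: "norm (e - (1 - \<i> * of_real y - of_real (y\<^sup>2) / 2)) \<le> \<bar>y\<bar>^3 / 6"
    using 1 unfolding s2 by (simp add: e_def fact_numeral power3_eq_cube power2_eq_square mult.assoc)
  have b: "norm (e - (1 - \<i> * of_real y)) \<le> \<bar>y\<bar>^2 / 2"
    using 2 unfolding s1 by (simp add: e_def power2_eq_square)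
  have "e - 1 + \<i> * of_real y * ((1 + e) / 2) = (e - (1 - \<i> * of_real y - of_real (y\<^sup>2) / 2)) + \<i> * of_real y / 2 * (e - (1 - \<i> * of_real y))"
    by (simp add: field_simps power2_eq_square)
  also have "norm \<dots> \<le> \<bar>y\<bar>^3 / 6 + \<bar>y\<bar> / 2 * (\<bar>y\<bar>^2 / 2)"
  proof (intro norm_triangle_mono a)
    have "norm (\<i> * of_real y / 2 * (e - (1 - \<i> * of_real y))) = \<bar>y\<bar> / 2 * norm (e - (1 - \<i> * of_real y))"
      by (simp add: norm_mult norm_divide)
    also have "\<dots> \<le> \<bar>y\<bar> / 2 * (\<bar>y\<bar>^2 / 2)" by (intro mult_left_mono b) auto
    finally show "norm (\<i> * of_real y / 2 * (e - (1 - \<i> * of_real y))) \<le> \<bar>y\<bar> / 2 * (\<bar>y\<bar>^2 / 2)" .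
  qed
  also have "\<dots> = 5 / 12 * \<bar>y\<bar>^3" by (simp add: power3_eq_cube power2_eq_square)
  also have "\<dots> \<le> 1 * \<bar>y\<bar>^3" by (intro mult_right_mono) auto
  finally show ?thesis by (simp add: e_def)
qed

context prob_space
begin

lemma prob_ex_le:
  fixes J :: nat
  assumes "\<And>j. j \<le> J \<Longrightarrow> {\<omega>\<in>space M. P j \<omega>} \<in> events" "\<And>j. j \<le> J \<Longrightarrow> prob {\<omega>\<in>space M. P j \<omega>} \<le> \<eta>"
  shows "prob {\<omega>\<in>space M. \<exists>j\<le>J. P j \<omega>} \<le> (real J + 1) * \<eta>"
proof -
  have "{\<omega>\<in>space M. \<exists>j\<le>J. P j \<omega>} = (\<Union>j\<in>{..J}. {\<omega>\<in>space M. P j \<omega>})" by auto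
  also have "prob \<dots> \<le> (\<Sum>j\<in>{..J}. prob {\<omega>\<in>space M. P j \<omega>})"
    using assms by (intro measure_UNION_le) auto
  also have "\<dots> \<le> (\<Sum>j\<in>{..J}. \<eta>)" using assms by (intro sum_mono) auto
  finally show ?thesis by (simp add: algebra_simps)
qed

end

lemma Collect_conj_disj_eq: "{x\<in>A. P x \<or> Q x} = {x\<in>A. P x} \<union> {x\<in>A. Q x}"
  by auto

section \<open>Transforms of the residual by the rotation \<open>u\<close>\<close>

context strat_sde
begin

definition u :: "real \<Rightarrow> 'a \<Rightarrow> complex" where
  "u t \<omega> = exp (- (\<i> * of_real (a * W t \<omega>)))"

lemma u_norm[simp]: "norm (u t \<omega>) = 1"
  by (simp add: u_def norm_exp_eq_Re)

lemma u_cont: "AE \<omega> in M. continuous_on {0..} (\<lambda>t. u t \<omega>)"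
  using W_cont unfolding u_def by eventually_elim (intro continuous_intros)

lemma u_adapted: "t \<ge> 0 \<Longrightarrow> u t \<in> borel_measurable (F t)"
  using W_adapted[of t] unfolding u_def by measurable

lemma u_meas: "t \<ge> 0 \<Longrightarrow> u t \<in> borel_measurable M"
  using u_adapted meas_F_M by blast

text \<open>The increments of \<open>u\<close> over a coarse mesh are uniformly small, so freezing \<open>u\<close> on the coarse
  mesh costs little by stability, while the frozen sum only involves finitely many values of \<open>Z\<close>.\<close>

lemma sum_u_E_small:
  assumes T: "T \<ge> 0" and e: "\<epsilon> > 0"
  shows "\<exists>J>0. \<exists>L0>0. \<forall>L\<ge>L0. prob {\<omega>\<in>space M. norm (\<Sum>k<J*L. u (uniform_partition T (J*L) k) \<omega> * E (uniform_partition T (J*L)) k \<omega>) > \<epsilon>} < \<epsilon>"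
proof -
  have e3: "\<epsilon>/3 > 0" using e by simp
  obtain \<kappa> where k: "\<kappa> > 0" and w1: "\<And>n p w. is_partition T n p \<Longrightarrow> weights p n \<kappa> w \<Longrightarrow>
      prob {\<omega>\<in>space M. norm (\<Sum>k<n. w k \<omega> * E p k \<omega>) > \<epsilon>/3} < \<epsilon>/3"
    using stableD[OF stable_E[OF T] e3] by blast
  \<comment> \<open>Each of the \<open>Suc J\<close> coarse blocks consists of \<open>L\<close> fine
    cells, and \<open>k div L * L\<close> is the left end of the block containing \<open>k\<close>.
    The event has to be rare for one \<open>J\<close> and all \<open>L\<close> at once, since
    \<open>L\<close> is chosen only after the accuracy of \<open>Z\<close> at the block
    ends.\<close>
  define A where "A J L = {\<omega>\<in>space M. \<exists>k<Suc J*L. norm (u (uniform_partition T (Suc J*L) k) \<omega> - u (uniform_partition T (Suc J*L) (k div L * L)) \<omega>) > \<kappa>}" for J L :: nat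
  have unif0: "uniform_partition T n k \<ge> 0" for n k using T by (simp add: uniform_partition_def)
  have um[measurable]: "u (uniform_partition T n k) \<in> borel_measurable M" for n k by (rule u_meas[OF unif0])
  have Am: "A J L \<in> events" for J L unfolding A_def by measurable
  have "\<exists>m0. \<forall>m\<ge>m0. \<forall>i\<in>{0<..}. prob (A m i) < \<epsilon>/3"
  proof (rule uniform_small[OF _ _ e3, where I = "\<lambda>_. {0<..}"])
    show "AE \<omega> in M. \<exists>m0. \<forall>m\<ge>m0. \<forall>i\<in>{0<..}. \<omega> \<notin> A m i"
      using u_cont
    proof eventually_elim
      case (elim \<omega>)
      have "uniformly_continuous_on {0..T} (\<lambda>t. u t \<omega>)"
        by (intro compact_uniformly_continuous continuous_on_subset[OF elim]) auto
      then obtain \<delta> where d: "\<delta> > 0" "\<And>s t. s \<in> {0..T} \<Longrightarrow> t \<in> {0..T} \<Longrightarrow> dist s t < \<delta> \<Longrightarrow> dist (u s \<omega>) (u t \<omega>) < \<kappa>"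
        using k unfolding uniformly_continuous_on_def by metis
      obtain m0 where m0: "T / \<delta> < real m0" using reals_Archimedean2 by blast
      show ?case
      proof (intro exI[of _ m0] allI impI ballI)
        fix m L :: nat assume m: "m0 \<le> m" and "L \<in> {0<..}" then have L: "L > 0" by simp
        have "\<not> norm (u (uniform_partition T (Suc m*L) k) \<omega> - u (uniform_partition T (Suc m*L) (k div L * L)) \<omega>) > \<kappa>" if kk: "k < Suc m * L" for k
        proof -
          define n where "n = Suc m * L"
          have n: "n > 0" using L by (simp add: n_def)
          have le: "k div L * L \<le> k" by simp
          have kn: "k \<le> n" "k div L * L \<le> n" 
          proof -
            show "k \<le> n" using kk by (simp add: n_def)
            with le show "k div L * L \<le> n" by (rule order_trans)
          qed
          have T1: "uniform_partition T n k \<in> {0..T}" "uniform_partition T n (k div L * L) \<in> {0..T}"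
            using partition_bounds[OF is_partition_uniform[OF T n]] kn by auto
          have "real k - real (k div L * L) \<le> real L"
            using L by (metis (no_types) le minus_div_mult_eq_mod mod_less_divisor of_nat_diff of_nat_mono less_imp_le)
          then have "T * (real k - real (k div L * L)) / n \<le> T * real L / n"
            using T n by (intro divide_right_mono mult_left_mono) auto
          also have "T * real L / n = T / Suc m"
            using L unfolding n_def of_nat_mult by (simp del: of_nat_Suc)
          also have "\<dots> < \<delta>"
          proof -
            have "T / \<delta> < real (Suc m)" using m0 m by linarith
            then show ?thesis using d(1) by (simp add: field_simps)
          qed
          finally have "T * (real k - real (k div L * L)) / n < \<delta>" .
          moreover have "uniform_partition T n k - uniform_partition T n (k div L * L) = T * (real k - real (k div L * L)) / n"
            by (simp add: uniform_partition_def diff_divide_distrib right_diff_distrib)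
          moreover have "uniform_partition T n k - uniform_partition T n (k div L * L) \<ge> 0"
            unfolding calculation(2) using T le by (intro divide_nonneg_nonneg mult_nonneg_nonneg) (auto simp del: of_nat_mult)
          ultimately have "dist (uniform_partition T n k) (uniform_partition T n (k div L * L)) < \<delta>" by (simp add: dist_real_def)
          from d(2)[OF T1 this] show ?thesis by (simp add: dist_norm n_def)
        qed
        then show "\<omega> \<notin> A m L" by (auto simp: A_def)
      qed
    qed
  qed (use Am in auto)
  then obtain J' where J': "\<And>L. L > 0 \<Longrightarrow> prob (A J' L) < \<epsilon>/3" by auto
  define J where "J = Suc J'"
  \<comment> \<open>This value serves twice: the J block increments of \<open>Z\<close> contribute
    at most 2 \<eta> each, and the J + 1 exceptional events have probability below \<eta> each; both
    totals stay within \<epsilon>/3.\<close>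
  define \<eta> where "\<eta> = \<epsilon> / (6 * (real J + 1))"
  have eta: "\<eta> > 0" "2 * real J * \<eta> \<le> \<epsilon>/3" "(real J + 1) * \<eta> < \<epsilon>/3"
    using e by (auto simp: \<eta>_def field_simps add_pos_nonneg)
  obtain \<delta> where d: "\<delta> > 0" "\<And>n p j. is_partition T n p \<Longrightarrow> mesh_less \<delta> n p \<Longrightarrow> j \<le> n \<Longrightarrow> prob {\<omega>\<in>space M. norm (Z p j \<omega>) > \<eta>} < \<eta>"
    using Z_small[OF T eta(1)] by blast
  obtain N where N: "N > 0" "\<And>n. n \<ge> N \<Longrightarrow> mesh_less \<delta> n (uniform_partition T n)" using uniform_partition_mesh[OF T d(1)] by blast
  show ?thesis
  proof (rule exI[of _ J], intro conjI, simp add: J_def, rule exI[of _ N], intro conjI allI impI)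
    fix L assume L: "L \<ge> N"
    then have L0: "L > 0" using N by simp
    define n where "n = J * L"
    define p where "p = uniform_partition T n"
    have n: "n > 0" "n \<ge> N" using L L0 by (auto simp: n_def J_def)
    have p: "is_partition T n p" "mesh_less \<delta> n p" using is_partition_uniform[OF T n(1)] N(2)[OF n(2)] by (auto simp: p_def)
    have [measurable]: "u (p k) \<in> borel_measurable M" for k by (simp add: p_def)
    have [measurable]: "E p k \<in> borel_measurable M" if "k < n" for k by (rule E_meas[OF p(1) that])
    have [measurable]: "Z p j \<in> borel_measurable M" if "j \<le> n" for j by (rule Z_meas[OF p(1) that])
    \<comment> \<open>Cutting off differences larger than \<open>\<kappa>\<close> makes the weight
      bound hold everywhere; off the event \<open>A J' L\<close> nothing is cut.\<close>
    define w where "w k \<omega> = (if norm (u (p k) \<omega> - u (p (k div L * L)) \<omega>) \<le> \<kappa> then u (p k) \<omega> - u (p (k div L * L)) \<omega> else 0)" for k \<omega>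
    have wt: "weights p n \<kappa> w" unfolding weights_def
    proof (intro conjI allI impI ballI)
      fix k \<omega> assume kn: "k < n"
      have "p (k div L * L) \<le> p k" using partition_mono[OF p(1), of "k div L * L" k] kn by simp
      moreover have "0 \<le> p k" "0 \<le> p (k div L * L)" using unif0 by (auto simp: p_def)
      ultimately have "u (p k) \<in> borel_measurable (F (p k))" "u (p (k div L * L)) \<in> borel_measurable (F (p k))"
        by (auto intro: u_adapted meas_F_mono[OF u_adapted])
      note [measurable] = this
      show "w k \<in> borel_measurable (F (p k))" unfolding w_def by measurable
      show "norm (w k \<omega>) \<le> \<kappa>" using k by (simp add: w_def)
    qed
    have [measurable]: "w k \<in> borel_measurable M" for k unfolding w_def by measurable
    have JL: "j * L \<le> n" if "j \<le> J" for j using that by (simp add: n_def)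
    have key: "norm (\<Sum>k<n. w k \<omega> * E p k \<omega>) > \<epsilon>/3 \<or> (\<omega> \<in> A J' L \<or> (\<exists>j\<le>J. norm (Z p (j * L) \<omega>) > \<eta>))"
      if \<omega>: "\<omega> \<in> space M" and gt: "norm (\<Sum>k<n. u (p k) \<omega> * E p k \<omega>) > \<epsilon>" for \<omega>
    proof (rule disjCI)
      assume asm: "\<not> (\<omega> \<in> A J' L \<or> (\<exists>j\<le>J. norm (Z p (j * L) \<omega>) > \<eta>))"
      then have z: "norm (Z p (j * L) \<omega>) \<le> \<eta>" if "j \<le> J" for j using that by (auto simp: not_less)
      have wk: "w k \<omega> = u (p k) \<omega> - u (p (k div L * L)) \<omega>" if "k < n" for k
      proof -
        have "\<omega> \<notin> A J' L" using asm by blast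
        then have "norm (u (p k) \<omega> - u (p (k div L * L)) \<omega>) \<le> \<kappa>"
          using \<omega> that unfolding A_def p_def n_def J_def by (auto simp del: mult_Suc simp: not_less[symmetric])
        then show ?thesis by (simp add: w_def)
      qed
      have "(\<Sum>k<n. u (p k) \<omega> * E p k \<omega>) = (\<Sum>k<n. w k \<omega> * E p k \<omega>) + (\<Sum>k<n. u (p (k div L * L)) \<omega> * E p k \<omega>)"
        unfolding sum.distrib[symmetric] by (intro sum.cong refl) (simp add: wk algebra_simps)
      also have "(\<Sum>k<n. u (p (k div L * L)) \<omega> * E p k \<omega>) = (\<Sum>j<J. \<Sum>k=j*L..<j*L+L. u (p (k div L * L)) \<omega> * E p k \<omega>)"
        unfolding n_def by (rule sum.nat_group[symmetric])
      also have "\<dots> = (\<Sum>j<J. u (p (j * L)) \<omega> * (Z p (Suc j * L) \<omega> - Z p (j * L) \<omega>))"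
      proof (intro sum.cong refl)
        fix j
        have "(\<Sum>k=j*L..<j*L+L. u (p (k div L * L)) \<omega> * E p k \<omega>) = (\<Sum>k=j*L..<j*L+L. u (p (j * L)) \<omega> * E p k \<omega>)"
        proof (intro sum.cong refl)
          fix k assume "k \<in> {j*L..<j*L+L}"
          then have "k div L = j" by (intro div_nat_eqI) (auto simp: mult.commute)
          then show "u (p (k div L * L)) \<omega> * E p k \<omega> = u (p (j * L)) \<omega> * E p k \<omega>" by simp
        qed
        also have "\<dots> = u (p (j * L)) \<omega> * (\<Sum>k=j*L..<j*L+L. E p k \<omega>)" by (simp add: sum_distrib_left)
        also have "(\<Sum>k=j*L..<j*L+L. E p k \<omega>) = Z p (Suc j * L) \<omega> - Z p (j * L) \<omega>"
          unfolding Z_def lessThan_atLeast0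
          using sum.atLeastLessThan_concat[of 0 "j * L" "j * L + L" "\<lambda>k. E p k \<omega>"] by (simp add: algebra_simps)
        finally show "(\<Sum>k=j*L..<j*L+L. u (p (k div L * L)) \<omega> * E p k \<omega>) = u (p (j * L)) \<omega> * (Z p (Suc j * L) \<omega> - Z p (j * L) \<omega>)" .
      qed
      finally have eq: "(\<Sum>k<n. u (p k) \<omega> * E p k \<omega>) = (\<Sum>k<n. w k \<omega> * E p k \<omega>) + (\<Sum>j<J. u (p (j * L)) \<omega> * (Z p (Suc j * L) \<omega> - Z p (j * L) \<omega>))" .
      have "norm (\<Sum>j<J. u (p (j * L)) \<omega> * (Z p (Suc j * L) \<omega> - Z p (j * L) \<omega>)) \<le> (\<Sum>j<J. 2 * \<eta>)"
      proof (rule sum_norm_le)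
        fix j assume "j \<in> {..<J}"
        then have "norm (Z p (Suc j * L) \<omega> - Z p (j * L) \<omega>) \<le> \<eta> + \<eta>"
          using z[of j] z[of "Suc j"] by (intro order_trans[OF norm_triangle_ineq4] add_mono) auto
        then show "norm (u (p (j * L)) \<omega> * (Z p (Suc j * L) \<omega> - Z p (j * L) \<omega>)) \<le> 2 * \<eta>"
          by (simp add: norm_mult)
      qed
      also have "\<dots> \<le> \<epsilon>/3" using eta(2) by (simp add: mult_ac)
      finally have "norm (\<Sum>j<J. u (p (j * L)) \<omega> * (Z p (Suc j * L) \<omega> - Z p (j * L) \<omega>)) \<le> \<epsilon>/3" .
      then show "norm (\<Sum>k<n. w k \<omega> * E p k \<omega>) > \<epsilon>/3"
        using gt norm_triangle_ineq[of "\<Sum>k<n. w k \<omega> * E p k \<omega>" "\<Sum>j<J. u (p (j * L)) \<omega> * (Z p (Suc j * L) \<omega> - Z p (j * L) \<omega>)"]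
        unfolding eq using e by linarith
    qed
    have zm: "{\<omega>\<in>space M. norm (Z p (j * L) \<omega>) > \<eta>} \<in> events" if "j \<le> J" for j
      using Z_meas[OF p(1) JL[OF that]] by measurable
    have sm1: "{\<omega>\<in>space M. norm (\<Sum>k<n. w k \<omega> * E p k \<omega>) > \<epsilon>/3} \<in> events" by measurable
    have em: "{\<omega>\<in>space M. \<exists>j\<le>J. norm (Z p (j * L) \<omega>) > \<eta>} \<in> events"
    proof -
      have [measurable]: "Z p (j * L) \<in> borel_measurable M" if "j \<le> J" for j by (rule Z_meas[OF p(1) JL[OF that]])
      show ?thesis by measurable
    qed
    have am: "{\<omega>\<in>space M. \<omega> \<in> A J' L} \<in> events" using Am by (simp add: sets.Int)
    have m2: "{\<omega>\<in>space M. \<omega> \<in> A J' L \<or> (\<exists>j\<le>J. norm (Z p (j * L) \<omega>) > \<eta>)} \<in> events"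
    proof -
      have "{\<omega>\<in>space M. \<omega> \<in> A J' L \<or> (\<exists>j\<le>J. norm (Z p (j * L) \<omega>) > \<eta>)} =
        {\<omega>\<in>space M. \<omega> \<in> A J' L} \<union> {\<omega>\<in>space M. \<exists>j\<le>J. norm (Z p (j * L) \<omega>) > \<eta>}" by (rule Collect_conj_disj_eq)
      then show ?thesis using sets.Un[OF am em] by (simp only:)
    qed
    have "prob {\<omega>\<in>space M. norm (\<Sum>k<n. u (p k) \<omega> * E p k \<omega>) > \<epsilon>} \<le> prob {\<omega>\<in>space M. norm (\<Sum>k<n. w k \<omega> * E p k \<omega>) > \<epsilon>/3} +
        prob {\<omega>\<in>space M. \<omega> \<in> A J' L \<or> (\<exists>j\<le>J. norm (Z p (j * L) \<omega>) > \<eta>)}"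
    proof (rule prob_le_add[OF _ sm1 m2])
      show "AE \<omega> in M. norm (\<Sum>k<n. u (p k) \<omega> * E p k \<omega>) > \<epsilon> \<longrightarrow>
        norm (\<Sum>k<n. w k \<omega> * E p k \<omega>) > \<epsilon>/3 \<or> (\<omega> \<in> A J' L \<or> (\<exists>j\<le>J. norm (Z p (j * L) \<omega>) > \<eta>))"
        by (intro AE_I2 impI) (rule key; assumption)
    qed
    also have "prob {\<omega>\<in>space M. \<omega> \<in> A J' L \<or> (\<exists>j\<le>J. norm (Z p (j * L) \<omega>) > \<eta>)} \<le>
        prob {\<omega>\<in>space M. \<omega> \<in> A J' L} + prob {\<omega>\<in>space M. \<exists>j\<le>J. norm (Z p (j * L) \<omega>) > \<eta>}"
      by (rule prob_le_add[OF _ am em]) auto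
    also have "{\<omega>\<in>space M. \<omega> \<in> A J' L} = A J' L" by (auto simp: A_def)
    also have "prob {\<omega>\<in>space M. \<exists>j\<le>J. norm (Z p (j * L) \<omega>) > \<eta>} \<le> (real J + 1) * \<eta>"
      using zm d(2)[OF p JL] by (intro prob_ex_le) (auto intro: less_imp_le)
    finally have "prob {\<omega>\<in>space M. norm (\<Sum>k<n. u (p k) \<omega> * E p k \<omega>) > \<epsilon>} < \<epsilon>"
      using w1[OF p(1) wt] J'[OF L0] eta(3) by linarith
    then show "prob {\<omega>\<in>space M. norm (\<Sum>k<J*L. u (uniform_partition T (J*L) k) \<omega> * E (uniform_partition T (J*L)) k \<omega>) > \<epsilon>} < \<epsilon>"
      by (simp add: n_def p_def)
  qed (rule N(1))
qed

text \<open>The increment of \<open>u\<close> is \<open>u (p k)\<close> times the sum of a centred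
  function \<theta> of the Brownian increment and the deterministic \<mu> - 1, where \<mu> is a
  value of the Gaussian characteristic function. The first part is handled by the isometry, the
  second in L1, with 1 - \<mu>^2 \<le> a^2 \<Delta> and 1 - \<mu> \<le> a^2 \<Delta>/2. Both use
  only moments of \<open>Z p k\<close> truncated at \<open>c\<close>, for each \<open>k\<close>
  separately, and these are small by \<open>Z_small\<close>; uniform smallness along the partition
  does not enter.\<close>

lemma sum_Z_du_small:
  assumes T: "T \<ge> 0" and e: "\<epsilon> > 0"
  shows "\<exists>\<delta>>0. \<forall>n p. is_partition T n p \<longrightarrow> mesh_less \<delta> n p \<longrightarrow>
    prob {\<omega>\<in>space M. norm (\<Sum>k<n. Z p k \<omega> * (u (p (Suc k)) \<omega> - u (p k) \<omega>)) > \<epsilon>} < \<epsilon>"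
proof -
  have e2: "\<epsilon>/2 > 0" using e by simp
  obtain c where c: "c > 0" "\<And>n p. is_partition T n p \<Longrightarrow> prob {\<omega>\<in>space M. \<exists>j\<le>n. norm (Z p j \<omega>) > c} < \<epsilon>/2"
    using Z_tight_max[OF T e2] by blast
  \<comment> \<open>Times \<eta>, the summands are the Chebyshev bound for the centred part and the
    Markov bound for the compensator, both at level \<epsilon>/2. The cap \<eta> \<le> 1 allows
    \<eta>^2 to be replaced by \<eta>.\<close>
  define R where "R = 4 * (1 + c\<^sup>2) * (a\<^sup>2 * T) / \<epsilon>\<^sup>2 + (1 + c) * (a\<^sup>2 * T) / \<epsilon>"
  have R0: "R \<ge> 0" using c T e by (auto simp: R_def)
  define \<eta> where "\<eta> = min 1 (\<epsilon> / (4 * (R + 1)))"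
  have eta: "\<eta> > 0" "\<eta> \<le> 1" "\<eta> \<le> \<epsilon> / (4 * (R + 1))" using e R0 by (auto simp: \<eta>_def)
  have etaR: "\<eta> * R < \<epsilon>/2"
  proof -
    have "\<eta> * R \<le> \<epsilon> / (4 * (R + 1)) * R" using eta R0 by (intro mult_right_mono) auto
    also have "\<dots> < \<epsilon>/2" using e R0 by (simp add: field_simps add_pos_nonneg)
    finally show ?thesis .
  qed
  obtain \<delta> where d: "\<delta> > 0" "\<And>n p j. is_partition T n p \<Longrightarrow> mesh_less \<delta> n p \<Longrightarrow> j \<le> n \<Longrightarrow> prob {\<omega>\<in>space M. norm (Z p j \<omega>) > \<eta>} < \<eta>"
    using Z_small[OF T eta(1)] by blast
  show ?thesis
  proof (intro exI[of _ \<delta>] conjI allI impI d(1))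
    fix n p assume p: "is_partition T n p" and f: "mesh_less \<delta> n p"
    have pk: "0 \<le> p k" "p k \<le> p (Suc k)" if "k < n" for k
      using partition_bounds(1)[OF p, of k] p that by (auto simp: is_partition_def)
    define \<Delta> where "\<Delta> k = p (Suc k) - p k" for k
    define \<mu> where "\<mu> k = exp (- (a\<^sup>2 * \<Delta> k / 2))" for k
    have \<Delta>0: "\<Delta> k \<ge> 0" if "k < n" for k using pk[OF that] by (simp add: \<Delta>_def)
    have \<mu>: "0 \<le> \<mu> k" "\<mu> k \<le> 1" "1 - \<mu> k \<le> a\<^sup>2 * \<Delta> k / 2" "1 - (\<mu> k)\<^sup>2 \<le> a\<^sup>2 * \<Delta> k" if "k < n" for k
    proof -
      show "1 - \<mu> k \<le> a\<^sup>2 * \<Delta> k / 2" unfolding \<mu>_def using exp_ge_add_one_self[of "- (a\<^sup>2 * \<Delta> k / 2)"] by linarith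
      have "(\<mu> k)\<^sup>2 = exp (- (a\<^sup>2 * \<Delta> k))" by (simp add: \<mu>_def power2_eq_square flip: exp_add)
      then show "1 - (\<mu> k)\<^sup>2 \<le> a\<^sup>2 * \<Delta> k" using exp_ge_add_one_self[of "- (a\<^sup>2 * \<Delta> k)"] by simp
      show "\<mu> k \<le> 1" using \<Delta>0[OF that] by (simp add: \<mu>_def)
    qed (simp add: \<mu>_def)
    define \<phi> where "\<phi> k y = exp (- (\<i> * of_real (a * y))) - of_real (\<mu> k)" for k y
    have \<phi>m: "\<phi> k \<in> borel_measurable borel" for k unfolding \<phi>_def by measurable
    define \<theta> where "\<theta> k \<omega> = \<phi> k (W (p (Suc k)) \<omega> - W (p k) \<omega>)" for k \<omega>
    have DW: "(\<lambda>\<omega>. W (p (Suc k)) \<omega> - W (p k) \<omega>) \<in> borel_measurable M" if "k < n" for k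
      using partition_meas(4)[OF p, of k] partition_meas(4)[OF p, of "Suc k"] that by simp
    have \<theta>m: "\<theta> k \<in> borel_measurable M" if "k < n" for k
      unfolding \<theta>_def using DW[OF that] \<phi>m by measurable
    have ei: "integrable M (\<lambda>\<omega>. exp (- (\<i> * of_real (a * (W (p (Suc k)) \<omega> - W (p k) \<omega>)))))" if "k < n" for k
    proof -
      note [measurable] = DW[OF that]
      show ?thesis by (rule integrable_const_bound[where B = 1]) (simp add: norm_exp_eq_Re, measurable)
    qed
    have ee: "expectation (\<lambda>\<omega>. exp (- (\<i> * of_real (a * (W (p (Suc k)) \<omega> - W (p k) \<omega>))))) = of_real (\<mu> k)" if "k < n" for k
      using W_char[OF pk[OF that], of "-a"] by (simp add: \<mu>_def \<Delta>_def)
    have \<theta>z: "expectation (\<theta> k) = 0" if "k < n" for k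
      unfolding \<theta>_def \<phi>_def using ei[OF that] ee[OF that] by (simp add: prob_space)
    have \<theta>sq: "(norm (\<theta> k \<omega>))\<^sup>2 = 1 + (\<mu> k)\<^sup>2 - 2 * \<mu> k * Re (exp (- (\<i> * of_real (a * (W (p (Suc k)) \<omega> - W (p k) \<omega>)))))" for k \<omega>
    proof -
      let ?e = "exp (- (\<i> * of_real (a * (W (p (Suc k)) \<omega> - W (p k) \<omega>))))"
      have "(norm ?e)\<^sup>2 = 1" by (simp add: norm_exp_eq_Re)
      then have "(Re ?e)\<^sup>2 + (Im ?e)\<^sup>2 = 1" unfolding cmod_power2 .
      then show ?thesis unfolding \<theta>_def \<phi>_def cmod_power2
        by (simp add: power2_diff del: Re_exp Im_exp)
    qed
    have \<theta>2: "integrable M (\<lambda>\<omega>. (norm (\<theta> k \<omega>))\<^sup>2)" "expectation (\<lambda>\<omega>. (norm (\<theta> k \<omega>))\<^sup>2) \<le> a\<^sup>2 * \<Delta> k" if k: "k < n" for k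
    proof -
      have i: "integrable M (\<lambda>\<omega>. Re (exp (- (\<i> * of_real (a * (W (p (Suc k)) \<omega> - W (p k) \<omega>))))))"
        by (rule integrable_Re[OF ei[OF k]])
      have ex: "expectation (\<lambda>\<omega>. Re (exp (- (\<i> * of_real (a * (W (p (Suc k)) \<omega> - W (p k) \<omega>)))))) = \<mu> k"
        using integral_Re[OF ei[OF k]] unfolding ee[OF k] by simp
      show "integrable M (\<lambda>\<omega>. (norm (\<theta> k \<omega>))\<^sup>2)" unfolding \<theta>sq using i by simp
      have "expectation (\<lambda>\<omega>. (norm (\<theta> k \<omega>))\<^sup>2) = 1 + (\<mu> k)\<^sup>2 - 2 * \<mu> k * \<mu> k"
        unfolding \<theta>sq using i ex by (simp add: prob_space del: Re_exp)
      then show "expectation (\<lambda>\<omega>. (norm (\<theta> k \<omega>))\<^sup>2) \<le> a\<^sup>2 * \<Delta> k" using \<mu>(4)[OF k] by (simp add: power2_eq_square)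
    qed
    define w where "w k \<omega> = (if norm (Z p k \<omega>) \<le> c then Z p k \<omega> * u (p k) \<omega> else 0)" for k \<omega>
    have wt: "weights p n c w" unfolding weights_def
    proof (intro conjI allI impI ballI)
      fix k \<omega> assume k: "k < n"
      have [measurable]: "Z p k \<in> borel_measurable (F (p k))" "u (p k) \<in> borel_measurable (F (p k))"
        using Z_adapted[OF p order_refl, of k] u_adapted[OF pk(1)[OF k]] k by auto
      show "w k \<in> borel_measurable (F (p k))" unfolding w_def by measurable
      show "norm (w k \<omega>) \<le> c" using c by (simp add: w_def norm_mult)
    qed
    have [measurable]: "w k \<in> borel_measurable M" if "k < n" for k
      using wt that by (auto simp: weights_def intro: meas_F_M)
    have [measurable]: "\<theta> k \<in> borel_measurable M" if "k < n" for k using \<theta>m[OF that] .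
    have Zm[measurable]: "Z p j \<in> borel_measurable M" if "j \<le> n" for j by (rule Z_meas[OF p that])
    have w1: "norm (w k \<omega>) \<le> \<eta> + c * (if norm (Z p k \<omega>) > \<eta> then 1 else 0)" for k \<omega>
      using c eta by (auto simp: w_def norm_mult)
    have w2: "(norm (w k \<omega>))\<^sup>2 \<le> \<eta>\<^sup>2 + c\<^sup>2 * (if norm (Z p k \<omega>) > \<eta> then 1 else 0)" for k \<omega>
      using c eta by (auto simp: w_def norm_mult intro: power_mono add_increasing)
    have Eind: "integrable M (\<lambda>\<omega>. if norm (Z p k \<omega>) > \<eta> then 1 else 0 :: real)"
      "expectation (\<lambda>\<omega>. if norm (Z p k \<omega>) > \<eta> then 1 else 0 :: real) \<le> \<eta>" if k: "k < n" for k
    proof -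
      have [measurable]: "Z p k \<in> borel_measurable M" using Zm k by simp
      show "integrable M (\<lambda>\<omega>. if norm (Z p k \<omega>) > \<eta> then 1 else 0 :: real)"
        by (rule integrable_const_bound[where B = 1]) auto
      have "expectation (\<lambda>\<omega>. if norm (Z p k \<omega>) > \<eta> then 1 else 0 :: real) = expectation (indicator {\<omega>\<in>space M. norm (Z p k \<omega>) > \<eta>})"
        by (intro Bochner_Integration.integral_cong refl) (simp add: indicator_def)
      also have "\<dots> = prob {\<omega>\<in>space M. norm (Z p k \<omega>) > \<eta>}"
        by (simp add: Int_def conj_commute)
      finally show "expectation (\<lambda>\<omega>. if norm (Z p k \<omega>) > \<eta> then 1 else 0 :: real) \<le> \<eta>"
        using d(2)[OF p f, of k] k by simp
    qed
    have wi: "integrable M (\<lambda>\<omega>. norm (w k \<omega>))" "integrable M (\<lambda>\<omega>. (norm (w k \<omega>))\<^sup>2)" if k: "k < n" for k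
    proof -
      have b: "norm (w k \<omega>) \<le> c" if "\<omega> \<in> space M" for \<omega> using wt k that by (auto simp: weights_def)
      have [measurable]: "w k \<in> borel_measurable M" using wt k by (auto simp: weights_def intro: meas_F_M)
      show "integrable M (\<lambda>\<omega>. norm (w k \<omega>))" by (rule integrable_const_bound[where B = c]) (use b in auto)
      show "integrable M (\<lambda>\<omega>. (norm (w k \<omega>))\<^sup>2)"
        by (rule integrable_const_bound[where B = "c\<^sup>2"]) (auto intro!: AE_I2 power_mono b)
    qed
    have Ew1: "expectation (\<lambda>\<omega>. norm (w k \<omega>)) \<le> \<eta> * (1 + c)" if k: "k < n" for k
    proof -
      have "expectation (\<lambda>\<omega>. norm (w k \<omega>)) \<le> expectation (\<lambda>\<omega>. \<eta> + c * (if norm (Z p k \<omega>) > \<eta> then 1 else 0))"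
        by (intro integral_mono wi[OF k] w1) (use Eind[OF k] in auto)
      also have "\<dots> = \<eta> + c * expectation (\<lambda>\<omega>. if norm (Z p k \<omega>) > \<eta> then 1 else 0 :: real)"
        using Eind[OF k] by (subst Bochner_Integration.integral_add) (auto simp: prob_space)
      also have "\<dots> \<le> \<eta> + c * \<eta>" using Eind(2)[OF k] c by (intro add_left_mono mult_left_mono) auto
      finally show ?thesis by (simp add: algebra_simps)
    qed
    have Ew2: "expectation (\<lambda>\<omega>. (norm (w k \<omega>))\<^sup>2) \<le> \<eta> * (1 + c\<^sup>2)" if k: "k < n" for k
    proof -
      have "expectation (\<lambda>\<omega>. (norm (w k \<omega>))\<^sup>2) \<le> expectation (\<lambda>\<omega>. \<eta>\<^sup>2 + c\<^sup>2 * (if norm (Z p k \<omega>) > \<eta> then 1 else 0))"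
        by (intro integral_mono wi[OF k] w2) (use Eind[OF k] in auto)
      also have "\<dots> = \<eta>\<^sup>2 + c\<^sup>2 * expectation (\<lambda>\<omega>. if norm (Z p k \<omega>) > \<eta> then 1 else 0 :: real)"
        using Eind[OF k] by (subst Bochner_Integration.integral_add) (auto simp: prob_space)
      also have "\<dots> \<le> \<eta> * 1 + c\<^sup>2 * \<eta>" using Eind(2)[OF k] c eta
        unfolding power2_eq_square[of \<eta>] by (intro add_mono mult_left_mono) auto
      finally show ?thesis by (simp add: algebra_simps)
    qed
    have sumD: "(\<Sum>k<n. \<Delta> k) = T" using p by (simp add: \<Delta>_def sum_lessThan_telescope[of p] is_partition_def)
    define A where "A \<omega> = (\<Sum>k<n. w k \<omega> * \<theta> k \<omega>)" for \<omega>
    define B where "B \<omega> = (\<Sum>k<n. norm (w k \<omega>) * (1 - \<mu> k))" for \<omega>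
    have Am[measurable]: "A \<in> borel_measurable M" unfolding A_def by measurable
    have Bm[measurable]: "B \<in> borel_measurable M" unfolding B_def by measurable
    have L2: "integrable M (\<lambda>\<omega>. (norm (A \<omega>))\<^sup>2)" "expectation (\<lambda>\<omega>. (norm (A \<omega>))\<^sup>2) =
       (\<Sum>k<n. expectation (\<lambda>\<omega>. (norm (w k \<omega>))\<^sup>2) * expectation (\<lambda>\<omega>. (norm (\<theta> k \<omega>))\<^sup>2))"
      using increments_L2[OF p wt, of \<phi> n] \<phi>m \<theta>2(1) \<theta>z unfolding A_def \<theta>_def by auto
    have EA: "expectation (\<lambda>\<omega>. (norm (A \<omega>))\<^sup>2) \<le> \<eta> * ((1 + c\<^sup>2) * (a\<^sup>2 * T))"
    proof -
      have "expectation (\<lambda>\<omega>. (norm (A \<omega>))\<^sup>2) \<le> (\<Sum>k<n. (\<eta> * (1 + c\<^sup>2)) * (a\<^sup>2 * \<Delta> k))"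
        unfolding L2(2) using Ew2 \<theta>2 eta \<Delta>0 by (intro sum_mono mult_mono) (auto intro: integral_nonneg_AE)
      also have "\<dots> = \<eta> * (1 + c\<^sup>2) * (a\<^sup>2 * (\<Sum>k<n. \<Delta> k))" by (simp add: sum_distrib_left)
      finally show ?thesis unfolding sumD by (simp add: mult.assoc)
    qed
    have EB: "integrable M B" "expectation B \<le> \<eta> * ((1 + c) * (a\<^sup>2 * T)) / 2"
    proof -
      show "integrable M B" unfolding B_def using wi by (intro Bochner_Integration.integrable_sum integrable_mult_left) auto
      have "expectation B = (\<Sum>k<n. expectation (\<lambda>\<omega>. norm (w k \<omega>)) * (1 - \<mu> k))"
        unfolding B_def using wi by (subst Bochner_Integration.integral_sum) auto
      also have "\<dots> \<le> (\<Sum>k<n. (\<eta> * (1 + c)) * (a\<^sup>2 * \<Delta> k / 2))"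
        using Ew1 \<mu> eta c by (intro sum_mono mult_mono) auto
      also have "\<dots> = (\<eta> * (1 + c)) * (a\<^sup>2 * (\<Sum>k<n. \<Delta> k) / 2)" by (simp add: sum_distrib_left sum_divide_distrib)
      finally show "expectation B \<le> \<eta> * ((1 + c) * (a\<^sup>2 * T)) / 2" unfolding sumD by (simp add: mult.assoc)
    qed
    have B0: "B \<omega> \<ge> 0" for \<omega> unfolding B_def using \<mu> by (intro sum_nonneg) auto
    have key: "(\<exists>j\<le>n. norm (Z p j \<omega>) > c) \<or> ((norm (A \<omega>))\<^sup>2 > (\<epsilon>/2)\<^sup>2 \<or> B \<omega> > \<epsilon>/2)"
      if gt: "norm (\<Sum>k<n. Z p k \<omega> * (u (p (Suc k)) \<omega> - u (p k) \<omega>)) > \<epsilon>" for \<omega>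
    proof (rule disjCI)
      assume "\<not> ((norm (A \<omega>))\<^sup>2 > (\<epsilon>/2)\<^sup>2 \<or> B \<omega> > \<epsilon>/2)"
      then have ab: "norm (A \<omega>) \<le> \<epsilon>/2" "B \<omega> \<le> \<epsilon>/2"
        using e by (auto simp: not_less intro: power2_le_imp_le)
      show "\<exists>j\<le>n. norm (Z p j \<omega>) > c"
      proof (rule ccontr)
        assume "\<not> ?thesis"
        then have wk: "w k \<omega> = Z p k \<omega> * u (p k) \<omega>" if "k < n" for k using that by (auto simp: w_def not_less)
        have du: "u (p (Suc k)) \<omega> - u (p k) \<omega> = u (p k) \<omega> * (\<theta> k \<omega> + of_real (\<mu> k) - 1)" for k
          unfolding \<theta>_def \<phi>_def u_def by (simp add: algebra_simps flip: exp_add)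
        have "(\<Sum>k<n. Z p k \<omega> * (u (p (Suc k)) \<omega> - u (p k) \<omega>)) = A \<omega> - (\<Sum>k<n. w k \<omega> * of_real (1 - \<mu> k))"
          unfolding A_def sum_subtractf[symmetric] by (intro sum.cong refl) (simp add: wk du algebra_simps)
        also have "norm \<dots> \<le> norm (A \<omega>) + norm (\<Sum>k<n. w k \<omega> * of_real (1 - \<mu> k))" by (rule norm_triangle_ineq4)
        also have "norm (\<Sum>k<n. w k \<omega> * of_real (1 - \<mu> k)) \<le> B \<omega>" unfolding B_def
        proof (rule sum_norm_le)
          fix k assume "k \<in> {..<n}"
          then have "\<bar>1 - \<mu> k\<bar> = 1 - \<mu> k" using \<mu>(2)[of k] by simp
          then show "norm (w k \<omega> * of_real (1 - \<mu> k)) \<le> norm (w k \<omega>) * (1 - \<mu> k)"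
            unfolding norm_mult norm_of_real by simp
        qed
        finally show False using gt ab by linarith
      qed
    qed
    have "prob {\<omega>\<in>space M. norm (\<Sum>k<n. Z p k \<omega> * (u (p (Suc k)) \<omega> - u (p k) \<omega>)) > \<epsilon>} \<le>
      prob {\<omega>\<in>space M. \<exists>j\<le>n. norm (Z p j \<omega>) > c} + prob {\<omega>\<in>space M. (norm (A \<omega>))\<^sup>2 > (\<epsilon>/2)\<^sup>2 \<or> B \<omega> > \<epsilon>/2}"
      by (rule prob_le_add, intro AE_I2 impI key) measurable
    also have "prob {\<omega>\<in>space M. (norm (A \<omega>))\<^sup>2 > (\<epsilon>/2)\<^sup>2 \<or> B \<omega> > \<epsilon>/2} \<le>
      prob {\<omega>\<in>space M. (norm (A \<omega>))\<^sup>2 > (\<epsilon>/2)\<^sup>2} + prob {\<omega>\<in>space M. B \<omega> > \<epsilon>/2}"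
      by (rule prob_le_add, simp) measurable
    also have "prob {\<omega>\<in>space M. (norm (A \<omega>))\<^sup>2 > (\<epsilon>/2)\<^sup>2} \<le> expectation (\<lambda>\<omega>. (norm (A \<omega>))\<^sup>2) / (\<epsilon>/2)\<^sup>2"
      by (rule prob_markov) (use L2 e in auto)
    also have "\<dots> \<le> \<eta> * ((1 + c\<^sup>2) * (a\<^sup>2 * T)) / (\<epsilon>/2)\<^sup>2" using EA by (intro divide_right_mono) auto
    also have "prob {\<omega>\<in>space M. B \<omega> > \<epsilon>/2} \<le> expectation B / (\<epsilon>/2)"
      by (rule prob_markov) (use EB B0 e in auto)
    also have "\<dots> \<le> \<eta> * ((1 + c) * (a\<^sup>2 * T)) / 2 / (\<epsilon>/2)" using EB e by (intro divide_right_mono) auto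
    finally have "prob {\<omega>\<in>space M. norm (\<Sum>k<n. Z p k \<omega> * (u (p (Suc k)) \<omega> - u (p k) \<omega>)) > \<epsilon>} \<le>
       prob {\<omega>\<in>space M. \<exists>j\<le>n. norm (Z p j \<omega>) > c} + (\<eta> * ((1 + c\<^sup>2) * (a\<^sup>2 * T)) / (\<epsilon>/2)\<^sup>2 + \<eta> * ((1 + c) * (a\<^sup>2 * T)) / 2 / (\<epsilon>/2))"
      by simp
    also have "\<eta> * ((1 + c\<^sup>2) * (a\<^sup>2 * T)) / (\<epsilon>/2)\<^sup>2 + \<eta> * ((1 + c) * (a\<^sup>2 * T)) / 2 / (\<epsilon>/2) = \<eta> * R"
      using e by (simp add: R_def field_simps power2_eq_square)
    finally show "prob {\<omega>\<in>space M. norm (\<Sum>k<n. Z p k \<omega> * (u (p (Suc k)) \<omega> - u (p k) \<omega>)) > \<epsilon>} < \<epsilon>"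
      using c(2)[OF p] etaR by linarith
  qed
qed

end

section \<open>Trapezoidal error of \<open>u\<close> and assembly of the product rule\<close>

lemma continuous_on_bounded_interval:
  fixes f :: "real \<Rightarrow> 'b::real_normed_vector"
  assumes "continuous_on {0..} f"
  shows "\<exists>B>0. \<forall>t\<in>{0..T}. norm (f t) \<le> B"
proof -
  have "compact (f ` {0..T})"
    by (intro compact_continuous_image continuous_on_subset[OF assms]) auto
  then have "bounded (f ` {0..T})" by (rule compact_imp_bounded)
  then show ?thesis unfolding bounded_pos by auto
qed

context strat_sde
begin

text \<open>Formally du = -i a u \<circ> dW. The second factor is the residual of this equation over
  one cell, and the average of \<open>h\<close> is the weight that the product rule puts on
  it.\<close>

definition err :: "(nat \<Rightarrow> real) \<Rightarrow> nat \<Rightarrow> 'a \<Rightarrow> complex" where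
  "err p k \<omega> = (h (p k) \<omega> + h (p (Suc k)) \<omega>) / 2 *
     (u (p (Suc k)) \<omega> - u (p k) \<omega> + \<i> * of_real a * ((u (p k) \<omega> + u (p (Suc k)) \<omega>) / 2) * of_real (W (p (Suc k)) \<omega> - W (p k) \<omega>))"

lemma err_meas:
  assumes p: "is_partition T n p" and k: "k < n"
  shows "err p k \<in> borel_measurable M"
proof -
  have "h (p k) \<in> borel_measurable M" "h (p (Suc k)) \<in> borel_measurable M"
    "W (p k) \<in> borel_measurable M" "W (p (Suc k)) \<in> borel_measurable M"
    "u (p k) \<in> borel_measurable M" "u (p (Suc k)) \<in> borel_measurable M"
    using partition_meas[OF p, of k] partition_meas[OF p, of "Suc k"] k
      u_meas[OF partition_bounds(1)[OF p, of k]] u_meas[OF partition_bounds(1)[OF p, of "Suc k"]] by auto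
  note [measurable] = this
  show ?thesis unfolding err_def by measurable
qed

lemma err_bound:
  "norm (err p k \<omega>) \<le> norm ((h (p k) \<omega> + h (p (Suc k)) \<omega>) / 2) * \<bar>a * (W (p (Suc k)) \<omega> - W (p k) \<omega>)\<bar>^3"
proof -
  let ?y = "a * (W (p (Suc k)) \<omega> - W (p k) \<omega>)"
  have uS: "u (p (Suc k)) \<omega> = u (p k) \<omega> * exp (- (\<i> * of_real ?y))"
    unfolding u_def by (simp add: algebra_simps flip: exp_add)
  have "u (p (Suc k)) \<omega> - u (p k) \<omega> + \<i> * of_real a * ((u (p k) \<omega> + u (p (Suc k)) \<omega>) / 2) * of_real (W (p (Suc k)) \<omega> - W (p k) \<omega>) =
    u (p k) \<omega> * (exp (- (\<i> * of_real ?y)) - 1 + \<i> * of_real ?y * ((1 + exp (- (\<i> * of_real ?y))) / 2))"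
    unfolding uS by (simp add: field_simps)
  then have "norm (u (p (Suc k)) \<omega> - u (p k) \<omega> + \<i> * of_real a * ((u (p k) \<omega> + u (p (Suc k)) \<omega>) / 2) * of_real (W (p (Suc k)) \<omega> - W (p k) \<omega>)) =
    norm (exp (- (\<i> * of_real ?y)) - 1 + \<i> * of_real ?y * ((1 + exp (- (\<i> * of_real ?y))) / 2))"
    by (simp only: norm_mult u_norm mult_1_left)
  also have "\<dots> \<le> \<bar>?y\<bar>^3" by (rule exp_trapezoid)
  finally show ?thesis unfolding err_def by (subst norm_mult) (intro mult_left_mono norm_ge_zero)
qed

text \<open>Each term is bounded by a multiple of |\<Delta>W|^3, split as |\<Delta>W| times
  |\<Delta>W|^2: the first factor is uniformly small by continuity of the paths, and the sums of the
  second are tight.\<close>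

lemma sum_err_small:
  assumes T: "T \<ge> 0" and e: "\<epsilon> > 0"
  shows "\<exists>\<delta>>0. \<forall>n p. is_partition T n p \<longrightarrow> mesh_less \<delta> n p \<longrightarrow>
    prob {\<omega>\<in>space M. norm (\<Sum>k<n. err p k \<omega>) > \<epsilon>} < \<epsilon>"
proof -
  have e2: "\<epsilon>/2 > 0" using e by simp
  have aux: "q * (r / (c * q)) = r / c" if "q > 0" for q r c :: real
    using that by simp
  obtain C where C: "C > 0" "\<And>n p. is_partition T n p \<Longrightarrow> prob {\<omega>\<in>space M. (\<Sum>k<n. norm ((W (p (Suc k)) \<omega> - W (p k) \<omega>)\<^sup>2)) > C} < \<epsilon>/2"
    using tight_sum_W_sq[OF T] e2 unfolding tight_sum_def by meson
  define g where "g p k \<omega> = norm ((h (p k) \<omega> + h (p (Suc k)) \<omega>) / 2) * (\<bar>a\<bar>^3 * \<bar>W (p (Suc k)) \<omega> - W (p k) \<omega>\<bar>)" for p :: "nat \<Rightarrow> real" and k \<omega>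
  have gm: "g p k \<in> borel_measurable M" "(\<lambda>\<omega>. W (p (Suc k)) \<omega> - W (p k) \<omega>) \<in> borel_measurable M" if p: "is_partition T n p" and k: "k < n" for n p k
  proof -
    have [measurable]: "h (p k) \<in> borel_measurable M" "h (p (Suc k)) \<in> borel_measurable M"
      "W (p k) \<in> borel_measurable M" "W (p (Suc k)) \<in> borel_measurable M"
      using partition_meas[OF p, of k] partition_meas[OF p, of "Suc k"] k by auto
    show "g p k \<in> borel_measurable M" unfolding g_def by measurable
    show "(\<lambda>\<omega>. W (p (Suc k)) \<omega> - W (p k) \<omega>) \<in> borel_measurable M" by measurable
  qed
  have gm2: "{\<omega>\<in>space M. \<exists>k<n. g p k \<omega> > \<epsilon> / C} \<in> events" if p: "is_partition T n p" for n p
  proof -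
    note [measurable] = gm(1)[OF p]
    show ?thesis by measurable
  qed
  have "\<exists>\<delta>>0. \<forall>n p. is_partition T n p \<longrightarrow> mesh_less \<delta> n p \<longrightarrow> prob {\<omega>\<in>space M. \<exists>k<n. g p k \<omega> > \<epsilon> / C} < \<epsilon>/2"
  proof (rule uniform_small_fine[OF gm2 _ e2])
    show "AE \<omega> in M. \<exists>\<delta>>0. \<forall>n p. is_partition T n p \<longrightarrow> mesh_less \<delta> n p \<longrightarrow> \<not> (\<exists>k<n. g p k \<omega> > \<epsilon> / C)"
      using h_cont W_cont
    proof eventually_elim
      case (elim \<omega>)
      obtain B where B: "B > 0" "\<And>t. t \<in> {0..T} \<Longrightarrow> norm (h t \<omega>) \<le> B"
        using continuous_on_bounded_interval[OF elim(1), of T] by auto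
      \<comment> \<open>Chosen so that B (|a|^3 + 1) e' = \<epsilon>/C; the added 1 avoids a zero
        denominator when \<open>a = 0\<close>.\<close>
      define e' where "e' = \<epsilon> / (C * (B * (\<bar>a\<bar>^3 + 1)))"
      have den: "B * (\<bar>a\<bar>^3 + 1) > 0" using B by (intro mult_pos_pos add_nonneg_pos) auto
      have e': "e' > 0" unfolding e'_def by (intro divide_pos_pos e mult_pos_pos[OF C(1) den])
      obtain \<delta> where d: "\<delta> > 0" "\<And>n p k s. is_partition T n p \<Longrightarrow> mesh_less \<delta> n p \<Longrightarrow> k < n \<Longrightarrow> s \<in> {p k..p (Suc k)} \<Longrightarrow>
        dist (W s \<omega>) (W (p k) \<omega>) < e'"
        using partition_continuous_fine[OF elim(2) e', of T] by metis
      have gb: "g p k \<omega> \<le> \<epsilon> / C" if p: "is_partition T n p" "mesh_less \<delta> n p" "k < n" for n p k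
      proof -
        have "p k \<le> p (Suc k)" using p by (simp add: is_partition_def)
        then have w: "\<bar>W (p (Suc k)) \<omega> - W (p k) \<omega>\<bar> \<le> e'" using d(2)[OF p, of "p (Suc k)"] by (simp add: dist_real_def)
        have "norm (h (p k) \<omega> + h (p (Suc k)) \<omega>) \<le> B + B"
          using partition_bounds[OF p(1), of k] partition_bounds[OF p(1), of "Suc k"] p(3)
          by (intro norm_triangle_mono B) auto
        then have "norm ((h (p k) \<omega> + h (p (Suc k)) \<omega>) / 2) \<le> B" by (simp add: norm_divide)
        then have "g p k \<omega> \<le> B * ((\<bar>a\<bar>^3 + 1) * e')" unfolding g_def
          using w B by (intro mult_mono) auto
        also have "\<dots> = (B * (\<bar>a\<bar>^3 + 1)) * (\<epsilon> / (C * (B * (\<bar>a\<bar>^3 + 1))))"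
          unfolding e'_def by (simp only: mult.assoc)
        also have "\<dots> = \<epsilon> / C" using aux[OF den] .
        finally show ?thesis .
      qed
      have "\<not> (\<exists>k<n. g p k \<omega> > \<epsilon> / C)" if "is_partition T n p" "mesh_less \<delta> n p" for n p
        using gb[OF that] not_le by blast
      then show ?case using d(1) by blast
    qed
  qed
  then obtain \<delta> where d: "\<delta> > 0" "\<And>n p. is_partition T n p \<Longrightarrow> mesh_less \<delta> n p \<Longrightarrow> prob {\<omega>\<in>space M. \<exists>k<n. g p k \<omega> > \<epsilon> / C} < \<epsilon>/2"
    by blast
  show ?thesis
  proof (intro exI[of _ \<delta>] conjI allI impI d(1))
    fix n p assume p: "is_partition T n p" and f: "mesh_less \<delta> n p"
    have key: "(\<exists>k<n. g p k \<omega> > \<epsilon> / C) \<or> (\<Sum>k<n. norm ((W (p (Suc k)) \<omega> - W (p k) \<omega>)\<^sup>2)) > C"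
      if gt: "norm (\<Sum>k<n. err p k \<omega>) > \<epsilon>" for \<omega>
    proof (rule ccontr)
      assume a: "\<not> ?thesis"
      then have g: "g p k \<omega> \<le> \<epsilon> / C" if "k < n" for k using that not_le by blast
      have "norm (\<Sum>k<n. err p k \<omega>) \<le> (\<Sum>k<n. \<epsilon> / C * norm ((W (p (Suc k)) \<omega> - W (p k) \<omega>)\<^sup>2))"
      proof (rule sum_norm_le)
        fix k assume "k \<in> {..<n}"
        have "norm (err p k \<omega>) \<le> g p k \<omega> * norm ((W (p (Suc k)) \<omega> - W (p k) \<omega>)\<^sup>2)"
          using err_bound[of p k \<omega>] unfolding g_def abs_mult power_mult_distrib
          by (simp add: power3_eq_cube power2_eq_square mult_ac)
        also have "\<dots> \<le> \<epsilon> / C * norm ((W (p (Suc k)) \<omega> - W (p k) \<omega>)\<^sup>2)"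
          using g \<open>k \<in> {..<n}\<close> by (intro mult_right_mono) auto
        finally show "norm (err p k \<omega>) \<le> \<epsilon> / C * norm ((W (p (Suc k)) \<omega> - W (p k) \<omega>)\<^sup>2)" .
      qed
      also have "\<dots> = \<epsilon> / C * (\<Sum>k<n. norm ((W (p (Suc k)) \<omega> - W (p k) \<omega>)\<^sup>2))" by (simp add: sum_distrib_left)
      also have "\<dots> \<le> \<epsilon> / C * C" using a e C by (intro mult_left_mono) auto
      finally show False using gt C by simp
    qed
    have m2: "{\<omega>\<in>space M. (\<Sum>k<n. norm ((W (p (Suc k)) \<omega> - W (p k) \<omega>)\<^sup>2)) > C} \<in> events"
    proof -
      note [measurable] = gm(2)[OF p]
      show ?thesis by measurable
    qed
    have "prob {\<omega>\<in>space M. norm (\<Sum>k<n. err p k \<omega>) > \<epsilon>} \<le>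
      prob {\<omega>\<in>space M. \<exists>k<n. g p k \<omega> > \<epsilon> / C} + prob {\<omega>\<in>space M. (\<Sum>k<n. norm ((W (p (Suc k)) \<omega> - W (p k) \<omega>)\<^sup>2)) > C}"
      by (rule prob_le_add[OF _ gm2[OF p] m2]) (intro AE_I2 impI key)
    then show "prob {\<omega>\<in>space M. norm (\<Sum>k<n. err p k \<omega>) > \<epsilon>} < \<epsilon>"
      using d(2)[OF p f] C(2)[OF p] by linarith
  qed
qed

definition R :: "(nat \<Rightarrow> real) \<Rightarrow> nat \<Rightarrow> 'a \<Rightarrow> complex" where
  "R p n \<omega> = (\<Sum>k<n. (u (p k) \<omega> + u (p (Suc k)) \<omega>) / 2 * b (h (p k) \<omega>) * of_real (p (Suc k) - p k))"

text \<open>The discrete Leibniz rule with averages, \<Delta>(u h) = avg(u) \<Delta>h + avg(h)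
  \<Delta>u, is exact, and the noise parts of its two terms cancel. This leaves avg(u) times the
  residual. The half with \<open>u (p (Suc k))\<close> has a weight not known at \<open>p k\<close>;
  summing it by parts produces the boundary term and the sum of \<open>Z\<close> against the
  increments of \<open>u\<close>.\<close>

lemma product_decomposition:
  "u (p n) \<omega> * h (p n) \<omega> - u (p 0) \<omega> * h (p 0) \<omega> - R p n \<omega> =
    (u (p n) \<omega> * Z p n \<omega> + (\<Sum>k<n. u (p k) \<omega> * E p k \<omega>) - (\<Sum>k<n. Z p k \<omega> * (u (p (Suc k)) \<omega> - u (p k) \<omega>))) / 2
     + (\<Sum>k<n. err p k \<omega>)"
proof (induction n)
  case (Suc n)
  have Z: "Z p (Suc n) \<omega> = Z p n \<omega> + E p n \<omega>" by (simp add: Z_def)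
  have R: "R p (Suc n) \<omega> = R p n \<omega> + (u (p n) \<omega> + u (p (Suc n)) \<omega>) / 2 * b (h (p n) \<omega>) * of_real (p (Suc n) - p n)"
    by (simp add: R_def)
  have step: "u (p (Suc n)) \<omega> * h (p (Suc n)) \<omega> - u (p n) \<omega> * h (p n) \<omega> =
     (u (p n) \<omega> + u (p (Suc n)) \<omega>) / 2 * b (h (p n) \<omega>) * of_real (p (Suc n) - p n) +
     (u (p n) \<omega> + u (p (Suc n)) \<omega>) / 2 * E p n \<omega> + err p n \<omega>"
    unfolding err_def E_def by (simp add: field_simps)
  have "u (p (Suc n)) \<omega> * h (p (Suc n)) \<omega> - u (p 0) \<omega> * h (p 0) \<omega> - R p (Suc n) \<omega> =
    (u (p n) \<omega> * h (p n) \<omega> - u (p 0) \<omega> * h (p 0) \<omega> - R p n \<omega>) + (u (p n) \<omega> + u (p (Suc n)) \<omega>) / 2 * E p n \<omega> + err p n \<omega>"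
    unfolding R using step by (simp add: algebra_simps)
  also have "\<dots> = (u (p n) \<omega> * Z p n \<omega> + (\<Sum>k<n. u (p k) \<omega> * E p k \<omega>) - (\<Sum>k<n. Z p k \<omega> * (u (p (Suc k)) \<omega> - u (p k) \<omega>))) / 2
     + (\<Sum>k<n. err p k \<omega>) + (u (p n) \<omega> + u (p (Suc n)) \<omega>) / 2 * E p n \<omega> + err p n \<omega>"
    unfolding Suc.IH ..
  also have "\<dots> = (u (p (Suc n)) \<omega> * Z p (Suc n) \<omega> + (\<Sum>k<Suc n. u (p k) \<omega> * E p k \<omega>) - (\<Sum>k<Suc n. Z p k \<omega> * (u (p (Suc k)) \<omega> - u (p k) \<omega>))) / 2
     + (\<Sum>k<Suc n. err p k \<omega>)"
    unfolding Z by (simp add: field_simps)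
  finally show ?case .
qed (simp add: R_def Z_def)

text \<open>The bound on the sum of \<open>u E\<close> is available only when the number of cells is
  divisible by the block count \<open>J\<close>; hence the claim is for some arbitrarily large
  \<open>n\<close>, which suffices to extract a sequence.\<close>

lemma product_remainder_small:
  assumes T: "T \<ge> 0" and e: "\<epsilon> > 0"
  shows "\<exists>n\<ge>N. n > 0 \<and> prob {\<omega>\<in>space M. norm (u T \<omega> * h T \<omega> - u 0 \<omega> * h 0 \<omega> - R (uniform_partition T n) n \<omega>) > \<epsilon>} < \<epsilon>"
proof -
  have e4: "\<epsilon>/4 > 0" using e by simp
  obtain \<delta>1 where d1: "\<delta>1 > 0" "\<And>n p. is_partition T n p \<Longrightarrow> mesh_less \<delta>1 n p \<Longrightarrow> prob {\<omega>\<in>space M. norm (Z p n \<omega>) > \<epsilon>/4} < \<epsilon>/4"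
    using Z_small_end[OF T e4] by blast
  obtain \<delta>2 where d2: "\<delta>2 > 0" "\<And>n p. is_partition T n p \<Longrightarrow> mesh_less \<delta>2 n p \<Longrightarrow>
      prob {\<omega>\<in>space M. norm (\<Sum>k<n. Z p k \<omega> * (u (p (Suc k)) \<omega> - u (p k) \<omega>)) > \<epsilon>/4} < \<epsilon>/4"
    using sum_Z_du_small[OF T e4] by blast
  obtain \<delta>3 where d3: "\<delta>3 > 0" "\<And>n p. is_partition T n p \<Longrightarrow> mesh_less \<delta>3 n p \<Longrightarrow> prob {\<omega>\<in>space M. norm (\<Sum>k<n. err p k \<omega>) > \<epsilon>/4} < \<epsilon>/4"
    using sum_err_small[OF T e4] by blast
  have "min \<delta>1 (min \<delta>2 \<delta>3) > 0" using d1 d2 d3 by simp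
  then obtain N1 where N1: "N1 > 0" "\<And>n. n \<ge> N1 \<Longrightarrow> mesh_less (min \<delta>1 (min \<delta>2 \<delta>3)) n (uniform_partition T n)"
    using uniform_partition_mesh[OF T] by blast
  obtain J L0 where J: "J > 0" "L0 > 0" "\<And>L. L \<ge> L0 \<Longrightarrow> prob {\<omega>\<in>space M. norm (\<Sum>k<J*L. u (uniform_partition T (J*L) k) \<omega> * E (uniform_partition T (J*L)) k \<omega>) > \<epsilon>/4} < \<epsilon>/4"
    using sum_u_E_small[OF T e4] by blast
  define L where "L = L0 + N1 + N"
  define n where "n = J * L"
  define p where "p = uniform_partition T n"
  have L: "L \<ge> L0" "L \<ge> N1" "L \<ge> N" "L > 0" using J(2) by (auto simp: L_def)
  have "L \<le> n" using J(1) by (simp add: n_def)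
  with L have n: "n \<ge> N1" "n \<ge> N" "n > 0" by auto
  have p: "is_partition T n p" using is_partition_uniform[OF T n(3)] by (simp add: p_def)
  have f: "mesh_less \<delta>1 n p" "mesh_less \<delta>2 n p" "mesh_less \<delta>3 n p"
    using N1(2)[OF n(1)] unfolding p_def by (auto intro: mesh_less_mono)
  define A where "A \<omega> = norm (Z p n \<omega>)" for \<omega>
  define B where "B \<omega> = norm (\<Sum>k<n. Z p k \<omega> * (u (p (Suc k)) \<omega> - u (p k) \<omega>))" for \<omega>
  define C where "C \<omega> = norm (\<Sum>k<n. err p k \<omega>)" for \<omega>
  define D where "D \<omega> = norm (\<Sum>k<n. u (p k) \<omega> * E p k \<omega>)" for \<omega>
  have um: "u (p k) \<in> borel_measurable M" if "k \<le> n" for k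
    by (rule u_meas[OF partition_bounds(1)[OF p that]])
  have [measurable]: "A \<in> borel_measurable M" unfolding A_def using Z_meas[OF p order_refl] by measurable
  have [measurable]: "B \<in> borel_measurable M" unfolding B_def using Z_meas[OF p] um
    by (intro measurable_compose[OF _ borel_measurable_norm] borel_measurable_sum borel_measurable_times borel_measurable_diff) auto
  have [measurable]: "C \<in> borel_measurable M" unfolding C_def using err_meas[OF p]
    by (intro measurable_compose[OF _ borel_measurable_norm] borel_measurable_sum) auto
  have [measurable]: "D \<in> borel_measurable M" unfolding D_def using E_meas[OF p] um
    by (intro measurable_compose[OF _ borel_measurable_norm] borel_measurable_sum borel_measurable_times) auto
  have key: "A \<omega> > \<epsilon>/4 \<or> (B \<omega> > \<epsilon>/4 \<or> (C \<omega> > \<epsilon>/4 \<or> D \<omega> > \<epsilon>/4))"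
    if gt: "norm (u T \<omega> * h T \<omega> - u 0 \<omega> * h 0 \<omega> - R p n \<omega>) > \<epsilon>" for \<omega>
  proof -
    have "p n = T" "p 0 = 0" using p by (auto simp: is_partition_def)
    then have "u T \<omega> * h T \<omega> - u 0 \<omega> * h 0 \<omega> - R p n \<omega> = (u T \<omega> * Z p n \<omega> + (\<Sum>k<n. u (p k) \<omega> * E p k \<omega>) - (\<Sum>k<n. Z p k \<omega> * (u (p (Suc k)) \<omega> - u (p k) \<omega>))) / 2
     + (\<Sum>k<n. err p k \<omega>)" using product_decomposition[of p n \<omega>] by simp
    also have "norm \<dots> \<le> (A \<omega> + D \<omega> + B \<omega>) / 2 + C \<omega>"
    proof (intro norm_triangle_mono)
      have "norm (u T \<omega> * Z p n \<omega> + (\<Sum>k<n. u (p k) \<omega> * E p k \<omega>) - (\<Sum>k<n. Z p k \<omega> * (u (p (Suc k)) \<omega> - u (p k) \<omega>))) \<le> A \<omega> + D \<omega> + B \<omega>"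
        unfolding B_def by (intro order_trans[OF norm_triangle_ineq4] add_right_mono order_trans[OF norm_triangle_ineq])
          (simp add: A_def D_def norm_mult)
      then show "norm ((u T \<omega> * Z p n \<omega> + (\<Sum>k<n. u (p k) \<omega> * E p k \<omega>) - (\<Sum>k<n. Z p k \<omega> * (u (p (Suc k)) \<omega> - u (p k) \<omega>))) / 2) \<le> (A \<omega> + D \<omega> + B \<omega>) / 2"
        by (simp add: norm_divide divide_right_mono)
    qed (simp add: C_def)
    finally have le: "norm (u T \<omega> * h T \<omega> - u 0 \<omega> * h 0 \<omega> - R p n \<omega>) \<le> (A \<omega> + D \<omega> + B \<omega>) / 2 + C \<omega>" .
    show ?thesis
    proof (rule ccontr)
      assume "\<not> ?thesis"
      then have "A \<omega> \<le> \<epsilon>/4" "B \<omega> \<le> \<epsilon>/4" "C \<omega> \<le> \<epsilon>/4" "D \<omega> \<le> \<epsilon>/4" by (auto simp: not_less)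
      then show False using le gt e by argo
    qed
  qed
  have "prob {\<omega>\<in>space M. norm (u T \<omega> * h T \<omega> - u 0 \<omega> * h 0 \<omega> - R p n \<omega>) > \<epsilon>} \<le>
    prob {\<omega>\<in>space M. A \<omega> > \<epsilon>/4} + prob {\<omega>\<in>space M. B \<omega> > \<epsilon>/4 \<or> (C \<omega> > \<epsilon>/4 \<or> D \<omega> > \<epsilon>/4)}"
    by (rule prob_le_add, intro AE_I2 impI key) measurable
  also have "prob {\<omega>\<in>space M. B \<omega> > \<epsilon>/4 \<or> (C \<omega> > \<epsilon>/4 \<or> D \<omega> > \<epsilon>/4)} \<le>
     prob {\<omega>\<in>space M. B \<omega> > \<epsilon>/4} + prob {\<omega>\<in>space M. C \<omega> > \<epsilon>/4 \<or> D \<omega> > \<epsilon>/4}"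
    by (rule prob_le_add, simp) measurable
  also have "prob {\<omega>\<in>space M. C \<omega> > \<epsilon>/4 \<or> D \<omega> > \<epsilon>/4} \<le> prob {\<omega>\<in>space M. C \<omega> > \<epsilon>/4} + prob {\<omega>\<in>space M. D \<omega> > \<epsilon>/4}"
    by (rule prob_le_add, simp) measurable
  finally have "prob {\<omega>\<in>space M. norm (u T \<omega> * h T \<omega> - u 0 \<omega> * h 0 \<omega> - R p n \<omega>) > \<epsilon>} < \<epsilon>"
    using d1(2)[OF p f(1)] d2(2)[OF p f(2)] d3(2)[OF p f(3)] J(3)[OF L(1)]
    unfolding A_def B_def C_def D_def p_def n_def by linarith
  then show ?thesis using n unfolding p_def by blast
qed

text \<open>A sequence with summable exceptional probabilities converges almost surely by
  Borel-Cantelli; along it the sums \<open>R\<close> converge pathwise to the ordinary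
  integral.\<close>

lemma product_formula_fixed_time:
  assumes T: "T \<ge> 0"
  shows "AE \<omega> in M. u T \<omega> * h T \<omega> = x + integral {0..T} (\<lambda>s. u s \<omega> * b (h s \<omega>))"
proof -
  define X where "X n \<omega> = u T \<omega> * h T \<omega> - u 0 \<omega> * h 0 \<omega> - R (uniform_partition T n) n \<omega>" for n \<omega>
  have "\<exists>n\<ge>j. n > 0 \<and> prob {\<omega>\<in>space M. norm (X n \<omega>) > (1/2)^j} < (1/2)^j" for j
    unfolding X_def by (rule product_remainder_small[OF T]) simp
  then obtain m where m: "\<And>j. m j \<ge> j" "\<And>j. m j > 0" "\<And>j. prob {\<omega>\<in>space M. norm (X (m j) \<omega>) > (1/2)^j} < (1/2)^j"
    by metis
  have Xm: "X n \<in> borel_measurable M" if n: "n > 0" for n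
  proof -
    define p where "p = uniform_partition T n"
    have p: "is_partition T n p" using is_partition_uniform[OF T n] by (simp add: p_def)
    have hu: "h (p k) \<in> borel_measurable M" "u (p k) \<in> borel_measurable M" if "k \<le> n" for k
      using h_meas u_meas partition_bounds(1)[OF p that] by auto
    have [measurable]: "h T \<in> borel_measurable M" "u T \<in> borel_measurable M" "h 0 \<in> borel_measurable M" "u 0 \<in> borel_measurable M"
      using h_meas u_meas T by auto
    have "R p n \<in> borel_measurable M" unfolding R_def
    proof (rule borel_measurable_sum)
      fix k assume k: "k \<in> {..<n}"
      have [measurable]: "h (p k) \<in> borel_measurable M" "u (p k) \<in> borel_measurable M" "u (p (Suc k)) \<in> borel_measurable M"
        using hu[of k] hu[of "Suc k"] k by auto
      show "(\<lambda>\<omega>. (u (p k) \<omega> + u (p (Suc k)) \<omega>) / 2 * b (h (p k) \<omega>) * of_real (p (Suc k) - p k)) \<in> borel_measurable M"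
        by measurable
    qed
    note [measurable] = this[unfolded p_def]
    show ?thesis unfolding X_def by measurable
  qed
  have "AE \<omega> in M. eventually (\<lambda>j. \<omega> \<in> space M - {\<omega>\<in>space M. norm (X (m j) \<omega>) > (1/2)^j}) sequentially"
  proof (rule borel_cantelli_AE1)
    show "{\<omega>\<in>space M. norm (X (m j) \<omega>) > (1/2)^j} \<in> events" for j using Xm[OF m(2)[of j]] by measurable
    show "summable (\<lambda>j. prob {\<omega>\<in>space M. norm (X (m j) \<omega>) > (1/2)^j})"
      by (rule summable_comparison_test'[where g = "\<lambda>j. (1/2)^j" and N = 0])
        (use m(3) in \<open>auto intro: less_imp_le summable_geometric simp del: power_divide power_one_over\<close>)
  qed (simp add: emeasure_eq_measure)
  then show ?thesis
    using h_cont u_cont h_0 W_0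
  proof eventually_elim
    case (elim \<omega>)
    have X0: "(\<lambda>j. X (m j) \<omega>) \<longlonglongrightarrow> 0"
    proof (rule tendsto_norm_zero_cancel, rule tendsto_sandwich[OF _ _ tendsto_const])
      show "\<forall>\<^sub>F j in sequentially. norm (X (m j) \<omega>) \<le> (1/2)^j"
        using elim(1) by eventually_elim (auto simp: not_less)
      show "(\<lambda>j. (1/2 :: real)^j) \<longlonglongrightarrow> 0" by (rule LIMSEQ_power_zero) simp
    qed simp
    define f where "f s = u s \<omega> * b (h s \<omega>)" for s
    have cbh: "continuous_on {0..} (\<lambda>s. b (h s \<omega>))" by (rule continuous_on_compose2[OF b_cont elim(2)]) auto
    have f: "continuous_on {0..} f" unfolding f_def by (intro continuous_intros elim(3) cbh)
    obtain B where B: "B > 0" "\<And>t. t \<in> {0..T} \<Longrightarrow> norm (b (h t \<omega>)) \<le> B"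
      using continuous_on_bounded_interval[OF cbh, of T] by auto
    have "(\<lambda>j. R (uniform_partition T (m j)) (m j) \<omega>) \<longlonglongrightarrow> integral {0..T} f"
    proof (rule LIMSEQ_I)
      fix r :: real assume r: "r > 0"
      define e where "e = r / (4 * (T + 1))"
      have e: "e > 0" "2 * e * T < r"
      proof -
        show "e > 0" using r T by (simp add: e_def)
        have "2 * e * T \<le> 2 * (e * (T + 1))" using r T by (simp add: e_def field_simps)
        also have "e * (T + 1) = r / 4" using T by (simp add: e_def field_simps)
        finally show "2 * e * T < r" using r by simp
      qed
      obtain \<delta>1 where d1: "\<delta>1 > 0" "\<And>n p v. is_partition T n p \<Longrightarrow> mesh_less \<delta>1 n p \<Longrightarrow> (\<forall>k<n. norm (v k - f (p k)) \<le> e) \<Longrightarrow>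
         norm (integral {0..T} f - (\<Sum>k<n. v k * of_real (p (Suc k) - p k))) \<le> 2 * e * T"
        using riemann_sum_fine[OF f e(1), of T] by blast
      \<comment> \<open>The averaged \<open>u\<close> differs from its left value by half an
        increment, which is multiplied by a drift of modulus at most \<open>B\<close> on this
        path.\<close>
      have "e / B > 0" using e B by simp
      then obtain \<delta>2 where d2: "\<delta>2 > 0" "\<And>n p k s. is_partition T n p \<Longrightarrow> mesh_less \<delta>2 n p \<Longrightarrow> k < n \<Longrightarrow> s \<in> {p k..p (Suc k)} \<Longrightarrow>
        dist (u s \<omega>) (u (p k) \<omega>) < e / B"
        using partition_continuous_fine[OF elim(3), of "e / B" T] by metis
      have "min \<delta>1 \<delta>2 > 0" using d1 d2 by simp
      then obtain N where N: "N > 0" "\<And>n. n \<ge> N \<Longrightarrow> mesh_less (min \<delta>1 \<delta>2) n (uniform_partition T n)"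
        using uniform_partition_mesh[OF T] by blast
      show "\<exists>no. \<forall>j\<ge>no. norm (R (uniform_partition T (m j)) (m j) \<omega> - integral {0..T} f) < r"
      proof (intro exI[of _ N] allI impI)
        fix j assume j: "j \<ge> N"
        define n where "n = m j"
        define p where "p = uniform_partition T n"
        have n: "n \<ge> N" "n > 0" using m(1)[of j] m(2)[of j] j by (auto simp: n_def)
        have p: "is_partition T n p" "mesh_less \<delta>1 n p" "mesh_less \<delta>2 n p"
          using is_partition_uniform[OF T n(2)] N(2)[OF n(1)] by (auto simp: p_def intro: mesh_less_mono)
        have "norm ((u (p k) \<omega> + u (p (Suc k)) \<omega>) / 2 * b (h (p k) \<omega>) - f (p k)) \<le> e" if k: "k < n" for k
        proof -
          have "p k \<le> p (Suc k)" using p k by (simp add: is_partition_def)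
          then have 1: "norm (u (p (Suc k)) \<omega> - u (p k) \<omega>) \<le> e / B"
            using d2(2)[OF p(1,3) k, of "p (Suc k)"] by (simp add: dist_norm)
          have 2: "norm (b (h (p k) \<omega>)) \<le> B" using B(2) partition_bounds[OF p(1), of k] k by simp
          have "(u (p k) \<omega> + u (p (Suc k)) \<omega>) / 2 * b (h (p k) \<omega>) - f (p k) = (u (p (Suc k)) \<omega> - u (p k) \<omega>) * b (h (p k) \<omega>) / 2"
            by (simp add: f_def field_simps)
          also have "norm \<dots> \<le> (e / B) * B / 2"
            unfolding norm_divide norm_mult norm_numeral using 1 2 B e by (intro divide_right_mono mult_mono) auto
          also have "\<dots> \<le> e" using B e by simp
          finally show ?thesis .
        qed
        then have "norm (integral {0..T} f - R p n \<omega>) \<le> 2 * e * T"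
          unfolding R_def by (intro d1(2)[OF p(1,2)]) auto
        then show "norm (R (uniform_partition T (m j)) (m j) \<omega> - integral {0..T} f) < r"
          using e(2) by (simp add: norm_minus_commute n_def p_def)
      qed
    qed
    then have "(\<lambda>j. X (m j) \<omega>) \<longlonglongrightarrow> u T \<omega> * h T \<omega> - u 0 \<omega> * h 0 \<omega> - integral {0..T} f"
      unfolding X_def by (intro tendsto_intros)
    then have "u T \<omega> * h T \<omega> - u 0 \<omega> * h 0 \<omega> - integral {0..T} f = 0"
      using X0 LIMSEQ_unique by blast
    then show ?case using elim(4,5) by (simp add: f_def[abs_def] u_def algebra_simps)
  qed
qed

end

section \<open>The pathwise Riccati equation\<close>

lemma continuous_integral_halfline:
  fixes f :: "real \<Rightarrow> 'b::banach"
  assumes "continuous_on {0..} f"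
  shows "continuous_on {0..} (\<lambda>t. integral {0..t} f)"
  unfolding continuous_on_eq_continuous_within
proof
  fix t :: real assume t: "t \<in> {0..}"
  have "f integrable_on {0..t+1}"
    by (intro integrable_continuous_real continuous_on_subset[OF assms]) auto
  then have "continuous_on {0..t+1} (\<lambda>t. integral {0..t} f)" by (rule indefinite_integral_continuous_1)
  then have "continuous (at t within {0..t+1}) (\<lambda>t. integral {0..t} f)"
    using t by (auto simp: continuous_on_eq_continuous_within)
  moreover have "at t within {0..t+1} = at t within {0..}"
    using t by (intro at_within_nhd[of _ "{..<t+1}"]) auto
  ultimately show "continuous (at t within {0..}) (\<lambda>t. integral {0..t} f)" by simp
qed

lemma eq_on_halfline_if_rational:
  fixes f g :: "real \<Rightarrow> 'b::t2_space"
  assumes f: "continuous_on {0..} f" and g: "continuous_on {0..} g"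
    and eq: "\<And>q. q \<in> \<rat> \<Longrightarrow> q \<ge> 0 \<Longrightarrow> f q = g q" and t: "t \<ge> 0"
  shows "f t = g t"
proof -
  have "\<exists>q\<in>\<rat>. t < q \<and> q < t + 1 / Suc n" for n by (rule Rats_dense_in_real) simp
  then obtain q where q: "\<And>n. q n \<in> \<rat>" "\<And>n. t < q n" "\<And>n. q n < t + 1 / Suc n" by metis
  have "q \<longlonglongrightarrow> t"
  proof (rule tendsto_sandwich[OF _ _ tendsto_const])
    show "(\<lambda>n. t + 1 / Suc n) \<longlonglongrightarrow> t"
      using tendsto_add[OF tendsto_const[of t] LIMSEQ_inverse_real_of_nat] by (simp add: inverse_eq_divide)
    show "\<forall>\<^sub>F n in sequentially. t \<le> q n" using q(2) by (intro eventuallyI less_imp_le)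
    show "\<forall>\<^sub>F n in sequentially. q n \<le> t + 1 / Suc n" using q(3) by (intro eventuallyI less_imp_le)
  qed
  then have "(\<lambda>n. f (q n)) \<longlonglongrightarrow> f t" "(\<lambda>n. g (q n)) \<longlonglongrightarrow> g t"
    using q(2) t by (auto intro!: continuous_on_tendsto_compose[OF f] continuous_on_tendsto_compose[OF g] eventuallyI order_trans[OF t less_imp_le])
  moreover have "f (q n) = g (q n)" for n using eq q(1,2) t by (meson less_eq_real_def order_trans)
  ultimately show ?thesis using LIMSEQ_unique by simp
qed

text \<open>The null set of the fixed-time formula depends on the time; the countably many rational
  times share one, and both sides are continuous in time.\<close>

lemma (in strat_sde) product_formula:
  "AE \<omega> in M. \<forall>t\<ge>0. u t \<omega> * h t \<omega> = x + integral {0..t} (\<lambda>s. u s \<omega> * b (h s \<omega>))"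
proof -
  have "AE \<omega> in M. \<forall>t\<in>{q\<in>\<rat>. q \<ge> 0}. u t \<omega> * h t \<omega> = x + integral {0..t} (\<lambda>s. u s \<omega> * b (h s \<omega>))"
    by (subst AE_ball_countable) (auto intro: product_formula_fixed_time countable_subset[OF _ countable_rat])
  then show ?thesis
    using h_cont u_cont
  proof eventually_elim
    case (elim \<omega>)
    have cbh: "continuous_on {0..} (\<lambda>s. b (h s \<omega>))" by (rule continuous_on_compose2[OF b_cont elim(2)]) auto
    have 1: "continuous_on {0..} (\<lambda>t. u t \<omega> * h t \<omega>)" by (intro continuous_intros elim)
    have "continuous_on {0..} (\<lambda>s. u s \<omega> * b (h s \<omega>))" by (intro continuous_intros elim cbh)
    then have 2: "continuous_on {0..} (\<lambda>t. x + integral {0..t} (\<lambda>s. u s \<omega> * b (h s \<omega>)))"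
      by (intro continuous_on_add continuous_on_const continuous_integral_halfline)
    show ?case using eq_on_halfline_if_rational[OF 1 2] elim(1) by simp
  qed
qed

lemma linear_ode_solution:
  fixes q c :: "real \<Rightarrow> real"
  assumes q: "\<And>t. t \<in> {0..T} \<Longrightarrow> (q has_vector_derivative c t * q t) (at t within {0..T})"
    and c: "continuous_on {0..T} c" and T: "T \<ge> 0"
  shows "q T = q 0 * exp (integral {0..T} c)"
proof -
  define C where "C t = integral {0..t} c" for t
  have C: "(C has_vector_derivative c t) (at t within {0..T})" if "t \<in> {0..T}" for t
    unfolding C_def by (rule integral_has_vector_derivative[OF c that])
  have "((\<lambda>t. q t * exp (- C t)) has_real_derivative 0) (at t within {0..T})" if t: "t \<in> {0..T}" for t
  proof -
    have 1: "(q has_real_derivative c t * q t) (at t within {0..T})" "(C has_real_derivative c t) (at t within {0..T})"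
      using q[OF t] C[OF t] by (auto simp: has_real_derivative_iff_has_vector_derivative)
    show ?thesis by (rule derivative_eq_intros 1 refl)+ (simp add: algebra_simps)
  qed
  then have "((\<lambda>t. q t * exp (- C t)) has_vector_derivative 0) (at t within {0..T})" if t: "t \<in> {0..T}" for t
    using t by (simp add: has_real_derivative_iff_has_vector_derivative)
  then obtain k where k: "\<And>t. t \<in> {0..T} \<Longrightarrow> q t * exp (- C t) = k"
    using has_vector_derivative_zero_constant[of "{0..T}" "\<lambda>t. q t * exp (- C t)"] by auto
  have "q T * exp (- C T) = q 0" using k[of T] k[of 0] T by (simp add: C_def)
  then show ?thesis by (simp add: C_def exp_minus field_simps)
qed

lemma inner_complex_Re_cnj: "z \<bullet> w = Re (cnj z * w)" for z w :: complex
  by (simp add: inner_complex_def)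

text \<open>One path with the randomness frozen. The rotation \<open>u\<close> may be any continuous
  path of modulus 1 starting at 1, so the consequences are deterministic statements, valid for
  almost every \<omega>.\<close>

locale riccati_path =
  fixes K :: real and x :: complex and u h :: "real \<Rightarrow> complex"
  assumes u_cont: "continuous_on {0..} u" and u_norm: "\<And>t. norm (u t) = 1" and u_0: "u 0 = 1"
    and h_cont: "continuous_on {0..} h" and K: "K > 0"
    and eq: "\<And>t. t \<ge> 0 \<Longrightarrow> u t * h t = x + integral {0..t} (\<lambda>s. u s * (of_real K * (1 - (h s)\<^sup>2)))"
begin

lemma h_0: "h 0 = x"
  using eq[of 0] u_0 by simp

lemma rhs_cont: "continuous_on {0..} (\<lambda>s. u s * (of_real K * (1 - (h s)\<^sup>2)))"
  by (intro continuous_intros u_cont h_cont)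

lemma g_deriv:
  assumes t: "t \<in> {0..T}"
  shows "((\<lambda>t. u t * h t) has_vector_derivative u t * (of_real K * (1 - (h t)\<^sup>2))) (at t within {0..T})"
proof -
  have "((\<lambda>t. x + integral {0..t} (\<lambda>s. u s * (of_real K * (1 - (h s)\<^sup>2)))) has_vector_derivative u t * (of_real K * (1 - (h t)\<^sup>2))) (at t within {0..T})"
    using integral_has_vector_derivative[OF continuous_on_subset[OF rhs_cont] t] by (auto intro!: derivative_eq_intros)
  from has_vector_derivative_transform[OF t _ this] show ?thesis using eq by auto
qed

lemma u_cnj: "cnj (u t) * u t = 1"
  using u_norm[of t] by (simp add: complex_norm_square[symmetric] mult.commute)

text \<open>Because Re(cnj(h)(1 - h^2)) = Re(h)(1 - |h|^2), the defect 1 - |h|^2 solves a linear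
  homogeneous equation with coefficient -2 K Re h. It keeps its sign and vanishes at all times or at
  none, which gives the invariance of all three sets.\<close>

lemma defect_formula:
  assumes T: "T \<ge> 0"
  shows "1 - (norm (h T))\<^sup>2 = (1 - (norm x)\<^sup>2) * exp (- 2 * K * integral {0..T} (\<lambda>s. Re (h s)))"
proof -
  define q where "q t = 1 - (norm (u t * h t))\<^sup>2" for t
  have q': "q t = 1 - (norm (h t))\<^sup>2" for t by (simp add: q_def norm_mult u_norm)
  have "q T = q 0 * exp (integral {0..T} (\<lambda>s. - 2 * K * Re (h s)))"
  proof (rule linear_ode_solution[OF _ _ T])
    show "continuous_on {0..T} (\<lambda>s. - 2 * K * Re (h s))"
      by (intro continuous_intros continuous_on_subset[OF h_cont]) auto
    fix t assume t: "t \<in> {0..T}"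
    let ?g' = "u t * (of_real K * (1 - (h t)\<^sup>2))"
    have "((\<lambda>t. (u t * h t) \<bullet> (u t * h t)) has_vector_derivative (u t * h t) \<bullet> ?g' + ?g' \<bullet> (u t * h t)) (at t within {0..T})"
      by (rule bounded_bilinear.has_vector_derivative[OF bounded_bilinear_inner g_deriv[OF t] g_deriv[OF t]])
    then have d: "(q has_vector_derivative - 2 * ((u t * h t) \<bullet> ?g')) (at t within {0..T})"
      unfolding q_def power2_norm_eq_inner by (auto intro!: derivative_eq_intros simp: inner_commute)
    have "(u t * h t) \<bullet> ?g' = Re (cnj (u t * h t) * ?g')" by (rule inner_complex_Re_cnj)
    also have "cnj (u t * h t) * ?g' = (cnj (u t) * u t) * (of_real K * (cnj (h t) * (1 - (h t)\<^sup>2)))"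
      by (simp add: algebra_simps)
    also have "\<dots> = of_real K * (cnj (h t) - (cnj (h t) * h t) * h t)" unfolding u_cnj by (simp add: algebra_simps power2_eq_square)
    also have "cnj (h t) * h t = of_real ((norm (h t))\<^sup>2)" by (subst mult.commute) (rule complex_norm_square[symmetric])
    also have "Re (of_real K * (cnj (h t) - of_real ((norm (h t))\<^sup>2) * h t)) = K * Re (h t) * q t"
      by (simp add: q' algebra_simps del: of_real_power)
    finally show "(q has_vector_derivative - 2 * K * Re (h t) * q t) (at t within {0..T})" using d by (simp add: mult.assoc)
  qed
  then show ?thesis by (simp add: q' h_0)
qed

lemma norm_le_1: "norm x \<le> 1 \<Longrightarrow> t \<ge> 0 \<Longrightarrow> norm (h t) \<le> 1"
  using defect_formula[of t] by (smt (verit) exp_ge_zero mult_nonneg_nonneg norm_ge_zero power_le_one_iff power2_le_imp_le power_one abs_le_square_iff abs_norm_cancel one_power2)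

lemma norm_less_1:
  assumes "norm x < 1" "t \<ge> 0" shows "norm (h t) < 1"
proof -
  have "(norm x)\<^sup>2 < 1" using assms by (simp add: abs_square_less_1)
  then have "1 - (norm (h t))\<^sup>2 > 0" unfolding defect_formula[OF assms(2)] by (intro mult_pos_pos) auto
  then show ?thesis using abs_square_less_1[of "norm (h t)"] by simp
qed

lemma norm_eq_1: "norm x = 1 \<Longrightarrow> t \<ge> 0 \<Longrightarrow> norm (h t) = 1"
  using defect_formula[of t] power2_eq_1_iff[of "norm (h t)"] norm_ge_zero[of "h t"] by (auto simp del: norm_ge_zero)

lemma g_lipschitz:
  assumes x: "norm x \<le> 1" and st: "0 \<le> s" "s \<le> t"
  shows "norm (u t * h t - u s * h s) \<le> 2 * K * (t - s)"
proof -
  let ?f = "\<lambda>s. u s * (of_real K * (1 - (h s)\<^sup>2))"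
  have "?f integrable_on {0..t}" by (intro integrable_continuous_real continuous_on_subset[OF rhs_cont]) auto
  from Henstock_Kurzweil_Integration.integral_combine[OF st this]
  have "u t * h t - u s * h s = integral {s..t} ?f"
    using eq[of t] eq[of s] st by (simp add: algebra_simps)
  also have "norm \<dots> \<le> 2 * K * (t - s)"
  proof (rule integral_bound[OF st(2)])
    show "continuous_on {s..t} ?f" by (rule continuous_on_subset[OF rhs_cont]) (use st in auto)
    show "norm (?f r) \<le> 2 * K" if "r \<in> {s..t}" for r
    proof -
      have "norm (1 - (h r)\<^sup>2) \<le> 1 + (norm (h r))\<^sup>2" by (metis norm_triangle_ineq4 norm_one norm_power)
      also have "\<dots> \<le> 2" using norm_le_1[OF x, of r] that st by (simp add: power_le_one)
      finally have "K * norm (1 - (h r)\<^sup>2) \<le> K * 2" using K by (intro mult_left_mono) auto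
      then show ?thesis using K by (simp add: norm_mult u_norm mult.commute)
    qed
  qed
  finally show ?thesis .
qed

end

text \<open>For a common rotation the derivative of u (h1 - h2) is -K (h1 + h2) u (h1 - h2), so the
  squared distance solves a linear equation whose coefficient is at most 4 K in modulus on the disc.
  What results is Lipschitz dependence on the starting point, with a constant that grows in
  time.\<close>

lemma riccati_contraction:
  assumes 1: "riccati_path K x u h1" and 2: "riccati_path K y u h2" and xy: "norm x \<le> 1" "norm y \<le> 1" and T: "T \<ge> 0"
  shows "norm (h1 T - h2 T) \<le> norm (x - y) * exp (2 * K * T)"
proof -
  interpret A: riccati_path K x u h1 by (rule 1)
  interpret B: riccati_path K y u h2 by (rule 2)
  define q where "q t = (norm (u t * h1 t - u t * h2 t))\<^sup>2" for t
  have q': "q t = (norm (h1 t - h2 t))\<^sup>2" for t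
    by (simp add: q_def norm_mult A.u_norm flip: right_diff_distrib)
  define c where "c t = - 2 * K * Re (h1 t + h2 t)" for t
  have c: "continuous_on {0..T} c" unfolding c_def
    by (intro continuous_intros continuous_on_subset[OF A.h_cont] continuous_on_subset[OF B.h_cont]) auto
  have "q T = q 0 * exp (integral {0..T} c)"
  proof (rule linear_ode_solution[OF _ c T])
    fix t assume t: "t \<in> {0..T}"
    let ?D = "u t * h1 t - u t * h2 t"
    let ?g' = "u t * (of_real K * (1 - (h1 t)\<^sup>2)) - u t * (of_real K * (1 - (h2 t)\<^sup>2))"
    have D: "((\<lambda>t. u t * h1 t - u t * h2 t) has_vector_derivative ?g') (at t within {0..T})"
      by (rule has_vector_derivative_diff[OF A.g_deriv[OF t] B.g_deriv[OF t]])
    have "((\<lambda>t. (u t * h1 t - u t * h2 t) \<bullet> (u t * h1 t - u t * h2 t)) has_vector_derivative ?D \<bullet> ?g' + ?g' \<bullet> ?D) (at t within {0..T})"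
      by (rule bounded_bilinear.has_vector_derivative[OF bounded_bilinear_inner D D])
    then have d: "(q has_vector_derivative 2 * (?D \<bullet> ?g')) (at t within {0..T})"
      unfolding q_def power2_norm_eq_inner by (simp add: inner_commute)
    have "?D \<bullet> ?g' = Re (cnj ?D * ?g')" by (rule inner_complex_Re_cnj)
    also have "cnj ?D * ?g' = cnj ?D * (- (of_real K * (h1 t + h2 t)) * ?D)"
      by (rule arg_cong[where f = "\<lambda>z. cnj ?D * z"]) (simp add: algebra_simps power2_eq_square)
    also have "\<dots> = - (of_real K * (h1 t + h2 t)) * (?D * cnj ?D)" by (simp only: mult_ac)
    also have "?D * cnj ?D = of_real (q t)" unfolding q_def by (rule complex_norm_square[symmetric])
    also have "Re (- (of_real K * (h1 t + h2 t)) * of_real (q t)) = c t * q t / 2" by (simp add: c_def)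
    finally show "(q has_vector_derivative c t * q t) (at t within {0..T})" using d by (simp only: mult_2 field_sum_of_halves)
  qed
  also have "integral {0..T} c \<le> 4 * K * T"
  proof -
    have "norm (integral {0..T} c) \<le> 4 * K * (T - 0)"
    proof (rule integral_bound[OF T c])
      fix t assume "t \<in> {0..T}"
      then have "norm (h1 t) \<le> 1" "norm (h2 t) \<le> 1" using A.norm_le_1[OF xy(1)] B.norm_le_1[OF xy(2)] by auto
      then have "\<bar>Re (h1 t + h2 t)\<bar> \<le> 2"
        using abs_Re_le_cmod[of "h1 t"] abs_Re_le_cmod[of "h2 t"] by simp
      then have "K * \<bar>Re (h1 t + h2 t)\<bar> \<le> K * 2" using A.K by (intro mult_left_mono) auto
      then show "norm (c t) \<le> 4 * K" using A.K by (simp add: c_def abs_mult)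
    qed
    then show ?thesis by simp
  qed
  finally have "(norm (h1 T - h2 T))\<^sup>2 \<le> (norm (x - y))\<^sup>2 * exp (4 * K * T)"
    by (simp add: q' A.h_0 B.h_0 mult_left_mono)
  also have "\<dots> = (norm (x - y) * exp (2 * K * T))\<^sup>2"
    by (simp add: power_mult_distrib power2_eq_square flip: exp_add)
  finally show ?thesis by (rule power2_le_imp_le) simp
qed

section \<open>Moments of the solution\<close>

lemma has_vector_derivative_iff_quotient:
  fixes f :: "real \<Rightarrow> 'b::real_normed_vector"
  shows "(f has_vector_derivative D) (at x within S) \<longleftrightarrow> ((\<lambda>y. (f y - f x) /\<^sub>R (y - x)) \<longlongrightarrow> D) (at x within S)"
proof -
  have eq: "norm ((f y - f x) /\<^sub>R (y - x) - D) = norm ((1 / norm (y - x)) *\<^sub>R (f y - (f x + (y - x) *\<^sub>R D)))" if "y \<noteq> x" for y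
  proof -
    have "(f y - f x) /\<^sub>R (y - x) - D = (1 / (y - x)) *\<^sub>R ((f y - f x) - (y - x) *\<^sub>R D)"
      using that unfolding scaleR_right_diff_distrib[of "1 / (y - x)" "f y - f x"] by (simp add: divide_inverse)
    then show ?thesis by (simp add: diff_diff_eq)
  qed
  have "((\<lambda>y. (f y - f x) /\<^sub>R (y - x)) \<longlongrightarrow> D) (at x within S) \<longleftrightarrow>
    ((\<lambda>y. norm ((f y - f x) /\<^sub>R (y - x) - D)) \<longlongrightarrow> 0) (at x within S)"
    by (simp add: tendsto_norm_zero_iff LIM_zero_iff)
  also have "\<dots> \<longleftrightarrow> ((\<lambda>y. norm ((1 / norm (y - x)) *\<^sub>R (f y - (f x + (y - x) *\<^sub>R D)))) \<longlongrightarrow> 0) (at x within S)"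
    using eq by (intro filterlim_cong refl) (auto simp: eventually_at_filter)
  finally show ?thesis
    unfolding has_vector_derivative_def has_derivative_within tendsto_norm_zero_iff
    by (simp add: bounded_linear_scaleR_left)
qed

lemma difference_quotient_swap:
  fixes A B :: "'b::real_vector"
  shows "(A - B) /\<^sub>R (p - r) = (B - A) /\<^sub>R (r - p)"
proof -
  have "inverse (p - r) = - inverse (r - p)" by (metis inverse_minus_eq minus_diff_eq)
  then have "(A - B) /\<^sub>R (p - r) = (- inverse (r - p)) *\<^sub>R (- (B - A))" by simp
  also have "\<dots> = (B - A) /\<^sub>R (r - p)" by (simp only: scaleR_minus_left scaleR_minus_right minus_minus)
  finally show ?thesis .
qed

text \<open>Radial retraction of the plane onto the closed disc. Solutions are given only for
  starting points in the disc; composing with \<open>proj\<close> makes \<open>h (proj x)\<close>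
  meaningful for every \<open>x\<close>, so that kernels can live on the whole plane.\<close>

definition proj :: "complex \<Rightarrow> complex" where
  "proj z = z /\<^sub>R max 1 (norm z)"

lemma proj_in: "proj z \<in> cball 0 1"
  by (auto simp: proj_def field_simps max_def)

lemma proj_id: "z \<in> cball 0 1 \<Longrightarrow> proj z = z"
  by (simp add: proj_def max_def)

lemma proj_cont: "continuous_on UNIV proj"
  unfolding proj_def by (intro continuous_intros) auto

text \<open>On the circle, h = exp(i \<theta>) turns the equation into d\<theta> = -2 K sin \<theta>
  dt + sqrt 2 \<epsilon> dW, a noisy Adler equation. Solutions from different starting points share
  the probability space and \<open>W\<close>.\<close>

locale adler = bm_space +
  fixes h :: "complex \<Rightarrow> real \<Rightarrow> 'a \<Rightarrow> complex" and K \<epsilon> :: real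
  assumes K0: "K > 0" and e0: "\<epsilon> > 0"
    and sol: "\<And>x. x \<in> cball 0 1 \<Longrightarrow>
           stratonovich_solution M F W
             (\<lambda>z. of_real K * (1 - z\<^sup>2)) (\<lambda>z. of_real (sqrt 2) * \<i> * of_real \<epsilon> * z) x (h x)"
begin

definition U :: "real \<Rightarrow> 'a \<Rightarrow> complex" where
  "U t \<omega> = exp (- (\<i> * of_real (sqrt 2 * \<epsilon> * W t \<omega>)))"

lemma strat_sde_solution:
  assumes x: "x \<in> cball 0 1"
  shows "\<exists>S. strat_sde M F W (h x) S (\<lambda>z. of_real K * (1 - z\<^sup>2)) (sqrt 2 * \<epsilon>) x"
proof -
  from sol[OF x] obtain S where s: "complex_continuous_semimartingale M F (h x)" "AE \<omega> in M. h x 0 \<omega> = x"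
    "has_stratonovich_integral M (\<lambda>t \<omega>. of_real (sqrt 2) * \<i> * of_real \<epsilon> * h x t \<omega>) W S"
    "AE \<omega> in M. \<forall>t\<ge>0. h x t \<omega> = x + integral {0..t} (\<lambda>s. of_real K * (1 - (h x s \<omega>)\<^sup>2)) + S t \<omega>"
    unfolding stratonovich_solution_def by auto
  have eq: "(\<lambda>t \<omega>. of_real (sqrt 2) * \<i> * of_real \<epsilon> * h x t \<omega>) = (\<lambda>t \<omega>. \<i> * of_real (sqrt 2 * \<epsilon>) * h x t \<omega>)"
    by (intro ext) (simp add: mult_ac)
  show ?thesis
  proof (intro exI[of _ S] strat_sde.intro bm_space_axioms strat_sde_axioms.intro)
    show "continuous_on UNIV (\<lambda>z. complex_of_real K * (1 - z\<^sup>2))" by (intro continuous_intros)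
  qed (use s eq in auto)
qed

lemma h_adapted: "x \<in> cball 0 1 \<Longrightarrow> t \<ge> 0 \<Longrightarrow> h x t \<in> borel_measurable (F t)"
  using strat_sde_solution strat_sde.h_adapted by blast

lemma h_meas: "x \<in> cball 0 1 \<Longrightarrow> t \<ge> 0 \<Longrightarrow> h x t \<in> borel_measurable M"
  using h_adapted meas_F_M by blast

lemma U_adapted: "t \<ge> 0 \<Longrightarrow> U t \<in> borel_measurable (F t)"
  using W_adapted[of t] unfolding U_def by measurable

lemma U_meas: "t \<ge> 0 \<Longrightarrow> U t \<in> borel_measurable M"
  using U_adapted meas_F_M by blast

lemma U_norm[simp]: "norm (U t \<omega>) = 1"
  by (simp add: U_def norm_exp_eq_Re)

lemma path:
  assumes x: "x \<in> cball 0 1"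
  shows "AE \<omega> in M. riccati_path K x (\<lambda>t. U t \<omega>) (\<lambda>t. h x t \<omega>)"
proof -
  obtain S where "strat_sde M F W (h x) S (\<lambda>z. of_real K * (1 - z\<^sup>2)) (sqrt 2 * \<epsilon>) x"
    using strat_sde_solution[OF x] by blast
  then interpret S: strat_sde M F W "h x" S "\<lambda>z. of_real K * (1 - z\<^sup>2)" "sqrt 2 * \<epsilon>" x .
  have u: "S.u t \<omega> = U t \<omega>" for t \<omega> by (simp add: S.u_def U_def)
  show ?thesis
    using S.product_formula S.h_cont S.u_cont W_0
  proof eventually_elim
    case (elim \<omega>)
    then show ?case unfolding u by unfold_locales (use K0 in \<open>auto simp: U_def norm_exp_eq_Re\<close>)
  qed
qed

lemma h_norm_le_1: "x \<in> cball 0 1 \<Longrightarrow> t \<ge> 0 \<Longrightarrow> AE \<omega> in M. norm (h x t \<omega>) \<le> 1"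
  by (rule AE_mp[OF path]) (auto intro!: AE_I2 riccati_path.norm_le_1)

lemma h_in_ball: "x \<in> ball 0 1 \<Longrightarrow> t \<ge> 0 \<Longrightarrow> AE \<omega> in M. h x t \<omega> \<in> ball 0 1"
  by (rule AE_mp[OF path, of x]) (auto intro!: AE_I2 riccati_path.norm_less_1)

lemma h_in_sphere: "x \<in> sphere 0 1 \<Longrightarrow> t \<ge> 0 \<Longrightarrow> AE \<omega> in M. h x t \<omega> \<in> sphere 0 1"
  by (rule AE_mp[OF path, of x]) (auto intro!: AE_I2 riccati_path.norm_eq_1)

lemma h_lipschitz:
  assumes "x \<in> cball 0 1" "y \<in> cball 0 1" "t \<ge> 0"
  shows "AE \<omega> in M. norm (h x t \<omega> - h y t \<omega>) \<le> norm (x - y) * exp (2 * K * t)"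
  using path[OF assms(1)] path[OF assms(2)]
proof eventually_elim
  case (elim \<omega>)
  show ?case by (rule riccati_contraction[OF elim]) (use assms in auto)
qed

definition moment :: "nat \<Rightarrow> complex \<Rightarrow> real \<Rightarrow> complex" where
  "moment n x t = expectation (\<lambda>\<omega>. (h x t \<omega>) ^ n)"

lemma h_power_integrable:
  assumes "x \<in> cball 0 1" "t \<ge> 0"
  shows "integrable M (\<lambda>\<omega>. (h x t \<omega>) ^ n)"
  using h_norm_le_1[OF assms] h_meas[OF assms]
  by (intro integrable_const_bound[where B = 1]) (auto elim!: eventually_mono simp: norm_power power_le_one)

lemma moment_bound:
  assumes "x \<in> cball 0 1" "t \<ge> 0"
  shows "norm (moment n x t) \<le> 1"
proof -
  have "norm (moment n x t) \<le> expectation (\<lambda>\<omega>. norm ((h x t \<omega>) ^ n))"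
    unfolding moment_def by (rule integral_norm_bound)
  also have "\<dots> \<le> expectation (\<lambda>\<omega>. 1)"
    using h_norm_le_1[OF assms]
    by (intro integral_mono_AE integrable_norm h_power_integrable assms integrable_const)
      (auto elim!: eventually_mono simp: norm_power power_le_one)
  finally show ?thesis by (simp add: prob_space)
qed

lemma moment_0: "moment 0 x t = 1"
  by (simp add: moment_def prob_space)

lemma moment_start:
  assumes "x \<in> cball 0 1" shows "moment n x 0 = x ^ n"
proof -
  have "moment n x 0 = expectation (\<lambda>\<omega>. x ^ n)" unfolding moment_def
  proof (rule integral_cong_AE)
    show "AE \<omega> in M. (h x 0 \<omega>) ^ n = x ^ n"
      using path[OF assms] by eventually_elim (drule riccati_path.h_0, simp)
  qed (use h_meas[OF assms] in auto)
  then show ?thesis by (simp add: prob_space)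
qed

lemma moment_tendsto:
  assumes x: "x \<in> cball 0 1" and t: "t \<ge> 0" and s: "\<And>j. s j \<ge> 0" "s \<longlonglongrightarrow> t"
  shows "(\<lambda>j. moment n x (s j)) \<longlonglongrightarrow> moment n x t"
  unfolding moment_def
proof (rule integral_dominated_convergence[where w = "\<lambda>_. 1"])
  show "AE \<omega> in M. (\<lambda>j. (h x (s j) \<omega>) ^ n) \<longlonglongrightarrow> (h x t \<omega>) ^ n"
    using path[OF x]
  proof eventually_elim
    case (elim \<omega>)
    show ?case
      using s t by (intro tendsto_power continuous_on_tendsto_compose[OF riccati_path.h_cont[OF elim]]) auto
  qed
  show "AE \<omega> in M. norm ((h x (s j) \<omega>) ^ n) \<le> 1" for j
    using h_norm_le_1[OF x s(1)[of j]] by eventually_elim (simp add: norm_power power_le_one)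
qed (use h_meas[OF x] t s in auto)

text \<open>Takes the place of Ito's formula. In h(t)^n = cnj(U(t))^n (U(t) h(t))^n the second
  factor is Lipschitz in time, and its increment forms the first term. In the rest, (cnj(U(t))
  U(s))^n is a function of the Brownian increment, hence independent of h(s), with mean
  exp(-\<epsilon>^2 n^2 (t - s)); the rate is half the square of the frequency sqrt 2 \<epsilon>
  n.\<close>

lemma moment_increment:
  assumes x: "x \<in> cball 0 1" and st: "0 \<le> s" "s \<le> t"
  shows "moment n x t - moment n x s = expectation (\<lambda>\<omega>. cnj (U t \<omega>) ^ n * ((U t \<omega> * h x t \<omega>) ^ n - (U s \<omega> * h x s \<omega>) ^ n))
    + of_real (exp (- (\<epsilon>\<^sup>2 * (real n)\<^sup>2 * (t - s))) - 1) * moment n x s"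
proof -
  have t: "0 \<le> t" using st by simp
  define y where "y = sqrt 2 * \<epsilon> * real n"
  define \<phi> where "\<phi> d = exp (\<i> * of_real (y * d))" for d :: real
  note [measurable] = h_meas[OF x t] h_meas[OF x st(1)] U_meas[OF t] U_meas[OF st(1)] W_meas[OF t] W_meas[OF st(1)]
  have UU: "cnj (U t \<omega>) * U t \<omega> = 1" for t \<omega>
    using U_norm[of t \<omega>] by (simp add: complex_norm_square[symmetric] mult.commute del: U_norm)
  have e1: "cnj (U t \<omega>) ^ n * (U t \<omega> * h x t \<omega>) ^ n = (h x t \<omega>) ^ n" for \<omega>
    unfolding power_mult_distrib[symmetric] mult.assoc[symmetric] UU by simp
  have e2: "cnj (U t \<omega>) ^ n * (U s \<omega> * h x s \<omega>) ^ n = (h x s \<omega>) ^ n * \<phi> (W t \<omega> - W s \<omega>)" for \<omega>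
  proof -
    have "cnj (U t \<omega>) * U s \<omega> = exp (\<i> * of_real (sqrt 2 * \<epsilon> * (W t \<omega> - W s \<omega>)))"
      by (simp add: U_def exp_cnj algebra_simps flip: exp_add)
    then have "(cnj (U t \<omega>) * U s \<omega>) ^ n = \<phi> (W t \<omega> - W s \<omega>)"
      by (simp add: \<phi>_def y_def algebra_simps flip: exp_of_nat_mult)
    then show ?thesis unfolding power_mult_distrib[symmetric] mult.assoc[symmetric] by (simp add: power_mult_distrib mult.commute)
  qed
  have \<phi>moment: "\<phi> \<in> borel_measurable borel" unfolding \<phi>_def by measurable
  have \<phi>i: "integrable M (\<lambda>\<omega>. \<phi> (W t \<omega> - W s \<omega>))"
    by (rule integrable_const_bound[where B = 1]) (auto simp: \<phi>_def norm_exp_eq_Re)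
  have hF: "(\<lambda>\<omega>. (h x s \<omega>) ^ n) \<in> borel_measurable (F s)" using h_adapted[OF x st(1)] by measurable
  note I = W_indep_integral[OF st hF h_power_integrable[OF x st(1)] \<phi>moment \<phi>i]
  have E\<phi>: "expectation (\<lambda>\<omega>. \<phi> (W t \<omega> - W s \<omega>)) = of_real (exp (- (\<epsilon>\<^sup>2 * (real n)\<^sup>2 * (t - s))))"
    unfolding \<phi>_def W_char[OF st] by (simp add: y_def power_mult_distrib)
  have "expectation (\<lambda>\<omega>. cnj (U t \<omega>) ^ n * ((U t \<omega> * h x t \<omega>) ^ n - (U s \<omega> * h x s \<omega>) ^ n)) =
    moment n x t - of_real (exp (- (\<epsilon>\<^sup>2 * (real n)\<^sup>2 * (t - s)))) * moment n x s"
    unfolding right_diff_distrib e1 e2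
      Bochner_Integration.integral_diff[OF h_power_integrable[OF x t] I(1)] I(2) E\<phi>
    by (simp only: moment_def mult.commute)
  then show ?thesis by (simp add: algebra_simps)
qed

text \<open>The first term of \<open>moment_increment\<close> is differentiated pathwise under a
  constant bound; rotating back by cnj(U)^n turns the derivative of (U h)^n into n K (h^(n-1) -
  h^(n+1)). The second term is an explicit exponential.\<close>

lemma moment_deriv:
  assumes x: "x \<in> cball 0 1" and t: "t \<ge> 0"
  shows "(moment (Suc k) x has_vector_derivative
     of_real (real (Suc k) * K) * (moment k x t - moment (Suc (Suc k)) x t) - of_real (\<epsilon>\<^sup>2 * (real (Suc k))\<^sup>2) * moment (Suc k) x t) (at t within {0..})"
  unfolding has_vector_derivative_iff_quotient tendsto_at_iff_sequentially comp_def
proof (intro allI impI)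
  fix q :: "nat \<Rightarrow> real" assume q: "\<forall>j. q j \<in> {0..} - {t}" "q \<longlonglongrightarrow> t"
  define n where "n = Suc k"
  \<comment> \<open>The increment formula runs forward in time, so each quotient is taken over the
    interval between \<open>q j\<close> and \<open>t\<close> in increasing order; this covers both
    sides of \<open>t\<close>.\<close>
  define s where "s j = min (q j) t" for j
  define \<tau> where "\<tau> j = max (q j) t" for j
  define l where "l = \<epsilon>\<^sup>2 * (real n)\<^sup>2"
  have q0: "q j \<ge> 0" "q j \<noteq> t" for j using q by auto
  have s: "0 \<le> s j" "s j \<le> \<tau> j" "s j < \<tau> j" "0 \<le> \<tau> j" for j using q0[of j] t by (auto simp: s_def \<tau>_def)
  have sl: "s \<longlonglongrightarrow> t" "\<tau> \<longlonglongrightarrow> t" unfolding s_def \<tau>_def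
    using tendsto_min[OF q(2) tendsto_const[of t]] tendsto_max[OF q(2) tendsto_const[of t]] by simp_all
  define G where "G r \<omega> = (U r \<omega> * h x r \<omega>) ^ n" for r \<omega>
  define Q where "Q j \<omega> = cnj (U (\<tau> j) \<omega>) ^ n * ((G (\<tau> j) \<omega> - G (s j) \<omega>) /\<^sub>R (\<tau> j - s j))" for j \<omega>
  have GM: "G r \<in> borel_measurable M" if "r \<ge> 0" for r
    unfolding G_def using h_meas[OF x that] U_meas[OF that] by measurable
  have QM: "Q j \<in> borel_measurable M" for j
    unfolding Q_def using GM[OF s(1)] GM[OF s(4)] U_meas[OF s(4)] by measurable
  have quot: "(moment n x (q j) - moment n x t) /\<^sub>R (q j - t) = expectation (Q j) + of_real ((exp (- (l * (\<tau> j - s j))) - 1) / (\<tau> j - s j)) * moment n x (s j)" for j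
  proof -
    have "(moment n x (q j) - moment n x t) /\<^sub>R (q j - t) = (moment n x (\<tau> j) - moment n x (s j)) /\<^sub>R (\<tau> j - s j)"
    proof (cases "q j \<le> t")
      case True
      then have "s j = q j" "\<tau> j = t" by (auto simp: s_def \<tau>_def)
      then show ?thesis using difference_quotient_swap by metis
    next
      case False
      then show ?thesis by (simp add: s_def \<tau>_def)
    qed
    also have "\<dots> = expectation (\<lambda>\<omega>. cnj (U (\<tau> j) \<omega>) ^ n * (G (\<tau> j) \<omega> - G (s j) \<omega>)) /\<^sub>R (\<tau> j - s j) +
        of_real ((exp (- (l * (\<tau> j - s j))) - 1) / (\<tau> j - s j)) * moment n x (s j)"
      unfolding moment_increment[OF x s(1,2)] G_def l_def
      by (simp add: scaleR_conv_of_real divide_inverse distrib_left mult_ac)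
    also have "expectation (\<lambda>\<omega>. cnj (U (\<tau> j) \<omega>) ^ n * (G (\<tau> j) \<omega> - G (s j) \<omega>)) /\<^sub>R (\<tau> j - s j) = expectation (Q j)"
      unfolding Q_def mult_scaleR_right by (rule integral_scaleR_right[symmetric])
    finally show ?thesis .
  qed
  define D where "D \<omega> = of_real (real n * K) * ((h x t \<omega>) ^ k - (h x t \<omega>) ^ Suc (Suc k))" for \<omega>
  have ED: "expectation D = of_real (real n * K) * (moment k x t - moment (Suc (Suc k)) x t)"
    unfolding D_def moment_def using h_power_integrable[OF x t]
    by (simp del: power_Suc of_real_mult of_nat_Suc)
  have lim1: "(\<lambda>j. expectation (Q j)) \<longlonglongrightarrow> expectation D"
  proof (rule integral_dominated_convergence[where w = "\<lambda>_. real n * (2 * K)"])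
    show "AE \<omega> in M. norm (Q j \<omega>) \<le> real n * (2 * K)" for j
      using path[OF x]
    proof eventually_elim
      case (elim \<omega>)
      then interpret R: riccati_path K x "\<lambda>t. U t \<omega>" "\<lambda>t. h x t \<omega>" .
      have x1: "norm x \<le> 1" using x by simp
      have "norm (G (\<tau> j) \<omega> - G (s j) \<omega>) \<le> real n * norm (U (\<tau> j) \<omega> * h x (\<tau> j) \<omega> - U (s j) \<omega> * h x (s j) \<omega>)"
        unfolding G_def by (rule norm_power_diff) (use R.norm_le_1[OF x1] s in \<open>auto simp: norm_mult\<close>)
      also have "\<dots> \<le> real n * (2 * K * (\<tau> j - s j))"
        by (intro mult_left_mono R.g_lipschitz[OF x1 s(1,2)]) auto
      finally have "norm (G (\<tau> j) \<omega> - G (s j) \<omega>) / (\<tau> j - s j) \<le> real n * (2 * K)"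
        using s(3)[of j] by (simp add: divide_le_eq mult.assoc)
      then show ?case using s(3)[of j] by (simp add: Q_def norm_mult norm_power divide_inverse mult.commute)
    qed
    show "AE \<omega> in M. (\<lambda>j. Q j \<omega>) \<longlonglongrightarrow> D \<omega>"
      using path[OF x]
    proof eventually_elim
      case (elim \<omega>)
      then interpret R: riccati_path K x "\<lambda>t. U t \<omega>" "\<lambda>t. h x t \<omega>" .
      let ?g' = "U t \<omega> * (of_real K * (1 - (h x t \<omega>)\<^sup>2))"
      have "((\<lambda>r. U r \<omega> * h x r \<omega>) has_vector_derivative ?g') (at t within {0..t+1})"
        using R.g_deriv[of t "t+1"] t by simp
      moreover have "at t within {0..t+1} = at t within {0..}"
        using t by (intro at_within_nhd[of _ "{..<t+1}"]) auto
      ultimately have g: "((\<lambda>r. U r \<omega> * h x r \<omega>) has_vector_derivative ?g') (at t within {0..})" by simp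
      have pw: "((\<lambda>z. z ^ n) has_field_derivative of_nat n * (U t \<omega> * h x t \<omega>) ^ k) (at (U t \<omega> * h x t \<omega>) within (\<lambda>r. U r \<omega> * h x r \<omega>) ` {0..})"
        by (rule DERIV_cong[OF DERIV_power[OF DERIV_ident]]) (simp add: n_def del: of_nat_Suc)
      have "((\<lambda>r. G r \<omega>) has_vector_derivative ?g' * (of_nat n * (U t \<omega> * h x t \<omega>) ^ k)) (at t within {0..})"
        using field_vector_diff_chain_within[OF g pw] by (simp add: comp_def G_def)
      then have "(\<lambda>j. (G (q j) \<omega> - G t \<omega>) /\<^sub>R (q j - t)) \<longlonglongrightarrow> ?g' * (of_nat n * (U t \<omega> * h x t \<omega>) ^ k)"
        unfolding has_vector_derivative_iff_quotient tendsto_at_iff_sequentially comp_def using q by blast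
      moreover have "(G (q j) \<omega> - G t \<omega>) /\<^sub>R (q j - t) = (G (\<tau> j) \<omega> - G (s j) \<omega>) /\<^sub>R (\<tau> j - s j)" for j
      proof (cases "q j \<le> t")
        case True
        then have "s j = q j" "\<tau> j = t" by (auto simp: s_def \<tau>_def)
        then show ?thesis using difference_quotient_swap by metis
      next
        case False
        then show ?thesis by (simp add: s_def \<tau>_def)
      qed
      ultimately have L: "(\<lambda>j. (G (\<tau> j) \<omega> - G (s j) \<omega>) /\<^sub>R (\<tau> j - s j)) \<longlonglongrightarrow> ?g' * (of_nat n * (U t \<omega> * h x t \<omega>) ^ k)"
        by simp
      have Ul: "(\<lambda>j. U (\<tau> j) \<omega>) \<longlonglongrightarrow> U t \<omega>"
        using s(4) t sl(2) by (intro continuous_on_tendsto_compose[OF R.u_cont]) auto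
      have "(\<lambda>j. Q j \<omega>) \<longlonglongrightarrow> cnj (U t \<omega>) ^ n * (?g' * (of_nat n * (U t \<omega> * h x t \<omega>) ^ k))"
        unfolding Q_def by (intro tendsto_mult tendsto_power tendsto_cnj Ul L)
      also have "cnj (U t \<omega>) ^ n * (?g' * (of_nat n * (U t \<omega> * h x t \<omega>) ^ k)) =
        (cnj (U t \<omega>) * U t \<omega>) ^ n * (of_nat n * (of_real K * (1 - (h x t \<omega>)\<^sup>2)) * (h x t \<omega>) ^ k)"
        unfolding n_def by (simp add: power_mult_distrib mult_ac)
      also have "\<dots> = D \<omega>" unfolding R.u_cnj D_def by (simp add: algebra_simps power2_eq_square)
      finally show ?case .
    qed
    show "D \<in> borel_measurable M" unfolding D_def using h_meas[OF x t] by measurable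
  qed (use QM in auto)
  have lim2: "(\<lambda>j. (exp (- (l * (\<tau> j - s j))) - 1) / (\<tau> j - s j)) \<longlonglongrightarrow> - l"
  proof -
    have "((\<lambda>y. exp (- (l * y))) has_field_derivative - l) (at (0::real))"
      by (auto intro!: derivative_eq_intros)
    then have "((\<lambda>y. (exp (- (l * y)) - 1) / y) \<longlongrightarrow> - l) (at 0)"
      by (simp add: has_field_derivative_iff)
    moreover have "(\<lambda>j. \<tau> j - s j) \<longlonglongrightarrow> 0" using tendsto_diff[OF sl(2,1)] by simp
    moreover have "\<tau> j - s j \<noteq> 0" for j using s(3)[of j] by simp
    ultimately show ?thesis unfolding tendsto_at_iff_sequentially comp_def by auto
  qed
  have "(\<lambda>j. (moment n x (q j) - moment n x t) /\<^sub>R (q j - t)) \<longlonglongrightarrow> expectation D + of_real (- l) * moment n x t"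
    unfolding quot by (intro tendsto_add lim1 tendsto_mult tendsto_of_real lim2 moment_tendsto[OF x t s(1) sl(1)])
  then show "(\<lambda>j. (moment (Suc k) x (q j) - moment (Suc k) x t) /\<^sub>R (q j - t)) \<longlonglongrightarrow>
      of_real (real (Suc k) * K) * (moment k x t - moment (Suc (Suc k)) x t) - of_real (\<epsilon>\<^sup>2 * (real (Suc k))\<^sup>2) * moment (Suc k) x t"
    unfolding ED l_def n_def by simp
qed

end

section \<open>Bounded solutions of the moment equations\<close>

text \<open>With alternating signs removed the recurrence has positive coefficients, and a nonnegative
  solution that does not vanish is unbounded.\<close>

lemma bounded_recurrence_zero:
  fixes r :: "nat \<Rightarrow> real"
  assumes c: "c > 0" and B: "\<And>k. \<bar>r k\<bar> \<le> B" and rec: "\<And>k. r (Suc (Suc k)) = r k - c * real (Suc k) * r (Suc k)"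
    and 0: "r 0 \<ge> 0" and 1: "r 1 \<le> 0"
  shows "r k = 0"
proof -
  define s where "s k = (-1)^k * r k" for k
  have srec: "s (Suc (Suc k)) = s k + c * real (Suc k) * s (Suc k)" for k
    by (simp add: s_def rec algebra_simps)
  have sabs: "\<bar>s k\<bar> = \<bar>r k\<bar>" for k by (simp add: s_def abs_mult)
  have nn: "s k \<ge> 0 \<and> s (Suc k) \<ge> 0" for k
  proof (induction k)
    case (Suc k)
    then show ?case unfolding srec using c by (auto intro!: add_nonneg_nonneg mult_nonneg_nonneg)
  qed (use 0 1 in \<open>auto simp: s_def\<close>)
  have "s j = 0" for j
  proof (rule ccontr)
    assume "s j \<noteq> 0"
    then have j: "s j > 0" using nn[of j] by simp
    have grow: "s j \<le> s (j + 2 * i)" for i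
    proof (induction i)
      case (Suc i)
      have "s (j + 2 * i) \<le> s (Suc (Suc (j + 2 * i)))"
        unfolding srec using nn[of "j + 2 * i"] c by auto
      then show ?case using Suc by simp
    qed simp
    obtain i where i: "B / (c * s j) < real i" using reals_Archimedean2 by blast
    have i0: "B / (c * s j) \<ge> 0" using B[of 0] c j by (auto intro!: divide_nonneg_pos)
    then have "i > 0" using i by (cases i) auto
    \<comment> \<open>Here \<open>Suc k = j + 2 * i\<close>, an index at which \<open>s\<close> is
      at least \<open>s j\<close>; one step of the recurrence multiplies this by at least c (j + 2
      i), which outgrows \<open>B\<close>.\<close>
    define k where "k = j + 2 * i - 1"
    have k: "Suc k = j + 2 * i" using \<open>i > 0\<close> by (simp add: k_def)
    have "B < real i * (c * s j)" using i c j by (simp add: field_simps)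
    also have "\<dots> \<le> real (Suc k) * (c * s (Suc k))"
      using grow[of i] c j unfolding k by (intro mult_mono) auto
    also have "\<dots> \<le> s (Suc (Suc k))" unfolding srec using nn[of k] by (simp add: mult_ac)
    also have "\<dots> \<le> B" using B[of "Suc (Suc k)"] sabs[of "Suc (Suc k)"] by linarith
    finally show False by simp
  qed
  then show ?thesis using sabs[of k] by simp
qed

section \<open>Uniqueness of bounded solutions of the time-dependent moment system\<close>

lemma nondecreasing_on_halfline:
  fixes g g' :: "real \<Rightarrow> real"
  assumes g: "\<And>t. t \<ge> 0 \<Longrightarrow> (g has_real_derivative g' t) (at t within {0..})" and pos: "\<And>t. t \<ge> 0 \<Longrightarrow> g' t \<ge> 0"
    and T: "T \<ge> 0"
  shows "g 0 \<le> g T"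
proof (rule DERIV_nonneg_imp_increasing_open[OF T])
  show "\<exists>y. DERIV g x :> y \<and> 0 \<le> y" if "0 < x" "x < T" for x
  proof -
    have "at x within {0..} = at x" using that by (intro at_within_interior) auto
    then show ?thesis using g[of x] pos[of x] that by auto
  qed
  show "continuous_on {0..T} g"
  proof (rule continuous_on_subset)
    show "continuous_on {0..} g"
      using g by (auto simp: continuous_on_eq_continuous_within intro: DERIV_continuous)
  qed auto
qed

text \<open>The dissipative term forces the decay \<open>d n = O(1/n)\<close>; this makes the boundary term of the
  truncated energy \<open>\<Sum>n\<le>N. (d n)\<^sup>2 / n\<close> negligible, all other transport terms telescoping.\<close>

lemma moment_system_zero:
  fixes d :: "nat \<Rightarrow> real \<Rightarrow> real"
  assumes K: "K > 0" and l: "l > 0" and B: "\<And>n t. t \<ge> 0 \<Longrightarrow> \<bar>d n t\<bar> \<le> B"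
    and d0: "\<And>t. t \<ge> 0 \<Longrightarrow> d 0 t = 0" and init: "\<And>n. d n 0 = 0"
    and deriv: "\<And>n t. t \<ge> 0 \<Longrightarrow> (d (Suc n) has_real_derivative
       real (Suc n) * K * (d n t - d (Suc (Suc n)) t) - l * (real (Suc n))\<^sup>2 * d (Suc n) t) (at t within {0..})"
    and T: "T \<ge> 0"
  shows "d n T = 0"
proof -
  have B0: "B \<ge> 0" using B[of 0 0] by linarith
  \<comment> \<open>Balance of damping and the largest possible transport in mode n: l n^2 (C/n) = n
    K (2 B).\<close>
  define C where "C = 2 * B * K / l"
  have C0: "C \<ge> 0" using B0 K l by (simp add: C_def)
  have decay: "\<bar>d (Suc n) t\<bar> \<le> C / real (Suc n)" if t: "t \<ge> 0" for n t
  proof -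
    define a where "a = l * (real (Suc n))\<^sup>2"
    have a: "a > 0" using l by (simp add: a_def)
    have one: "sg * d (Suc n) t \<le> C / real (Suc n)" if sg: "\<bar>sg\<bar> = 1" for sg :: real
    proof -
      \<comment> \<open>Integrating factor for the damping: \<open>g\<close> is nondecreasing
        because the transport stays below a C/n, and it starts nonnegative. The sign
        \<open>sg\<close> treats both bounds at once.\<close>
      define g where "g t = exp (a * t) * (C / real (Suc n) - sg * d (Suc n) t)" for t
      have "g 0 \<le> g t"
      proof (rule nondecreasing_on_halfline[OF _ _ t])
        fix t :: real assume t: "t \<ge> 0"
        show "(g has_real_derivative exp (a * t) * (a * C / real (Suc n) - sg * real (Suc n) * K * (d n t - d (Suc (Suc n)) t))) (at t within {0..})"
          unfolding g_def by (rule derivative_eq_intros deriv[OF t] refl)+ (simp add: a_def algebra_simps)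
        have "\<bar>d n t - d (Suc (Suc n)) t\<bar> \<le> 2 * B" using B[OF t, of n] B[OF t, of "Suc (Suc n)"] by linarith
        then have "\<bar>sg * real (Suc n) * K * (d n t - d (Suc (Suc n)) t)\<bar> \<le> real (Suc n) * K * (2 * B)"
          unfolding abs_mult sg using K by (simp add: mult_left_mono)
        also have "\<dots> = a * C / real (Suc n)" using l by (simp add: a_def C_def power2_eq_square)
        finally have "sg * real (Suc n) * K * (d n t - d (Suc (Suc n)) t) \<le> a * C / real (Suc n)" by linarith
        then show "0 \<le> exp (a * t) * (a * C / real (Suc n) - sg * real (Suc n) * K * (d n t - d (Suc (Suc n)) t))" by simp
      qed
      moreover have "g 0 \<ge> 0" using C0 by (simp add: g_def init)
      ultimately have "0 \<le> g t" by simp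
      then show ?thesis by (simp add: g_def zero_le_mult_iff)
    qed
    show ?thesis using one[of 1] one[of "-1"] by (simp add: abs_le_iff)
  qed
  \<comment> \<open>The weight 1/n cancels the factor n of the transport, so that the exchange
    between neighbouring modes becomes antisymmetric.\<close>
  define E where "E N t = (\<Sum>n<N. (d (Suc n) t)\<^sup>2 / real (Suc n))" for N t
  have bound: "E (Suc N) T \<le> 2 * K * C\<^sup>2 * T / real (Suc N)" for N
  proof -
    \<comment> \<open>Growth rate of the truncated energy: both factors of the boundary product
      decay, and one factor 1/(N + 1) is kept.\<close>
    define b where "b = 2 * K * C\<^sup>2 / real (Suc N)"
    define e' where "e' t = (\<Sum>n<Suc N. 2 * K * (d n t * d (Suc n) t - d (Suc n) t * d (Suc (Suc n)) t) - 2 * l * real (Suc n) * (d (Suc n) t)\<^sup>2)" for t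
    have "b * 0 - E (Suc N) 0 \<le> b * T - E (Suc N) T"
    proof (rule nondecreasing_on_halfline[OF _ _ T])
      fix t :: real assume t: "t \<ge> 0"
      have summand: "((\<lambda>t. (d (Suc n) t)\<^sup>2 / real (Suc n)) has_real_derivative
         2 * K * (d n t * d (Suc n) t - d (Suc n) t * d (Suc (Suc n)) t) - 2 * l * real (Suc n) * (d (Suc n) t)\<^sup>2) (at t within {0..})" for n
      proof -
        have "((\<lambda>t. (d (Suc n) t)\<^sup>2) has_real_derivative 2 * d (Suc n) t * (real (Suc n) * K * (d n t - d (Suc (Suc n)) t) - l * (real (Suc n))\<^sup>2 * d (Suc n) t)) (at t within {0..})"
          by (rule derivative_eq_intros deriv[OF t] refl)+ (simp)
        from DERIV_cdivide[OF this, of "real (Suc n)"]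
        show ?thesis by (rule DERIV_cong) (simp add: field_simps power2_eq_square del: of_nat_Suc)
      qed
      have "(E (Suc N) has_real_derivative e' t) (at t within {0..})"
        unfolding E_def e'_def by (intro DERIV_sum summand)
      then show "((\<lambda>t. b * t - E (Suc N) t) has_real_derivative b - e' t) (at t within {0..})"
        by (auto intro!: derivative_eq_intros)
      have "e' t \<le> (\<Sum>n<Suc N. 2 * K * (d n t * d (Suc n) t - d (Suc n) t * d (Suc (Suc n)) t))"
        unfolding e'_def using l by (intro sum_mono) (simp add: mult_nonneg_nonneg)
      also have "\<dots> = 2 * K * (\<Sum>n<Suc N. d n t * d (Suc n) t - d (Suc n) t * d (Suc (Suc n)) t)"
        by (simp only: sum_distrib_left)
      also have "(\<Sum>n<Suc N. d n t * d (Suc n) t - d (Suc n) t * d (Suc (Suc n)) t) = d 0 t * d 1 t - d (Suc N) t * d (Suc (Suc N)) t"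
        using sum_lessThan_telescope'[of "\<lambda>n. d n t * d (Suc n) t" "Suc N"] by simp
      also have "\<dots> = - (d (Suc N) t * d (Suc (Suc N)) t)" using d0[OF t] by simp
      also have "2 * K * - (d (Suc N) t * d (Suc (Suc N)) t) \<le> 2 * K * (C\<^sup>2 / real (Suc N))"
      proof (intro mult_left_mono)
        have "\<bar>d (Suc N) t * d (Suc (Suc N)) t\<bar> \<le> C / real (Suc N) * (C / real (Suc (Suc N)))"
          unfolding abs_mult by (intro mult_mono decay t) (use C0 in auto)
        also have "\<dots> \<le> C / real (Suc N) * (C / 1)" using C0 by (intro mult_left_mono divide_left_mono) auto
        finally show "- (d (Suc N) t * d (Suc (Suc N)) t) \<le> C\<^sup>2 / real (Suc N)" by (simp add: power2_eq_square)
      qed (use K in auto)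
      finally show "0 \<le> b - e' t" by (simp add: b_def)
    qed
    then show ?thesis by (simp add: b_def E_def init)
  qed
  have "d (Suc n) T = 0" for n
  proof -
    have "(\<lambda>N. 2 * K * C\<^sup>2 * T / real (Suc N)) \<longlonglongrightarrow> 0"
      by (intro lim_const_over_n[THEN LIMSEQ_Suc])
    moreover have "(d (Suc n) T)\<^sup>2 / real (Suc n) \<le> 2 * K * C\<^sup>2 * T / real (Suc N)" if "N \<ge> n" for N
    proof -
      have "(d (Suc n) T)\<^sup>2 / real (Suc n) \<le> E (Suc N) T"
        unfolding E_def by (rule member_le_sum[where f = "\<lambda>n. (d (Suc n) T)\<^sup>2 / real (Suc n)"]) (use that in auto)
      then show ?thesis using bound[of N] by linarith
    qed
    ultimately have "(d (Suc n) T)\<^sup>2 / real (Suc n) \<le> 0"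
      by (intro LIMSEQ_le_const) auto
    moreover have "0 \<le> (d (Suc n) T)\<^sup>2 / real (Suc n)" by (intro divide_nonneg_nonneg) auto
    ultimately have "(d (Suc n) T)\<^sup>2 / real (Suc n) = 0" by linarith
    then show ?thesis by (simp del: of_nat_Suc)
  qed
  then show ?thesis using d0[OF T] by (cases n) auto
qed

section \<open>Measures on the circle\<close>

lemma closed_indicator_limit:
  fixes C :: "'b::metric_space set"
  assumes "closed C" "C \<noteq> {}"
  shows "(\<lambda>n. max 0 (1 - real n * infdist z C)) \<longlonglongrightarrow> (indicator C z :: real)"
proof (cases "z \<in> C")
  case True
  then show ?thesis by simp
next
  case False
  then have pos: "infdist z C > 0" using assms by (simp add: infdist_pos_not_in_closed)
  obtain N where N: "1 / infdist z C < real N" using reals_Archimedean2 by blast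
  have "max 0 (1 - real n * infdist z C) = 0" if "n \<ge> N" for n
  proof -
    have "1 / infdist z C < real n" using N that by linarith
    then show ?thesis using pos by (simp add: field_simps)
  qed
  then have "eventually (\<lambda>n. max 0 (1 - real n * infdist z C) = 0) sequentially"
    by (auto simp: eventually_sequentially)
  then show ?thesis using False by (simp add: tendsto_eventually)
qed

lemma Int_stable_closed: "Int_stable (Collect closed)"
  by (auto simp: Int_stable_def)

lemma closed_indicator_approx_continuous:
  "continuous_on UNIV (\<lambda>z. max 0 (1 - real n * infdist z C))"
  by (intro continuous_intros)

text \<open>Closed sets form an intersection-stable generator, and their indicators are pointwise
  limits of the continuous functions \<open>max 0 (1 - n * infdist z C)\<close>.\<close>

lemma borel_measure_eqI_continuous:
  fixes \<mu> \<nu> :: "'b::metric_space measure"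
  assumes "prob_space \<mu>" "prob_space \<nu>" and s[measurable_cong]: "sets \<mu> = sets borel" "sets \<nu> = sets borel"
    and eq: "\<And>f :: 'b \<Rightarrow> real. continuous_on UNIV f \<Longrightarrow> (\<And>z. \<bar>f z\<bar> \<le> 1) \<Longrightarrow> (LINT z|\<mu>. f z) = (LINT z|\<nu>. f z)"
  shows "\<mu> = \<nu>"
proof -
  interpret \<mu>: prob_space \<mu> by fact
  interpret \<nu>: prob_space \<nu> by fact
  have meq: "measure \<mu> C = measure \<nu> C" if C: "closed C" for C
  proof (cases "C = {}")
    case False
    have lim: "(\<lambda>n. LINT z|\<rho>. max 0 (1 - real n * infdist z C)) \<longlonglongrightarrow> measure \<rho> C"
      if "prob_space \<rho>" and [measurable_cong]: "sets \<rho> = sets borel" for \<rho> :: "'b measure"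
    proof -
      interpret \<rho>: prob_space \<rho> by fact
      have [measurable]: "C \<in> sets borel" using C by simp
      have [measurable]: "(\<lambda>z. max 0 (1 - real n * infdist z C)) \<in> borel_measurable borel" for n
        by (intro borel_measurable_continuous_onI closed_indicator_approx_continuous)
      have "(\<lambda>n. LINT z|\<rho>. max 0 (1 - real n * infdist z C)) \<longlonglongrightarrow> (LINT z|\<rho>. indicator C z)"
      proof (rule integral_dominated_convergence[where w = "\<lambda>_. 1"])
        show "AE z in \<rho>. (\<lambda>n. max 0 (1 - real n * infdist z C)) \<longlonglongrightarrow> indicator C z"
          using closed_indicator_limit[OF C False] by auto
        show "AE z in \<rho>. norm (max 0 (1 - real n * infdist z C)) \<le> 1" for n
          by (auto simp: infdist_nonneg mult_nonneg_nonneg)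
      qed auto
      then show ?thesis by (simp add: sets_eq_imp_space_eq[OF that(2)])
    qed
    have "(LINT z|\<mu>. max 0 (1 - real n * infdist z C)) = (LINT z|\<nu>. max 0 (1 - real n * infdist z C))" for n
      by (rule eq[OF closed_indicator_approx_continuous]) (auto simp: infdist_nonneg mult_nonneg_nonneg)
    then show ?thesis using lim[of \<mu>] lim[of \<nu>] assms(1,2) s LIMSEQ_unique by auto
  qed simp
  show ?thesis
  proof (rule measure_eqI_generator_eq[where E = "Collect closed" and \<Omega> = UNIV and A = "\<lambda>_. UNIV"])
    show "emeasure \<mu> X = emeasure \<nu> X" if "X \<in> Collect closed" for X
      using meq[of X] that by (simp add: \<mu>.emeasure_eq_measure \<nu>.emeasure_eq_measure)
    have "sets (borel :: 'b measure) = sigma_sets UNIV (Collect closed)"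
      unfolding borel_eq_closed by simp
    then show "sets \<mu> = sigma_sets UNIV (Collect closed)" "sets \<nu> = sigma_sets UNIV (Collect closed)"
      using s by auto
  qed (auto simp: Int_stable_closed)
qed

text \<open>On the circle, the functions whose products with all integer powers have equal integrals form a
  module over the real polynomials, because \<open>Re\<close> and \<open>Im\<close> act by shifting the power.\<close>

lemma circle_measure_eqI:
  fixes \<mu> \<nu> :: "complex measure"
  assumes "prob_space \<mu>" "prob_space \<nu>" and s[measurable_cong]: "sets \<mu> = sets borel" "sets \<nu> = sets borel"
    and c: "AE z in \<mu>. z \<in> sphere 0 1" "AE z in \<nu>. z \<in> sphere 0 1"
    and mom: "\<And>n. (LINT z|\<mu>. z ^ n) = (LINT z|\<nu>. z ^ n)"
  shows "\<mu> = \<nu>"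
proof (rule borel_measure_eqI_continuous[OF assms(1-4)])
  interpret \<mu>: prob_space \<mu> by fact
  interpret \<nu>: prob_space \<nu> by fact
  \<comment> \<open>Measurability and boundedness on the circle belong to the predicate, so that
    integrability is inherited by shifts and linear combinations.\<close>
  define Eq where "Eq \<phi> \<longleftrightarrow> \<phi> \<in> borel_measurable borel \<and> (\<exists>B. \<forall>z\<in>sphere 0 1. norm (\<phi> z) \<le> B) \<and>
     (\<forall>j::int. (LINT z|\<mu>. \<phi> z * z powi j) = (LINT z|\<nu>. \<phi> z * z powi j))" for \<phi> :: "complex \<Rightarrow> complex"
  have pm[measurable]: "(\<lambda>z::complex. z powi j) \<in> borel_measurable borel" for j
    unfolding power_int_def by measurable
  have int: "integrable \<rho> (\<lambda>z. \<phi> z * z powi j)"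
    if "prob_space \<rho>" and [measurable_cong]: "sets \<rho> = sets borel" and ae: "AE z in \<rho>. z \<in> sphere 0 1" and "Eq \<phi>"
    for \<rho> :: "complex measure" and \<phi> j
  proof -
    interpret \<rho>: prob_space \<rho> by fact
    obtain B where [measurable]: "\<phi> \<in> borel_measurable borel" and B: "\<forall>z\<in>sphere 0 1. norm (\<phi> z) \<le> B"
      using \<open>Eq \<phi>\<close> by (auto simp: Eq_def)
    show ?thesis
    proof (rule \<rho>.integrable_const_bound[where B = B])
      show "AE z in \<rho>. norm (\<phi> z * z powi j) \<le> B"
        using ae by eventually_elim (use B in \<open>auto simp: norm_mult norm_power_int\<close>)
    qed measurable
  qed
  note int\<mu> = int[OF assms(1) s(1) c(1)] and int\<nu> = int[OF assms(2) s(2) c(2)]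
  have cong: "(LINT z|\<rho>. f z) = (LINT z|\<rho>. g z)"
    if [measurable_cong]: "sets \<rho> = sets borel" and ae: "AE z in \<rho>. z \<in> sphere 0 1"
      and [measurable]: "f \<in> borel_measurable borel" "g \<in> borel_measurable borel" and fg: "\<And>z. norm z = 1 \<Longrightarrow> f z = g z"
    for \<rho> :: "complex measure" and f g :: "complex \<Rightarrow> complex"
    by (rule integral_cong_AE) (use ae fg in \<open>auto elim!: eventually_mono\<close>)
  have "Eq (\<lambda>_. 1)"
    unfolding Eq_def
  proof (intro conjI allI exI[of _ 1] ballI)
    fix j :: int
    show "(LINT z|\<mu>. 1 * z powi j) = (LINT z|\<nu>. 1 * z powi j)"
    proof (cases "j \<ge> 0")
      case True
      then have "(\<lambda>z::complex. 1 * z powi j) = (\<lambda>z. z ^ nat j)" by (auto simp: power_int_def)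
      then show ?thesis using mom by simp
    next
      case False
      \<comment> \<open>On the circle a negative power is the conjugate of a positive one, so
        moments with natural exponents give all integer ones.\<close>
      have *: "(LINT z|\<rho>. 1 * z powi j) = cnj (LINT z|\<rho>. z ^ nat (- j))"
        if "prob_space \<rho>" and s: "sets \<rho> = sets borel" and ae: "AE z in \<rho>. z \<in> sphere 0 1" for \<rho> :: "complex measure"
      proof -
        have "(LINT z|\<rho>. 1 * z powi j) = (LINT z|\<rho>. cnj (z ^ nat (- j)))"
        proof (rule cong[OF s ae])
          have "cnj \<in> borel_measurable borel"  by (intro borel_measurable_continuous_onI continuous_intros)
          then show "(\<lambda>z. cnj (z ^ nat (- j))) \<in> borel_measurable borel" by measurable
          fix z :: complex assume "norm z = 1"
          then have "z * cnj z = 1" by (simp flip: complex_norm_square)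
          then have "inverse z = cnj z" by (metis inverse_unique)
          then show "1 * z powi j = cnj (z ^ nat (- j))" using False by (simp add: power_int_def)
        qed measurable
        then show ?thesis by (simp only: Bochner_Integration.integral_cnj)
      qed
      show ?thesis using *[OF assms(1) s(1) c(1)] *[OF assms(2) s(2) c(2)] mom by simp
    qed
  qed auto
  moreover have shift: "Eq (\<lambda>z. z * \<phi> z)" "Eq (\<lambda>z. cnj z * \<phi> z)" if \<phi>: "Eq \<phi>" for \<phi>
  proof -
    have cm[measurable]: "cnj \<in> borel_measurable borel" by (intro borel_measurable_continuous_onI continuous_intros)
    obtain B where [measurable]: "\<phi> \<in> borel_measurable borel" and B: "\<forall>z\<in>sphere 0 1. norm (\<phi> z) \<le> B"
      and e: "\<And>j. (LINT z|\<mu>. \<phi> z * z powi j) = (LINT z|\<nu>. \<phi> z * z powi j)"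
      using \<phi> by (auto simp: Eq_def)
    have 1: "(LINT z|\<rho>. z * \<phi> z * z powi j) = (LINT z|\<rho>. \<phi> z * z powi (j + 1))"
      if s: "sets \<rho> = sets borel" and ae: "AE z in \<rho>. z \<in> sphere 0 1" for \<rho> :: "complex measure" and j
    proof (rule cong[OF s ae])
      fix z :: complex assume "norm z = 1"
      then have "z \<noteq> 0" by auto
      then show "z * \<phi> z * z powi j = \<phi> z * z powi (j + 1)" by (simp add: power_int_add)
    qed measurable
    have 2: "(LINT z|\<rho>. cnj z * \<phi> z * z powi j) = (LINT z|\<rho>. \<phi> z * z powi (j - 1))"
      if s: "sets \<rho> = sets borel" and ae: "AE z in \<rho>. z \<in> sphere 0 1" for \<rho> :: "complex measure" and j
    proof (rule cong[OF s ae])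
      fix z :: complex assume n: "norm z = 1"
      then have z: "z \<noteq> 0" by auto
      have "z * cnj z = 1" using n by (simp flip: complex_norm_square)
      then have "cnj z = inverse z" by (metis inverse_unique)
      then show "cnj z * \<phi> z * z powi j = \<phi> z * z powi (j - 1)" using z by (simp add: power_int_diff divide_inverse)
    qed measurable
    show "Eq (\<lambda>z. z * \<phi> z)" unfolding Eq_def
    proof (intro conjI exI[of _ B] allI ballI)
      show "norm (z * \<phi> z) \<le> B" if "z \<in> sphere 0 1" for z using B that by (simp add: norm_mult)
      show "(LINT z|\<mu>. z * \<phi> z * z powi j) = (LINT z|\<nu>. z * \<phi> z * z powi j)" for j
        unfolding 1[OF s(1) c(1)] 1[OF s(2) c(2)] by (rule e)
    qed measurable
    show "Eq (\<lambda>z. cnj z * \<phi> z)" unfolding Eq_def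
    proof (intro conjI exI[of _ B] allI ballI)
      show "norm (cnj z * \<phi> z) \<le> B" if "z \<in> sphere 0 1" for z using B that by (simp add: norm_mult)
      show "(LINT z|\<mu>. cnj z * \<phi> z * z powi j) = (LINT z|\<nu>. cnj z * \<phi> z * z powi j)" for j
        unfolding 2[OF s(1) c(1)] 2[OF s(2) c(2)] by (rule e)
    qed measurable
  qed
  moreover have lin: "Eq (\<lambda>z. a * \<phi> z + b * \<psi> z)" if \<phi>: "Eq \<phi>" and \<psi>: "Eq \<psi>" for a b \<phi> \<psi>
  proof -
    obtain B B' where [measurable]: "\<phi> \<in> borel_measurable borel" "\<psi> \<in> borel_measurable borel"
      and B: "\<forall>z\<in>sphere 0 1. norm (\<phi> z) \<le> B" "\<forall>z\<in>sphere 0 1. norm (\<psi> z) \<le> B'"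
      and e: "\<And>j. (LINT z|\<mu>. \<phi> z * z powi j) = (LINT z|\<nu>. \<phi> z * z powi j)"
         "\<And>j. (LINT z|\<mu>. \<psi> z * z powi j) = (LINT z|\<nu>. \<psi> z * z powi j)"
      using \<phi> \<psi> by (auto simp: Eq_def)
    show ?thesis unfolding Eq_def
    proof (intro conjI exI[of _ "norm a * B + norm b * B'"] allI ballI)
      show "norm (a * \<phi> z + b * \<psi> z) \<le> norm a * B + norm b * B'" if "z \<in> sphere 0 1" for z
        using B that by (intro norm_triangle_mono) (auto simp: norm_mult intro!: mult_left_mono)
      show "(LINT z|\<mu>. (a * \<phi> z + b * \<psi> z) * z powi j) = (LINT z|\<nu>. (a * \<phi> z + b * \<psi> z) * z powi j)" for j
        using int\<mu>[OF \<phi>] int\<mu>[OF \<psi>] int\<nu>[OF \<phi>] int\<nu>[OF \<psi>] e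
        by (simp add: distrib_right mult.assoc)
    qed measurable
  qed
  have poly: "\<forall>\<phi>. Eq \<phi> \<longrightarrow> Eq (\<lambda>z. of_real (p z) * \<phi> z)" if "real_polynomial_function p" for p :: "complex \<Rightarrow> real"
    using that
  proof induction
    case (linear f)
    interpret f: bounded_linear f by fact
    \<comment> \<open>Every real-linear functional on the plane has the form a z + cnj(a) cnj(z);
      evaluation at 1 and at \<i> gives this \<open>a\<close>.\<close>
    define a where "a = (of_real (f 1) - \<i> * of_real (f \<i>)) / 2"
    have f: "complex_of_real (f z) = a * z + cnj a * cnj z" for z
    proof -
      have "z = Re z *\<^sub>R 1 + Im z *\<^sub>R \<i>" by (simp add: complex_eq_iff)
      then have "f z = Re z * f 1 + Im z * f \<i>" by (metis f.add f.scaleR real_scaleR_def)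
      then show ?thesis by (simp add: a_def complex_eq_iff field_simps)
    qed
    show ?case
    proof (intro allI impI)
      fix \<phi> assume "Eq \<phi>"
      from lin[OF shift(1)[OF this] shift(2)[OF this], of a "cnj a"]
      show "Eq (\<lambda>z. of_real (f z) * \<phi> z)" by (simp add: f algebra_simps)
    qed
  next
    case (const c)
    then show ?case using lin[of _ _ "of_real c" 0] by simp
  next
    case (add f g)
    then show ?case using lin[of "\<lambda>z. of_real (f z) * _ z" "\<lambda>z. of_real (g z) * _ z" 1 1] by (simp add: distrib_right)
  next
    case (mult f g)
    then show ?case by (simp add: mult.assoc)
  qed
  fix f :: "complex \<Rightarrow> real" assume f: "continuous_on UNIV f" and fb: "\<And>z. \<bar>f z\<bar> \<le> 1"
  have fm: "f \<in> borel_measurable borel" using f by (rule borel_measurable_continuous_onI)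
  have close: "\<bar>(LINT z|\<mu>. f z) - (LINT z|\<nu>. f z)\<bar> \<le> 2 * e" if e: "e > 0" for e
  proof -
    have sph: "compact (sphere (0::complex) 1)" "continuous_on (sphere 0 1) f"
      using continuous_on_subset[OF f] by auto
    \<comment> \<open>Approximation on the circle is enough, because both measures are carried by
      it.\<close>
    obtain p where p: "real_polynomial_function p" "\<And>z. z \<in> sphere 0 1 \<Longrightarrow> \<bar>f z - p z\<bar> < e"
      by (rule Stone_Weierstrass_real_polynomial_function[OF sph e]) blast
    have "Eq (\<lambda>z. of_real (p z) * 1)" using poly[OF p(1)] \<open>Eq (\<lambda>_. 1)\<close> by blast
    then have E: "Eq (\<lambda>z. of_real (p z))" by simp
    have "(LINT z|\<mu>. of_real (p z) * z powi 0) = (LINT z|\<nu>. complex_of_real (p z) * z powi 0)" using E unfolding Eq_def by blast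
    then have pe: "(LINT z|\<mu>. p z) = (LINT z|\<nu>. p z)" by simp
    have ip: "integrable \<mu> p" "integrable \<nu> p"
      using int\<mu>[OF E, of 0] int\<nu>[OF E, of 0] by (simp_all add: complex_of_real_integrable_eq)
    have near: "\<bar>(LINT z|\<rho>. f z) - (LINT z|\<rho>. p z)\<bar> \<le> e"
      if "prob_space \<rho>" and [measurable_cong]: "sets \<rho> = sets borel" and ae: "AE z in \<rho>. z \<in> sphere 0 1" and ip: "integrable \<rho> p" for \<rho> :: "complex measure"
    proof -
      interpret \<rho>: prob_space \<rho> by fact
      have iF: "integrable \<rho> f" by (rule \<rho>.integrable_const_bound[where B = 1]) (use fb fm in auto)
      have "\<bar>(LINT z|\<rho>. f z - p z)\<bar> \<le> (LINT z|\<rho>. \<bar>f z - p z\<bar>)" by (rule integral_abs_bound)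
      also have "\<dots> \<le> (LINT z|\<rho>. e)"
        using ae p(2) iF ip by (intro integral_mono_AE) (auto elim!: eventually_mono intro: less_imp_le)
      finally show ?thesis using iF ip by (simp add: \<rho>.prob_space)
    qed
    show ?thesis
      using near[OF assms(1) s(1) c(1) ip(1)] near[OF assms(2) s(2) c(2) ip(2)] pe by linarith
  qed
  show "(LINT z|\<mu>. f z) = (LINT z|\<nu>. f z)"
  proof (rule ccontr)
    assume ne: "\<not> ?thesis"
    define d where "d = \<bar>(LINT z|\<mu>. f z) - (LINT z|\<nu>. f z)\<bar>"
    with ne have pos: "d / 4 > 0" by simp
    show False using close[OF pos] pos unfolding d_def[symmetric] by linarith
  qed
qed

section \<open>The von Mises distribution\<close>

definition von_mises_weight :: "real \<Rightarrow> real \<Rightarrow> real" where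
  "von_mises_weight \<kappa> \<theta> = indicator {0..2*pi} \<theta> * exp (\<kappa> * cos \<theta>)"

definition von_mises_mass :: "real \<Rightarrow> real" where
  "von_mises_mass \<kappa> = (LINT \<theta>|lborel. von_mises_weight \<kappa> \<theta>)"

definition von_mises :: "real \<Rightarrow> complex measure" where
  "von_mises \<kappa> = distr (density lborel (\<lambda>\<theta>. ennreal (von_mises_weight \<kappa> \<theta> / von_mises_mass \<kappa>))) borel cis"

lemma cis_measurable[measurable]: "cis \<in> borel_measurable borel"
  by (intro borel_measurable_continuous_onI continuous_intros)

lemma von_mises_weight_measurable[measurable]: "von_mises_weight \<kappa> \<in> borel_measurable borel"
  unfolding von_mises_weight_def by measurable

lemma von_mises_weight_nonneg: "0 \<le> von_mises_weight \<kappa> \<theta>"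
  by (simp add: von_mises_weight_def)

lemma integrable_continuous_Icc:
  fixes f :: "real \<Rightarrow> 'b::{banach, second_countable_topology}"
  assumes "continuous_on {a..b} f"
  shows "integrable lborel (\<lambda>\<theta>. indicator {a..b} \<theta> *\<^sub>R f \<theta>)"
  using borel_integrable_compact[OF _ assms] by auto

lemma von_mises_weight_integrable: "integrable lborel (von_mises_weight \<kappa>)"
proof -
  have "continuous_on {0..2*pi} (\<lambda>\<theta>. exp (\<kappa> * cos \<theta>))" by (intro continuous_intros)
  from integrable_continuous_Icc[OF this] show ?thesis
    by (simp add: von_mises_weight_def[abs_def])
qed

lemma von_mises_mass_pos: "von_mises_mass \<kappa> > 0"
proof -
  have "2 * pi * exp (- \<bar>\<kappa>\<bar>) = (LINT \<theta>|lborel. indicator {0..2*pi} \<theta> * exp (- \<bar>\<kappa>\<bar>))"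
    by (simp)
  also have "\<dots> \<le> von_mises_mass \<kappa>"
    unfolding von_mises_mass_def
  proof (rule integral_mono)
    show "integrable lborel (\<lambda>\<theta>. indicator {0..2*pi} \<theta> * exp (- \<bar>\<kappa>\<bar>))"
      using integrable_continuous_Icc[of 0 "2*pi" "\<lambda>_. exp (- \<bar>\<kappa>\<bar>)"] by simp
    show "indicator {0..2*pi} \<theta> * exp (- \<bar>\<kappa>\<bar>) \<le> von_mises_weight \<kappa> \<theta>" for \<theta> :: real
    proof -
      have "\<bar>\<kappa> * cos \<theta>\<bar> \<le> \<bar>\<kappa>\<bar> * 1" unfolding abs_mult by (intro mult_left_mono) auto
      then show ?thesis by (auto simp: von_mises_weight_def intro!: mult_left_mono)
    qed
  qed (rule von_mises_weight_integrable)
  finally show ?thesis by (rule less_le_trans[rotated]) simp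
qed

lemma sets_von_mises[simp, measurable_cong]: "sets (von_mises \<kappa>) = sets borel"
  by (simp add: von_mises_def)

lemma integral_von_mises:
  fixes f :: "complex \<Rightarrow> complex"
  assumes [measurable]: "f \<in> borel_measurable borel"
  shows "(LINT z|von_mises \<kappa>. f z) = (LINT \<theta>|lborel. von_mises_weight \<kappa> \<theta> *\<^sub>R f (cis \<theta>)) /\<^sub>R von_mises_mass \<kappa>"
proof -
  have "(LINT z|von_mises \<kappa>. f z) = (LINT \<theta>|density lborel (\<lambda>\<theta>. ennreal (von_mises_weight \<kappa> \<theta> / von_mises_mass \<kappa>)). f (cis \<theta>))"
    unfolding von_mises_def by (rule integral_distr) auto
  also have "\<dots> = (LINT \<theta>|lborel. (von_mises_weight \<kappa> \<theta> / von_mises_mass \<kappa>) *\<^sub>R f (cis \<theta>))"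
    using von_mises_weight_nonneg von_mises_mass_pos
    by (intro integral_density) (auto intro!: AE_I2 divide_nonneg_pos)
  also have "\<dots> = (LINT \<theta>|lborel. inverse (von_mises_mass \<kappa>) *\<^sub>R (von_mises_weight \<kappa> \<theta> *\<^sub>R f (cis \<theta>)))"
    by (intro Bochner_Integration.integral_cong refl) (simp add: divide_inverse mult.commute)
  also have "\<dots> = (LINT \<theta>|lborel. von_mises_weight \<kappa> \<theta> *\<^sub>R f (cis \<theta>)) /\<^sub>R von_mises_mass \<kappa>"
    by (rule integral_scaleR_right)
  finally show ?thesis .
qed

lemma prob_space_von_mises: "prob_space (von_mises \<kappa>)"
  unfolding von_mises_def
proof (rule prob_space.prob_space_distr)
  show "prob_space (density lborel (\<lambda>\<theta>. ennreal (von_mises_weight \<kappa> \<theta> / von_mises_mass \<kappa>)))"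
  proof
    have "emeasure (density lborel (\<lambda>\<theta>. ennreal (von_mises_weight \<kappa> \<theta> / von_mises_mass \<kappa>))) UNIV =
       (\<integral>\<^sup>+\<theta>. ennreal (von_mises_weight \<kappa> \<theta> / von_mises_mass \<kappa>) \<partial>lborel)"
      by (subst emeasure_density) auto
    also have "\<dots> = ennreal (LINT \<theta>|lborel. von_mises_weight \<kappa> \<theta> / von_mises_mass \<kappa>)"
      using von_mises_weight_nonneg von_mises_mass_pos von_mises_weight_integrable
      by (intro nn_integral_eq_integral) (auto intro!: AE_I2 divide_nonneg_pos)
    also have "(LINT \<theta>|lborel. von_mises_weight \<kappa> \<theta> / von_mises_mass \<kappa>) = von_mises_mass \<kappa> / von_mises_mass \<kappa>"
      by (simp add: von_mises_mass_def)
    also have "\<dots> = 1" using von_mises_mass_pos[of \<kappa>] by simp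
    finally show "emeasure (density lborel (\<lambda>\<theta>. ennreal (von_mises_weight \<kappa> \<theta> / von_mises_mass \<kappa>)))
      (space (density lborel (\<lambda>\<theta>. ennreal (von_mises_weight \<kappa> \<theta> / von_mises_mass \<kappa>)))) = 1" by simp
  qed
qed simp

lemma von_mises_sphere: "AE z in von_mises \<kappa>. z \<in> sphere 0 1"
proof -
  have [measurable]: "sphere (0::complex) 1 \<in> sets borel" by simp
  show ?thesis unfolding von_mises_def by (subst AE_distr_iff) auto
qed

text \<open>Integration by parts: the boundary terms of \<open>cis (n \<theta>) exp (\<kappa> cos \<theta>)\<close> cancel over a period.\<close>

lemma von_mises_moments:
  "(2 * real (Suc k)) *\<^sub>R (LINT z|von_mises \<kappa>. z ^ Suc k) =
     \<kappa> *\<^sub>R ((LINT z|von_mises \<kappa>. z ^ k) - (LINT z|von_mises \<kappa>. z ^ Suc (Suc k)))"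
proof -
  define I where "I n = (LINT \<theta>|lborel. von_mises_weight \<kappa> \<theta> *\<^sub>R cis \<theta> ^ n)" for n
  define F where "F n \<theta> = exp (\<kappa> * cos \<theta>) *\<^sub>R cis \<theta> ^ n" for n \<theta>
  have I: "I n = (LINT \<theta>|lborel. indicator {0..2*pi} \<theta> *\<^sub>R F n \<theta>)" for n
    by (simp add: I_def F_def von_mises_weight_def)
  have Fc: "continuous_on A (F n)" for A n unfolding F_def by (intro continuous_intros)
  have Fi: "integrable lborel (\<lambda>\<theta>. indicator {0..2*pi} \<theta> *\<^sub>R F n \<theta>)" for n
    by (rule integrable_continuous_Icc[OF Fc])
  let ?D = "\<lambda>\<theta>. (\<i> * of_nat (Suc k)) * F (Suc k) \<theta> + (\<i> * of_real \<kappa> / 2) * (F (Suc (Suc k)) \<theta> - F k \<theta>)"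
  have deriv: "(F (Suc k) has_vector_derivative ?D \<theta>) (at \<theta> within {0..2*pi})" for \<theta>
  proof -
    have Fcis: "F n \<theta> = exp (\<kappa> * cos \<theta>) *\<^sub>R cis (real n * \<theta>)" for n \<theta>
      by (simp add: F_def Complex.DeMoivre)
    have 1: "((\<lambda>\<theta>. exp (\<kappa> * cos \<theta>)) has_real_derivative exp (\<kappa> * cos \<theta>) * (\<kappa> * - sin \<theta>)) (at \<theta> within {0..2*pi})"
      by (auto intro!: derivative_eq_intros)
    have 2: "((\<lambda>\<theta>. cis (real (Suc k) * \<theta>)) has_vector_derivative of_real (real (Suc k)) * (\<i> * cis (real (Suc k) * \<theta>))) (at \<theta> within {0..2*pi})"
    proof -
      have "((\<lambda>\<theta>. cos (real (Suc k) * \<theta>)) has_real_derivative - sin (real (Suc k) * \<theta>) * real (Suc k)) (at \<theta> within {0..2*pi})"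
        "((\<lambda>\<theta>. sin (real (Suc k) * \<theta>)) has_real_derivative cos (real (Suc k) * \<theta>) * real (Suc k)) (at \<theta> within {0..2*pi})"
        by (auto intro!: derivative_eq_intros simp del: of_nat_Suc)
      then have "((\<lambda>\<theta>. of_real (cos (real (Suc k) * \<theta>)) + \<i> * of_real (sin (real (Suc k) * \<theta>))) has_vector_derivative
        of_real (- sin (real (Suc k) * \<theta>) * real (Suc k)) + \<i> * of_real (cos (real (Suc k) * \<theta>) * real (Suc k))) (at \<theta> within {0..2*pi})"
        by (intro has_vector_derivative_add has_vector_derivative_mult_right has_vector_derivative_of_real)
          (simp_all only: has_real_derivative_iff_has_vector_derivative)
      moreover have "of_real (cos t) + \<i> * of_real (sin t) = cis t" for t by (simp add: complex_eq_iff)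
      moreover have "of_real (- sin t * r) + \<i> * of_real (cos t * r) = of_real r * (\<i> * cis t)" for t r :: real
        by (simp add: complex_eq_iff)
      ultimately show ?thesis by (simp only:)
    qed
    have "(F (Suc k) has_vector_derivative exp (\<kappa> * cos \<theta>) *\<^sub>R (of_real (real (Suc k)) * (\<i> * cis (real (Suc k) * \<theta>))) +
       (exp (\<kappa> * cos \<theta>) * (\<kappa> * - sin \<theta>)) *\<^sub>R cis (real (Suc k) * \<theta>)) (at \<theta> within {0..2*pi})"
      unfolding Fcis[abs_def] by (rule has_vector_derivative_scaleR[OF 1 2])
    moreover have "exp (\<kappa> * cos \<theta>) *\<^sub>R (of_real (real (Suc k)) * (\<i> * cis (real (Suc k) * \<theta>))) +
       (exp (\<kappa> * cos \<theta>) * (\<kappa> * - sin \<theta>)) *\<^sub>R cis (real (Suc k) * \<theta>) = ?D \<theta>"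
    proof -
      \<comment> \<open>Writing sin \<theta> through cis(\<theta>) and cis(-\<theta>) turns the
        derivative of the weight into a difference of the modes k + 2 and k.\<close>
      have "complex_of_real (sin \<theta>) * cis (real (Suc k) * \<theta>) = - (\<i> / 2) * (cis (real (Suc (Suc k)) * \<theta>) - cis (real k * \<theta>))"
      proof -
        have c: "cis (real (Suc (Suc k)) * \<theta>) = cis (real (Suc k) * \<theta>) * cis \<theta>" "cis (real k * \<theta>) = cis (real (Suc k) * \<theta>) * cis (- \<theta>)"
          by (simp_all add: cis_mult algebra_simps)
        have "cis \<theta> - cis (- \<theta>) = 2 * \<i> * of_real (sin \<theta>)" by (simp add: complex_eq_iff)
        then show ?thesis unfolding c right_diff_distrib[symmetric] by (simp add: mult_ac)
      qed
      then have s: "(exp (\<kappa> * cos \<theta>) * (\<kappa> * - sin \<theta>)) *\<^sub>R cis (real (Suc k) * \<theta>) =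
        of_real (exp (\<kappa> * cos \<theta>) * \<kappa>) * ((\<i> / 2) * (cis (real (Suc (Suc k)) * \<theta>) - cis (real k * \<theta>)))"
        by (simp add: scaleR_conv_of_real mult.assoc del: of_nat_Suc) (simp only: mult.assoc mult_minus_right[symmetric])?
      show ?thesis unfolding s Fcis by (simp add: scaleR_conv_of_real algebra_simps del: of_nat_Suc)
    qed
    ultimately show ?thesis by simp
  qed
  have Dc: "continuous_on {0..2*pi} ?D" by (intro continuous_intros Fc)
  have "(LINT \<theta>|lborel. indicator {0..2*pi} \<theta> *\<^sub>R ?D \<theta>) = F (Suc k) (2*pi) - F (Suc k) 0"
    by (rule integral_FTC_Icc) (use deriv Dc in auto)
  also have "F (Suc k) (2*pi) - F (Suc k) 0 = 0"
    by (simp add: F_def)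
  also have "(LINT \<theta>|lborel. indicator {0..2*pi} \<theta> *\<^sub>R ?D \<theta>) =
     (LINT \<theta>|lborel. (\<i> * of_nat (Suc k)) * (indicator {0..2*pi} \<theta> *\<^sub>R F (Suc k) \<theta>) +
      (\<i> * of_real \<kappa> / 2) * (indicator {0..2*pi} \<theta> *\<^sub>R F (Suc (Suc k)) \<theta> - indicator {0..2*pi} \<theta> *\<^sub>R F k \<theta>))"
    by (intro Bochner_Integration.integral_cong refl) (simp add: scaleR_conv_of_real algebra_simps)
  also have "\<dots> = (\<i> * of_nat (Suc k)) * I (Suc k) + (\<i> * of_real \<kappa> / 2) * (I (Suc (Suc k)) - I k)"
    unfolding I
    by (subst Bochner_Integration.integral_add, intro integrable_mult_right Fi,
        intro integrable_mult_right Bochner_Integration.integrable_diff Fi)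
      (simp only: integral_mult_right_zero Bochner_Integration.integral_diff[OF Fi Fi])
  finally have "\<i> * (2 * of_nat (Suc k) * I (Suc k) + of_real \<kappa> * (I (Suc (Suc k)) - I k)) = 0"
    by (simp add: field_simps)
  then have "2 * of_nat (Suc k) * I (Suc k) + of_real \<kappa> * (I (Suc (Suc k)) - I k) = 0" by simp
  then have "2 * of_nat (Suc k) * I (Suc k) = of_real \<kappa> * (I k - I (Suc (Suc k)))" by (simp add: algebra_simps)
  then have "(2 * real (Suc k)) *\<^sub>R I (Suc k) = \<kappa> *\<^sub>R (I k - I (Suc (Suc k)))" by (simp add: scaleR_conv_of_real)
  moreover have "(LINT z|von_mises \<kappa>. z ^ n) = I n /\<^sub>R von_mises_mass \<kappa>" for n
    unfolding I_def by (rule integral_von_mises) measurable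
  ultimately show ?thesis
    by (simp only: scaleR_right_diff_distrib[symmetric] scaleR_left_commute[of _ "inverse (von_mises_mass \<kappa>)"])
qed

section \<open>Stationarity of the von Mises distribution\<close>

lemma norm_quotient_le:
  fixes Y :: "'b::real_normed_vector"
  assumes "norm Y \<le> S * \<bar>d\<bar>" "d \<noteq> 0"
  shows "norm (Y /\<^sub>R d) \<le> S"
proof -
  have "norm (Y /\<^sub>R d) = norm Y / \<bar>d\<bar>" by (simp add: divide_inverse mult.commute)
  then show ?thesis using assms by (simp add: divide_le_eq)
qed

section \<open>Transition kernels and their measurability\<close>

context adler
begin

definition kernel :: "real \<Rightarrow> complex \<Rightarrow> complex measure" where
  "kernel t x = distr M borel (h (proj x) t)"

lemma h_proj_meas: "t \<ge> 0 \<Longrightarrow> h (proj x) t \<in> borel_measurable M"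
  using h_meas[OF proj_in] .

lemma prob_space_kernel: "t \<ge> 0 \<Longrightarrow> prob_space (kernel t x)"
  unfolding kernel_def by (rule prob_space_distr[OF h_proj_meas])

lemma sets_kernel[simp]: "sets (kernel t x) = sets borel"
  by (simp add: kernel_def)

lemma integral_kernel:
  fixes f :: "complex \<Rightarrow> 'b::{banach, second_countable_topology}"
  assumes "t \<ge> 0" "f \<in> borel_measurable borel"
  shows "(LINT z|kernel t x. f z) = expectation (\<lambda>\<omega>. f (h (proj x) t \<omega>))"
  unfolding kernel_def by (rule integral_distr[OF h_proj_meas[OF assms(1)] assms(2)])

text \<open>Feller property for Lipschitz test functions. The almost sure comparison is applied to
  one pair of starting points at a time, so its null set may depend on the pair.\<close>

lemma expectation_lipschitz_continuous:
  fixes \<phi> :: "complex \<Rightarrow> real"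
  assumes t: "t \<ge> 0" and L: "L \<ge> 0" "\<And>z w. \<bar>\<phi> z - \<phi> w\<bar> \<le> L * norm (z - w)" and b: "\<And>z. \<bar>\<phi> z\<bar> \<le> 1"
    and moment: "\<phi> \<in> borel_measurable borel"
  shows "continuous_on UNIV (\<lambda>x. expectation (\<lambda>\<omega>. \<phi> (h (proj x) t \<omega>)))"
proof (rule continuous_on_compose2[OF _ proj_cont])
  have int: "integrable M (\<lambda>\<omega>. \<phi> (h x t \<omega>))" if "x \<in> cball 0 1" for x
    by (rule integrable_const_bound[where B = 1]) (use b moment h_meas[OF that t] in auto)
  have "dist (expectation (\<lambda>\<omega>. \<phi> (h x t \<omega>))) (expectation (\<lambda>\<omega>. \<phi> (h y t \<omega>))) \<le> (L * exp (2 * K * t)) * dist x y"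
    if x: "x \<in> cball 0 1" and y: "y \<in> cball 0 1" for x y
  proof -
    have "\<bar>expectation (\<lambda>\<omega>. \<phi> (h x t \<omega>) - \<phi> (h y t \<omega>))\<bar> \<le> expectation (\<lambda>\<omega>. \<bar>\<phi> (h x t \<omega>) - \<phi> (h y t \<omega>)\<bar>)"
      by (rule integral_abs_bound)
    also have "\<dots> \<le> expectation (\<lambda>\<omega>. (L * exp (2 * K * t)) * dist x y)"
    proof (rule integral_mono_AE)
      show "AE \<omega> in M. \<bar>\<phi> (h x t \<omega>) - \<phi> (h y t \<omega>)\<bar> \<le> (L * exp (2 * K * t)) * dist x y"
        using h_lipschitz[OF x y t]
      proof eventually_elim
        case (elim \<omega>)
        have "\<bar>\<phi> (h x t \<omega>) - \<phi> (h y t \<omega>)\<bar> \<le> L * norm (h x t \<omega> - h y t \<omega>)" by (rule L(2))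
        also have "\<dots> \<le> L * (norm (x - y) * exp (2 * K * t))" by (intro mult_left_mono elim L(1))
        finally show ?case by (simp add: dist_norm mult_ac)
      qed
    qed (use int[OF x] int[OF y] in auto)
    finally show ?thesis using int[OF x] int[OF y] by (simp add: dist_real_def prob_space)
  qed
  then have "(L * exp (2 * K * t))-lipschitz_on (cball 0 1) (\<lambda>x. expectation (\<lambda>\<omega>. \<phi> (h x t \<omega>)))"
    using L(1) by (intro lipschitz_onI) auto
  then show "continuous_on (cball 0 1) (\<lambda>x. expectation (\<lambda>\<omega>. \<phi> (h x t \<omega>)))" by (rule lipschitz_on_continuous_on)
qed (use proj_in in auto)

text \<open>Nothing is known about joint measurability of \<open>h\<close> in the starting point and
  \<omega>. Instead, the probability of a closed set is a pointwise limit of continuous functions of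
  the starting point, and closed sets generate the Borel sets.\<close>

lemma kernel_measurable:
  assumes t: "t \<ge> 0"
  shows "kernel t \<in> borel \<rightarrow>\<^sub>M subprob_algebra borel"
proof (rule measurable_subprob_algebra_generated[where G = "Collect closed" and \<Omega> = UNIV])
  show "sets (borel :: complex measure) = sigma_sets UNIV (Collect closed)"
    unfolding borel_eq_closed by simp
  show "subprob_space (kernel t a)" for a using prob_space_kernel[OF t] by (rule prob_space_imp_subprob_space)
  show C: "(\<lambda>a. emeasure (kernel t a) C) \<in> borel_measurable borel" if C: "C \<in> Collect closed" for C
  proof (cases "C = {}")
    case False
    let ?\<phi> = "\<lambda>n z. max 0 (1 - real n * infdist z C)"
    have b: "\<bar>?\<phi> n z\<bar> \<le> 1" for n z by (auto simp: infdist_nonneg mult_nonneg_nonneg)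
    have \<phi>moment: "?\<phi> n \<in> borel_measurable borel" for n by (intro borel_measurable_continuous_onI closed_indicator_approx_continuous)
    have "(\<lambda>a. measure (kernel t a) C) \<in> borel_measurable borel"
    proof (rule borel_measurable_LIMSEQ_real)
      show "(\<lambda>a. expectation (\<lambda>\<omega>. ?\<phi> n (h (proj a) t \<omega>))) \<in> borel_measurable borel" for n
      proof (intro borel_measurable_continuous_onI expectation_lipschitz_continuous[OF t, where L = "real n"] b \<phi>moment)
        show "\<bar>?\<phi> n z - ?\<phi> n w\<bar> \<le> real n * norm (z - w)" for z w
        proof -
          have "\<bar>infdist z C - infdist w C\<bar> \<le> norm (z - w)" using infdist_triangle_abs[of z C w] by (simp add: dist_norm)
          then have "real n * \<bar>infdist z C - infdist w C\<bar> \<le> real n * norm (z - w)" by (intro mult_left_mono) auto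
          then have "\<bar>real n * infdist z C - real n * infdist w C\<bar> \<le> real n * norm (z - w)"
            by (simp add: abs_mult flip: right_diff_distrib)
          then show ?thesis by (auto simp: max_def abs_if split: if_splits)
        qed
      qed (simp_all add: closed_indicator_approx_continuous)
      show "(\<lambda>n. expectation (\<lambda>\<omega>. ?\<phi> n (h (proj a) t \<omega>))) \<longlonglongrightarrow> measure (kernel t a) C" for a
      proof -
        have "(\<lambda>n. LINT z|kernel t a. ?\<phi> n z) \<longlonglongrightarrow> (LINT z|kernel t a. indicator C z)"
        proof (rule integral_dominated_convergence[where w = "\<lambda>_. 1"])
          interpret k: prob_space "kernel t a" by (rule prob_space_kernel[OF t])
          show "integrable (kernel t a) (\<lambda>_. 1::real)" by simp
          show "indicator C \<in> borel_measurable (kernel t a)" using C by (auto simp: measurable_cong_sets[OF sets_kernel refl])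
          show "?\<phi> n \<in> borel_measurable (kernel t a)" for n using \<phi>moment by (simp add: measurable_cong_sets[OF sets_kernel refl])
          show "AE z in kernel t a. (\<lambda>n. ?\<phi> n z) \<longlonglongrightarrow> indicator C z"
            using closed_indicator_limit[of C] C False by auto
        qed (use b in auto)
        moreover have "(LINT z|kernel t a. indicator C z) = measure (kernel t a) C"
          by (simp add: kernel_def)
        ultimately show ?thesis using integral_kernel[OF t \<phi>moment] by simp
      qed
    qed
    moreover have "emeasure (kernel t a) C = ennreal (measure (kernel t a) C)" for a
    proof -
      interpret k: prob_space "kernel t a" by (rule prob_space_kernel[OF t])
      show ?thesis by (rule k.emeasure_eq_measure)
    qed
    ultimately show ?thesis by simp
  qed simp
  then show "(\<lambda>a. emeasure (kernel t a) UNIV) \<in> borel_measurable borel" by simp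
qed (auto simp: Int_stable_closed)

lemma expectation_measurable:
  fixes f :: "complex \<Rightarrow> 'b::{banach, second_countable_topology}"
  assumes t: "t \<ge> 0" and f: "f \<in> borel_measurable borel"
  shows "(\<lambda>x. expectation (\<lambda>\<omega>. f (h (proj x) t \<omega>))) \<in> borel_measurable borel"
  using measurable_compose[OF kernel_measurable[OF t] integral_measurable_subprob_algebra[OF f]]
  unfolding integral_kernel[OF t f] .

lemma moment_measurable: "t \<ge> 0 \<Longrightarrow> (\<lambda>x. moment n (proj x) t) \<in> borel_measurable borel"
  unfolding moment_def by (rule expectation_measurable) auto

text \<open>A Lipschitz constant in time of the n-th moment: the derivative of \<open>U h\<close>
  has modulus at most 2 K, which contributes 2 n K, and the Gaussian factor contributes \<epsilon>^2
  n^2. It does not depend on the starting point and so dominates all difference quotients.\<close>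

definition speed :: "nat \<Rightarrow> real" where
  "speed n = 2 * real n * K + \<epsilon>\<^sup>2 * (real n)\<^sup>2"

lemma moment_increment_le:
  assumes x: "x \<in> cball 0 1" and st: "0 \<le> s" "s \<le> t"
  shows "norm (moment n x t - moment n x s) \<le> speed n * (t - s)"
proof -
  have t: "0 \<le> t" using st by simp
  let ?X = "\<lambda>\<omega>. cnj (U t \<omega>) ^ n * ((U t \<omega> * h x t \<omega>) ^ n - (U s \<omega> * h x s \<omega>) ^ n)"
  define l where "l = \<epsilon>\<^sup>2 * (real n)\<^sup>2 * (t - s)"
  have l0: "l \<ge> 0" using st by (simp add: l_def)
  have ae: "AE \<omega> in M. norm (?X \<omega>) \<le> 2 * real n * K * (t - s)"
    using path[OF x]
  proof eventually_elim
    case (elim \<omega>)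
    then interpret R: riccati_path K x "\<lambda>t. U t \<omega>" "\<lambda>t. h x t \<omega>" .
    have x1: "norm x \<le> 1" using x by simp
    have "norm ((U t \<omega> * h x t \<omega>) ^ n - (U s \<omega> * h x s \<omega>) ^ n) \<le> real n * norm (U t \<omega> * h x t \<omega> - U s \<omega> * h x s \<omega>)"
      by (rule norm_power_diff) (use R.norm_le_1[OF x1] st in \<open>auto simp: norm_mult\<close>)
    also have "\<dots> \<le> real n * (2 * K * (t - s))" by (intro mult_left_mono R.g_lipschitz[OF x1 st]) auto
    finally show ?case by (simp add: norm_mult norm_power mult_ac)
  qed
  have Xm: "?X \<in> borel_measurable M"
    using h_meas[OF x t] h_meas[OF x st(1)] U_meas[OF t] U_meas[OF st(1)] by measurable
  have "norm (expectation ?X) \<le> expectation (\<lambda>\<omega>. norm (?X \<omega>))" by (rule integral_norm_bound)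
  also have "\<dots> \<le> expectation (\<lambda>\<omega>. 2 * real n * K * (t - s))"
    using ae Xm by (intro integral_mono_AE integrable_norm integrable_const_bound[where f = ?X, OF ae]) auto
  finally have 1: "norm (expectation ?X) \<le> 2 * real n * K * (t - s)" by (simp add: prob_space)
  have "norm (of_real (exp (- l) - 1) * moment n x s) \<le> l * 1"
    unfolding norm_mult norm_of_real
  proof (rule mult_mono)
    have "exp (- l) \<le> 1" "1 - l \<le> exp (- l)" using l0 exp_ge_add_one_self[of "- l"] by auto
    then show "\<bar>exp (- l) - 1\<bar> \<le> l" by linarith
  qed (use moment_bound[OF x st(1)] l0 in auto)
  then have 2: "norm (of_real (exp (- (\<epsilon>\<^sup>2 * (real n)\<^sup>2 * (t - s))) - 1) * moment n x s) \<le> \<epsilon>\<^sup>2 * (real n)\<^sup>2 * (t - s)"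
    by (simp add: l_def)
  have "norm (moment n x t - moment n x s) \<le> 2 * real n * K * (t - s) + \<epsilon>\<^sup>2 * (real n)\<^sup>2 * (t - s)"
    unfolding moment_increment[OF x st] by (rule norm_triangle_mono[OF 1 2])
  then show ?thesis by (simp add: speed_def algebra_simps)
qed

text \<open>The Gibbs measure of the phase equation d\<theta> = -2 K sin \<theta> dt + sqrt 2
  \<epsilon> dW: the drift is minus the derivative of the potential -2 K cos \<theta> and the
  temperature is \<epsilon>^2, which gives the parameter
  \<open>2 * K / \<epsilon>\<^sup>2\<close>.\<close>

definition stationary :: "complex measure" where
  "stationary = von_mises (2 * K / \<epsilon>\<^sup>2)"

lemma stationary_prob: "prob_space stationary" and stationary_sets[simp, measurable_cong]: "sets stationary = sets borel"
  unfolding stationary_def by (auto simp: prob_space_von_mises)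

lemma stationary_sphere: "AE z in stationary. z \<in> sphere 0 1"
  unfolding stationary_def by (rule von_mises_sphere)

definition stationary_moment :: "nat \<Rightarrow> complex" where
  "stationary_moment n = (LINT z|stationary. z ^ n)"

lemma stationary_moment_0: "stationary_moment 0 = 1"
  using prob_space.prob_space[OF stationary_prob] by (simp add: stationary_moment_def)

text \<open>The integration by parts identity, multiplied by \<epsilon>^2 n/2 with n = k + 1, says
  that the von Mises moments are a constant solution of the moment equations.\<close>

lemma stationary_moment_rec: "of_real (real (Suc k) * K) * (stationary_moment k - stationary_moment (Suc (Suc k))) = of_real (\<epsilon>\<^sup>2 * (real (Suc k))\<^sup>2) * stationary_moment (Suc k)"
proof -
  have "(2 * real (Suc k)) *\<^sub>R stationary_moment (Suc k) = (2 * K / \<epsilon>\<^sup>2) *\<^sub>R (stationary_moment k - stationary_moment (Suc (Suc k)))"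
    unfolding stationary_moment_def stationary_def by (rule von_mises_moments)
  then have "(\<epsilon>\<^sup>2 * real (Suc k) / 2) *\<^sub>R ((2 * real (Suc k)) *\<^sub>R stationary_moment (Suc k)) = (\<epsilon>\<^sup>2 * real (Suc k) / 2) *\<^sub>R ((2 * K / \<epsilon>\<^sup>2) *\<^sub>R (stationary_moment k - stationary_moment (Suc (Suc k))))"
    by simp
  moreover have "\<epsilon>\<^sup>2 * real (Suc k) / 2 * (2 * real (Suc k)) = \<epsilon>\<^sup>2 * (real (Suc k))\<^sup>2" by (simp add: power2_eq_square)
  moreover have "\<epsilon>\<^sup>2 * real (Suc k) / 2 * (2 * K / \<epsilon>\<^sup>2) = real (Suc k) * K" using e0 by simp
  ultimately show ?thesis unfolding scaleR_scaleR by (simp only: scaleR_conv_of_real)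
qed

section \<open>Moments of the law started from the von Mises distribution\<close>

definition evolved_moment :: "nat \<Rightarrow> real \<Rightarrow> complex" where
  "evolved_moment n t = (LINT x|stationary. moment n (proj x) t)"

lemma evolved_moment_integrable: "t \<ge> 0 \<Longrightarrow> integrable stationary (\<lambda>x. moment n (proj x) t)"
proof -
  interpret V: prob_space stationary by (rule stationary_prob)
  assume t: "t \<ge> 0"
  show ?thesis
    using moment_bound[OF proj_in t] moment_measurable[OF t] by (intro V.integrable_const_bound[where B = 1]) auto
qed

lemma evolved_moment_deriv:
  assumes t: "t \<ge> 0"
  shows "(evolved_moment (Suc k) has_vector_derivative
     of_real (real (Suc k) * K) * (evolved_moment k t - evolved_moment (Suc (Suc k)) t) - of_real (\<epsilon>\<^sup>2 * (real (Suc k))\<^sup>2) * evolved_moment (Suc k) t) (at t within {0..})"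
  unfolding has_vector_derivative_iff_quotient tendsto_at_iff_sequentially comp_def
proof (intro allI impI)
  interpret V: prob_space stationary by (rule stationary_prob)
  fix q :: "nat \<Rightarrow> real" assume q: "\<forall>j. q j \<in> {0..} - {t}" "q \<longlonglongrightarrow> t"
  have q0: "q j \<ge> 0" "q j \<noteq> t" for j using q by auto
  let ?D = "\<lambda>x. of_real (real (Suc k) * K) * (moment k (proj x) t - moment (Suc (Suc k)) (proj x) t) - of_real (\<epsilon>\<^sup>2 * (real (Suc k))\<^sup>2) * moment (Suc k) (proj x) t"
  have "(\<lambda>j. LINT x|stationary. (moment (Suc k) (proj x) (q j) - moment (Suc k) (proj x) t) /\<^sub>R (q j - t)) \<longlonglongrightarrow> (LINT x|stationary. ?D x)"
  proof (rule integral_dominated_convergence[where w = "\<lambda>_. speed (Suc k)"])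
    show "AE x in stationary. (\<lambda>j. (moment (Suc k) (proj x) (q j) - moment (Suc k) (proj x) t) /\<^sub>R (q j - t)) \<longlonglongrightarrow> ?D x"
      using moment_deriv[OF proj_in t] q
      unfolding has_vector_derivative_iff_quotient tendsto_at_iff_sequentially comp_def by auto
    show "AE x in stationary. norm ((moment (Suc k) (proj x) (q j) - moment (Suc k) (proj x) t) /\<^sub>R (q j - t)) \<le> speed (Suc k)" for j
    proof (rule AE_I2)
      fix x
      have "norm (moment (Suc k) (proj x) (q j) - moment (Suc k) (proj x) t) \<le> speed (Suc k) * \<bar>q j - t\<bar>"
        using moment_increment_le[OF proj_in q0(1), of j t "Suc k" x] moment_increment_le[OF proj_in t, of "q j" "Suc k" x]
        by (cases "q j \<le> t") (auto simp: norm_minus_commute)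
      then show "norm ((moment (Suc k) (proj x) (q j) - moment (Suc k) (proj x) t) /\<^sub>R (q j - t)) \<le> speed (Suc k)"
        using q0(2)[of j] by (intro norm_quotient_le) auto
    qed
    show "?D \<in> borel_measurable stationary" using moment_measurable[OF t] by measurable
    show "(\<lambda>x. (moment (Suc k) (proj x) (q j) - moment (Suc k) (proj x) t) /\<^sub>R (q j - t)) \<in> borel_measurable stationary" for j
      using moment_measurable[OF t] moment_measurable[OF q0(1)] by measurable
  qed simp
  moreover have "(LINT x|stationary. (moment (Suc k) (proj x) (q j) - moment (Suc k) (proj x) t) /\<^sub>R (q j - t)) = (evolved_moment (Suc k) (q j) - evolved_moment (Suc k) t) /\<^sub>R (q j - t)" for j
    unfolding evolved_moment_def using evolved_moment_integrable[OF t] evolved_moment_integrable[OF q0(1)] by simp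
  moreover have "(LINT x|stationary. ?D x) = of_real (real (Suc k) * K) * (evolved_moment k t - evolved_moment (Suc (Suc k)) t) - of_real (\<epsilon>\<^sup>2 * (real (Suc k))\<^sup>2) * evolved_moment (Suc k) t"
    unfolding evolved_moment_def
    by (subst Bochner_Integration.integral_diff, intro integrable_mult_right Bochner_Integration.integrable_diff evolved_moment_integrable t,
        intro integrable_mult_right evolved_moment_integrable t)
      (simp only: integral_mult_right_zero Bochner_Integration.integral_diff[OF evolved_moment_integrable[OF t] evolved_moment_integrable[OF t]])
  ultimately show "(\<lambda>j. (evolved_moment (Suc k) (q j) - evolved_moment (Suc k) t) /\<^sub>R (q j - t)) \<longlonglongrightarrow> of_real (real (Suc k) * K) * (evolved_moment k t - evolved_moment (Suc (Suc k)) t) - of_real (\<epsilon>\<^sup>2 * (real (Suc k))\<^sup>2) * evolved_moment (Suc k) t"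
    by (simp only:)
qed

lemma evolved_moment_0: "evolved_moment n 0 = stationary_moment n"
  unfolding evolved_moment_def stationary_moment_def
proof (rule integral_cong_AE)
  show "AE x in stationary. moment n (proj x) 0 = x ^ n"
    using stationary_sphere by eventually_elim (simp add: moment_start proj_id)
qed (use moment_measurable[of 0] in auto)

lemma evolved_moment_bound: "t \<ge> 0 \<Longrightarrow> norm (evolved_moment n t) \<le> 1"
proof -
  interpret V: prob_space stationary by (rule stationary_prob)
  assume t: "t \<ge> 0"
  have "norm (evolved_moment n t) \<le> (LINT x|stationary. norm (moment n (proj x) t))" unfolding evolved_moment_def by (rule integral_norm_bound)
  also have "\<dots> \<le> (LINT x|stationary. 1)"
    using moment_bound[OF proj_in t] evolved_moment_integrable[OF t] by (intro integral_mono) auto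
  finally show ?thesis by (simp add: V.prob_space)
qed

text \<open>Evolved and von Mises moments obey the same linear system, so their difference solves it
  too; it starts at 0, is bounded by 2, and has zeroth component 0 because all measures involved
  have mass 1. The coefficients are real, so real and imaginary parts are treated separately, as
  images under a real-linear \<open>l\<close>.\<close>

lemma evolved_moment_constant:
  assumes t: "t \<ge> 0" shows "evolved_moment n t = stationary_moment n"
proof -
  have main: "l (evolved_moment n t - stationary_moment n) = 0" if l: "bounded_linear l" and lb: "\<And>z. \<bar>l z\<bar> \<le> norm z" for l :: "complex \<Rightarrow> real"
  proof (rule moment_system_zero[where d = "\<lambda>n t. l (evolved_moment n t - stationary_moment n)" and B = 2 and K = K and l = "\<epsilon>\<^sup>2"])
    interpret l: bounded_linear l by (rule l)
    have lr: "l (of_real r * z) = r * l z" for r z using l.scaleR[of r z] by (simp add: scaleR_conv_of_real)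
    show "\<bar>l (evolved_moment n t - stationary_moment n)\<bar> \<le> 2" if "t \<ge> 0" for n t
    proof -
      have "\<bar>l (evolved_moment n t - stationary_moment n)\<bar> \<le> norm (evolved_moment n t) + norm (stationary_moment n)" by (rule order_trans[OF lb norm_triangle_ineq4])
      also have "\<dots> \<le> 2" using evolved_moment_bound[OF that, of n] evolved_moment_bound[of 0 n] by (simp add: evolved_moment_0)
      finally show ?thesis .
    qed
    show "l (evolved_moment 0 t - stationary_moment 0) = 0" if "t \<ge> 0" for t
    proof -
      interpret V: prob_space stationary by (rule stationary_prob)
      show ?thesis by (simp add: evolved_moment_def moment_0 stationary_moment_0 V.prob_space l.zero)
    qed
    show "l (evolved_moment n 0 - stationary_moment n) = 0" for n by (simp add: evolved_moment_0 l.zero)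
    show "((\<lambda>t. l (evolved_moment (Suc n) t - stationary_moment (Suc n))) has_real_derivative
       real (Suc n) * K * (l (evolved_moment n t - stationary_moment n) - l (evolved_moment (Suc (Suc n)) t - stationary_moment (Suc (Suc n)))) - \<epsilon>\<^sup>2 * (real (Suc n))\<^sup>2 * l (evolved_moment (Suc n) t - stationary_moment (Suc n))) (at t within {0..})"
      if t: "t \<ge> 0" for n t
    proof -
      have "((\<lambda>t. l (evolved_moment (Suc n) t - stationary_moment (Suc n))) has_vector_derivative
        l (of_real (real (Suc n) * K) * (evolved_moment n t - evolved_moment (Suc (Suc n)) t) - of_real (\<epsilon>\<^sup>2 * (real (Suc n))\<^sup>2) * evolved_moment (Suc n) t - 0)) (at t within {0..})"
        by (intro l.has_vector_derivative has_vector_derivative_diff evolved_moment_deriv[OF t] has_vector_derivative_const)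
      moreover have "l (of_real (real (Suc n) * K) * (evolved_moment n t - evolved_moment (Suc (Suc n)) t) - of_real (\<epsilon>\<^sup>2 * (real (Suc n))\<^sup>2) * evolved_moment (Suc n) t - 0) =
        real (Suc n) * K * (l (evolved_moment n t - stationary_moment n) - l (evolved_moment (Suc (Suc n)) t - stationary_moment (Suc (Suc n)))) - \<epsilon>\<^sup>2 * (real (Suc n))\<^sup>2 * l (evolved_moment (Suc n) t - stationary_moment (Suc n))"
      proof -
        have "of_real (real (Suc n) * K) * (evolved_moment n t - evolved_moment (Suc (Suc n)) t) - of_real (\<epsilon>\<^sup>2 * (real (Suc n))\<^sup>2) * evolved_moment (Suc n) t - 0 =
          of_real (real (Suc n) * K) * ((evolved_moment n t - stationary_moment n) - (evolved_moment (Suc (Suc n)) t - stationary_moment (Suc (Suc n)))) - of_real (\<epsilon>\<^sup>2 * (real (Suc n))\<^sup>2) * (evolved_moment (Suc n) t - stationary_moment (Suc n))"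
          using stationary_moment_rec[of n] by (simp only: right_diff_distrib diff_0_right) (simp only: algebra_simps)
        then show ?thesis by (simp only: l.diff lr)
      qed
      ultimately show ?thesis by (simp only: has_real_derivative_iff_has_vector_derivative)
    qed
  qed (use K0 e0 t in auto)
  have "Re (evolved_moment n t - stationary_moment n) = 0" by (rule main[OF bounded_linear_Re abs_Re_le_cmod])
  moreover have "Im (evolved_moment n t - stationary_moment n) = 0" by (rule main[OF bounded_linear_Im abs_Im_le_cmod])
  ultimately show ?thesis by (simp add: complex_eq_iff)
qed

lemma integral_bind_kernel:
  fixes f :: "complex \<Rightarrow> real"
  assumes t: "t \<ge> 0" and f: "f \<in> borel_measurable borel" "\<And>z. \<bar>f z\<bar> \<le> B"
  shows "(LINT z|(stationary \<bind> kernel t). f z) = (LINT x|stationary. expectation (\<lambda>\<omega>. f (h (proj x) t \<omega>)))"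
proof -
  interpret V: prob_space stationary by (rule stationary_prob)
  have "(LINT z|(stationary \<bind> kernel t). f z) = (LINT x|stationary. LINT z|kernel t x. f z)"
  proof (rule integral_bind[where K = borel and B = B and B' = 1])
    show "kernel t \<in> stationary \<rightarrow>\<^sub>M subprob_algebra borel" using kernel_measurable[OF t] by simp
    show "AE x in stationary. emeasure (kernel t x) (space (kernel t x)) \<le> ennreal 1"
      using prob_space.emeasure_space_1[OF prob_space_kernel[OF t]] by simp
    show "finite_measure stationary" by unfold_locales
  qed (use f in auto)
  then show ?thesis by (simp only: integral_kernel[OF t f(1)])
qed

lemma stationary_not_empty: "space stationary \<noteq> {}"
  using prob_space.not_empty[OF stationary_prob] .

lemma bind_stationary_sets: "sets (stationary \<bind> kernel t) = sets borel"
  by (rule sets_bind[OF _ stationary_not_empty]) simp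

lemma bind_stationary_prob: "t \<ge> 0 \<Longrightarrow> prob_space (stationary \<bind> kernel t)"
  using kernel_measurable prob_space_kernel
  by (intro prob_space.prob_space_bind[OF stationary_prob, where S = borel]) auto

lemma bind_stationary_sphere:
  assumes t: "t \<ge> 0"
  shows "AE z in stationary \<bind> kernel t. z \<in> sphere 0 1"
proof -
  have [measurable]: "sphere (0::complex) 1 \<in> sets borel" by simp
  have "AE x in stationary. AE z in kernel t x. z \<in> sphere 0 1"
    using stationary_sphere
  proof eventually_elim
    case (elim x)
    then have x: "proj x \<in> sphere 0 1" by (simp add: proj_id)
    show ?case unfolding kernel_def
      by (subst AE_distr_iff[OF h_proj_meas[OF t]]) (use h_in_sphere[OF x t] in auto)
  qed
  then show ?thesis
    by (subst AE_bind[where B = borel]) (use kernel_measurable[OF t] in auto)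
qed

lemma power_proj_measurable: "(\<lambda>z. proj z ^ n) \<in> borel_measurable borel"
  using borel_measurable_continuous_onI[OF proj_cont] by measurable

lemma norm_proj_power: "norm (proj z ^ n) \<le> 1"
  using proj_in[of z] by (simp add: norm_power power_le_one)

text \<open>The power z^n is unbounded on the plane; composed with \<open>proj\<close> it becomes a
  bounded test function with the same values on the circle. The functional \<open>l\<close> makes it
  real-valued, as the semigroup identities require.\<close>

lemma moment_linear_functional:
  fixes l :: "complex \<Rightarrow> real"
  assumes "prob_space \<mu>" and s[measurable_cong]: "sets \<mu> = sets borel" and ae: "AE z in \<mu>. z \<in> sphere 0 1" and l: "bounded_linear l"
  shows "l (LINT z|\<mu>. z ^ n) = (LINT z|\<mu>. l (proj z ^ n))"
proof -
  interpret \<mu>: prob_space \<mu> by fact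
  have i: "integrable \<mu> (\<lambda>z. proj z ^ n)"
    using norm_proj_power power_proj_measurable by (intro \<mu>.integrable_const_bound[where B = 1]) auto
  have "(LINT z|\<mu>. z ^ n) = (LINT z|\<mu>. proj z ^ n)"
  proof (rule integral_cong_AE)
    show "AE z in \<mu>. z ^ n = proj z ^ n" using ae by eventually_elim (simp add: proj_id)
  qed (use power_proj_measurable in auto)
  then show ?thesis using integral_bounded_linear[OF l i] by simp
qed

lemma expectation_power_proj:
  fixes l :: "complex \<Rightarrow> real"
  assumes x: "x \<in> cball 0 1" and t: "t \<ge> 0" and l: "bounded_linear l"
  shows "expectation (\<lambda>\<omega>. l (proj (h x t \<omega>) ^ n)) = l (moment n x t)"
proof -
  have [measurable]: "h x t \<in> borel_measurable M" "l \<in> borel_measurable borel" "proj \<in> borel_measurable borel"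
    using h_meas[OF x t] borel_measurable_continuous_onI[OF linear_continuous_on[OF l]]
      borel_measurable_continuous_onI[OF proj_cont] by auto
  have "expectation (\<lambda>\<omega>. l (proj (h x t \<omega>) ^ n)) = expectation (\<lambda>\<omega>. l ((h x t \<omega>) ^ n))"
  proof (rule integral_cong_AE)
    show "AE \<omega> in M. l (proj (h x t \<omega>) ^ n) = l ((h x t \<omega>) ^ n)"
      using h_norm_le_1[OF x t] by eventually_elim (simp add: proj_id)
  qed measurable
  then show ?thesis unfolding moment_def using integral_bounded_linear[OF l h_power_integrable[OF x t]] by simp
qed

text \<open>Both sides are carried by the circle, so comparing moments is enough; those on the left
  are the evolved moments.\<close>

lemma bind_stationary:
  assumes t: "t \<ge> 0"
  shows "stationary \<bind> kernel t = stationary"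
proof (rule circle_measure_eqI[OF bind_stationary_prob[OF t] stationary_prob bind_stationary_sets stationary_sets bind_stationary_sphere[OF t] stationary_sphere])
  fix n
  have main: "l (LINT z|(stationary \<bind> kernel t). z ^ n) = l (LINT z|stationary. z ^ n)" if l: "bounded_linear l" and lb: "\<And>z. \<bar>l z\<bar> \<le> norm z" for l :: "complex \<Rightarrow> real"
  proof -
    have lm: "l \<in> borel_measurable borel" using borel_measurable_continuous_onI[OF linear_continuous_on[OF l]] .
    have "l (LINT z|(stationary \<bind> kernel t). z ^ n) = (LINT z|(stationary \<bind> kernel t). l (proj z ^ n))"
      by (rule moment_linear_functional[OF bind_stationary_prob[OF t] bind_stationary_sets bind_stationary_sphere[OF t] l])
    also have "\<dots> = (LINT x|stationary. expectation (\<lambda>\<omega>. l (proj (h (proj x) t \<omega>) ^ n)))"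
    proof (rule integral_bind_kernel[OF t])
      show "(\<lambda>z. l (proj z ^ n)) \<in> borel_measurable borel" using lm power_proj_measurable by measurable
      show "\<bar>l (proj z ^ n)\<bar> \<le> 1" for z by (rule order_trans[OF lb norm_proj_power])
    qed
    also have "\<dots> = (LINT x|stationary. l (moment n (proj x) t))"
      by (simp only: expectation_power_proj[OF proj_in t l])
    also have "\<dots> = l (evolved_moment n t)"
      unfolding evolved_moment_def by (rule integral_bounded_linear[OF l evolved_moment_integrable[OF t]])
    also have "\<dots> = l (LINT z|stationary. z ^ n)" unfolding evolved_moment_constant[OF t] stationary_moment_def ..
    finally show ?thesis .
  qed
  show "(LINT z|(stationary \<bind> kernel t). z ^ n) = (LINT z|stationary. z ^ n)"
    using main[OF bounded_linear_Re abs_Re_le_cmod] main[OF bounded_linear_Im abs_Im_le_cmod] by (simp add: complex_eq_iff)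
qed

end

section \<open>Invariant measures on the closed disc\<close>

text \<open>Covers the three state spaces at once: only the values on the space of \<open>\<mu>\<close> matter, so
  test functions may be taken Borel on the whole plane.\<close>

locale disc_invariant = adler +
  fixes \<mu> :: "complex measure"
  assumes \<mu>_prob: "prob_space \<mu>" and \<mu>_space: "space \<mu> \<subseteq> cball 0 1"
    and \<mu>_meas: "\<And>f :: complex \<Rightarrow> real. f \<in> borel_measurable borel \<Longrightarrow> f \<in> borel_measurable \<mu>"
    and \<mu>_inv: "\<And>t B (f :: complex \<Rightarrow> real). t \<ge> 0 \<Longrightarrow> f \<in> borel_measurable borel \<Longrightarrow> (\<And>z. \<bar>f z\<bar> \<le> B) \<Longrightarrow>
       (LINT x|\<mu>. f x) = (LINT x|\<mu>. expectation (\<lambda>\<omega>. f (h (proj x) t \<omega>)))"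
begin

sublocale \<mu>: prob_space \<mu> by (rule \<mu>_prob)

lemma \<mu>_integrable:
  fixes f :: "complex \<Rightarrow> real"
  assumes "f \<in> borel_measurable borel" "\<And>z. \<bar>f z\<bar> \<le> B"
  shows "integrable \<mu> f"
proof (rule \<mu>.integrable_const_bound[where B = B])
  show "AE x in \<mu>. norm (f x) \<le> B" using assms(2) by simp
qed (rule \<mu>_meas[OF assms(1)])

text \<open>Invariance makes the integral of (P_q f - f)/q vanish for every q > 0. When the
  quotients converge pointwise along q = 1/(j + 1), bounded uniformly in the starting point,
  dominated convergence passes this to the limit. No domain of a generator has to be
  described.\<close>

lemma generator_integral_zero:
  fixes f D :: "complex \<Rightarrow> real"
  assumes f: "f \<in> borel_measurable borel" "\<And>z. \<bar>f z\<bar> \<le> B" and D: "D \<in> borel_measurable borel"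
    and lim: "\<And>x. x \<in> cball 0 1 \<Longrightarrow> (\<lambda>j. (expectation (\<lambda>\<omega>. f (h x (1 / real (Suc j)) \<omega>)) - f x) / (1 / real (Suc j))) \<longlonglongrightarrow> D x"
    and bd: "\<And>x j. x \<in> cball 0 1 \<Longrightarrow> \<bar>expectation (\<lambda>\<omega>. f (h x (1 / real (Suc j)) \<omega>)) - f x\<bar> \<le> C * (1 / real (Suc j))"
  shows "(LINT x|\<mu>. D x) = 0"
proof -
  define q where "q j = 1 / real (Suc j)" for j
  have q: "q j > 0" for j by (simp add: q_def)
  define g where "g j x = expectation (\<lambda>\<omega>. f (h (proj x) (q j) \<omega>))" for j x
  have gm: "g j \<in> borel_measurable borel" for j
    unfolding g_def using q[of j] f(1) by (intro expectation_measurable) auto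
  have gb: "\<bar>g j x\<bar> \<le> B" for j x
  proof -
    have i: "integrable M (\<lambda>\<omega>. f (h (proj x) (q j) \<omega>))"
      by (rule integrable_const_bound[where B = B]) (use f q[of j] h_proj_meas[of "q j" x] in auto)
    have "\<bar>g j x\<bar> \<le> expectation (\<lambda>\<omega>. \<bar>f (h (proj x) (q j) \<omega>)\<bar>)" unfolding g_def by (rule integral_abs_bound)
    also have "\<dots> \<le> expectation (\<lambda>\<omega>. B)" using f(2) i by (intro integral_mono) auto
    finally show ?thesis by (simp add: prob_space)
  qed
  have lim': "(\<lambda>j. LINT x|\<mu>. (g j x - f x) / q j) \<longlonglongrightarrow> (LINT x|\<mu>. D x)"
  proof (rule integral_dominated_convergence[where w = "\<lambda>_. C"])
    show "AE x in \<mu>. (\<lambda>j. (g j x - f x) / q j) \<longlonglongrightarrow> D x"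
    proof (rule AE_I2)
      fix x assume "x \<in> space \<mu>"
      then have x: "x \<in> cball 0 1" using \<mu>_space by auto
      show "(\<lambda>j. (g j x - f x) / q j) \<longlonglongrightarrow> D x" using lim[OF x] unfolding g_def q_def proj_id[OF x] .
    qed
    show "AE x in \<mu>. norm ((g j x - f x) / q j) \<le> C" for j
    proof (rule AE_I2)
      fix x assume "x \<in> space \<mu>"
      then have x: "x \<in> cball 0 1" using \<mu>_space by auto
      have "\<bar>g j x - f x\<bar> \<le> C * q j" unfolding g_def q_def using bd[OF x, of j] by (simp add: proj_id[OF x])
      then show "norm ((g j x - f x) / q j) \<le> C" using q[of j] by (simp add: divide_le_eq)
    qed
    show "(\<lambda>x. (g j x - f x) / q j) \<in> borel_measurable \<mu>" for j
      using \<mu>_meas[OF gm] \<mu>_meas[OF f(1)] by measurable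
  qed (use \<mu>_meas[OF D] in auto)
  have zero: "(LINT x|\<mu>. (g j x - f x) / q j) = 0" for j
  proof -
    have "(LINT x|\<mu>. f x) = (LINT x|\<mu>. g j x)" unfolding g_def by (rule \<mu>_inv[OF less_imp_le[OF q] f])
    then show ?thesis
      by (simp only: integral_divide_zero Bochner_Integration.integral_diff[OF \<mu>_integrable[OF gm gb] \<mu>_integrable[OF f]]
        diff_self div_0)
  qed
  show ?thesis using lim' unfolding zero by (simp add: LIMSEQ_const_iff)
qed

definition weighted_moment :: "(complex \<Rightarrow> real) \<Rightarrow> complex set \<Rightarrow> nat \<Rightarrow> real" where
  "weighted_moment l D n = (LINT x|\<mu>. indicator D x * l (proj x ^ n))"

text \<open>Membership in \<open>D\<close> is conserved by the dynamics, so the indicator of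
  \<open>D\<close> factors out of the expectation and only the evolution of z^n matters. The
  recurrence thus holds for the part of \<open>\<mu>\<close> on \<open>D\<close>, which is not
  normalized.\<close>

lemma weighted_moment_recurrence:
  assumes l: "bounded_linear l" and lb: "\<And>z. \<bar>l z\<bar> \<le> norm z" and D: "D \<in> sets borel"
    and pres: "\<And>x t. x \<in> cball 0 1 \<Longrightarrow> t \<ge> 0 \<Longrightarrow> AE \<omega> in M. h x t \<omega> \<in> D \<longleftrightarrow> x \<in> D"
  shows "weighted_moment l D (Suc (Suc k)) = weighted_moment l D k - \<epsilon>\<^sup>2 / K * real (Suc k) * weighted_moment l D (Suc k)"
proof -
  interpret l: bounded_linear l by (rule l)
  have lr: "l (of_real c * z) = c * l z" for c z using l.scaleR[of c z] by (simp add: scaleR_conv_of_real)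
  have lm[measurable]: "l \<in> borel_measurable borel" using borel_measurable_continuous_onI[OF linear_continuous_on[OF l]] .
  define f where "f n x = indicator D x * l (proj x ^ n)" for n x
  have fm: "f n \<in> borel_measurable borel" for n unfolding f_def using D power_proj_measurable[of n] by measurable
  have l1: "\<bar>l (proj x ^ n)\<bar> \<le> 1" for x n by (rule order_trans[OF lb norm_proj_power])
  have fb: "\<bar>f n x\<bar> \<le> 1" for n x using l1[of x n] by (simp add: f_def indicator_def)
  have Ef: "expectation (\<lambda>\<omega>. f n (h x t \<omega>)) = indicator D x * l (moment n x t)" if x: "x \<in> cball 0 1" and t: "t \<ge> 0" for n x t
  proof -
    have [measurable]: "h x t \<in> borel_measurable M" using h_meas[OF x t] .
    have "expectation (\<lambda>\<omega>. f n (h x t \<omega>)) = expectation (\<lambda>\<omega>. indicator D x * l (proj (h x t \<omega>) ^ n))"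
    proof (rule integral_cong_AE)
      show "AE \<omega> in M. f n (h x t \<omega>) = indicator D x * l (proj (h x t \<omega>) ^ n)"
        using pres[OF x t] by eventually_elim (simp add: f_def indicator_def)
      show "(\<lambda>\<omega>. f n (h x t \<omega>)) \<in> borel_measurable M" using fm by measurable
      show "(\<lambda>\<omega>. indicator D x * l (proj (h x t \<omega>) ^ n)) \<in> borel_measurable M" using power_proj_measurable[of n] by measurable
    qed
    then show ?thesis using expectation_power_proj[OF x t l] by simp
  qed
  let ?D = "\<lambda>x. (real (Suc k) * K) * (f k x - f (Suc (Suc k)) x) - (\<epsilon>\<^sup>2 * (real (Suc k))\<^sup>2) * f (Suc k) x"
  have "(LINT x|\<mu>. ?D x) = 0"
  proof (rule generator_integral_zero[where f = "f (Suc k)" and B = 1 and C = "speed (Suc k)"])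
    show "?D \<in> borel_measurable borel" using fm by measurable
    fix x :: complex assume x: "x \<in> cball 0 1"
    have f0: "f n x = indicator D x * l (moment n x 0)" for n by (simp add: f_def moment_start[OF x] proj_id[OF x])
    show "(\<lambda>j. (expectation (\<lambda>\<omega>. f (Suc k) (h x (1 / real (Suc j)) \<omega>)) - f (Suc k) x) / (1 / real (Suc j))) \<longlonglongrightarrow> ?D x"
    proof -
      let ?q = "\<lambda>j. 1 / real (Suc j)"
      have q: "\<forall>j. ?q j \<in> {0..} - {0}" "?q \<longlonglongrightarrow> 0"
        using LIMSEQ_inverse_real_of_nat by (auto simp: inverse_eq_divide)
      let ?L = "of_real (real (Suc k) * K) * (moment k x 0 - moment (Suc (Suc k)) x 0) - of_real (\<epsilon>\<^sup>2 * (real (Suc k))\<^sup>2) * moment (Suc k) x 0"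
      have "(\<lambda>j. (moment (Suc k) x (?q j) - moment (Suc k) x 0) /\<^sub>R (?q j - 0)) \<longlonglongrightarrow> ?L"
        by (rule moment_deriv[OF x order_refl, of k, unfolded has_vector_derivative_iff_quotient tendsto_at_iff_sequentially comp_def, rule_format, of ?q])
          (rule q(1)[rule_format], rule q(2))
      then have "(\<lambda>j. indicator D x * l ((moment (Suc k) x (?q j) - moment (Suc k) x 0) /\<^sub>R (?q j - 0))) \<longlonglongrightarrow> indicator D x * l ?L"
        by (intro tendsto_mult tendsto_const l.tendsto)
      moreover have "indicator D x * l ((moment (Suc k) x (?q j) - moment (Suc k) x 0) /\<^sub>R (?q j - 0)) =
        (expectation (\<lambda>\<omega>. f (Suc k) (h x (?q j) \<omega>)) - f (Suc k) x) / ?q j" for j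
      proof -
        have "0 \<le> ?q j" by simp
        show ?thesis unfolding Ef[OF x \<open>0 \<le> ?q j\<close>] f0[of "Suc k"] l.scaleR l.diff diff_0_right
          by (simp only: real_scaleR_def divide_inverse right_diff_distrib mult_ac)
      qed
      moreover have "indicator D x * l ?L = ?D x" unfolding f0 l.diff lr by (simp only: right_diff_distrib mult_ac)
      ultimately show ?thesis by (simp only:)
    qed
    show "\<bar>expectation (\<lambda>\<omega>. f (Suc k) (h x (1 / real (Suc j)) \<omega>)) - f (Suc k) x\<bar> \<le> speed (Suc k) * (1 / real (Suc j))" for j
    proof -
      have q: "0 \<le> 1 / real (Suc j)" by simp
      have "\<bar>indicator D x * l (moment (Suc k) x (1 / real (Suc j)) - moment (Suc k) x 0)\<bar> \<le> \<bar>l (moment (Suc k) x (1 / real (Suc j)) - moment (Suc k) x 0)\<bar>"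
        by (simp add: indicator_def)
      also have "\<dots> \<le> norm (moment (Suc k) x (1 / real (Suc j)) - moment (Suc k) x 0)" by (rule lb)
      also have "\<dots> \<le> speed (Suc k) * (1 / real (Suc j) - 0)" by (rule moment_increment_le[OF x order_refl q])
      finally show ?thesis unfolding Ef[OF x q] f0 by (simp only: l.diff right_diff_distrib diff_0_right mult_zero_right)
    qed
  qed (use fm fb in auto)
  moreover have fi: "integrable \<mu> (f n)" for n by (rule \<mu>_integrable[OF fm fb])
  moreover have "weighted_moment l D n = (LINT x|\<mu>. f n x)" for n by (simp add: weighted_moment_def f_def)
  ultimately have "(real (Suc k) * K) * (weighted_moment l D k - weighted_moment l D (Suc (Suc k))) - (\<epsilon>\<^sup>2 * (real (Suc k))\<^sup>2) * weighted_moment l D (Suc k) = 0"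
    by (simp del: of_nat_Suc)
  \<comment> \<open>The factor k + 1 is common to transport and damping; cancelling it leaves a
    damping coefficient linear in k.\<close>
  then have "real (Suc k) * (K * (weighted_moment l D k - weighted_moment l D (Suc (Suc k))) - \<epsilon>\<^sup>2 * real (Suc k) * weighted_moment l D (Suc k)) = 0"
    by (simp add: algebra_simps power2_eq_square del: of_nat_Suc)
  then have "K * (weighted_moment l D k - weighted_moment l D (Suc (Suc k))) = \<epsilon>\<^sup>2 * real (Suc k) * weighted_moment l D (Suc k)" by (simp del: of_nat_Suc)
  then have "weighted_moment l D k - weighted_moment l D (Suc (Suc k)) = \<epsilon>\<^sup>2 * real (Suc k) * weighted_moment l D (Suc k) / K" using K0 by (simp add: field_simps del: of_nat_Suc)
  then show ?thesis by simp
qed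

lemma weighted_moment_bound:
  assumes l: "bounded_linear l" and lb: "\<And>z. \<bar>l z\<bar> \<le> norm z" and D: "D \<in> sets borel"
  shows "\<bar>weighted_moment l D n\<bar> \<le> 1"
proof -
  have lm[measurable]: "l \<in> borel_measurable borel" using borel_measurable_continuous_onI[OF linear_continuous_on[OF l]] .
  have fm: "(\<lambda>x. indicator D x * l (proj x ^ n)) \<in> borel_measurable borel" using D power_proj_measurable[of n] by measurable
  have l1: "\<bar>l (proj x ^ n)\<bar> \<le> 1" for x by (rule order_trans[OF lb norm_proj_power])
  have fb: "\<bar>indicator D x * l (proj x ^ n)\<bar> \<le> 1" for x using l1[of x] by (simp add: indicator_def)
  have "\<bar>weighted_moment l D n\<bar> \<le> (LINT x|\<mu>. \<bar>indicator D x * l (proj x ^ n)\<bar>)" unfolding weighted_moment_def by (rule integral_abs_bound)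
  also have "\<dots> \<le> (LINT x|\<mu>. 1)" using fb \<mu>_integrable[OF fm fb] by (intro integral_mono integrable_abs) auto
  finally show ?thesis by (simp add: \<mu>.prob_space)
qed

text \<open>The closed disc is the disjoint union of the open disc and the circle, and each is
  preserved forward in time, so membership can be neither lost nor gained.\<close>

lemma ball_preserved:
  assumes "x \<in> cball 0 1" "t \<ge> 0"
  shows "AE \<omega> in M. h x t \<omega> \<in> ball 0 1 \<longleftrightarrow> x \<in> ball 0 1" "AE \<omega> in M. h x t \<omega> \<in> sphere 0 1 \<longleftrightarrow> x \<in> sphere 0 1"
proof -
  have "x \<in> ball 0 1 \<or> x \<in> sphere 0 1" using assms by (auto simp: less_le)
  then have "(AE \<omega> in M. h x t \<omega> \<in> ball 0 1 \<longleftrightarrow> x \<in> ball 0 1) \<and> (AE \<omega> in M. h x t \<omega> \<in> sphere 0 1 \<longleftrightarrow> x \<in> sphere 0 1)"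
  proof
    assume x: "x \<in> ball 0 1"
    show ?thesis using h_in_ball[OF x assms(2)] x by (auto elim!: eventually_mono)
  next
    assume x: "x \<in> sphere 0 1"
    show ?thesis using h_in_sphere[OF x assms(2)] x by (auto elim!: eventually_mono)
  qed
  then show "AE \<omega> in M. h x t \<omega> \<in> ball 0 1 \<longleftrightarrow> x \<in> ball 0 1" "AE \<omega> in M. h x t \<omega> \<in> sphere 0 1 \<longleftrightarrow> x \<in> sphere 0 1"
    by auto
qed

end

section \<open>Powers of 1 - |z|^2 and the first moment on the open disc\<close>

lemma abs_exp_minus_one_le: "\<bar>exp y - 1\<bar> \<le> \<bar>y\<bar> * exp \<bar>y\<bar>" for y :: real
proof (rule abs_leI)
  have "exp y * (1 + - y) \<le> exp y * exp (- y)" by (intro mult_left_mono exp_ge_add_one_self) auto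
  then have "exp y - 1 \<le> y * exp y" by (simp add: algebra_simps flip: exp_add)
  also have "\<dots> \<le> \<bar>y\<bar> * exp y" by (intro mult_right_mono) auto
  also have "\<dots> \<le> \<bar>y\<bar> * exp \<bar>y\<bar>" by (intro mult_left_mono) auto
  finally show "exp y - 1 \<le> \<bar>y\<bar> * exp \<bar>y\<bar>" .
  have "- (exp y - 1) \<le> - y" using exp_ge_add_one_self[of y] by linarith
  also have "\<dots> \<le> \<bar>y\<bar> * 1" by simp
  also have "\<dots> \<le> \<bar>y\<bar> * exp \<bar>y\<bar>" by (intro mult_left_mono) auto
  finally show "- (exp y - 1) \<le> \<bar>y\<bar> * exp \<bar>y\<bar>" .
qed

text \<open>The generator maps \<open>defect_pow \<delta>\<close> to \<open>- 2 K \<delta> Re z\<close> times itself. Integrating against an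
  invariant measure, dividing by \<open>\<delta>\<close> and letting \<open>\<delta>\<close> tend to 0 shows that the part of the measure
  on the open disc has a first moment with vanishing real part.\<close>

definition defect_pow :: "real \<Rightarrow> complex \<Rightarrow> real" where
  "defect_pow \<delta> z = (max 0 (1 - (norm z)\<^sup>2)) powr \<delta>"

lemma defect_pow_measurable[measurable]: "defect_pow \<delta> \<in> borel_measurable borel"
  unfolding defect_pow_def by measurable

lemma defect_pow_bound: "\<delta> \<ge> 0 \<Longrightarrow> \<bar>defect_pow \<delta> z\<bar> \<le> 1"
  unfolding defect_pow_def by (simp add: powr_le1)

text \<open>Inside the disc the base is positive and its small powers tend to 1. On the circle the
  base is 0 and \<open>0 powr \<delta> = 0\<close> for every exponent, so the limit sees the open
  disc only.\<close>

lemma defect_pow_tendsto_indicator: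
  assumes "z \<in> cball 0 1"
  shows "(\<lambda>j. defect_pow (1 / real (Suc j)) z) \<longlonglongrightarrow> indicator (ball 0 1) z"
proof (cases "z \<in> ball 0 1")
  case True
  then have "(norm z)\<^sup>2 < 1" by (simp add: abs_square_less_1)
  then have "(\<lambda>j. (1 - (norm z)\<^sup>2) powr (1 / real (Suc j))) \<longlonglongrightarrow> (1 - (norm z)\<^sup>2) powr 0"
    using LIMSEQ_inverse_real_of_nat by (intro tendsto_powr) (auto simp: inverse_eq_divide)
  then show ?thesis using True \<open>(norm z)\<^sup>2 < 1\<close> by (simp add: defect_pow_def)
next
  case False
  then have "norm z = 1" using assms by simp
  then show ?thesis using False by (simp add: defect_pow_def)
qed

context riccati_path
begin

lemma Re_h_cont: "continuous_on {0..} (\<lambda>s. Re (h s))"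
  by (intro continuous_intros h_cont)

lemma defect_pow_formula:
  assumes x: "norm x \<le> 1" and T: "T \<ge> 0"
  shows "defect_pow \<delta> (h T) = defect_pow \<delta> x * exp (- 2 * K * \<delta> * integral {0..T} (\<lambda>s. Re (h s)))"
proof -
  have x1: "0 \<le> 1 - (norm x)\<^sup>2" and h1: "0 \<le> 1 - (norm (h T))\<^sup>2"
    using x norm_le_1[OF x T] by (auto simp: power_le_one)
  show ?thesis
    unfolding defect_pow_def max_absorb2[OF x1] max_absorb2[OF h1]
    unfolding defect_formula[OF T] by (subst powr_mult) (use x1 in \<open>auto simp: exp_powr_real mult_ac\<close>)
qed

lemma integral_Re_bound:
  assumes x: "norm x \<le> 1" and T: "T \<ge> 0"
  shows "\<bar>integral {0..T} (\<lambda>s. Re (h s))\<bar> \<le> T"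
proof -
  have "norm (integral {0..T} (\<lambda>s. Re (h s))) \<le> 1 * (T - 0)"
  proof (rule integral_bound[OF T])
    show "continuous_on {0..T} (\<lambda>s. Re (h s))" by (rule continuous_on_subset[OF Re_h_cont]) auto
    show "norm (Re (h t)) \<le> 1" if "t \<in> {0..T}" for t
      using norm_le_1[OF x, of t] abs_Re_le_cmod[of "h t"] that by simp
  qed
  then show ?thesis by simp
qed

text \<open>For small \<delta> the function is not Lipschitz up to the circle; the multiplicative
  formula still bounds its increments along paths linearly in T, uniformly in the starting point.
  Taking T \<le> 1 bounds the exponent by 2 K \<delta>.\<close>

lemma defect_pow_increment:
  assumes x: "norm x \<le> 1" and T: "0 \<le> T" "T \<le> 1" and \<delta>: "\<delta> \<ge> 0"
  shows "\<bar>defect_pow \<delta> (h T) - defect_pow \<delta> x\<bar> \<le> 2 * K * \<delta> * exp (2 * K * \<delta>) * T"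
proof -
  define y where "y = - 2 * K * \<delta> * integral {0..T} (\<lambda>s. Re (h s))"
  have y: "\<bar>y\<bar> \<le> 2 * K * \<delta> * T"
    unfolding y_def using integral_Re_bound[OF x T(1)] K \<delta> by (simp add: abs_mult mult_left_mono)
  also have "\<dots> \<le> 2 * K * \<delta>" using K \<delta> T(2) by (simp add: mult_left_le)
  finally have y1: "\<bar>y\<bar> \<le> 2 * K * \<delta>" .
  have "\<bar>defect_pow \<delta> (h T) - defect_pow \<delta> x\<bar> = \<bar>defect_pow \<delta> x\<bar> * \<bar>exp y - 1\<bar>"
    unfolding defect_pow_formula[OF x T(1)] y_def[symmetric] abs_mult[symmetric] by (simp add: algebra_simps)
  also have "\<dots> \<le> 1 * (\<bar>y\<bar> * exp \<bar>y\<bar>)"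
    by (intro mult_mono defect_pow_bound \<delta> abs_exp_minus_one_le) auto
  also have "\<dots> \<le> 1 * ((2 * K * \<delta> * T) * exp (2 * K * \<delta>))"
    using y y1 K \<delta> T by (intro mult_left_mono mult_mono) auto
  finally show ?thesis by (simp add: mult_ac)
qed

lemma defect_pow_quotient:
  assumes x: "norm x \<le> 1"
  shows "(\<lambda>j. (defect_pow \<delta> (h (1 / real (Suc j))) - defect_pow \<delta> x) / (1 / real (Suc j)))
    \<longlonglongrightarrow> - 2 * K * \<delta> * (Re x * defect_pow \<delta> x)"
proof -
  let ?q = "\<lambda>j. 1 / real (Suc j)" and ?I = "\<lambda>t. integral {0..t} (\<lambda>s. Re (h s))"
  have "(?I has_vector_derivative Re (h 0)) (at 0 within {0..1})"
    by (rule integral_has_vector_derivative) (auto intro: continuous_on_subset[OF Re_h_cont])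
  then have "(?I has_real_derivative Re x) (at 0 within {0..1})"
    by (simp add: h_0 has_real_derivative_iff_has_vector_derivative)
  then have "((\<lambda>t. defect_pow \<delta> x * exp (- 2 * K * \<delta> * ?I t)) has_real_derivative
      defect_pow \<delta> x * (exp (- 2 * K * \<delta> * ?I 0) * (- 2 * K * \<delta> * Re x))) (at 0 within {0..1})"
    by (rule DERIV_cmult[OF DERIV_chain'[OF DERIV_cmult DERIV_exp]])
  then have d: "((\<lambda>t. (defect_pow \<delta> x * exp (- 2 * K * \<delta> * ?I t) - defect_pow \<delta> x) / t) \<longlongrightarrow> - 2 * K * \<delta> * (Re x * defect_pow \<delta> x)) (at 0 within {0..1})"
    by (simp add: has_field_derivative_iff mult_ac)
  have "(\<lambda>j. (defect_pow \<delta> x * exp (- 2 * K * \<delta> * ?I (?q j)) - defect_pow \<delta> x) / ?q j) \<longlonglongrightarrow> - 2 * K * \<delta> * (Re x * defect_pow \<delta> x)"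
    by (rule d[unfolded tendsto_at_iff_sequentially comp_def, rule_format, of ?q])
      (use LIMSEQ_inverse_real_of_nat in \<open>auto simp: inverse_eq_divide\<close>)
  moreover have "defect_pow \<delta> (h (?q j)) = defect_pow \<delta> x * exp (- 2 * K * \<delta> * ?I (?q j))" for j
    by (rule defect_pow_formula[OF x]) simp
  ultimately show ?thesis by (simp only:)
qed

end

context disc_invariant
begin

lemma weighted_moment_integrand_measurable:
  fixes l :: "complex \<Rightarrow> real"
  assumes "l \<in> borel_measurable borel" "D \<in> sets borel"
  shows "(\<lambda>x. indicator D x * l (proj x ^ n)) \<in> borel_measurable borel"
  using assms power_proj_measurable[of n] by measurable

lemma Re_defect_pow_integral_zero:
  assumes \<delta>: "\<delta> > 0"
  shows "(LINT x|\<mu>. Re x * defect_pow \<delta> x) = 0"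
proof -
  have "(LINT x|\<mu>. - 2 * K * \<delta> * (Re x * defect_pow \<delta> x)) = 0"
  proof (rule generator_integral_zero[where f = "defect_pow \<delta>" and B = 1 and C = "2 * K * \<delta> * exp (2 * K * \<delta>)"])
    show "\<bar>defect_pow \<delta> z\<bar> \<le> 1" for z using \<delta> by (intro defect_pow_bound) simp
    fix x :: complex assume x: "x \<in> cball 0 1"
    then have x1: "norm x \<le> 1" by simp
    let ?q = "\<lambda>j. 1 / real (Suc j)"
    have q: "0 \<le> ?q j" "?q j \<le> 1" "0 < ?q j" for j by auto
    have [measurable]: "(\<lambda>\<omega>. defect_pow \<delta> (h x (?q j) \<omega>)) \<in> borel_measurable M" for j
      by (rule measurable_compose[OF h_meas[OF x q(1)] defect_pow_measurable])
    have i: "integrable M (\<lambda>\<omega>. defect_pow \<delta> (h x (?q j) \<omega>))" for j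
    proof (rule integrable_const_bound[where B = 1])
      show "AE \<omega> in M. norm (defect_pow \<delta> (h x (?q j) \<omega>)) \<le> 1"
        using defect_pow_bound[of \<delta>] \<delta> by simp
      show "(\<lambda>\<omega>. defect_pow \<delta> (h x (?q j) \<omega>)) \<in> borel_measurable M"
        by (rule measurable_compose[OF h_meas[OF x q(1)] defect_pow_measurable])
    qed
    have E: "expectation (\<lambda>\<omega>. defect_pow \<delta> (h x (?q j) \<omega>)) - defect_pow \<delta> x = expectation (\<lambda>\<omega>. defect_pow \<delta> (h x (?q j) \<omega>) - defect_pow \<delta> x)" for j
      using i by (subst Bochner_Integration.integral_diff) (auto simp: prob_space)
    have incr: "AE \<omega> in M. \<bar>defect_pow \<delta> (h x (?q j) \<omega>) - defect_pow \<delta> x\<bar> \<le> 2 * K * \<delta> * exp (2 * K * \<delta>) * ?q j" for j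
      using path[OF x]
    proof eventually_elim
      case (elim \<omega>)
      show ?case by (rule riccati_path.defect_pow_increment[OF elim x1 q(1,2)]) (use \<delta> in simp)
    qed
    show "\<bar>expectation (\<lambda>\<omega>. defect_pow \<delta> (h x (?q j) \<omega>)) - defect_pow \<delta> x\<bar> \<le> 2 * K * \<delta> * exp (2 * K * \<delta>) * ?q j" for j
    proof -
      have "\<bar>expectation (\<lambda>\<omega>. defect_pow \<delta> (h x (?q j) \<omega>) - defect_pow \<delta> x)\<bar> \<le> expectation (\<lambda>\<omega>. \<bar>defect_pow \<delta> (h x (?q j) \<omega>) - defect_pow \<delta> x\<bar>)"
        by (rule integral_abs_bound)
      also have "\<dots> \<le> expectation (\<lambda>\<omega>. 2 * K * \<delta> * exp (2 * K * \<delta>) * ?q j)"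
        using i by (intro integral_mono_AE integrable_abs Bochner_Integration.integrable_diff integrable_const incr) auto
      also have "\<dots> = 2 * K * \<delta> * exp (2 * K * \<delta>) * ?q j" by (simp add: prob_space)
      finally show ?thesis unfolding E .
    qed
    show "(\<lambda>j. (expectation (\<lambda>\<omega>. defect_pow \<delta> (h x (?q j) \<omega>)) - defect_pow \<delta> x) / ?q j) \<longlonglongrightarrow> - 2 * K * \<delta> * (Re x * defect_pow \<delta> x)"
    proof -
      have "(\<lambda>j. expectation (\<lambda>\<omega>. (defect_pow \<delta> (h x (?q j) \<omega>) - defect_pow \<delta> x) / ?q j)) \<longlonglongrightarrow> expectation (\<lambda>\<omega>. - 2 * K * \<delta> * (Re x * defect_pow \<delta> x))"
      proof (rule integral_dominated_convergence[where w = "\<lambda>_. 2 * K * \<delta> * exp (2 * K * \<delta>)"])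
        show "AE \<omega> in M. (\<lambda>j. (defect_pow \<delta> (h x (?q j) \<omega>) - defect_pow \<delta> x) / ?q j) \<longlonglongrightarrow> - 2 * K * \<delta> * (Re x * defect_pow \<delta> x)"
          using path[OF x]
        proof eventually_elim
          case (elim \<omega>)
          show ?case by (rule riccati_path.defect_pow_quotient[OF elim x1])
        qed
        show "AE \<omega> in M. norm ((defect_pow \<delta> (h x (?q j) \<omega>) - defect_pow \<delta> x) / ?q j) \<le> 2 * K * \<delta> * exp (2 * K * \<delta>)" for j
          using incr[of j]
        proof eventually_elim
          case (elim \<omega>)
          then have "\<bar>defect_pow \<delta> (h x (?q j) \<omega>) - defect_pow \<delta> x\<bar> / ?q j \<le> 2 * K * \<delta> * exp (2 * K * \<delta>)"
            unfolding pos_divide_le_eq[OF q(3)] .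
          then show ?case by (simp add: abs_mult del: of_nat_Suc)
        qed
        show "(\<lambda>\<omega>. (defect_pow \<delta> (h x (?q j) \<omega>) - defect_pow \<delta> x) / ?q j) \<in> borel_measurable M" for j
          by (intro borel_measurable_divide borel_measurable_diff borel_measurable_const borel_measurable_integrable[OF i])
      qed simp_all
      then show ?thesis unfolding E by (simp add: prob_space del: of_nat_Suc)
    qed
  qed auto
  then show ?thesis using K0 \<delta> by simp
qed

lemma Re_ball_integral_zero: "weighted_moment Re (ball 0 1) 1 = 0"
proof -
  have "(\<lambda>j. LINT x|\<mu>. Re x * defect_pow (1 / real (Suc j)) x) \<longlonglongrightarrow> (LINT x|\<mu>. indicator (ball 0 1) x * Re (proj x ^ 1))"
  proof (rule integral_dominated_convergence[where w = "\<lambda>_. 1"])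
    show "AE x in \<mu>. (\<lambda>j. Re x * defect_pow (1 / real (Suc j)) x) \<longlonglongrightarrow> indicator (ball 0 1) x * Re (proj x ^ 1)"
    proof (rule AE_I2)
      fix x assume "x \<in> space \<mu>"
      then have x: "x \<in> cball 0 1" using \<mu>_space by auto
      have "(\<lambda>j. Re x * defect_pow (1 / real (Suc j)) x) \<longlonglongrightarrow> Re x * indicator (ball 0 1) x"
        by (intro tendsto_mult tendsto_const defect_pow_tendsto_indicator x)
      then show "(\<lambda>j. Re x * defect_pow (1 / real (Suc j)) x) \<longlonglongrightarrow> indicator (ball 0 1) x * Re (proj x ^ 1)"
        by (simp add: proj_id[OF x] mult.commute)
    qed
    show "AE x in \<mu>. norm (Re x * defect_pow (1 / real (Suc j)) x) \<le> 1" for j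
    proof (rule AE_I2)
      fix x assume "x \<in> space \<mu>"
      then have "norm x \<le> 1" using \<mu>_space by auto
      then have "\<bar>Re x\<bar> \<le> 1" using abs_Re_le_cmod[of x] by linarith
      then have "\<bar>Re x\<bar> * \<bar>defect_pow (1 / real (Suc j)) x\<bar> \<le> 1 * 1" by (intro mult_mono defect_pow_bound) auto
      then show "norm (Re x * defect_pow (1 / real (Suc j)) x) \<le> 1" by (simp add: abs_mult)
    qed
    show "(\<lambda>x. indicator (ball 0 1) x * Re (proj x ^ 1)) \<in> borel_measurable \<mu>"
      by (intro \<mu>_meas weighted_moment_integrand_measurable borel_measurable_Re borel_open open_ball)
    show "(\<lambda>x. Re x * defect_pow (1 / real (Suc j)) x) \<in> borel_measurable \<mu>" for j by (rule \<mu>_meas) measurable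
  qed simp
  then have "(LINT x|\<mu>. indicator (ball 0 1) x * Re (proj x ^ 1)) = 0"
    by (subst (asm) Re_defect_pow_integral_zero) (auto simp: LIMSEQ_const_iff)
  then show ?thesis by (simp only: weighted_moment_def)
qed

text \<open>The index 0 is the one that matters: there the weighted moment is the mass of the open
  disc.\<close>

lemma weighted_moment_ball_zero: "weighted_moment Re (ball 0 1) k = 0"
proof (rule bounded_recurrence_zero[where c = "\<epsilon>\<^sup>2 / K" and B = 1])
  show "weighted_moment Re (ball 0 1) (Suc (Suc k)) = weighted_moment Re (ball 0 1) k - \<epsilon>\<^sup>2 / K * real (Suc k) * weighted_moment Re (ball 0 1) (Suc k)" for k
    by (rule weighted_moment_recurrence[OF bounded_linear_Re abs_Re_le_cmod _ ball_preserved(1)]) auto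
  show "\<bar>weighted_moment Re (ball 0 1) k\<bar> \<le> 1" for k by (rule weighted_moment_bound[OF bounded_linear_Re abs_Re_le_cmod]) auto
  show "weighted_moment Re (ball 0 1) 0 \<ge> 0" by (simp add: weighted_moment_def)
qed (use e0 K0 Re_ball_integral_zero in auto)

lemma AE_sphere: "AE x in \<mu>. x \<in> sphere 0 1"
proof -
  have bm: "(indicator (ball 0 1) :: complex \<Rightarrow> real) \<in> borel_measurable borel"
    by (intro borel_measurable_indicator borel_open open_ball)
  have "(LINT x|\<mu>. indicator (ball 0 1) x :: real) = 0" using weighted_moment_ball_zero[of 0] by (simp add: weighted_moment_def)
  then have "AE x in \<mu>. indicator (ball 0 1) x = (0 :: real)"
    using integral_nonneg_eq_0_iff_AE[OF \<mu>_integrable[OF bm, of 1]] by simp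
  then show ?thesis using AE_space
  proof eventually_elim
    case (elim x)
    then have "x \<notin> ball 0 1" "x \<in> cball 0 1" using \<mu>_space by (auto simp: indicator_eq_0_iff)
    then show ?case by simp
  qed
qed

lemma stationary_moment_functional_recurrence:
  assumes l: "bounded_linear l"
  shows "l (stationary_moment (Suc (Suc k))) = l (stationary_moment k) - \<epsilon>\<^sup>2 / K * real (Suc k) * l (stationary_moment (Suc k))"
proof -
  interpret l: bounded_linear l by (rule l)
  have lr: "l (of_real c * z) = c * l z" for c z using l.scaleR[of c z] by (simp add: scaleR_conv_of_real)
  have "real (Suc k) * K * (l (stationary_moment k) - l (stationary_moment (Suc (Suc k)))) = \<epsilon>\<^sup>2 * (real (Suc k))\<^sup>2 * l (stationary_moment (Suc k))"
    using arg_cong[OF stationary_moment_rec[of k], of l] unfolding lr l.diff .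
  then have "real (Suc k) * (K * (l (stationary_moment k) - l (stationary_moment (Suc (Suc k)))) - \<epsilon>\<^sup>2 * real (Suc k) * l (stationary_moment (Suc k))) = 0"
    by (simp add: algebra_simps power2_eq_square del: of_nat_Suc)
  then have "K * (l (stationary_moment k) - l (stationary_moment (Suc (Suc k)))) = \<epsilon>\<^sup>2 * real (Suc k) * l (stationary_moment (Suc k))" by (simp del: of_nat_Suc)
  then have "l (stationary_moment k) - l (stationary_moment (Suc (Suc k))) = \<epsilon>\<^sup>2 * real (Suc k) * l (stationary_moment (Suc k)) / K" using K0 by (simp add: field_simps del: of_nat_Suc)
  then show ?thesis by simp
qed

lemma weighted_moment_sphere:
  assumes l: "bounded_linear l" and lb: "\<And>z. \<bar>l z\<bar> \<le> norm z"
  shows "weighted_moment l (sphere 0 1) n = l (stationary_moment n)"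
proof -
  define e where "e n = weighted_moment l (sphere 0 1) n - l (stationary_moment n)" for n
  interpret V: prob_space stationary by (rule stationary_prob)
  have Mb: "norm (stationary_moment n) \<le> 1" for n
  proof -
    have "norm (stationary_moment n) \<le> (LINT z|stationary. norm (z ^ n))" unfolding stationary_moment_def by (rule integral_norm_bound)
    also have "\<dots> = (LINT z|stationary. 1)"
    proof (rule integral_cong_AE)
      show "AE z in stationary. norm (z ^ n) = 1" using stationary_sphere by eventually_elim (simp add: norm_power)
    qed auto
    finally show ?thesis by (simp add: V.prob_space)
  qed
  have rec: "weighted_moment l (sphere 0 1) (Suc (Suc k)) = weighted_moment l (sphere 0 1) k - \<epsilon>\<^sup>2 / K * real (Suc k) * weighted_moment l (sphere 0 1) (Suc k)" for k
    by (rule weighted_moment_recurrence[OF l lb _ ball_preserved(2)]) auto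
  have e_rec: "e (Suc (Suc k)) = e k - \<epsilon>\<^sup>2 / K * real (Suc k) * e (Suc k)" for k
    unfolding e_def rec stationary_moment_functional_recurrence[OF l] right_diff_distrib by (simp only: algebra_simps)
  have eb: "\<bar>e k\<bar> \<le> 2" for k
    using weighted_moment_bound[OF l lb, of "sphere 0 1" k] order_trans[OF lb[of "stationary_moment k"] Mb] unfolding e_def by simp
  have "weighted_moment l (sphere 0 1) 0 = (LINT x|\<mu>. l 1)" unfolding weighted_moment_def
  proof (rule integral_cong_AE)
    show "AE x in \<mu>. indicator (sphere 0 1) x * l (proj x ^ 0) = l 1" using AE_sphere by eventually_elim simp
    show "(\<lambda>x. indicator (sphere 0 1) x * l (proj x ^ 0)) \<in> borel_measurable \<mu>"
      using borel_measurable_continuous_onI[OF linear_continuous_on[OF l]]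
      by (intro \<mu>_meas weighted_moment_integrand_measurable borel_closed closed_sphere)
  qed simp
  then have e0': "e 0 = 0" by (simp add: e_def stationary_moment_0 \<mu>.prob_space)
  have c: "\<epsilon>\<^sup>2 / K > 0" using e0 K0 by simp
  have "e n = 0"
  \<comment> \<open>\<open>e 0 = 0\<close>, but the sign of \<open>e 1\<close> is unknown; the
    recurrence is linear, so one of \<open>e\<close> and \<open>- e\<close> meets the sign
    conditions.\<close>
  proof (cases "e 1 \<le> 0")
    case True
    show ?thesis by (rule bounded_recurrence_zero[OF c eb e_rec]) (use e0' True in auto)
  next
    case False
    have "- e n = 0"
    proof (rule bounded_recurrence_zero[OF c, of "\<lambda>n. - e n" 2])
      show "\<bar>- e k\<bar> \<le> 2" for k using eb by simp
      show "- e (Suc (Suc k)) = - e k - \<epsilon>\<^sup>2 / K * real (Suc k) * - e (Suc k)" for k unfolding e_rec by (simp only: algebra_simps)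
    qed (use e0' False in auto)
    then show ?thesis by simp
  qed
  then show ?thesis by (simp add: e_def)
qed

lemma borel_measurable_id: "(\<lambda>x. x) \<in> \<mu> \<rightarrow>\<^sub>M borel"
proof -
  have "(\<lambda>x. Complex (Re x) (Im x)) \<in> borel_measurable \<mu>"
    using \<mu>_meas[of Re] \<mu>_meas[of Im] unfolding borel_measurable_complex_iff by simp
  then show ?thesis by simp
qed

text \<open>\<open>\<mu>\<close> may live on a subspace; its image under the identity is a Borel
  measure on the whole plane, where measures carried by the circle are determined by their
  moments.\<close>

lemma distr_eq_stationary: "distr \<mu> borel (\<lambda>x. x) = stationary"
proof -
  note [measurable] = borel_measurable_id
  let ?N = "distr \<mu> borel (\<lambda>x. x)"
  have P: "prob_space ?N" by (rule \<mu>.prob_space_distr) measurable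
  have S: "sets ?N = sets borel" by simp
  have C: "AE z in ?N. z \<in> sphere 0 1"
    by (subst AE_distr_iff) (use AE_sphere in auto)
  show ?thesis
  proof (rule circle_measure_eqI[OF P stationary_prob S stationary_sets C stationary_sphere])
    fix n
    have main: "l (LINT z|?N. z ^ n) = l (LINT z|stationary. z ^ n)" if l: "bounded_linear l" and lb: "\<And>z. \<bar>l z\<bar> \<le> norm z" for l :: "complex \<Rightarrow> real"
    proof -
      have lm[measurable]: "l \<in> borel_measurable borel" using borel_measurable_continuous_onI[OF linear_continuous_on[OF l]] .
      have fm: "(\<lambda>x. l (proj x ^ n)) \<in> borel_measurable borel" using power_proj_measurable[of n] by measurable
      have fm': "(\<lambda>x. indicator (sphere 0 1) x * l (proj x ^ n)) \<in> borel_measurable borel"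
        by (intro weighted_moment_integrand_measurable lm borel_closed closed_sphere)
      have "l (LINT z|?N. z ^ n) = (LINT z|?N. l (proj z ^ n))" by (rule moment_linear_functional[OF P S C l])
      also have "\<dots> = (LINT z|\<mu>. l (proj z ^ n))" by (rule integral_distr[OF borel_measurable_id fm])
      also have "\<dots> = weighted_moment l (sphere 0 1) n" unfolding weighted_moment_def
      proof (rule integral_cong_AE[OF \<mu>_meas[OF fm] \<mu>_meas[OF fm']])
        show "AE x in \<mu>. l (proj x ^ n) = indicator (sphere 0 1) x * l (proj x ^ n)" using AE_sphere by eventually_elim simp
      qed
      finally show ?thesis unfolding weighted_moment_sphere[OF l lb] stationary_moment_def .
    qed
    show "(LINT z|?N. z ^ n) = (LINT z|stationary. z ^ n)"
      using main[OF bounded_linear_Re abs_Re_le_cmod] main[OF bounded_linear_Im abs_Im_le_cmod] by (simp add: complex_eq_iff)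
  qed
qed

end

section \<open>Passage to the three state spaces\<close>

context adler
begin

text \<open>Borel functions on the plane restrict to test functions on \<open>D\<close>, and since
  \<open>D\<close> is preserved the indicator in \<open>markov_semigroup\<close> is almost surely
  1.\<close>

lemma disc_invariant_of_invariant_measure:
  assumes inv: "invariant_measure M h D \<mu>" and D: "D \<in> sets borel" "D \<subseteq> cball 0 1"
    and pres: "\<And>x t. x \<in> D \<Longrightarrow> t \<ge> 0 \<Longrightarrow> AE \<omega> in M. h x t \<omega> \<in> D"
  shows "disc_invariant M F W h K \<epsilon> \<mu>"
proof -
  have P: "prob_space \<mu>" and S: "sets \<mu> = sets (restrict_space borel D)"
    using inv by (auto simp: invariant_measure_def prob_measure_on_def)
  have sp: "space \<mu> = D" using sets_eq_imp_space_eq[OF S] by (simp add: space_restrict_space)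
  have meas: "f \<in> borel_measurable (restrict_space borel D)" if "f \<in> borel_measurable borel" for f :: "complex \<Rightarrow> real"
    by (rule measurable_restrict_space1[OF that])
  have semi: "markov_semigroup M h D t f x = expectation (\<lambda>\<omega>. f (h (proj x) t \<omega>))"
    if x: "x \<in> D" and t: "t \<ge> 0" and f: "f \<in> borel_measurable borel" for x t and f :: "complex \<Rightarrow> real"
  proof -
    have xc: "x \<in> cball 0 1" using x D(2) by blast
    note hm = h_meas[OF xc t]
    show ?thesis unfolding markov_semigroup_def proj_id[OF xc]
    proof (rule integral_cong_AE)
      show "AE \<omega> in M. indicator D (h x t \<omega>) * f (h x t \<omega>) = f (h x t \<omega>)"
        using pres[OF x t] by eventually_elim simp
      show "(\<lambda>\<omega>. indicator D (h x t \<omega>) * f (h x t \<omega>)) \<in> borel_measurable M"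
        by (intro borel_measurable_times measurable_compose[OF hm f] measurable_compose[OF hm borel_measurable_indicator[OF D(1)]])
      show "(\<lambda>\<omega>. f (h x t \<omega>)) \<in> borel_measurable M" by (rule measurable_compose[OF hm f])
    qed
  qed
  have transported: "(LINT x|\<mu>. f x) = (LINT x|\<mu>. markov_semigroup M h D t f x)"
    if "t \<ge> 0" "f \<in> borel_measurable (restrict_space borel D)" "bounded (f ` D)" for t f
    using inv that unfolding invariant_measure_def is_transported_def by blast
  show ?thesis
  proof (intro disc_invariant.intro adler_axioms disc_invariant_axioms.intro P)
    show "space \<mu> \<subseteq> cball 0 1" using sp D by simp
    show "f \<in> borel_measurable \<mu>" if "f \<in> borel_measurable borel" for f :: "complex \<Rightarrow> real"
      using meas[OF that] by (simp only: measurable_cong_sets[OF S refl])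
    fix t B :: real and f :: "complex \<Rightarrow> real"
    assume t: "t \<ge> 0" and f: "f \<in> borel_measurable borel" "\<And>z. \<bar>f z\<bar> \<le> B"
    have "bounded (f ` D)" using f(2) by (intro boundedI[where B = B]) auto
    then have "(LINT x|\<mu>. f x) = (LINT x|\<mu>. markov_semigroup M h D t f x)"
      by (rule transported[OF t meas[OF f(1)]])
    also have "\<dots> = (LINT x|\<mu>. expectation (\<lambda>\<omega>. f (h (proj x) t \<omega>)))"
      by (rule Bochner_Integration.integral_cong[OF refl]) (auto simp: sp semi t f(1))
    finally show "(LINT x|\<mu>. f x) = (LINT x|\<mu>. expectation (\<lambda>\<omega>. f (h (proj x) t \<omega>)))" .
  qed
qed

lemma invariant_measure_imp_eq:
  assumes inv: "invariant_measure M h D \<mu>" and D: "D \<in> sets borel" "D \<subseteq> cball 0 1"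
    and pres: "\<And>x t. x \<in> D \<Longrightarrow> t \<ge> 0 \<Longrightarrow> AE \<omega> in M. h x t \<omega> \<in> D"
  shows "\<mu> = restrict_space stationary D"
proof -
  interpret D: disc_invariant M F W h K \<epsilon> \<mu>
    by (rule disc_invariant_of_invariant_measure[OF assms])
  have S: "sets \<mu> = sets (restrict_space borel D)"
    using inv by (auto simp: invariant_measure_def prob_measure_on_def)
  show ?thesis
  proof (rule measure_eqI)
    show "sets \<mu> = sets (restrict_space stationary D)"
      using S sets_restrict_space_cong[OF stationary_sets, of D] by simp
    fix E assume E: "E \<in> sets \<mu>"
    then have Eb: "E \<in> sets borel" "E \<subseteq> D" using D(1) by (auto simp: S sets_restrict_space_iff)
    have "emeasure (restrict_space stationary D) E = emeasure stationary E"
      using D(1) Eb by (intro emeasure_restrict_space) auto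
    also have "\<dots> = emeasure (distr \<mu> borel (\<lambda>x. x)) E" unfolding D.distr_eq_stationary ..
    also have "\<dots> = emeasure \<mu> E"
      using emeasure_distr[OF D.borel_measurable_id Eb(1)] sets.sets_into_space[OF E] by (simp add: Int_absorb2)
    finally show "emeasure \<mu> E = emeasure (restrict_space stationary D) E" ..
  qed
qed

lemma invariant_measure_restrict_stationary:
  assumes D: "D \<in> sets borel" "sphere 0 1 \<subseteq> D" "D \<subseteq> cball 0 1"
  shows "invariant_measure M h D (restrict_space stationary D)"
proof -
  interpret V: prob_space stationary by (rule stationary_prob)
  have AE_A: "AE z in stationary. z \<in> D" using stationary_sphere by eventually_elim (use D in auto)
  have As: "D \<in> sets stationary" "D \<inter> space stationary \<in> sets stationary" "D \<inter> space borel \<in> sets borel" using D(1) by auto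
  have P: "prob_measure_on D (restrict_space stationary D)"
    unfolding prob_measure_on_def
    using V.emeasure_eq_1_AE[OF As(1) AE_A] As(1) sets_restrict_space_cong[OF stationary_sets, of D]
    by (auto intro: prob_space_restrict_space)
  have "(LINT x|restrict_space stationary D. f x) = (LINT x|restrict_space stationary D. markov_semigroup M h D t f x)"
    if t: "t \<ge> 0" and f: "f \<in> borel_measurable (restrict_space borel D)" and b: "bounded (f ` D)" for t f
  proof -
    \<comment> \<open>Extension of the test function by 0 to the plane, so that the invariance of
      \<open>stationary\<close> under the planar kernel applies. It also absorbs the indicator of
      \<open>markov_semigroup\<close>.\<close>
    define g where "g x = indicator D x *\<^sub>R f x" for x
    have gm: "g \<in> borel_measurable borel"
      using f unfolding g_def borel_measurable_restrict_space_iff[OF As(3)] .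
    obtain B where B: "\<And>x. x \<in> D \<Longrightarrow> \<bar>f x\<bar> \<le> B" using b by (auto simp: bounded_iff)
    have gb: "\<bar>g z\<bar> \<le> max 0 B" for z using B[of z] by (cases "z \<in> D") (auto simp: g_def)
    define e where "e x = expectation (\<lambda>\<omega>. g (h (proj x) t \<omega>))" for x
    have em: "e \<in> borel_measurable borel" unfolding e_def by (rule expectation_measurable[OF t gm])
    have e: "indicator D x *\<^sub>R markov_semigroup M h D t f x = indicator D x *\<^sub>R e x" for x
      using D(3) by (cases "x \<in> D") (auto simp: e_def g_def markov_semigroup_def subset_iff proj_id)
    have "(LINT x|restrict_space stationary D. f x) = (LINT x|stationary. g x)"
      unfolding g_def by (rule integral_restrict_space[OF As(2)])
    also have "\<dots> = (LINT x|(stationary \<bind> kernel t). g x)" unfolding bind_stationary[OF t] ..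
    also have "\<dots> = (LINT x|stationary. e x)" unfolding e_def by (rule integral_bind_kernel[OF t gm gb])
    also have "\<dots> = (LINT x|stationary. indicator D x *\<^sub>R e x)"
    proof (rule integral_cong_AE)
      show "AE x in stationary. e x = indicator D x *\<^sub>R e x" using AE_A by eventually_elim simp
      show "e \<in> borel_measurable stationary" using em by simp
      show "(\<lambda>x. indicator D x *\<^sub>R e x) \<in> borel_measurable stationary" using em D(1) by simp
    qed
    also have "\<dots> = (LINT x|restrict_space stationary D. markov_semigroup M h D t f x)"
      unfolding e[symmetric] by (rule integral_restrict_space[OF As(2), symmetric])
    finally show ?thesis .
  qed
  then show ?thesis
    unfolding invariant_measure_def is_transported_def by (intro conjI allI impI ballI P)
qed

lemma invariant_measure_iff:
  assumes "D = sphere 0 1 \<or> D = cball 0 1"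
  shows "invariant_measure M h D \<mu> \<longleftrightarrow> \<mu> = restrict_space stationary D"
proof -
  have D: "D \<in> sets borel" "sphere 0 1 \<subseteq> D" "D \<subseteq> cball 0 1" using assms by auto
  have "AE \<omega> in M. h x t \<omega> \<in> D" if "x \<in> D" "t \<ge> 0" for x t
    using assms h_in_sphere[of x t] h_norm_le_1[of x t] that by auto
  note eq = invariant_measure_imp_eq[OF _ D(1,3) this]
  show ?thesis
  proof
    show "\<mu> = restrict_space stationary D" if "invariant_measure M h D \<mu>" by (rule eq[OF that])
    show "invariant_measure M h D \<mu>" if "\<mu> = restrict_space stationary D"
      unfolding that by (rule invariant_measure_restrict_stationary[OF D])
  qed
qed

text \<open>By \<open>AE_sphere\<close> an invariant measure would be carried by the circle, which
  does not meet the open disc.\<close>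

lemma no_invariant_measure_ball: "\<not> invariant_measure M h (ball 0 1) \<mu>"
proof
  assume inv: "invariant_measure M h (ball 0 1) \<mu>"
  interpret D: disc_invariant M F W h K \<epsilon> \<mu>
    by (rule disc_invariant_of_invariant_measure[OF inv _ _ h_in_ball]) auto
  have "space \<mu> = ball 0 1"
    using inv sets_eq_imp_space_eq[of \<mu> "restrict_space borel (ball 0 1)"]
    by (simp add: invariant_measure_def prob_measure_on_def space_restrict_space)
  then have "AE x in \<mu>. False"
    by (intro AE_mp[OF D.AE_sphere AE_I2]) simp
  then show False by simp
qed

lemma measure_restrict_stationary:
  assumes E: "E \<in> sets borel" "E \<subseteq> cball 0 1"
  shows "measure (restrict_space stationary (cball 0 1)) E = measure (restrict_space stationary (sphere 0 1)) (E \<inter> sphere 0 1)"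
proof -
  interpret V: prob_space stationary by (rule stationary_prob)
  have "measure (restrict_space stationary (cball 0 1)) E = measure stationary E"
    using E by (intro measure_restrict_space) auto
  also have "\<dots> = measure stationary (E \<inter> sphere 0 1)"
    using stationary_sphere E(1) by (intro measure_eq_AE) auto
  also have "\<dots> = measure (restrict_space stationary (sphere 0 1)) (E \<inter> sphere 0 1)"
    by (intro measure_restrict_space[symmetric]) auto
  finally show ?thesis .
qed

end

theorem theorem3:
  fixes M :: "'a measure" and F :: "real \<Rightarrow> 'a measure" and W :: "real \<Rightarrow> 'a \<Rightarrow> real"
    and h :: "complex \<Rightarrow> real \<Rightarrow> 'a \<Rightarrow> complex" and K \<epsilon> :: real
  assumes "filtered_prob_space M F" and "brownian_motion M F W"
    and "K > 0" and "\<epsilon> > 0"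
    and "\<And>x. x \<in> cball 0 1 \<Longrightarrow>
           stratonovich_solution M F W
             (\<lambda>z. of_real K * (1 - z\<^sup>2)) (\<lambda>z. of_real (sqrt 2) * \<i> * of_real \<epsilon> * z) x (h x)"
  shows "(\<exists>!\<mu>. invariant_measure M h (sphere 0 1) \<mu>) \<and>
    \<not> (\<exists>\<mu>. invariant_measure M h (ball 0 1) \<mu>) \<and>
    (\<exists>!\<mu>. invariant_measure M h (cball 0 1) \<mu>) \<and>
    (\<forall>\<mu> \<nu>. invariant_measure M h (sphere 0 1) \<mu> \<and> invariant_measure M h (cball 0 1) \<nu> \<longrightarrow>
      (\<forall>E \<in> sets borel. E \<subseteq> cball 0 1 \<longrightarrow> measure \<nu> E = measure \<mu> (E \<inter> sphere 0 1)))"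
proof -
  have "adler M F W h K \<epsilon>"
    using assms by (intro adler.intro bm_space.intro bm_space_axioms.intro adler_axioms.intro)
      (auto simp: filtered_prob_space_def)
  then interpret adler M F W h K \<epsilon> .
  \<comment> \<open>Both conditions pin the measure down to a restriction of the same planar measure
    \<open>stationary\<close>, so existence, uniqueness and the comparison on Borel sets can be read
    off.\<close>
  have "invariant_measure M h (sphere 0 1) \<mu> \<longleftrightarrow> \<mu> = restrict_space stationary (sphere 0 1)"
    "invariant_measure M h (cball 0 1) \<mu> \<longleftrightarrow> \<mu> = restrict_space stationary (cball 0 1)" for \<mu>
    by (intro invariant_measure_iff; simp)+
  then show ?thesis by (simp add: no_invariant_measure_ball measure_restrict_stationary)
qed

end
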